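(* Let $A$ be a $\mathbb{Z}_2$-graded real $C^*$-algebra. Then there is an isomorphism of abelian groups $\mathrm{SPT}^A \cong K_2(A^{op})$.
   Context: Algebras and modules. A $\mathbb{Z}_2$-graded real $C^*$-algebra $A=A_{ev}\oplus A_{odd}$ is a real $C^*$-algebra with a $\mathbb{Z}_2$-grading preserved by $*$; $|a|\in\{0,1\}$ is the degree of a homogeneous $a$. The tensor product of graded algebras is the graded one: $(a_1\otimes b_1)(a_2\otimes b_2)=(-1)^{|b_1||a_2|}a_1a_2\otimes b_1b_2$, $(a\otimes b)^*=(-1)^{|a||b|}a^*\otimes b^*$ (minimal $C^*$-completion). $Cl_{p,q}$ is the real Clifford algebra on $p$ anticommuting odd generators of square $+1$ and $q$ of square $-1$, a $\mathbb{Z}_2$-graded $C^*$-algebra with unitary generators; $Cl_{+n}=Cl_{n,0}$, $Cl_{-n}=Cl_{0,n}$. Opposite. $A^{op}$ is $A$ as a graded vector space, with $a^{op}b^{op}=(-1)^{|a||b|}(ba)^{op}$ and $(a^{op})^*=(-1)^{|a|}(a^* )^{op}$. Let $A$ be unital and $M$ a finitely generated projective (ungraded, left) $A$-module. A real-linear $T:M\to M$ is $A$-skewlinear if $T(am)=(-1)^{|a|}aT(m)$ for homogeneous $a$. $M$ is topologized as a direct summand of some $A^n$; skewlinear maps are then continuous and carry the operator norm topology (independent of choices). $\mathrm{Pol}_A(M)$ is the space of $A$-skewlinear $J:M\to M$ with $J^2=-\mathrm{id}_M$ ($A$-symmetric polarizations); $\mathrm{Grad}_A(M)$ is the space of $A$-skewlinear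 $\epsilon:M\to M$ with $\epsilon^2=\mathrm{id}_M$. $\mathrm{SPT}^A$ (unital $A$): consider triples $(M,J_1,J_2)$ with $M$ finitely generated projective and $J_1,J_2\in\mathrm{Pol}_A(M)$. A triple is elementary if $J_1,J_2$ are homotopic (joined by a path) in $\mathrm{Pol}_A(M)$. Isomorphisms are $A$-module isomorphisms intertwining $J_1$ with $J_1'$ and $J_2$ with $J_2'$. $\mathrm{SPT}^A$ is the set of triples modulo $T_1\sim T_2$ iff there are elementary $T_1',T_2'$ with $T_1\oplus T_1'\cong T_2\oplus T_2'$; it is a group under $\oplus$. $K_0(A)$ (Karoubi $K$-theory, unital $A$) is defined identically with triples $(M,\epsilon_1,\epsilon_2)$, $\epsilon_i\in\mathrm{Grad}_A(M)$. $K_n(A):=K_0(Cl_{+n}\otimes A)$. For non-unital $A$, with unitization $A_+=A\oplus\mathbb{R}$ (unit even), $K_n(A):=\ker(K_n(A_+)\to K_n(\mathbb{R}))$ and $\mathrm{SPT}^A:=\ker(\mathrm{SPT}^{A_+}\to\mathrm{SPT}^{\mathbb{R}})$, maps induced by $A_+\to\mathbb{R}$ via base change of modules. *)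

theory Defs
  imports "HOL-Algebra.Algebra" "HOL-Algebra.Free_Abelian_Groups" "HOL-Analysis.Analysis"
begin

section \<open>Graded real C*-algebras\<close>

text \<open>
  A graded algebra is a record extending the ring record of HOL-Algebra; only \<open>part A 0\<close> and
  \<open>part A 1\<close> (the even and the odd subspace) are meaningful, and the field \<open>\<one>\<close> is meaningful
  only if the algebra has a unit.
\<close>

record 'a gr_alg = "'a ring" +
  rscale :: "real \<Rightarrow> 'a \<Rightarrow> 'a"
  star :: "'a \<Rightarrow> 'a"
  nrm :: "'a \<Rightarrow> real"
  part :: "nat \<Rightarrow> 'a set"

definition unital :: "'a gr_alg \<Rightarrow> bool" where
  "unital A \<longleftrightarrow>
     (\<exists>u\<in>carrier A. \<forall>a\<in>carrier A. u \<otimes>\<^bsub>A\<^esub> a = a \<and> a \<otimes>\<^bsub>A\<^esub> u = a)"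

text \<open>The locale \<open>Metric_space\<close> constrains distances also off the carrier, hence the default 0.\<close>

definition nrm_dist :: "'a gr_alg \<Rightarrow> 'a \<Rightarrow> 'a \<Rightarrow> real" where
  "nrm_dist A a b =
     (if a \<in> carrier A \<and> b \<in> carrier A then nrm A (a \<ominus>\<^bsub>A\<^esub> b) else 0)"

text \<open>Homogeneous component of degree \<open>i \<in> {0, 1}\<close>.\<close>

definition hcomp :: "'a gr_alg \<Rightarrow> nat \<Rightarrow> 'a \<Rightarrow> 'a" where
  "hcomp A i a = (THE x. x \<in> part A i \<and> (\<exists>y\<in>part A (1 - i). x \<oplus>\<^bsub>A\<^esub> y = a))"

definition parity :: "'a gr_alg \<Rightarrow> 'a \<Rightarrow> 'a" where
  "parity A a = (\<Oplus>\<^bsub>A\<^esub>i\<in>{0, 1}. rscale A ((-1) ^ i) (hcomp A i a))"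

text \<open>
  In this and the following constructions of new algebras out of old ones, \<open>nrm\<close> is one
  convenient norm in the equivalence class of the C*-norm. It can differ from the C*-norm
  itself, but the notions below depend only on the topology it defines.
\<close>

definition unitization :: "'a gr_alg \<Rightarrow> ('a \<times> real) gr_alg" where
  "unitization A =
     \<lparr>carrier = carrier A \<times> UNIV,
      monoid.mult = (\<lambda>(a, r) (b, s).
        (a \<otimes>\<^bsub>A\<^esub> b \<oplus>\<^bsub>A\<^esub> rscale A r b \<oplus>\<^bsub>A\<^esub> rscale A s a, r * s)),
      monoid.one = (\<zero>\<^bsub>A\<^esub>, 1),
      ring.zero = (\<zero>\<^bsub>A\<^esub>, 0),
      ring.add = (\<lambda>(a, r) (b, s). (a \<oplus>\<^bsub>A\<^esub> b, r + s)),
      rscale = (\<lambda>t (a, r). (rscale A t a, t * r)),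
      star = (\<lambda>(a, r). (star A a, r)),
      nrm = (\<lambda>(a, r). nrm A a + \<bar>r\<bar>),
      part = (\<lambda>i. part A i \<times> (if i = 0 then UNIV else {0}))\<rparr>"

text \<open>
  The C*-identity alone does not characterize real C*-algebras (it holds for the complex numbers
  with trivial involution), hence the customary axiom that every \<open>1 + a\<^sup>* a\<close> is invertible
  in the unitization.
\<close>

locale real_cstar_algebra = abelian_group A for A :: "'a gr_alg" (structure) +
  assumes mult_closed: "a \<in> carrier A \<Longrightarrow> b \<in> carrier A \<Longrightarrow> a \<otimes> b \<in> carrier A"
    and mult_assoc: "a \<in> carrier A \<Longrightarrow> b \<in> carrier A \<Longrightarrow> c \<in> carrier A \<Longrightarrow>
      (a \<otimes> b) \<otimes> c = a \<otimes> (b \<otimes> c)"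
    and distrib_right: "a \<in> carrier A \<Longrightarrow> b \<in> carrier A \<Longrightarrow> c \<in> carrier A \<Longrightarrow>
      (a \<oplus> b) \<otimes> c = a \<otimes> c \<oplus> b \<otimes> c"
    and distrib_left: "a \<in> carrier A \<Longrightarrow> b \<in> carrier A \<Longrightarrow> c \<in> carrier A \<Longrightarrow>
      c \<otimes> (a \<oplus> b) = c \<otimes> a \<oplus> c \<otimes> b"
    and one_is_unit: "unital A \<Longrightarrow>
      \<one> \<in> carrier A \<and> (\<forall>a\<in>carrier A. \<one> \<otimes> a = a \<and> a \<otimes> \<one> = a)"
    and scale_closed: "a \<in> carrier A \<Longrightarrow> rscale A r a \<in> carrier A"
    and scale_add_right: "a \<in> carrier A \<Longrightarrow> b \<in> carrier A \<Longrightarrow>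
      rscale A r (a \<oplus> b) = rscale A r a \<oplus> rscale A r b"
    and scale_add_left: "a \<in> carrier A \<Longrightarrow>
      rscale A (r + s) a = rscale A r a \<oplus> rscale A s a"
    and scale_scale: "a \<in> carrier A \<Longrightarrow> rscale A r (rscale A s a) = rscale A (r * s) a"
    and scale_one: "a \<in> carrier A \<Longrightarrow> rscale A 1 a = a"
    and scale_mult_left: "a \<in> carrier A \<Longrightarrow> b \<in> carrier A \<Longrightarrow>
      rscale A r a \<otimes> b = rscale A r (a \<otimes> b)"
    and scale_mult_right: "a \<in> carrier A \<Longrightarrow> b \<in> carrier A \<Longrightarrow>
      a \<otimes> rscale A r b = rscale A r (a \<otimes> b)"
    and star_closed: "a \<in> carrier A \<Longrightarrow> star A a \<in> carrier A"
    and star_star: "a \<in> carrier A \<Longrightarrow> star A (star A a) = a"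
    and star_add: "a \<in> carrier A \<Longrightarrow> b \<in> carrier A \<Longrightarrow>
      star A (a \<oplus> b) = star A a \<oplus> star A b"
    and star_scale: "a \<in> carrier A \<Longrightarrow> star A (rscale A r a) = rscale A r (star A a)"
    and star_mult: "a \<in> carrier A \<Longrightarrow> b \<in> carrier A \<Longrightarrow>
      star A (a \<otimes> b) = star A b \<otimes> star A a"
    and nrm_nonneg: "a \<in> carrier A \<Longrightarrow> 0 \<le> nrm A a"
    and nrm_eq_0: "a \<in> carrier A \<Longrightarrow> nrm A a = 0 \<longleftrightarrow> a = \<zero>"
    and nrm_scale: "a \<in> carrier A \<Longrightarrow> nrm A (rscale A r a) = \<bar>r\<bar> * nrm A a"
    and nrm_triangle: "a \<in> carrier A \<Longrightarrow> b \<in> carrier A \<Longrightarrow>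
      nrm A (a \<oplus> b) \<le> nrm A a + nrm A b"
    and nrm_mult: "a \<in> carrier A \<Longrightarrow> b \<in> carrier A \<Longrightarrow>
      nrm A (a \<otimes> b) \<le> nrm A a * nrm A b"
    and complete: "Metric_space.mcomplete (carrier A) (nrm_dist A)"
    and cstar_identity: "a \<in> carrier A \<Longrightarrow> nrm A (star A a \<otimes> a) = (nrm A a)\<^sup>2"
    and one_plus_square_invertible: "a \<in> carrier A \<Longrightarrow>
      (star A a \<otimes> a, 1) \<in> Units (unitization A)"

locale graded_real_cstar_algebra = real_cstar_algebra +
  assumes part_subset: "i \<in> {0, 1} \<Longrightarrow> part A i \<subseteq> carrier A"
    and part_zero: "i \<in> {0, 1} \<Longrightarrow> \<zero> \<in> part A i"
    and part_add: "i \<in> {0, 1} \<Longrightarrow> a \<in> part A i \<Longrightarrow> b \<in> part A i \<Longrightarrow> a \<oplus> b \<in> part A i"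
    and part_scale: "i \<in> {0, 1} \<Longrightarrow> a \<in> part A i \<Longrightarrow> rscale A r a \<in> part A i"
    and part_closed: "i \<in> {0, 1} \<Longrightarrow>
      closedin (Metric_space.mtopology (carrier A) (nrm_dist A)) (part A i)"
    and part_sum: "a \<in> carrier A \<Longrightarrow> \<exists>x\<in>part A 0. \<exists>y\<in>part A 1. a = x \<oplus> y"
    and part_int: "part A 0 \<inter> part A 1 = {\<zero>}"
    and part_mult: "i \<in> {0, 1} \<Longrightarrow> j \<in> {0, 1} \<Longrightarrow> a \<in> part A i \<Longrightarrow> b \<in> part A j \<Longrightarrow>
      a \<otimes> b \<in> part A ((i + j) mod 2)"
    and part_star: "i \<in> {0, 1} \<Longrightarrow> a \<in> part A i \<Longrightarrow> star A a \<in> part A i"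

definition real_alg :: "real gr_alg" where
  "real_alg =
     \<lparr>carrier = UNIV, monoid.mult = (*), monoid.one = 1, ring.zero = 0, ring.add = (+),
      rscale = (*), star = (\<lambda>x. x), nrm = abs,
      part = (\<lambda>i. if i = 0 then UNIV else {0})\<rparr>"

text \<open>
  The graded opposite, on the same underlying set. For instance, \<open>Cl\<^bsub>1,0\<^esub>\<close> is the direct sum
  of two copies of the reals, while its opposite \<open>Cl\<^bsub>0,1\<^esub>\<close> is the complex numbers: here the
  C*-norms are equivalent but not equal.
\<close>

definition opposite :: "'a gr_alg \<Rightarrow> 'a gr_alg" where
  "opposite A = A
     \<lparr>monoid.mult := (\<lambda>a b. \<Oplus>\<^bsub>A\<^esub>i\<in>{0, 1}. \<Oplus>\<^bsub>A\<^esub>j\<in>{0, 1}.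
        rscale A ((-1) ^ (i * j)) (hcomp A j b \<otimes>\<^bsub>A\<^esub> hcomp A i a)),
      star := (\<lambda>a. \<Oplus>\<^bsub>A\<^esub>i\<in>{0, 1}. rscale A ((-1) ^ i) (star A (hcomp A i a)))\<rparr>"

text \<open>
  \<open>Cl\<^bsub>+n\<^esub> \<otimes> A\<close>: a function \<open>x\<close> on the subsets of \<open>{..<n}\<close> stands for the sum of
  all \<open>e\<^sub>I \<otimes> x I\<close>, where \<open>e\<^sub>I\<close> is the product in increasing order of the odd generators
  \<open>e\<^sub>k\<close> with \<open>k \<in> I\<close>; these generators anticommute and satisfy \<open>e\<^sub>k\<^sup>2 = 1\<close> and
  \<open>e\<^sub>k\<^sup>* = e\<^sub>k\<close>. Sorting gives \<open>e\<^sub>I e\<^sub>J = clifford_sign I J \<cdot> e\<^sub>K\<close> with \<open>K\<close> the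
  symmetric difference of \<open>I\<close> and \<open>J\<close>. Since \<open>Cl\<^bsub>+n\<^esub>\<close> is finite-dimensional, the algebraic
  tensor product is already complete in its unique C*-norm.
\<close>

definition clifford_sign :: "nat set \<Rightarrow> nat set \<Rightarrow> real" where
  "clifford_sign I J = (-1) ^ card {(i, j). i \<in> I \<and> j \<in> J \<and> j < i}"

definition clifford_tensor :: "nat \<Rightarrow> 'a gr_alg \<Rightarrow> (nat set \<Rightarrow> 'a) gr_alg" where
  "clifford_tensor n A =
     \<lparr>carrier = Pow {..<n} \<rightarrow>\<^sub>E carrier A,
      monoid.mult = (\<lambda>x y. \<lambda>K\<in>Pow {..<n}. \<Oplus>\<^bsub>A\<^esub>I\<in>Pow {..<n}. \<Oplus>\<^bsub>A\<^esub>i\<in>{0, 1}.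
        rscale A (clifford_sign I (sym_diff I K) * (-1) ^ (i * card (sym_diff I K)))
          (hcomp A i (x I) \<otimes>\<^bsub>A\<^esub> y (sym_diff I K))),
      monoid.one = (\<lambda>I\<in>Pow {..<n}. if I = {} then \<one>\<^bsub>A\<^esub> else \<zero>\<^bsub>A\<^esub>),
      ring.zero = (\<lambda>I\<in>Pow {..<n}. \<zero>\<^bsub>A\<^esub>),
      ring.add = (\<lambda>x y. \<lambda>I\<in>Pow {..<n}. x I \<oplus>\<^bsub>A\<^esub> y I),
      rscale = (\<lambda>r x. \<lambda>I\<in>Pow {..<n}. rscale A r (x I)),
      star = (\<lambda>x. \<lambda>I\<in>Pow {..<n}. \<Oplus>\<^bsub>A\<^esub>i\<in>{0, 1}.
        rscale A ((-1) ^ (i * card I) * (-1) ^ (card I * (card I - 1) div 2))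
          (star A (hcomp A i (x I)))),
      nrm = (\<lambda>x. \<Sum>I\<in>Pow {..<n}. nrm A (x I)),
      part = (\<lambda>d. \<Pi>\<^sub>E I\<in>Pow {..<n}. part A ((d + card I) mod 2))\<rparr>"

section \<open>Modules and skewlinear maps\<close>

text \<open>
  The module record of HOL-Algebra is reused (its fields \<open>mult\<close> and \<open>one\<close> are irrelevant), but
  its module locale is restricted to commutative rings.
\<close>

locale left_module = R?: ring R + M?: abelian_group M
  for R :: "'r gr_alg" (structure) and M :: "('r, 'm) module" (structure) +
  assumes smult_closed: "a \<in> carrier R \<Longrightarrow> x \<in> carrier M \<Longrightarrow> a \<odot>\<^bsub>M\<^esub> x \<in> carrier M"
    and smult_l_distr: "a \<in> carrier R \<Longrightarrow> b \<in> carrier R \<Longrightarrow> x \<in> carrier M \<Longrightarrow>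
      (a \<oplus>\<^bsub>R\<^esub> b) \<odot>\<^bsub>M\<^esub> x = a \<odot>\<^bsub>M\<^esub> x \<oplus>\<^bsub>M\<^esub> b \<odot>\<^bsub>M\<^esub> x"
    and smult_r_distr: "a \<in> carrier R \<Longrightarrow> x \<in> carrier M \<Longrightarrow> y \<in> carrier M \<Longrightarrow>
      a \<odot>\<^bsub>M\<^esub> (x \<oplus>\<^bsub>M\<^esub> y) = a \<odot>\<^bsub>M\<^esub> x \<oplus>\<^bsub>M\<^esub> a \<odot>\<^bsub>M\<^esub> y"
    and smult_assoc: "a \<in> carrier R \<Longrightarrow> b \<in> carrier R \<Longrightarrow> x \<in> carrier M \<Longrightarrow>
      (a \<otimes>\<^bsub>R\<^esub> b) \<odot>\<^bsub>M\<^esub> x = a \<odot>\<^bsub>M\<^esub> (b \<odot>\<^bsub>M\<^esub> x)"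
    and smult_one: "x \<in> carrier M \<Longrightarrow> \<one>\<^bsub>R\<^esub> \<odot>\<^bsub>M\<^esub> x = x"

definition mod_hom :: "'r gr_alg \<Rightarrow> ('r, 'm) module \<Rightarrow> ('r, 'n) module \<Rightarrow> ('m \<Rightarrow> 'n) set" where
  "mod_hom R M N = {f \<in> carrier M \<rightarrow> carrier N.
     (\<forall>x\<in>carrier M. \<forall>y\<in>carrier M. f (x \<oplus>\<^bsub>M\<^esub> y) = f x \<oplus>\<^bsub>N\<^esub> f y) \<and>
     (\<forall>a\<in>carrier R. \<forall>x\<in>carrier M. f (a \<odot>\<^bsub>M\<^esub> x) = a \<odot>\<^bsub>N\<^esub> f x)}"

definition free_module :: "'r gr_alg \<Rightarrow> nat \<Rightarrow> ('r, nat \<Rightarrow> 'r) module" where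
  "free_module R n =
     \<lparr>carrier = {..<n} \<rightarrow>\<^sub>E carrier R, monoid.mult = undefined, monoid.one = undefined,
      ring.zero = (\<lambda>k\<in>{..<n}. \<zero>\<^bsub>R\<^esub>),
      ring.add = (\<lambda>x y. \<lambda>k\<in>{..<n}. x k \<oplus>\<^bsub>R\<^esub> y k),
      module.smult = (\<lambda>a x. \<lambda>k\<in>{..<n}. a \<otimes>\<^bsub>R\<^esub> x k)\<rparr>"

text \<open>\<open>M\<close> as a direct summand of \<open>R\<^sup>n\<close>, by an inclusion \<open>\<iota>\<close> and a projection \<open>\<pi>\<close>.\<close>

definition is_summand ::
  "'r gr_alg \<Rightarrow> ('r, 'm) module \<Rightarrow> nat \<times> ('m \<Rightarrow> nat \<Rightarrow> 'r) \<times> ((nat \<Rightarrow> 'r) \<Rightarrow> 'm) \<Rightarrow> bool" where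
  "is_summand R M = (\<lambda>(n, \<iota>, \<pi>).
     \<iota> \<in> mod_hom R M (free_module R n) \<and> \<pi> \<in> mod_hom R (free_module R n) M \<and>
     (\<forall>x\<in>carrier M. \<pi> (\<iota> x) = x))"

definition fg_projective :: "'r gr_alg \<Rightarrow> ('r, 'm) module \<Rightarrow> bool" where
  "fg_projective R M \<longleftrightarrow> left_module R M \<and> (\<exists>s. is_summand R M s)"

text \<open>Reals act on \<open>M\<close> through multiples of \<open>\<one>\<close>; maps are made canonical off the carrier.\<close>

definition skewlinear :: "'r gr_alg \<Rightarrow> ('r, 'm) module \<Rightarrow> ('m \<Rightarrow> 'm) set" where
  "skewlinear R M = {T \<in> carrier M \<rightarrow>\<^sub>E carrier M.
     (\<forall>x\<in>carrier M. \<forall>y\<in>carrier M. T (x \<oplus>\<^bsub>M\<^esub> y) = T x \<oplus>\<^bsub>M\<^esub> T y) \<and>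
     (\<forall>r. \<forall>x\<in>carrier M. T (rscale R r \<one>\<^bsub>R\<^esub> \<odot>\<^bsub>M\<^esub> x) = rscale R r \<one>\<^bsub>R\<^esub> \<odot>\<^bsub>M\<^esub> T x) \<and>
     (\<forall>i\<in>{0, 1}. \<forall>a\<in>part R i. \<forall>x\<in>carrier M.
        T (a \<odot>\<^bsub>M\<^esub> x) = rscale R ((-1) ^ i) a \<odot>\<^bsub>M\<^esub> T x)}"

definition Pol :: "'r gr_alg \<Rightarrow> ('r, 'm) module \<Rightarrow> ('m \<Rightarrow> 'm) set" where
  "Pol R M = {J \<in> skewlinear R M. \<forall>x\<in>carrier M. J (J x) = \<ominus>\<^bsub>M\<^esub> x}"

definition Grad :: "'r gr_alg \<Rightarrow> ('r, 'm) module \<Rightarrow> ('m \<Rightarrow> 'm) set" where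
  "Grad R M = {\<epsilon> \<in> skewlinear R M. \<forall>x\<in>carrier M. \<epsilon> (\<epsilon> x) = x}"

text \<open>
  Distance in operator norm, for the norm on \<open>M\<close> induced from \<open>R\<^sup>n\<close> by some realization of
  \<open>M\<close> as a summand; different choices give equivalent norms.
\<close>

definition mod_nrm :: "'r gr_alg \<Rightarrow> ('r, 'm) module \<Rightarrow> 'm \<Rightarrow> real" where
  "mod_nrm R M x = (let (n, \<iota>, \<pi>) = (SOME s. is_summand R M s) in \<Sum>k<n. nrm R (\<iota> x k))"

definition op_dist :: "'r gr_alg \<Rightarrow> ('r, 'm) module \<Rightarrow> ('m \<Rightarrow> 'm) \<Rightarrow> ('m \<Rightarrow> 'm) \<Rightarrow> real" where
  "op_dist R M S T =
     (if S \<in> skewlinear R M \<and> T \<in> skewlinear R M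
      then (SUP x\<in>{x \<in> carrier M. mod_nrm R M x \<le> 1}. mod_nrm R M (S x \<ominus>\<^bsub>M\<^esub> T x))
      else 0)"

section \<open>The difference groups\<close>

datatype symmetry_kind = Polarization | Grading

definition symmetry_space :: "symmetry_kind \<Rightarrow> 'r gr_alg \<Rightarrow> ('r, 'm) module \<Rightarrow> ('m \<Rightarrow> 'm) set" where
  "symmetry_space k R M = (case k of Polarization \<Rightarrow> Pol R M | Grading \<Rightarrow> Grad R M)"

definition symmetry_topology ::
  "symmetry_kind \<Rightarrow> 'r gr_alg \<Rightarrow> ('r, 'm) module \<Rightarrow> ('m \<Rightarrow> 'm) topology" where
  "symmetry_topology k R M = Metric_space.mtopology (symmetry_space k R M) (op_dist R M)"

type_synonym ('r, 'm) triple = "('r, 'm) module \<times> ('m \<Rightarrow> 'm) \<times> ('m \<Rightarrow> 'm)"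

definition is_triple :: "symmetry_kind \<Rightarrow> 'r gr_alg \<Rightarrow> ('r, 'm) triple \<Rightarrow> bool" where
  "is_triple k R = (\<lambda>(M, J1, J2).
     fg_projective R M \<and> J1 \<in> symmetry_space k R M \<and> J2 \<in> symmetry_space k R M)"

definition elementary :: "symmetry_kind \<Rightarrow> 'r gr_alg \<Rightarrow> ('r, 'm) triple \<Rightarrow> bool" where
  "elementary k R = (\<lambda>(M, J1, J2).
     is_triple k R (M, J1, J2) \<and> path_component_of (symmetry_topology k R M) J1 J2)"

definition triple_iso :: "'r gr_alg \<Rightarrow> ('r, 'm) triple \<Rightarrow> ('r, 'n) triple \<Rightarrow> bool" where
  "triple_iso R = (\<lambda>(M, J1, J2) (N, J1', J2'). \<exists>f\<in>mod_hom R M N.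
     bij_betw f (carrier M) (carrier N) \<and>
     (\<forall>x\<in>carrier M. f (J1 x) = J1' (f x)) \<and> (\<forall>x\<in>carrier M. f (J2 x) = J2' (f x)))"

definition module_sum :: "('r, 'm) module \<Rightarrow> ('r, 'n) module \<Rightarrow> ('r, 'm \<times> 'n) module" where
  "module_sum M N =
     \<lparr>carrier = carrier M \<times> carrier N, monoid.mult = undefined, monoid.one = undefined,
      ring.zero = (\<zero>\<^bsub>M\<^esub>, \<zero>\<^bsub>N\<^esub>),
      ring.add = (\<lambda>(x, y) (x', y'). (x \<oplus>\<^bsub>M\<^esub> x', y \<oplus>\<^bsub>N\<^esub> y')),
      module.smult = (\<lambda>a (x, y). (a \<odot>\<^bsub>M\<^esub> x, a \<odot>\<^bsub>N\<^esub> y))\<rparr>"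

definition triple_sum :: "('r, 'm) triple \<Rightarrow> ('r, 'n) triple \<Rightarrow> ('r, 'm \<times> 'n) triple" where
  "triple_sum = (\<lambda>(M, J1, J2) (N, J1', J2').
     (module_sum M N,
      restrict (map_prod J1 J1') (carrier M \<times> carrier N),
      restrict (map_prod J2 J2') (carrier M \<times> carrier N)))"

definition zero_triple :: "('r, unit) triple" where
  "zero_triple =
     (\<lparr>carrier = UNIV, monoid.mult = undefined, monoid.one = undefined, ring.zero = (),
       ring.add = (\<lambda>_ _. ()), module.smult = (\<lambda>_ _. ())\<rparr>, id, id)"

text \<open>
  Every finitely generated projective \<open>R\<close>-module embeds in some \<open>R\<^sup>n\<close>, so up to isomorphism its
  carrier is a set of functions of type \<open>nat \<Rightarrow> 'r\<close>. Classes are therefore formed inside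
  this type; the equivalence relation itself also compares triples with carriers in other types
  (needed for direct sums and base change).
\<close>

definition stably_equiv :: "symmetry_kind \<Rightarrow> 'r gr_alg \<Rightarrow> ('r, 'm) triple \<Rightarrow> ('r, 'n) triple \<Rightarrow> bool" where
  "stably_equiv k R T1 T2 \<longleftrightarrow>
     (\<exists>(E1 :: ('r, nat \<Rightarrow> 'r) triple) (E2 :: ('r, nat \<Rightarrow> 'r) triple).
        elementary k R E1 \<and> elementary k R E2 \<and>
        triple_iso R (triple_sum T1 E1) (triple_sum T2 E2))"

definition triple_class ::
  "symmetry_kind \<Rightarrow> 'r gr_alg \<Rightarrow> ('r, 'm) triple \<Rightarrow> ('r, nat \<Rightarrow> 'r) triple set" where
  "triple_class k R T = {S. is_triple k R S \<and> stably_equiv k R S T}"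

definition difference_group ::
  "symmetry_kind \<Rightarrow> 'r gr_alg \<Rightarrow> ('r, nat \<Rightarrow> 'r) triple set monoid" where
  "difference_group k R =
     \<lparr>carrier = triple_class k R ` {T :: ('r, nat \<Rightarrow> 'r) triple. is_triple k R T},
      monoid.mult = (\<lambda>U V. \<Union>S\<in>U. \<Union>T\<in>V. triple_class k R (triple_sum S T)),
      monoid.one = triple_class k R zero_triple\<rparr>"

section \<open>Base change\<close>

text \<open>
  \<open>C \<otimes>\<^sub>B M\<close> along \<open>\<phi> : B \<rightarrow> C\<close>, as the free abelian group on \<open>C \<times> M\<close> modulo the
  bilinearity relations and \<open>c \<phi>(b) \<otimes> x = c \<otimes> b x\<close>.
\<close>

definition tensor_relations ::
  "('b \<Rightarrow> 'c) \<Rightarrow> 'b gr_alg \<Rightarrow> 'c gr_alg \<Rightarrow> ('b, 'm) module \<Rightarrow> (('c \<times> 'm) \<Rightarrow>\<^sub>0 int) set" where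
  "tensor_relations \<phi> B C M = generate (free_Abelian_group (carrier C \<times> carrier M))
     ({frag_of (c \<oplus>\<^bsub>C\<^esub> c', x) - frag_of (c, x) - frag_of (c', x) | c c' x.
         c \<in> carrier C \<and> c' \<in> carrier C \<and> x \<in> carrier M} \<union>
      {frag_of (c, x \<oplus>\<^bsub>M\<^esub> y) - frag_of (c, x) - frag_of (c, y) | c x y.
         c \<in> carrier C \<and> x \<in> carrier M \<and> y \<in> carrier M} \<union>
      {frag_of (c \<otimes>\<^bsub>C\<^esub> \<phi> b, x) - frag_of (c, b \<odot>\<^bsub>M\<^esub> x) | c b x.
         c \<in> carrier C \<and> b \<in> carrier B \<and> x \<in> carrier M})"

text \<open>The map on cosets induced by \<open>c \<otimes> x \<mapsto> g c \<otimes> h x\<close>.\<close>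

definition tensor_map ::
  "('b \<Rightarrow> 'c) \<Rightarrow> 'b gr_alg \<Rightarrow> 'c gr_alg \<Rightarrow> ('b, 'm) module \<Rightarrow> ('c \<Rightarrow> 'c) \<Rightarrow> ('m \<Rightarrow> 'm) \<Rightarrow>
   (('c \<times> 'm) \<Rightarrow>\<^sub>0 int) set \<Rightarrow> (('c \<times> 'm) \<Rightarrow>\<^sub>0 int) set" where
  "tensor_map \<phi> B C M g h Z =
     (\<Union>z\<in>Z. tensor_relations \<phi> B C M #>\<^bsub>free_Abelian_group (carrier C \<times> carrier M)\<^esub>
               frag_extend (\<lambda>(c, x). frag_of (g c, h x)) z)"

definition base_change ::
  "('b \<Rightarrow> 'c) \<Rightarrow> 'b gr_alg \<Rightarrow> 'c gr_alg \<Rightarrow> ('b, 'm) module \<Rightarrow>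
   ('c, (('c \<times> 'm) \<Rightarrow>\<^sub>0 int) set) module" where
  "base_change \<phi> B C M =
     (let Q = free_Abelian_group (carrier C \<times> carrier M) Mod tensor_relations \<phi> B C M in
      \<lparr>carrier = carrier Q, monoid.mult = undefined, monoid.one = undefined,
       ring.zero = \<one>\<^bsub>Q\<^esub>, ring.add = (\<otimes>\<^bsub>Q\<^esub>),
       module.smult = (\<lambda>c. tensor_map \<phi> B C M (\<lambda>c'. c \<otimes>\<^bsub>C\<^esub> c') (\<lambda>x. x))\<rparr>)"

text \<open>A skewlinear \<open>J\<close> extends as \<open>c \<otimes> x \<mapsto> (-1)\<^bsup>|c|\<^esup> c \<otimes> J x\<close>.\<close>

definition triple_base_change ::
  "('b \<Rightarrow> 'c) \<Rightarrow> 'b gr_alg \<Rightarrow> 'c gr_alg \<Rightarrow> ('b, 'm) triple \<Rightarrow>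
   ('c, (('c \<times> 'm) \<Rightarrow>\<^sub>0 int) set) triple" where
  "triple_base_change \<phi> B C = (\<lambda>(M, J1, J2).
     (base_change \<phi> B C M,
      restrict (tensor_map \<phi> B C M (parity C) J1) (carrier (base_change \<phi> B C M)),
      restrict (tensor_map \<phi> B C M (parity C) J2) (carrier (base_change \<phi> B C M))))"

definition induced_map ::
  "symmetry_kind \<Rightarrow> ('b \<Rightarrow> 'c) \<Rightarrow> 'b gr_alg \<Rightarrow> 'c gr_alg \<Rightarrow>
   ('b, nat \<Rightarrow> 'b) triple set \<Rightarrow> ('c, nat \<Rightarrow> 'c) triple set" where
  "induced_map k \<phi> B C U = (\<Union>T\<in>U. triple_class k C (triple_base_change \<phi> B C T))"

section \<open>The groups \<open>SPT\<close> and \<open>K\<^sub>n\<close>\<close>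

definition SPT_unital :: "'a gr_alg \<Rightarrow> ('a, nat \<Rightarrow> 'a) triple set monoid" where
  "SPT_unital A = difference_group Polarization A"

definition K0_unital :: "'a gr_alg \<Rightarrow> ('a, nat \<Rightarrow> 'a) triple set monoid" where
  "K0_unital A = difference_group Grading A"

definition K_unital ::
  "nat \<Rightarrow> 'a gr_alg \<Rightarrow> (nat set \<Rightarrow> 'a, nat \<Rightarrow> nat set \<Rightarrow> 'a) triple set monoid" where
  "K_unital n A = K0_unital (clifford_tensor n A)"

definition SPT_nonunital ::
  "'a gr_alg \<Rightarrow> ('a \<times> real, nat \<Rightarrow> 'a \<times> real) triple set monoid" where
  "SPT_nonunital A = (SPT_unital (unitization A))
     \<lparr>carrier := kernel (SPT_unital (unitization A)) (SPT_unital real_alg)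
        (induced_map Polarization snd (unitization A) real_alg)\<rparr>"

definition K_nonunital ::
  "nat \<Rightarrow> 'a gr_alg \<Rightarrow>
   (nat set \<Rightarrow> 'a \<times> real, nat \<Rightarrow> nat set \<Rightarrow> 'a \<times> real) triple set monoid" where
  "K_nonunital n A = (K_unital n (unitization A))
     \<lparr>carrier := kernel (K_unital n (unitization A)) (K_unital n real_alg)
        (induced_map Grading (\<lambda>x. \<lambda>I\<in>Pow {..<n}. snd (x I))
          (clifford_tensor n (unitization A)) (clifford_tensor n real_alg))\<rparr>"

definition abelian_group_iso :: "'x monoid \<Rightarrow> 'y monoid \<Rightarrow> bool" where
  "abelian_group_iso G H \<longleftrightarrow> comm_group G \<and> comm_group H \<and> G \<cong> H"

end

(* The involution identifies the opposite algebra with A carrying a sign-twisted product, and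
   under it the graded tensor product of the Clifford algebra Cl_2 with the opposite algebra becomes
   the algebra of 2 x 2 matrices over A, graded by the entrywise parity conjugated by
   w = (0, 1; -1, 0). For a module N over the matrix algebra with gradation e, the
   corner M = E11 N of Morita theory is an A-module, and E12 e restricts to a skewlinear map of M
   whose square is -1: the twist by w turns the sign of the square. Conversely M + M with
   the gradation (0, J; -J, 0) recovers (N, e). This correspondence
   respects direct sums, isomorphisms, homotopies and base change, so it induces isomorphisms of the
   difference groups, also on the kernels that define the non-unital case. *)

theory Submission
  imports Defs
begin

text \<open>The norm on \<open>clifford_tensor\<close> is only equivalent to a C*-norm, so the
  argument runs over rings in which multiplication and the grading involution are merely bounded. A
  grading is only required to have closed parts; boundedness of the involution comes from
  completeness by the closed graph theorem. Two further obstacles lie in the definitions. The norm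
  of a module depends on an arbitrary choice of a summand of a free module, and neither Morita
  theory nor base change respects this choice; continuity is therefore tested with functionals,
  which both constructions can follow. Base change is a quotient of a free abelian group; since the
  maps in question are surjective, it is replaced by a quotient map of the module itself. The
  adjoint explains why left modules serve on both sides: the opposite product reverses factors, and
  the adjoint reverses them again. Finally, classes contain only triples with carriers in one fixed
  type, while sums, corners and tensor products have carriers elsewhere, so representatives are
  moved back whenever a class is formed.\<close>

section \<open>Graded normed spaces\<close>

text \<open>Sorting a sum with \<open>a_ac\<close> need not make a term and its negative adjacent.
  These laws cancel them across one or two intervening summands, which is enough for the short
  signed sums that \<open>abelian_simps\<close> has to normalize.\<close>

lemma (in abelian_group) neg_cancel:
  assumes "x \<in> carrier G" "y \<in> carrier G"
  shows "x \<oplus> (y \<oplus> \<ominus> x) = y" "\<ominus> x \<oplus> (y \<oplus> x) = y"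
  using assms by (simp_all add: a_comm[of y] r_neg1 r_neg2)

lemma (in abelian_group) neg_cancel3:
  assumes "x \<in> carrier G" "y \<in> carrier G" "z \<in> carrier G"
  shows "x \<oplus> (y \<oplus> (z \<oplus> \<ominus> x)) = y \<oplus> z" "\<ominus> x \<oplus> (y \<oplus> (z \<oplus> x)) = y \<oplus> z"
    "x \<oplus> (y \<oplus> (\<ominus> x \<oplus> z)) = y \<oplus> z" "\<ominus> x \<oplus> (y \<oplus> (x \<oplus> z)) = y \<oplus> z"
proof -
  show 1: "x \<oplus> (y \<oplus> (z \<oplus> \<ominus> x)) = y \<oplus> z" "\<ominus> x \<oplus> (y \<oplus> (z \<oplus> x)) = y \<oplus> z"
    using assms neg_cancel[of x "y \<oplus> z"] by (simp_all add: a_assoc)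
  show "x \<oplus> (y \<oplus> (\<ominus> x \<oplus> z)) = y \<oplus> z" "\<ominus> x \<oplus> (y \<oplus> (x \<oplus> z)) = y \<oplus> z"
    using assms 1 a_comm[of z x] a_comm[of z "\<ominus> x"] by simp_all
qed

lemma (in abelian_group) diff_eq_zero [simp]:
  assumes "x \<in> carrier G" "y \<in> carrier G"
  shows "x \<ominus> y = \<zero> \<longleftrightarrow> x = y"
  using assms by (metis a_inv_closed minus_eq minus_equality minus_minus r_neg)

lemma (in abelian_group) diff_self [simp]: "x \<in> carrier G \<Longrightarrow> x \<ominus> x = \<zero>"
  by simp

lemma (in abelian_group) neg_cancel4:
  assumes "x \<in> carrier G" "y \<in> carrier G" "z \<in> carrier G" "w \<in> carrier G"
  shows "x \<oplus> (y \<oplus> (z \<oplus> (\<ominus> x \<oplus> w))) = y \<oplus> (z \<oplus> w)"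
    "\<ominus> x \<oplus> (y \<oplus> (z \<oplus> (x \<oplus> w))) = y \<oplus> (z \<oplus> w)"
  using assms neg_cancel3[of x "y \<oplus> z" w] by (simp_all add: a_assoc)

lemma (in abelian_group) neg_zero [simp]: "\<ominus> \<zero> = \<zero>"
  by (rule minus_equality) simp_all

lemma (in abelian_group) diff_zero [simp]: "x \<in> carrier G \<Longrightarrow> x \<ominus> \<zero> = x"
  by (simp add: minus_eq)

lemmas (in abelian_group) abelian_simps =
  minus_eq minus_add a_ac r_neg l_neg r_neg1 r_neg2 neg_cancel neg_cancel3 neg_cancel4

text \<open>No product is assumed. The opposite algebra and the Clifford tensor product enter as
  graded spaces, so that their parity can be computed first; the ring axioms of the tensor product
  are derived only later, from matrix entries.\<close>

locale graded_space = abelian_group R for R :: "'r gr_alg" (structure) +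
  assumes scale_closed [simp]: "a \<in> carrier R \<Longrightarrow> rscale R r a \<in> carrier R"
    and scale_add_right: "a \<in> carrier R \<Longrightarrow> b \<in> carrier R \<Longrightarrow>
      rscale R r (a \<oplus> b) = rscale R r a \<oplus> rscale R r b"
    and scale_add_left: "a \<in> carrier R \<Longrightarrow> rscale R (r + s) a = rscale R r a \<oplus> rscale R s a"
    and scale_scale: "a \<in> carrier R \<Longrightarrow> rscale R r (rscale R s a) = rscale R (r * s) a"
    and scale_one [simp]: "a \<in> carrier R \<Longrightarrow> rscale R 1 a = a"
    and part_subset: "i \<in> {0, 1} \<Longrightarrow> part R i \<subseteq> carrier R"
    and part_zero: "i \<in> {0, 1} \<Longrightarrow> \<zero> \<in> part R i"
    and part_add: "i \<in> {0, 1} \<Longrightarrow> a \<in> part R i \<Longrightarrow> b \<in> part R i \<Longrightarrow> a \<oplus> b \<in> part R i"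
    and part_scale: "i \<in> {0, 1} \<Longrightarrow> a \<in> part R i \<Longrightarrow> rscale R r a \<in> part R i"
    and part_sum: "a \<in> carrier R \<Longrightarrow> \<exists>x\<in>part R 0. \<exists>y\<in>part R 1. a = x \<oplus> y"
    and part_int: "part R 0 \<inter> part R 1 = {\<zero>}"
begin

lemma part_closed_carrier: "a \<in> part R 0 \<Longrightarrow> a \<in> carrier R" "a \<in> part R 1 \<Longrightarrow> a \<in> carrier R"
  using part_subset by auto

lemma scale_0 [simp]:
  assumes "a \<in> carrier R" shows "rscale R 0 a = \<zero>"
proof -
  have "rscale R 0 a \<oplus> rscale R 0 a = rscale R 0 a \<oplus> \<zero>"
    using scale_add_left[of a 0 0] assms by simp
  then show ?thesis
    using assms by (metis add.l_cancel scale_closed zero_closed)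
qed

lemma scale_minus:
  assumes "a \<in> carrier R" shows "rscale R (- r) a = \<ominus> rscale R r a"
proof -
  have "rscale R (- r) a \<oplus> rscale R r a = \<zero>"
    using scale_add_left[of a "- r" r] assms by simp
  then show ?thesis
    using assms by (simp add: minus_equality)
qed

lemma scale_minus_one: "a \<in> carrier R \<Longrightarrow> rscale R (- 1) a = \<ominus> a"
  using scale_minus[of a 1] by simp

lemma scale_zero_right [simp]: "rscale R r \<zero> = \<zero>"
  using scale_scale[of \<zero> r 0] by simp

lemma scale_neg_right: "a \<in> carrier R \<Longrightarrow> rscale R r (\<ominus> a) = \<ominus> rscale R r a"
  using scale_scale[of a r "-1"] by (simp add: scale_minus_one scale_minus)

lemma part_neg: "i \<in> {0, 1} \<Longrightarrow> a \<in> part R i \<Longrightarrow> \<ominus> a \<in> part R i"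
  using part_scale[of i a "-1"] part_subset[of i] by (auto simp: scale_minus_one)

lemma part_decomposition_unique:
  assumes "x \<in> part R 0" "y \<in> part R 1" "x' \<in> part R 0" "y' \<in> part R 1" "x \<oplus> y = x' \<oplus> y'"
  shows "x = x' \<and> y = y'"
proof -
  have x: "x \<in> carrier R" "x' \<in> carrier R" "y \<in> carrier R" "y' \<in> carrier R"
    using assms part_closed_carrier by auto
  have "x \<ominus> x' = (x \<oplus> y) \<ominus> (x' \<oplus> y)"
    using x by (simp add: abelian_simps)
  also have "\<dots> = y' \<ominus> y"
    using x assms(5) by (simp add: abelian_simps)
  finally have e: "x \<ominus> x' = y' \<ominus> y" .
  moreover have "x \<ominus> x' \<in> part R 0" "y' \<ominus> y \<in> part R 1"
    using assms part_add part_neg by (simp_all add: minus_eq)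
  ultimately have "x \<ominus> x' = \<zero>" "y' \<ominus> y = \<zero>"
    using part_int by auto
  then show ?thesis
    using x by simp
qed

text \<open>Evaluates the definite description behind \<open>hcomp\<close>: the given splitting is a
  witness, and directness of the sum makes it unique.\<close>

lemma hcomp_add:
  assumes "x \<in> part R 0" "y \<in> part R 1"
  shows "hcomp R 0 (x \<oplus> y) = x" "hcomp R 1 (x \<oplus> y) = y"
proof -
  have c: "x \<in> carrier R" "y \<in> carrier R"
    using assms part_closed_carrier by auto
  show "hcomp R 0 (x \<oplus> y) = x"
    unfolding hcomp_def
    by (rule the_equality) (use assms part_decomposition_unique in force)+
  show "hcomp R 1 (x \<oplus> y) = y"
    unfolding hcomp_def
  proof (rule the_equality)
    show "y \<in> part R 1 \<and> (\<exists>z\<in>part R (1 - 1). y \<oplus> z = x \<oplus> y)"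
      using assms a_comm[OF c] by auto
    fix z assume z: "z \<in> part R 1 \<and> (\<exists>w\<in>part R (1 - 1). z \<oplus> w = x \<oplus> y)"
    then obtain w where w: "w \<in> part R 0" "z \<oplus> w = x \<oplus> y" by auto
    with z have "w \<oplus> z = x \<oplus> y"
      using a_comm part_closed_carrier by metis
    then show "z = y"
      using part_decomposition_unique[OF w(1) _ assms] z by blast
  qed
qed

lemma hcomp_part:
  assumes "a \<in> carrier R"
  shows "hcomp R 0 a \<in> part R 0" "hcomp R 1 a \<in> part R 1" "hcomp R 0 a \<oplus> hcomp R 1 a = a"
proof -
  obtain x y where "x \<in> part R 0" "y \<in> part R 1" "a = x \<oplus> y"
    using part_sum[OF assms] by blast
  then show "hcomp R 0 a \<in> part R 0" "hcomp R 1 a \<in> part R 1" "hcomp R 0 a \<oplus> hcomp R 1 a = a"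
    using hcomp_add by auto
qed

lemma hcomp_closed [simp]:
  assumes "a \<in> carrier R"
  shows "hcomp R 0 a \<in> carrier R" "hcomp R (Suc 0) a \<in> carrier R"
  using hcomp_part[OF assms] part_closed_carrier by auto

lemma hcomp_of_part:
  assumes "i \<in> {0, 1}" "a \<in> part R i"
  shows "hcomp R i a = a" "hcomp R (1 - i) a = \<zero>"
  using assms hcomp_add[of a \<zero>] hcomp_add[of \<zero> a] part_zero part_closed_carrier by auto

lemma hcomp_sum:
  assumes "a \<in> carrier R" "b \<in> carrier R" "i \<in> {0, 1}"
  shows "hcomp R i (a \<oplus> b) = hcomp R i a \<oplus> hcomp R i b"
proof -
  have "a \<oplus> b = (hcomp R 0 a \<oplus> hcomp R 1 a) \<oplus> (hcomp R 0 b \<oplus> hcomp R 1 b)"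
    using hcomp_part assms by simp
  also have "\<dots> = (hcomp R 0 a \<oplus> hcomp R 0 b) \<oplus> (hcomp R 1 a \<oplus> hcomp R 1 b)"
    using assms by (simp add: a_ac)
  finally have e: "a \<oplus> b = \<dots>" .
  show ?thesis
    unfolding e using assms(3)
      hcomp_add[OF part_add[OF _ hcomp_part(1)[OF assms(1)] hcomp_part(1)[OF assms(2)]]
         part_add[OF _ hcomp_part(2)[OF assms(1)] hcomp_part(2)[OF assms(2)]]]
    by auto
qed

lemma hcomp_scale:
  assumes "a \<in> carrier R" "i \<in> {0, 1}"
  shows "hcomp R i (rscale R r a) = rscale R r (hcomp R i a)"
proof -
  have e: "rscale R r a = rscale R r (hcomp R 0 a) \<oplus> rscale R r (hcomp R 1 a)"
    using hcomp_part[OF assms(1)] scale_add_right[of "hcomp R 0 a" "hcomp R 1 a"] assms by simp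
  show ?thesis
    unfolding e using assms(2)
      hcomp_add[OF part_scale[OF _ hcomp_part(1)[OF assms(1)]] part_scale[OF _ hcomp_part(2)[OF assms(1)]]]
    by auto
qed

lemma parity_eq:
  assumes "a \<in> carrier R"
  shows "parity R a = hcomp R 0 a \<ominus> hcomp R 1 a"
  unfolding parity_def using assms by (simp add: finsum_insert scale_minus_one minus_eq Pi_def)

lemma parity_closed [simp]: "a \<in> carrier R \<Longrightarrow> parity R a \<in> carrier R"
  by (simp add: parity_eq)

lemma parity_homogeneous:
  assumes "i \<in> {0, 1}" "a \<in> part R i"
  shows "parity R a = rscale R ((-1) ^ i) a"
  using assms part_closed_carrier hcomp_of_part[OF assms]
  by (auto simp: parity_eq scale_minus_one minus_eq)

lemma parity_even: "a \<in> part R 0 \<Longrightarrow> parity R a = a"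
  and parity_odd: "a \<in> part R 1 \<Longrightarrow> parity R a = \<ominus> a"
  using parity_homogeneous[of 0 a] parity_homogeneous[of 1 a] part_closed_carrier
  by (auto simp: scale_minus_one)

lemma parity_add:
  assumes "a \<in> carrier R" "b \<in> carrier R"
  shows "parity R (a \<oplus> b) = parity R a \<oplus> parity R b"
  using assms by (simp add: parity_eq hcomp_sum minus_eq minus_add a_ac)

lemma parity_scale: "a \<in> carrier R \<Longrightarrow> parity R (rscale R r a) = rscale R r (parity R a)"
  by (simp add: parity_eq hcomp_scale scale_add_right minus_eq scale_neg_right)

lemma parity_zero [simp]: "parity R \<zero> = \<zero>"
  using parity_even[of \<zero>] part_zero by simp

lemma parity_neg: "a \<in> carrier R \<Longrightarrow> parity R (\<ominus> a) = \<ominus> parity R a"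
  using parity_scale[of a "-1"] by (simp add: scale_minus_one)

lemma hcomp_parity:
  assumes "a \<in> carrier R"
  shows "hcomp R 0 (parity R a) = hcomp R 0 a" "hcomp R 1 (parity R a) = \<ominus> hcomp R 1 a"
  using assms hcomp_add[OF hcomp_part(1)[OF assms] part_neg[OF _ hcomp_part(2)[OF assms]]]
  by (simp_all add: parity_eq minus_eq)

lemma parity_parity [simp]:
  assumes "a \<in> carrier R" shows "parity R (parity R a) = a"
  using assms hcomp_part(3)[OF assms] hcomp_parity[OF assms]
  by (simp add: parity_eq[of "parity R a"] minus_eq)

text \<open>The spectral projections of the involution \<open>parity\<close>. Through them,
  multiplicativity and boundedness of \<open>parity\<close> pass to the homogeneous
  components.\<close>

lemma hcomp_even_eq:
  assumes "a \<in> carrier R"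
  shows "hcomp R 0 a = rscale R (1/2) (a \<oplus> parity R a)"
    and "hcomp R 1 a = rscale R (1/2) (a \<ominus> parity R a)"
proof -
  have 2: "rscale R (1/2) (x \<oplus> x) = x" if "x \<in> carrier R" for x
    using scale_add_left[of x "1/2" "1/2"] scale_add_right[of x x "1/2"] that by simp
  have "a \<oplus> parity R a = (hcomp R 0 a \<oplus> hcomp R 1 a) \<oplus> (hcomp R 0 a \<ominus> hcomp R 1 a)"
    using hcomp_part(3)[OF assms] parity_eq[OF assms] by simp
  also have "\<dots> = hcomp R 0 a \<oplus> hcomp R 0 a"
    using assms by (simp add: abelian_simps)
  finally show "hcomp R 0 a = rscale R (1/2) (a \<oplus> parity R a)"
    using 2[of "hcomp R 0 a"] assms by simp
  have "a \<ominus> parity R a = (hcomp R 0 a \<oplus> hcomp R 1 a) \<ominus> (hcomp R 0 a \<ominus> hcomp R 1 a)"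
    using hcomp_part(3)[OF assms] parity_eq[OF assms] by simp
  also have "\<dots> = hcomp R 1 a \<oplus> hcomp R 1 a"
    using assms by (simp add: abelian_simps)
  finally show "hcomp R 1 a = rscale R (1/2) (a \<ominus> parity R a)"
    using 2[of "hcomp R 1 a"] assms by simp
qed

text \<open>The even element \<open>a \<oplus> z\<close> is fixed by \<open>parity\<close> and the
  odd element \<open>a \<ominus> z\<close> is negated; adding both equations cancels
  \<open>parity R z\<close> and leaves twice the claim. This is how the parity of a concrete element
  is found without decomposing it.\<close>

lemma parityI:
  assumes "a \<in> carrier R" "z \<in> carrier R" "a \<oplus> z \<in> part R 0" "a \<ominus> z \<in> part R 1"
  shows "parity R a = z"
proof -
  have "parity R a \<oplus> parity R z = a \<oplus> z"
    using parity_even[OF assms(3)] assms by (simp add: parity_add)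
  moreover have "parity R a \<ominus> parity R z = z \<ominus> a"
    using parity_odd[OF assms(4)] assms by (simp add: parity_add parity_neg minus_eq minus_add a_ac)
  ultimately have e: "(parity R a \<oplus> parity R z) \<oplus> (parity R a \<ominus> parity R z) = (a \<oplus> z) \<oplus> (z \<ominus> a)"
    by simp
  have "parity R a \<oplus> parity R a = (parity R a \<oplus> parity R z) \<oplus> (parity R a \<ominus> parity R z)"
    using assms by (simp add: abelian_simps)
  also have "\<dots> = z \<oplus> z"
    unfolding e using assms by (simp add: abelian_simps)
  finally have "rscale R (1/2) (parity R a \<oplus> parity R a) = rscale R (1/2) (z \<oplus> z)"
    by simp
  moreover have "rscale R (1/2) (x \<oplus> x) = x" if "x \<in> carrier R" for x
    using scale_add_left[of x "1/2" "1/2"] scale_add_right[of x x "1/2"] that by simp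
  ultimately show ?thesis
    using assms by simp
qed

end

locale normed_graded_space = graded_space +
  assumes nrm_nonneg [simp]: "a \<in> carrier R \<Longrightarrow> 0 \<le> nrm R a"
    and nrm_eq_0: "a \<in> carrier R \<Longrightarrow> nrm R a = 0 \<longleftrightarrow> a = \<zero>"
    and nrm_scale: "a \<in> carrier R \<Longrightarrow> nrm R (rscale R r a) = \<bar>r\<bar> * nrm R a"
    and nrm_triangle: "a \<in> carrier R \<Longrightarrow> b \<in> carrier R \<Longrightarrow> nrm R (a \<oplus> b) \<le> nrm R a + nrm R b"
begin

lemma nrm_zero [simp]: "nrm R \<zero> = 0"
  by (simp add: nrm_eq_0)

lemma nrm_neg [simp]: "a \<in> carrier R \<Longrightarrow> nrm R (\<ominus> a) = nrm R a"
  using nrm_scale[of a "-1"] by (simp add: scale_minus_one)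

lemma nrm_diff_triangle:
  assumes "a \<in> carrier R" "b \<in> carrier R" "c \<in> carrier R"
  shows "nrm R (a \<ominus> c) \<le> nrm R (a \<ominus> b) + nrm R (b \<ominus> c)"
proof -
  have "a \<ominus> c = (a \<ominus> b) \<oplus> (b \<ominus> c)"
    using assms by (simp add: abelian_simps)
  then show ?thesis
    using nrm_triangle[of "a \<ominus> b" "b \<ominus> c"] assms by simp
qed

lemma nrm_diff_commute: "a \<in> carrier R \<Longrightarrow> b \<in> carrier R \<Longrightarrow> nrm R (a \<ominus> b) = nrm R (b \<ominus> a)"
  using nrm_neg[of "a \<ominus> b"] by (simp add: minus_eq minus_add a_ac)

lemma nrm_diff_le: "a \<in> carrier R \<Longrightarrow> b \<in> carrier R \<Longrightarrow> nrm R (a \<ominus> b) \<le> nrm R a + nrm R b"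
  using nrm_triangle[of a "\<ominus> b"] by (simp add: minus_eq)

lemma nrm_triangle_diff: "a \<in> carrier R \<Longrightarrow> b \<in> carrier R \<Longrightarrow> nrm R a \<le> nrm R (a \<ominus> b) + nrm R b"
  using nrm_triangle[of "a \<ominus> b" b] by (simp add: minus_eq a_assoc l_neg)

lemma nrm_finsum:
  assumes "finite K" "\<And>k. k \<in> K \<Longrightarrow> f k \<in> carrier R"
  shows "nrm R (finsum R f K) \<le> (\<Sum>k\<in>K. nrm R (f k))"
  using assms
proof (induction K)
  case (insert x F)
  then have "nrm R (finsum R f (insert x F)) \<le> nrm R (f x) + nrm R (finsum R f F)"
    by (simp add: finsum_insert Pi_def nrm_triangle)
  then show ?case
    using insert by auto
qed auto

lemma metric: "Metric_space (carrier R) (nrm_dist R)"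
proof
  fix x y z
  show "0 \<le> nrm_dist R x y"
    by (simp add: nrm_dist_def)
  show "nrm_dist R x y = nrm_dist R y x"
    by (simp add: nrm_dist_def nrm_diff_commute)
  assume x: "x \<in> carrier R" and y: "y \<in> carrier R"
  then show "nrm_dist R x y = 0 \<longleftrightarrow> x = y"
    by (simp add: nrm_dist_def nrm_eq_0)
  assume z: "z \<in> carrier R"
  with x y show "nrm_dist R x z \<le> nrm_dist R x y + nrm_dist R y z"
    by (simp add: nrm_dist_def nrm_diff_triangle)
qed

end

sublocale normed_graded_space \<subseteq> metric: Metric_space "carrier R" "nrm_dist R"
  by (rule metric)

lemma (in normed_graded_space) limitin_iff:
  assumes "\<And>n. f n \<in> carrier R"
  shows "limitin metric.mtopology f l sequentially \<longleftrightarrow>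
    l \<in> carrier R \<and> (\<lambda>n. nrm R (f n \<ominus> l)) \<longlonglongrightarrow> 0"
  using assms by (auto simp: metric.limitin_metric_dist_null nrm_dist_def)

text \<open>This is the closed graph theorem: the graph of the involution is closed because the even and the
  odd part are closed.\<close>

lemma (in normed_graded_space) parity_bounded:
  assumes complete: "metric.mcomplete"
    and closed: "\<And>i. i \<in> {0, 1} \<Longrightarrow> closedin metric.mtopology (part R i)"
  shows "\<exists>C. \<forall>a\<in>carrier R. nrm R (parity R a) \<le> C * nrm R a"
proof -
  \<comment> \<open>The sets on which the parity has norm at most \<open>n\<close> exhaust the
    space, so by the theorem of Baire the closure of one of them contains a ball.\<close>
  define E where "E n = metric.mtopology closure_of {a \<in> carrier R. nrm R (parity R a) \<le> real n}" for n
  have "\<exists>n. metric.mtopology interior_of E n \<noteq> {}"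
  proof (rule ccontr)
    assume "\<nexists>n. metric.mtopology interior_of E n \<noteq> {}"
    then have "metric.mtopology interior_of \<Union> (range E) = {}"
      by (intro metric.metric_Baire_category_alt complete) (auto simp: E_def)
    moreover have "\<Union> (range E) = carrier R"
    proof
      show "\<Union> (range E) \<subseteq> carrier R"
        unfolding E_def using closure_of_subset_topspace by fastforce
      show "carrier R \<subseteq> \<Union> (range E)"
      proof
        fix a assume a: "a \<in> carrier R"
        obtain n where "nrm R (parity R a) \<le> real n"
          using real_arch_simple by blast
        then have "a \<in> E n"
          unfolding E_def using a closure_of_subset[of "{a \<in> carrier R. nrm R (parity R a) \<le> real n}" metric.mtopology]
          by auto
        then show "a \<in> \<Union> (range E)" by blast
      qed
    qed
    ultimately have "carrier R = {}"
      by (metis interior_of_topspace metric.topspace_mtopology)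
    then show False by auto
  qed
  then obtain n a0 where "a0 \<in> metric.mtopology interior_of E n" by blast
  moreover have "openin metric.mtopology (metric.mtopology interior_of E n)"
    by (rule openin_interior_of)
  ultimately obtain r where r0: "r > 0" "metric.mball a0 r \<subseteq> metric.mtopology interior_of E n"
    and a0: "a0 \<in> carrier R"
    unfolding metric.openin_mtopology by blast
  then have r: "r > 0" "metric.mball a0 r \<subseteq> E n"
    using interior_of_subset[of metric.mtopology "E n"] by auto
  have approx: "\<exists>u\<in>carrier R. nrm R (parity R u) \<le> real n \<and> nrm R (x \<ominus> u) < \<epsilon>"
    if "x \<in> metric.mball a0 r" "\<epsilon> > 0" for x \<epsilon>
  proof -
    have "x \<in> E n" "x \<in> carrier R" using that r by auto
    then show ?thesis
      using \<open>\<epsilon> > 0\<close> unfolding E_def metric.metric_closure_of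
      by (auto simp: nrm_dist_def)
  qed
  \<comment> \<open>Both \<open>a0 \<oplus> x\<close> and the centre \<open>a0\<close> are
    approximated inside the ball and subtracted: the centre cancels, and the bound \<open>n\<close>
    on the norm of the parity doubles.\<close>
  have step0: "\<exists>y\<in>carrier R. nrm R (parity R y) \<le> 2 * real n \<and> nrm R (x \<ominus> y) \<le> \<epsilon>"
    if x: "x \<in> carrier R" "nrm R x < r" and \<epsilon>: "\<epsilon> > 0" for x \<epsilon>
  proof -
    have "nrm R (a0 \<ominus> (a0 \<oplus> x)) = nrm R x"
      using x a0 by (simp add: abelian_simps)
    then have "a0 \<oplus> x \<in> metric.mball a0 r" "a0 \<in> metric.mball a0 r"
      using x a0 r by (auto simp: nrm_dist_def)
    then obtain u v where u: "u \<in> carrier R" "nrm R (parity R u) \<le> real n" "nrm R (a0 \<oplus> x \<ominus> u) < \<epsilon> / 2"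
      and v: "v \<in> carrier R" "nrm R (parity R v) \<le> real n" "nrm R (a0 \<ominus> v) < \<epsilon> / 2"
      using approx[of _ "\<epsilon> / 2"] \<epsilon> by (metis half_gt_zero)
    have "parity R (u \<ominus> v) = parity R u \<ominus> parity R v"
      using u v by (simp add: minus_eq parity_add parity_neg)
    then have "nrm R (parity R (u \<ominus> v)) \<le> 2 * real n"
      using nrm_diff_le[of "parity R u" "parity R v"] u v by simp
    moreover have "x \<ominus> (u \<ominus> v) = (a0 \<oplus> x \<ominus> u) \<ominus> (a0 \<ominus> v)"
      using u v x a0 by (simp add: abelian_simps)
    then have "nrm R (x \<ominus> (u \<ominus> v)) \<le> \<epsilon>"
      using nrm_diff_le[of "a0 \<oplus> x \<ominus> u" "a0 \<ominus> v"] u v x a0 by simp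
    ultimately show ?thesis
      using u v by (intro bexI[of _ "u \<ominus> v"]) auto
  qed
  \<comment> \<open>A nonzero \<open>x\<close> is scaled by \<open>r / (2 * nrm R x)\<close> into
    the ball and approximated with error \<open>r / 4\<close>. Scaling back halves the remainder
    relative to \<open>x\<close> and turns the bound \<open>2 * n\<close> into
    \<open>4 * n / r\<close> times the norm of \<open>x\<close>.\<close>
  define K where "K = 4 * real n / r"
  have "K \<ge> 0" using r by (simp add: K_def)
  have step: "\<exists>y\<in>carrier R. nrm R (parity R y) \<le> K * nrm R x \<and> nrm R (x \<ominus> y) \<le> nrm R x / 2"
    if x: "x \<in> carrier R" for x
  proof (cases "nrm R x = 0")
    case True
    then have "x = \<zero>" using x nrm_eq_0 by blast
    then show ?thesis by (intro bexI[of _ \<zero>]) auto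
  next
    case False
    then have pos: "nrm R x > 0"
      using x by (simp add: order_less_le)
    define t where "t = r / (2 * nrm R x)"
    have t: "t > 0" using pos r by (simp add: t_def)
    have "nrm R (rscale R t x) = r / 2"
      using pos r x by (simp add: nrm_scale t_def)
    then obtain y where y: "y \<in> carrier R" "nrm R (parity R y) \<le> 2 * real n"
      "nrm R (rscale R t x \<ominus> y) \<le> r / 4"
      using step0[of "rscale R t x" "r / 4"] x r by auto
    have "rscale R (1/t) (rscale R t x \<ominus> y) = x \<ominus> rscale R (1/t) y"
      using x y t by (simp add: minus_eq scale_add_right scale_neg_right scale_scale)
    then have "nrm R (x \<ominus> rscale R (1/t) y) = (1/t) * nrm R (rscale R t x \<ominus> y)"
      using nrm_scale[of "rscale R t x \<ominus> y" "1/t"] x y t by simp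
    also have "\<dots> \<le> (1/t) * (r / 4)"
      using y t by (intro mult_left_mono) auto
    also have "\<dots> = nrm R x / 2"
      using pos r by (simp add: t_def field_simps)
    finally have 1: "nrm R (x \<ominus> rscale R (1/t) y) \<le> nrm R x / 2" .
    have "nrm R (parity R (rscale R (1/t) y)) = (1/t) * nrm R (parity R y)"
      using y t by (simp add: parity_scale nrm_scale)
    also have "\<dots> \<le> (1/t) * (2 * real n)"
      using y t by (intro mult_left_mono) auto
    also have "\<dots> = K * nrm R x"
      using pos r by (simp add: t_def K_def field_simps)
    finally show ?thesis
      using 1 y by (intro bexI[of _ "rscale R (1/t) y"]) auto
  qed
  then obtain Y where Y: "\<And>x. x \<in> carrier R \<Longrightarrow> Y x \<in> carrier R"
    "\<And>x. x \<in> carrier R \<Longrightarrow> nrm R (parity R (Y x)) \<le> K * nrm R x"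
    "\<And>x. x \<in> carrier R \<Longrightarrow> nrm R (x \<ominus> Y x) \<le> nrm R x / 2"
    by metis
  have "nrm R (parity R x) \<le> 2 * K * nrm R x" if x: "x \<in> carrier R" for x
  proof -
    \<comment> \<open>Iterated correction writes \<open>x\<close> as the sum of the
      \<open>Y (rem k)\<close>. The partial sums \<open>s\<close> converge to \<open>x\<close>, and
      their parities \<open>z\<close> form a Cauchy sequence by comparison with a geometric series;
      continuity of \<open>parity\<close> is not yet available at this point.\<close>
    define rem where "rem = rec_nat x (\<lambda>_ u. u \<ominus> Y u)"
    have X0: "rem 0 = x" and XS: "rem (Suc k) = rem k \<ominus> Y (rem k)" for k
      by (simp_all add: rem_def)
    have Xc [simp]: "rem k \<in> carrier R" for k
      by (induction k) (use x Y in \<open>simp_all add: X0 XS\<close>)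
    have Xn: "nrm R (rem k) \<le> nrm R x / 2 ^ k" for k
    proof (induction k)
      case (Suc k)
      then show ?case using Y(3)[of "rem k"] by (simp add: XS)
    qed (simp add: X0)
    define s where "s k = x \<ominus> rem k" for k
    have sc [simp]: "s k \<in> carrier R" for k using x by (simp add: s_def)
    have s0: "s 0 = \<zero>" using x by (simp add: s_def X0)
    have sS: "s (Suc k) = s k \<oplus> Y (rem k)" for k
      using x Y(1)[of "rem k"] by (simp add: s_def XS abelian_simps)
    define z where "z k = parity R (s k)" for k
    have zc [simp]: "z k \<in> carrier R" for k by (simp add: z_def)
    have zS: "nrm R (z (Suc k) \<ominus> z k) \<le> K * (nrm R x / 2 ^ k)" for k
    proof -
      have "z (Suc k) \<ominus> z k = parity R (Y (rem k))"
        using Y(1)[of "rem k"] by (simp add: z_def sS parity_add abelian_simps)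
      then have "nrm R (z (Suc k) \<ominus> z k) \<le> K * nrm R (rem k)"
        using Y(2)[of "rem k"] by simp
      then show ?thesis
        using Xn[of k] \<open>K \<ge> 0\<close> mult_left_mono order_trans by blast
    qed
    have zd: "nrm R (z (k + m) \<ominus> z k) \<le> 2 * K * nrm R x * (1 / 2 ^ k - 1 / 2 ^ (k + m))" for k m
    proof (induction m)
      case (Suc m)
      have "nrm R (z (k + Suc m) \<ominus> z k) \<le> nrm R (z (Suc (k + m)) \<ominus> z (k + m)) + nrm R (z (k + m) \<ominus> z k)"
        using nrm_diff_triangle[of "z (Suc (k + m))" "z (k + m)" "z k"] by simp
      also have "\<dots> \<le> K * (nrm R x / 2 ^ (k + m)) + 2 * K * nrm R x * (1 / 2 ^ k - 1 / 2 ^ (k + m))"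
        using zS[of "k + m"] Suc by simp
      also have "\<dots> = 2 * K * nrm R x * (1 / 2 ^ k - 1 / 2 ^ (k + Suc m))"
        by (simp add: field_simps)
      finally show ?case .
    qed simp
    have z0: "z 0 = \<zero>" by (simp add: z_def s0)
    have zb: "nrm R (z m \<ominus> z k) \<le> 2 * K * nrm R x / 2 ^ k" if "k \<le> m" for m k
    proof -
      have "nrm R (z m \<ominus> z k) \<le> 2 * K * nrm R x * (1 / 2 ^ k - 1 / 2 ^ m)"
        using zd[of k "m - k"] that by simp
      also have "\<dots> \<le> 2 * K * nrm R x * (1 / 2 ^ k)"
        using \<open>K \<ge> 0\<close> x by (intro mult_left_mono) auto
      finally show ?thesis by simp
    qed
    have lim0: "(\<lambda>k. C / 2 ^ k) \<longlonglongrightarrow> 0" for C :: real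
      using tendsto_mult_right_zero[OF LIMSEQ_inverse_realpow_zero[of 2], of C]
      by (simp add: divide_inverse)
    have "metric.MCauchy z"
      unfolding metric.MCauchy_def
    proof (intro conjI allI impI)
      fix \<epsilon> :: real assume "\<epsilon> > 0"
      then obtain N where N: "2 * K * nrm R x / 2 ^ N < \<epsilon>"
        using order_tendstoD(2)[OF lim0[of "2 * K * nrm R x"]] eventually_sequentially by force
      have "nrm R (z m \<ominus> z k) < \<epsilon>" if "N \<le> k" "k \<le> m" for k m
      proof -
        have "2 * K * nrm R x / 2 ^ k \<le> 2 * K * nrm R x / 2 ^ N"
          using that \<open>K \<ge> 0\<close> x by (intro divide_left_mono) auto
        then show ?thesis using zb[OF that(2)] N by simp
      qed
      then show "\<exists>N. \<forall>k k'. N \<le> k \<longrightarrow> N \<le> k' \<longrightarrow> nrm_dist R (z k) (z k') < \<epsilon>"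
        by (intro exI[of _ N]) (auto simp: nrm_dist_def, metis nrm_diff_commute nle_le zc)
    qed (auto simp: image_subset_iff)
    then obtain l where "limitin metric.mtopology z l sequentially"
      using complete unfolding metric.mcomplete_def by blast
    then have l: "l \<in> carrier R" "(\<lambda>k. nrm R (z k \<ominus> l)) \<longlonglongrightarrow> 0"
      using limitin_iff[of z] by auto
    have sx: "(\<lambda>k. nrm R (s k \<ominus> x)) \<longlonglongrightarrow> 0"
    proof (rule Lim_null_comparison[OF _ lim0[of "nrm R x"]])
      have "nrm R (s k \<ominus> x) = nrm R (rem k)" for k
        using x by (simp add: s_def abelian_simps)
      then show "\<forall>\<^sub>F k in sequentially. norm (nrm R (s k \<ominus> x)) \<le> nrm R x / 2 ^ k"
        using Xn by simp
    qed
    \<comment> \<open>The elements \<open>s k \<oplus> z k\<close> and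
      \<open>s k \<ominus> z k\<close> are twice the homogeneous components of \<open>s k\<close>.
      Closedness of the parts passes to the limits \<open>x \<oplus> l\<close> and
      \<open>x \<ominus> l\<close>, and \<open>parityI\<close> then identifies \<open>l\<close> as
      the parity of \<open>x\<close>.\<close>
    have mem: "x' \<in> part R i"
      if i: "i \<in> {0, 1}" and f: "\<And>k. f k \<in> part R i" and x': "x' \<in> carrier R"
        and le: "\<And>k. nrm R (f k \<ominus> x') \<le> nrm R (s k \<ominus> x) + nrm R (z k \<ominus> l)" for f x' i
    proof -
      have fc: "f k \<in> carrier R" for k using f part_subset[OF i] by blast
      have "(\<lambda>k. nrm R (f k \<ominus> x')) \<longlonglongrightarrow> 0"
        by (rule Lim_null_comparison[OF _ tendsto_add_zero[OF sx l(2)]]) (use le fc x' in auto)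
      then have "limitin metric.mtopology f x' sequentially"
        using fc x' by (simp add: limitin_iff)
      then show ?thesis
        using closed[OF i] f unfolding metric.metric_closedin_iff_sequentially_closed
        by (metis image_subsetI)
    qed
    have "x \<oplus> l \<in> part R 0"
    proof (rule mem)
      fix k
      have "rscale R 2 (hcomp R 0 (s k)) = s k \<oplus> z k"
        unfolding hcomp_even_eq(1)[OF sc] z_def by (simp add: scale_scale)
      then show "s k \<oplus> z k \<in> part R 0"
        using part_scale[of 0 "hcomp R 0 (s k)" 2] hcomp_part[of "s k"] by simp
      have "(s k \<oplus> z k) \<ominus> (x \<oplus> l) = (s k \<ominus> x) \<oplus> (z k \<ominus> l)"
        using x l by (simp add: abelian_simps)
      then show "nrm R ((s k \<oplus> z k) \<ominus> (x \<oplus> l)) \<le> nrm R (s k \<ominus> x) + nrm R (z k \<ominus> l)"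
        using nrm_triangle[of "s k \<ominus> x" "z k \<ominus> l"] x l by simp
    qed (use x l in auto)
    moreover have "x \<ominus> l \<in> part R 1"
    proof (rule mem)
      fix k
      have "rscale R 2 (hcomp R 1 (s k)) = s k \<ominus> z k"
        unfolding hcomp_even_eq(2)[OF sc] z_def by (simp add: scale_scale)
      then show "s k \<ominus> z k \<in> part R 1"
        using part_scale[of 1 "hcomp R 1 (s k)" 2] hcomp_part[of "s k"] by simp
      have "(s k \<ominus> z k) \<ominus> (x \<ominus> l) = (s k \<ominus> x) \<ominus> (z k \<ominus> l)"
        using x l by (simp add: abelian_simps)
      then show "nrm R ((s k \<ominus> z k) \<ominus> (x \<ominus> l)) \<le> nrm R (s k \<ominus> x) + nrm R (z k \<ominus> l)"
        using nrm_diff_le[of "s k \<ominus> x" "z k \<ominus> l"] x l by simp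
    qed (use x l in auto)
    ultimately have "parity R x = l"
      using parityI x l by blast
    moreover have "nrm R l \<le> 2 * K * nrm R x + nrm R (z k \<ominus> l)" for k
      using nrm_triangle_diff[of l "z k"] nrm_diff_commute[of "z k" l] zb[of 0 k] l
      by (simp add: z0 minus_eq)
    then have "nrm R l \<le> 2 * K * nrm R x + 0"
      by (intro LIMSEQ_le_const[OF tendsto_add[OF tendsto_const l(2)]]) auto
    ultimately show ?thesis by simp
  qed
  then show ?thesis by blast
qed

section \<open>Graded normed rings\<close>

text \<open>Bounds with unspecified constants instead of submultiplicativity, because the sum norm
  on a Clifford tensor product is only equivalent to its C*-norm. Everything about paths and
  operator norms needs no more than such bounds.\<close>

locale normed_graded_ring = ring R + normed_graded_space R for R :: "'r gr_alg" (structure) +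
  assumes scale_mult_left: "a \<in> carrier R \<Longrightarrow> b \<in> carrier R \<Longrightarrow>
      rscale R r a \<otimes> b = rscale R r (a \<otimes> b)"
    and scale_mult_right: "a \<in> carrier R \<Longrightarrow> b \<in> carrier R \<Longrightarrow>
      a \<otimes> rscale R r b = rscale R r (a \<otimes> b)"
    and parity_mult: "a \<in> carrier R \<Longrightarrow> b \<in> carrier R \<Longrightarrow>
      parity R (a \<otimes> b) = parity R a \<otimes> parity R b"
    and nrm_mult_bounded:
      "\<exists>C. \<forall>a\<in>carrier R. \<forall>b\<in>carrier R. nrm R (a \<otimes> b) \<le> C * nrm R a * nrm R b"
    and nrm_parity_bounded: "\<exists>C. \<forall>a\<in>carrier R. nrm R (parity R a) \<le> C * nrm R a"
begin

text \<open>A multiplicative involution fixes the unit: apply it to the product of the unit with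
  \<open>parity R \<one>\<close>.\<close>

lemma parity_one [simp]: "parity R \<one> = \<one>"
proof -
  have "parity R (\<one> \<otimes> parity R \<one>) = parity R \<one> \<otimes> parity R (parity R \<one>)"
    by (rule parity_mult) simp_all
  then show ?thesis
    by simp
qed

lemma parity_scale_one [simp]: "parity R (rscale R r \<one>) = rscale R r \<one>"
  by (simp add: parity_scale)

end

locale normed_graded_star_ring = normed_graded_ring R for R :: "'r gr_alg" (structure) +
  assumes star_closed [simp]: "a \<in> carrier R \<Longrightarrow> star R a \<in> carrier R"
    and star_star [simp]: "a \<in> carrier R \<Longrightarrow> star R (star R a) = a"
    and star_add: "a \<in> carrier R \<Longrightarrow> b \<in> carrier R \<Longrightarrow>
      star R (a \<oplus> b) = star R a \<oplus> star R b"
    and star_scale: "a \<in> carrier R \<Longrightarrow> star R (rscale R r a) = rscale R r (star R a)"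
    and star_mult: "a \<in> carrier R \<Longrightarrow> b \<in> carrier R \<Longrightarrow>
      star R (a \<otimes> b) = star R b \<otimes> star R a"
    and star_part: "i \<in> {0, 1} \<Longrightarrow> a \<in> part R i \<Longrightarrow> star R a \<in> part R i"
    and nrm_star [simp]: "a \<in> carrier R \<Longrightarrow> nrm R (star R a) = nrm R a"

section \<open>Graded real C*-algebras as normed graded rings\<close>

lemma (in graded_real_cstar_algebra) normed_graded_space: "normed_graded_space A"
proof unfold_locales
  show "a \<in> carrier A \<Longrightarrow> \<exists>x\<in>part A 0. \<exists>y\<in>part A 1. a = x \<oplus> y" for a
    by (rule part_sum)
  show "part A 0 \<inter> part A 1 = {\<zero>}"
    by (rule part_int)
qed (simp_all add: scale_closed scale_add_right scale_add_left scale_scale scale_one nrm_nonneg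
    nrm_eq_0 nrm_scale nrm_triangle part_subset part_zero part_add part_scale)

sublocale graded_real_cstar_algebra \<subseteq> V: normed_graded_space A
  by (rule normed_graded_space)

context graded_real_cstar_algebra
begin

lemma nrm_parity_bounded: "\<exists>C. \<forall>a\<in>carrier A. nrm A (parity A a) \<le> C * nrm A a"
  using V.parity_bounded complete part_closed by blast

lemma zero_mult [simp]:
  assumes "a \<in> carrier A" shows "\<zero> \<otimes> a = \<zero>" "a \<otimes> \<zero> = \<zero>"
  using scale_mult_left[of a a 0] scale_mult_right[of a a 0] mult_closed[of a a] assms by simp_all

lemma neg_mult:
  assumes "a \<in> carrier A" "b \<in> carrier A"
  shows "\<ominus> a \<otimes> b = \<ominus> (a \<otimes> b)" "a \<otimes> \<ominus> b = \<ominus> (a \<otimes> b)"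
  using scale_mult_left[of a b "-1"] scale_mult_right[of a b "-1"] mult_closed assms
  by (simp_all add: V.scale_minus_one)

lemma parity_mult:
  assumes a: "a \<in> carrier A" and b: "b \<in> carrier A"
  shows "parity A (a \<otimes> b) = parity A a \<otimes> parity A b"
proof -
  define a0 a1 b0 b1 where "a0 = hcomp A 0 a" and "a1 = hcomp A 1 a"
    and "b0 = hcomp A 0 b" and "b1 = hcomp A 1 b"
  note d = this
  have p: "a0 \<in> part A 0" "a1 \<in> part A 1" "b0 \<in> part A 0" "b1 \<in> part A 1"
    using V.hcomp_part a b unfolding d by blast+
  have c [simp]: "a0 \<in> carrier A" "a1 \<in> carrier A" "b0 \<in> carrier A" "b1 \<in> carrier A"
    using a b unfolding d by simp_all
  have e: "a = a0 \<oplus> a1" "b = b0 \<oplus> b1"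
    using V.hcomp_part a b unfolding d by simp_all
  have "a0 \<otimes> b0 \<oplus> a1 \<otimes> b1 \<in> part A 0" "a0 \<otimes> b1 \<oplus> a1 \<otimes> b0 \<in> part A 1"
    using part_mult[of 0 0 a0 b0] part_mult[of 1 1 a1 b1] part_mult[of 0 1 a0 b1] part_mult[of 1 0 a1 b0] p
    by (auto intro!: part_add)
  then have "parity A ((a0 \<otimes> b0 \<oplus> a1 \<otimes> b1) \<oplus> (a0 \<otimes> b1 \<oplus> a1 \<otimes> b0))
    = (a0 \<otimes> b0 \<oplus> a1 \<otimes> b1) \<ominus> (a0 \<otimes> b1 \<oplus> a1 \<otimes> b0)"
    by (simp add: V.parity_add V.parity_even V.parity_odd mult_closed minus_eq)
  moreover have "a \<otimes> b = (a0 \<otimes> b0 \<oplus> a1 \<otimes> b1) \<oplus> (a0 \<otimes> b1 \<oplus> a1 \<otimes> b0)"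
    unfolding e by (simp add: distrib_left distrib_right mult_closed a_ac)
  moreover have "parity A a = a0 \<ominus> a1" "parity A b = b0 \<ominus> b1"
    unfolding d using V.parity_eq a b by simp_all
  ultimately show ?thesis
    by (simp add: minus_eq distrib_left distrib_right mult_closed neg_mult minus_add a_ac)
qed

text \<open>The C*-identity and submultiplicativity bound the square of the norm of \<open>a\<close>
  by the product of the norms of \<open>a\<close> and its adjoint. Cancelling gives one inequality
  for every element, and the adjoint element gives the reverse one.\<close>

lemma nrm_star: "a \<in> carrier A \<Longrightarrow> nrm A (star A a) = nrm A a"
proof -
  have le: "nrm A a \<le> nrm A (star A a)" if a: "a \<in> carrier A" for a
  proof (cases "nrm A a = 0")
    case False
    then have pos: "nrm A a > 0" using nrm_nonneg[OF a] by linarith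
    have "nrm A a * nrm A a \<le> nrm A (star A a) * nrm A a"
      using cstar_identity[OF a] nrm_mult[OF star_closed[OF a] a] by (simp add: power2_eq_square)
    then show ?thesis using pos by simp
  qed (simp add: nrm_nonneg star_closed a)
  assume a: "a \<in> carrier A"
  show ?thesis
    using le[OF a] le[OF star_closed[OF a]] star_star[OF a] by simp
qed

lemma unital_star_ring:
  assumes "unital A"
  shows "normed_graded_star_ring A"
proof -
  have one: "\<one> \<in> carrier A" "\<And>a. a \<in> carrier A \<Longrightarrow> \<one> \<otimes> a = a \<and> a \<otimes> \<one> = a"
    using one_is_unit[OF assms] by auto
  interpret ring A
    by (rule ringI) (use one in \<open>auto intro!: monoidI abelian_group_axioms
        simp: mult_closed mult_assoc distrib_left distrib_right\<close>)
  show ?thesis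
  proof unfold_locales
    show "\<exists>C. \<forall>a\<in>carrier A. \<forall>b\<in>carrier A. nrm A (a \<otimes> b) \<le> C * nrm A a * nrm A b"
      using nrm_mult by (intro exI[of _ 1]) auto
  qed (simp_all add: scale_mult_left scale_mult_right parity_mult nrm_parity_bounded star_closed
      star_star star_add star_scale star_mult part_star nrm_star)
qed

section \<open>The unitization\<close>

lemma unitization_simps [simp]:
  "carrier (unitization A) = carrier A \<times> UNIV"
  "(a, r) \<otimes>\<^bsub>unitization A\<^esub> (b, s) = (a \<otimes> b \<oplus> rscale A r b \<oplus> rscale A s a, r * s)"
  "(a, r) \<oplus>\<^bsub>unitization A\<^esub> (b, s) = (a \<oplus> b, r + s)"
  "\<one>\<^bsub>unitization A\<^esub> = (\<zero>, 1)"
  "\<zero>\<^bsub>unitization A\<^esub> = (\<zero>, 0)"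
  "rscale (unitization A) t (a, r) = (rscale A t a, t * r)"
  "star (unitization A) (a, r) = (star A a, r)"
  "nrm (unitization A) (a, r) = nrm A a + \<bar>r\<bar>"
  "part (unitization A) i = part A i \<times> (if i = 0 then UNIV else {0})"
  by (simp_all add: unitization_def)

lemma unitization_ring: "ring (unitization A)"
proof (rule ringI)
  show "abelian_group (unitization A)"
  proof (rule abelian_groupI)
    fix x assume "x \<in> carrier (unitization A)"
    then obtain a r where "x = (a, r)" "a \<in> carrier A" by auto
    then show "\<exists>y\<in>carrier (unitization A). y \<oplus>\<^bsub>unitization A\<^esub> x = \<zero>\<^bsub>unitization A\<^esub>"
      by (intro bexI[of _ "(\<ominus> a, - r)"]) (auto simp: l_neg)
  qed (auto simp: a_ac)
  show "monoid (unitization A)"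
  proof (rule monoidI)
    fix x y z assume "x \<in> carrier (unitization A)" "y \<in> carrier (unitization A)"
      "z \<in> carrier (unitization A)"
    then obtain a r b s c t where "x = (a, r)" "y = (b, s)" "z = (c, t)"
      "a \<in> carrier A" "b \<in> carrier A" "c \<in> carrier A" by auto
    then show "x \<otimes>\<^bsub>unitization A\<^esub> y \<otimes>\<^bsub>unitization A\<^esub> z = x \<otimes>\<^bsub>unitization A\<^esub> (y \<otimes>\<^bsub>unitization A\<^esub> z)"
      by (simp add: mult_closed mult_assoc distrib_left distrib_right scale_mult_left
          scale_mult_right V.scale_add_right V.scale_scale a_ac mult.commute)
  qed (auto simp: mult_closed)
qed (auto simp: mult_closed distrib_left distrib_right V.scale_add_left V.scale_add_right a_ac
    algebra_simps)

lemma unitization_normed_graded_space: "normed_graded_space (unitization A)"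
proof -
  interpret U: ring "unitization A" by (rule unitization_ring)
  show ?thesis
  proof unfold_locales
    fix x assume "x \<in> carrier (unitization A)"
    then obtain a r where x: "x = (a, r)" "a \<in> carrier A" by auto
    obtain a0 a1 where a: "a0 \<in> part A 0" "a1 \<in> part A 1" "a = a0 \<oplus> a1"
      using part_sum[OF x(2)] by blast
    then show "\<exists>u\<in>part (unitization A) 0. \<exists>v\<in>part (unitization A) 1. x = u \<oplus>\<^bsub>unitization A\<^esub> v"
      by (intro bexI[of _ "(a0, r)"] bexI[of _ "(a1, 0)"]) (auto simp: x)
  next
    show "part (unitization A) 0 \<inter> part (unitization A) 1 = {\<zero>\<^bsub>unitization A\<^esub>}"
      using part_int by auto
  next
    fix x y assume "x \<in> carrier (unitization A)" "y \<in> carrier (unitization A)"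
    then obtain a r b s where "x = (a, r)" "y = (b, s)" "a \<in> carrier A" "b \<in> carrier A" by auto
    then show "nrm (unitization A) (x \<oplus>\<^bsub>unitization A\<^esub> y) \<le> nrm (unitization A) x + nrm (unitization A) y"
      using nrm_triangle[of a b] by simp
  next
    fix x assume "x \<in> carrier (unitization A)"
    then obtain a r where "x = (a, r)" "a \<in> carrier A" by auto
    then show "nrm (unitization A) x = 0 \<longleftrightarrow> x = \<zero>\<^bsub>unitization A\<^esub>"
      using nrm_nonneg[of a] V.nrm_eq_0[of a] by (auto simp: add_nonneg_eq_0_iff)
  qed (auto simp: V.scale_add_left V.scale_add_right V.scale_scale part_zero part_add part_scale
      nrm_nonneg nrm_scale abs_mult algebra_simps dest: V.part_closed_carrier[unfolded One_nat_def])
qed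

lemma parity_unitization:
  assumes "a \<in> carrier A"
  shows "parity (unitization A) (a, r) = (parity A a, r)"
proof -
  interpret U: normed_graded_space "unitization A" by (rule unitization_normed_graded_space)
  have "(hcomp A 0 a, r) \<in> part (unitization A) 0" "(hcomp A 1 a, 0) \<in> part (unitization A) 1"
    using V.hcomp_part[OF assms] by auto
  then have e: "hcomp (unitization A) 0 (a, r) = (hcomp A 0 a, r)"
      "hcomp (unitization A) 1 (a, r) = (hcomp A 1 a, 0)"
    using U.hcomp_add[of "(hcomp A 0 a, r)" "(hcomp A 1 a, 0)"] V.hcomp_part[OF assms] by auto
  have "\<ominus>\<^bsub>unitization A\<^esub> (hcomp A 1 a, 0) = (\<ominus> hcomp A 1 a, 0)"
    using assms U.scale_minus_one[of "(hcomp A 1 a, 0)"] by (simp add: V.scale_minus_one)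
  then show ?thesis
    using assms e U.parity_eq[of "(a, r)"] V.parity_eq by (simp add: a_minus_def)
qed

lemma unitization_star_ring: "normed_graded_star_ring (unitization A)"
proof -
  interpret U: ring "unitization A" by (rule unitization_ring)
  interpret U: normed_graded_space "unitization A" by (rule unitization_normed_graded_space)
  show ?thesis
  proof unfold_locales
    fix x y assume "x \<in> carrier (unitization A)" "y \<in> carrier (unitization A)"
    then obtain a r b s where xy: "x = (a, r)" "y = (b, s)" "a \<in> carrier A" "b \<in> carrier A" by auto
    show "rscale (unitization A) t x \<otimes>\<^bsub>unitization A\<^esub> y = rscale (unitization A) t (x \<otimes>\<^bsub>unitization A\<^esub> y)" for t
      using xy by (simp add: mult_closed scale_mult_left V.scale_add_right V.scale_scale mult.commute)
    show "x \<otimes>\<^bsub>unitization A\<^esub> rscale (unitization A) t y = rscale (unitization A) t (x \<otimes>\<^bsub>unitization A\<^esub> y)" for t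
      using xy by (simp add: mult_closed scale_mult_right V.scale_add_right V.scale_scale mult.commute mult.left_commute)
    show "parity (unitization A) (x \<otimes>\<^bsub>unitization A\<^esub> y)
      = parity (unitization A) x \<otimes>\<^bsub>unitization A\<^esub> parity (unitization A) y"
      using xy by (simp add: parity_unitization mult_closed parity_mult V.parity_add V.parity_scale)
    show "star (unitization A) (x \<oplus>\<^bsub>unitization A\<^esub> y) =
        star (unitization A) x \<oplus>\<^bsub>unitization A\<^esub> star (unitization A) y"
      using xy by (simp add: star_add)
    show "star (unitization A) (x \<otimes>\<^bsub>unitization A\<^esub> y) =
        star (unitization A) y \<otimes>\<^bsub>unitization A\<^esub> star (unitization A) x"
      using xy by (simp add: mult_closed star_closed star_add star_mult star_scale a_ac)
  next
    have "nrm (unitization A) (x \<otimes>\<^bsub>unitization A\<^esub> y) \<le> nrm (unitization A) x * nrm (unitization A) y"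
      if "x \<in> carrier (unitization A)" "y \<in> carrier (unitization A)" for x y
    proof -
      from that obtain a r b s where xy: "x = (a, r)" "y = (b, s)" "a \<in> carrier A" "b \<in> carrier A" by auto
      have "nrm A (a \<otimes> b \<oplus> rscale A r b \<oplus> rscale A s a)
          \<le> nrm A a * nrm A b + \<bar>r\<bar> * nrm A b + \<bar>s\<bar> * nrm A a"
        using nrm_triangle[of "a \<otimes> b \<oplus> rscale A r b" "rscale A s a"]
          nrm_triangle[of "a \<otimes> b" "rscale A r b"] nrm_mult[of a b] xy
        by (simp add: nrm_scale mult_closed)
      then show ?thesis
        using xy by (simp add: abs_mult algebra_simps)
    qed
    then show "\<exists>C. \<forall>x\<in>carrier (unitization A). \<forall>y\<in>carrier (unitization A).
        nrm (unitization A) (x \<otimes>\<^bsub>unitization A\<^esub> y) \<le> C * nrm (unitization A) x * nrm (unitization A) y"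
      by (intro exI[of _ 1]) auto
    obtain C where C: "\<And>a. a \<in> carrier A \<Longrightarrow> nrm A (parity A a) \<le> C * nrm A a"
      using nrm_parity_bounded by blast
    \<comment> \<open>The scalar coordinate is fixed by the parity, so the constant must be at least
      1.\<close>
    have "nrm (unitization A) (parity (unitization A) x) \<le> max C 1 * nrm (unitization A) x"
      if "x \<in> carrier (unitization A)" for x
    proof -
      from that obtain a r where x: "x = (a, r)" "a \<in> carrier A" by auto
      have "nrm A (parity A a) \<le> max C 1 * nrm A a"
        using C[OF x(2)] mult_right_mono[of C "max C 1" "nrm A a"] nrm_nonneg[OF x(2)] by simp
      moreover have "\<bar>r\<bar> \<le> max C 1 * \<bar>r\<bar>"
        using mult_right_mono[of 1 "max C 1" "\<bar>r\<bar>"] by simp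
      ultimately show ?thesis
        using x by (simp add: parity_unitization algebra_simps)
    qed
    then show "\<exists>C. \<forall>x\<in>carrier (unitization A).
        nrm (unitization A) (parity (unitization A) x) \<le> C * nrm (unitization A) x"
      by blast
  qed (auto simp: star_closed star_star star_scale part_star nrm_star split: if_splits)
qed

end

section \<open>The real numbers as a purely even graded algebra\<close>

lemma real_alg_simps [simp]:
  "carrier real_alg = UNIV" "x \<otimes>\<^bsub>real_alg\<^esub> y = x * y" "x \<oplus>\<^bsub>real_alg\<^esub> y = x + y"
  "\<one>\<^bsub>real_alg\<^esub> = 1" "\<zero>\<^bsub>real_alg\<^esub> = 0" "rscale real_alg t x = t * x" "star real_alg x = x"
  "nrm real_alg x = \<bar>x\<bar>" "part real_alg i = (if i = 0 then UNIV else {0})"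
  by (simp_all add: real_alg_def)

lemma real_alg_ring: "ring real_alg"
proof (rule ringI)
  show "abelian_group real_alg"
  proof (rule abelian_groupI)
    fix x assume "x \<in> carrier real_alg"
    show "\<exists>y\<in>carrier real_alg. y \<oplus>\<^bsub>real_alg\<^esub> x = \<zero>\<^bsub>real_alg\<^esub>"
      by (intro bexI[of _ "- x"]) auto
  qed auto
  show "monoid real_alg"
    by (rule monoidI) auto
qed (auto simp: algebra_simps)

lemma real_alg_normed_graded_space: "normed_graded_space real_alg"
proof -
  interpret ring real_alg by (rule real_alg_ring)
  show ?thesis
    by unfold_locales (auto simp: algebra_simps abs_mult intro: exI[of _ 0])
qed

lemma parity_real_alg [simp]: "parity real_alg x = x"
proof -
  interpret normed_graded_space real_alg by (rule real_alg_normed_graded_space)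
  show ?thesis by (rule parity_even) simp
qed

lemma real_alg_star_ring: "normed_graded_star_ring real_alg"
proof -
  interpret ring real_alg by (rule real_alg_ring)
  interpret normed_graded_space real_alg by (rule real_alg_normed_graded_space)
  show ?thesis
  proof unfold_locales
    show "\<exists>C. \<forall>a\<in>carrier real_alg. nrm real_alg (parity real_alg a) \<le> C * nrm real_alg a"
      by (intro exI[of _ 1]) simp
    show "\<exists>C. \<forall>a\<in>carrier real_alg. \<forall>b\<in>carrier real_alg.
        nrm real_alg (a \<otimes>\<^bsub>real_alg\<^esub> b) \<le> C * nrm real_alg a * nrm real_alg b"
      by (intro exI[of _ 1]) (simp add: abs_mult)
  qed (auto simp: algebra_simps)
qed

section \<open>Modules and functionals\<close>

text \<open>Common ground of module homomorphisms, functionals, skewlinear maps and base changes,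
  which are linear over different rings or only up to a twist. Compatibility with negatives,
  differences and finite sums depends on additivity alone.\<close>

definition additive_map :: "('a, 'x) ring_scheme \<Rightarrow> ('b, 'y) ring_scheme \<Rightarrow> ('a \<Rightarrow> 'b) \<Rightarrow> bool" where
  "additive_map M N f \<longleftrightarrow> f \<in> carrier M \<rightarrow> carrier N \<and>
     (\<forall>x\<in>carrier M. \<forall>y\<in>carrier M. f (x \<oplus>\<^bsub>M\<^esub> y) = f x \<oplus>\<^bsub>N\<^esub> f y)"

lemma additive_mapI:
  assumes "\<And>x. x \<in> carrier M \<Longrightarrow> f x \<in> carrier N"
    and "\<And>x y. x \<in> carrier M \<Longrightarrow> y \<in> carrier M \<Longrightarrow> f (x \<oplus>\<^bsub>M\<^esub> y) = f x \<oplus>\<^bsub>N\<^esub> f y"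
  shows "additive_map M N f"
  using assms by (auto simp: additive_map_def)

lemma additive_mapD:
  assumes "additive_map M N f"
  shows "x \<in> carrier M \<Longrightarrow> f x \<in> carrier N"
    and "x \<in> carrier M \<Longrightarrow> y \<in> carrier M \<Longrightarrow> f (x \<oplus>\<^bsub>M\<^esub> y) = f x \<oplus>\<^bsub>N\<^esub> f y"
  using assms by (auto simp: additive_map_def)

lemma additive_map_zero:
  assumes "abelian_group M" "abelian_group N" "additive_map M N f"
  shows "f \<zero>\<^bsub>M\<^esub> = \<zero>\<^bsub>N\<^esub>"
proof -
  interpret M: abelian_group M by fact
  interpret N: abelian_group N by fact
  note f = additive_mapD[OF assms(3)]
  have "f \<zero>\<^bsub>M\<^esub> \<oplus>\<^bsub>N\<^esub> f \<zero>\<^bsub>M\<^esub> = f \<zero>\<^bsub>M\<^esub>"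
    using f(2)[of "\<zero>\<^bsub>M\<^esub>" "\<zero>\<^bsub>M\<^esub>"] by simp
  then show ?thesis
    using f(1)[OF M.zero_closed] by (metis N.add.l_cancel_one')
qed

lemma additive_map_neg:
  assumes "abelian_group M" "abelian_group N" "additive_map M N f" "x \<in> carrier M"
  shows "f (\<ominus>\<^bsub>M\<^esub> x) = \<ominus>\<^bsub>N\<^esub> f x"
proof -
  interpret M: abelian_group M by fact
  interpret N: abelian_group N by fact
  note f = additive_mapD[OF assms(3)]
  have "f (\<ominus>\<^bsub>M\<^esub> x) \<oplus>\<^bsub>N\<^esub> f x = \<zero>\<^bsub>N\<^esub>"
    using f(2)[of "\<ominus>\<^bsub>M\<^esub> x" x] assms additive_map_zero[OF assms(1-3)] by (simp add: M.l_neg)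
  then show ?thesis
    using assms f by (simp add: N.minus_equality)
qed

lemma additive_map_diff:
  assumes "abelian_group M" "abelian_group N" "additive_map M N f" "x \<in> carrier M" "y \<in> carrier M"
  shows "f (x \<ominus>\<^bsub>M\<^esub> y) = f x \<ominus>\<^bsub>N\<^esub> f y"
  using additive_map_neg[OF assms(1-3)] additive_mapD(2)[OF assms(3)] assms
    abelian_group.a_inv_closed[OF assms(1)]
  by (simp add: a_minus_def)

lemma additive_map_finsum:
  assumes "abelian_group M" "abelian_group N" "additive_map M N f"
    and "finite K" "\<And>k. k \<in> K \<Longrightarrow> g k \<in> carrier M"
  shows "f (finsum M g K) = finsum N (\<lambda>k. f (g k)) K"
proof -
  interpret M: abelian_group M by fact
  interpret N: abelian_group N by fact
  note f = additive_mapD[OF assms(3)]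
  show ?thesis
    using assms(4,5)
  proof (induction K)
    case empty
    then show ?case using additive_map_zero[OF assms(1-3)] by simp
  next
    case (insert k K)
    have "g \<in> K \<rightarrow> carrier M" "g k \<in> carrier M"
      using insert by auto
    then show ?case
      using insert f by (simp add: M.finsum_insert N.finsum_insert Pi_def)
  qed
qed

lemma additive_map_comp:
  "additive_map M N f \<Longrightarrow> additive_map N P g \<Longrightarrow> additive_map M P (\<lambda>x. g (f x))"
  by (auto simp: additive_map_def Pi_def)

context left_module
begin

lemma smult_zero_left [simp]:
  assumes "x \<in> carrier M" shows "\<zero>\<^bsub>R\<^esub> \<odot>\<^bsub>M\<^esub> x = \<zero>\<^bsub>M\<^esub>"
  by (rule additive_map_zero[of R M "\<lambda>a. a \<odot>\<^bsub>M\<^esub> x"])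
    (auto intro!: additive_mapI R.abelian_group_axioms M.abelian_group_axioms
      simp: smult_closed smult_l_distr assms)

lemma smult_additive: "a \<in> carrier R \<Longrightarrow> additive_map M M (\<lambda>x. a \<odot>\<^bsub>M\<^esub> x)"
  by (auto intro!: additive_mapI simp: smult_closed smult_r_distr)

lemma smult_zero_right [simp]:
  assumes "a \<in> carrier R" shows "a \<odot>\<^bsub>M\<^esub> \<zero>\<^bsub>M\<^esub> = \<zero>\<^bsub>M\<^esub>"
  by (rule additive_map_zero[OF M.abelian_group_axioms M.abelian_group_axioms smult_additive[OF assms]])

lemma smult_neg_left:
  assumes "a \<in> carrier R" "x \<in> carrier M"
  shows "(\<ominus>\<^bsub>R\<^esub> a) \<odot>\<^bsub>M\<^esub> x = \<ominus>\<^bsub>M\<^esub> (a \<odot>\<^bsub>M\<^esub> x)"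
  by (rule additive_map_neg[of R M "\<lambda>a. a \<odot>\<^bsub>M\<^esub> x"])
    (auto intro!: additive_mapI R.abelian_group_axioms M.abelian_group_axioms
      simp: smult_closed smult_l_distr assms)

lemma smult_neg_right:
  assumes "a \<in> carrier R" "x \<in> carrier M"
  shows "a \<odot>\<^bsub>M\<^esub> (\<ominus>\<^bsub>M\<^esub> x) = \<ominus>\<^bsub>M\<^esub> (a \<odot>\<^bsub>M\<^esub> x)"
  by (rule additive_map_neg[OF M.abelian_group_axioms M.abelian_group_axioms smult_additive]) fact+

lemma smult_diff_right:
  assumes "a \<in> carrier R" "x \<in> carrier M" "y \<in> carrier M"
  shows "a \<odot>\<^bsub>M\<^esub> (x \<ominus>\<^bsub>M\<^esub> y) = a \<odot>\<^bsub>M\<^esub> x \<ominus>\<^bsub>M\<^esub> a \<odot>\<^bsub>M\<^esub> y"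
  by (rule additive_map_diff[OF M.abelian_group_axioms M.abelian_group_axioms smult_additive]) fact+

lemma smult_finsum:
  assumes "a \<in> carrier R" "finite K" "\<And>k. k \<in> K \<Longrightarrow> g k \<in> carrier M"
  shows "a \<odot>\<^bsub>M\<^esub> finsum M g K = finsum M (\<lambda>k. a \<odot>\<^bsub>M\<^esub> g k) K"
  by (rule additive_map_finsum[OF M.abelian_group_axioms M.abelian_group_axioms smult_additive])
    (use assms in auto)

end

lemma left_moduleI:
  assumes "ring R" "abelian_group M"
    and "\<And>a x. a \<in> carrier R \<Longrightarrow> x \<in> carrier M \<Longrightarrow> a \<odot>\<^bsub>M\<^esub> x \<in> carrier M"
    and "\<And>a b x. a \<in> carrier R \<Longrightarrow> b \<in> carrier R \<Longrightarrow> x \<in> carrier M \<Longrightarrow>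
      (a \<oplus>\<^bsub>R\<^esub> b) \<odot>\<^bsub>M\<^esub> x = a \<odot>\<^bsub>M\<^esub> x \<oplus>\<^bsub>M\<^esub> b \<odot>\<^bsub>M\<^esub> x"
    and "\<And>a x y. a \<in> carrier R \<Longrightarrow> x \<in> carrier M \<Longrightarrow> y \<in> carrier M \<Longrightarrow>
      a \<odot>\<^bsub>M\<^esub> (x \<oplus>\<^bsub>M\<^esub> y) = a \<odot>\<^bsub>M\<^esub> x \<oplus>\<^bsub>M\<^esub> a \<odot>\<^bsub>M\<^esub> y"
    and "\<And>a b x. a \<in> carrier R \<Longrightarrow> b \<in> carrier R \<Longrightarrow> x \<in> carrier M \<Longrightarrow>
      (a \<otimes>\<^bsub>R\<^esub> b) \<odot>\<^bsub>M\<^esub> x = a \<odot>\<^bsub>M\<^esub> (b \<odot>\<^bsub>M\<^esub> x)"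
    and "\<And>x. x \<in> carrier M \<Longrightarrow> \<one>\<^bsub>R\<^esub> \<odot>\<^bsub>M\<^esub> x = x"
  shows "left_module R M"
  by (intro left_module.intro left_module_axioms.intro assms)

lemma left_module_abelian_group: "left_module R M \<Longrightarrow> abelian_group M"
  by (rule left_module.axioms(2))

section \<open>The dual module and dual bases\<close>

definition functionals :: "'r gr_alg \<Rightarrow> ('r, 'm) module \<Rightarrow> ('m \<Rightarrow> 'r) set" where
  "functionals R M = {f. additive_map M R f \<and>
     (\<forall>a\<in>carrier R. \<forall>x\<in>carrier M. f (a \<odot>\<^bsub>M\<^esub> x) = a \<otimes>\<^bsub>R\<^esub> f x)}"

lemma functionalsI:
  assumes "\<And>x. x \<in> carrier M \<Longrightarrow> f x \<in> carrier R"
    and "\<And>x y. x \<in> carrier M \<Longrightarrow> y \<in> carrier M \<Longrightarrow> f (x \<oplus>\<^bsub>M\<^esub> y) = f x \<oplus>\<^bsub>R\<^esub> f y"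
    and "\<And>a x. a \<in> carrier R \<Longrightarrow> x \<in> carrier M \<Longrightarrow> f (a \<odot>\<^bsub>M\<^esub> x) = a \<otimes>\<^bsub>R\<^esub> f x"
  shows "f \<in> functionals R M"
  using assms by (auto simp: functionals_def additive_map_def)

lemma functionalsD:
  assumes "f \<in> functionals R M"
  shows "additive_map M R f"
    and "x \<in> carrier M \<Longrightarrow> f x \<in> carrier R"
    and "x \<in> carrier M \<Longrightarrow> y \<in> carrier M \<Longrightarrow> f (x \<oplus>\<^bsub>M\<^esub> y) = f x \<oplus>\<^bsub>R\<^esub> f y"
    and "a \<in> carrier R \<Longrightarrow> x \<in> carrier M \<Longrightarrow> f (a \<odot>\<^bsub>M\<^esub> x) = a \<otimes>\<^bsub>R\<^esub> f x"
  using assms by (auto simp: functionals_def additive_map_def)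

lemma mod_homD:
  assumes "f \<in> mod_hom R M N"
  shows "additive_map M N f"
    and "x \<in> carrier M \<Longrightarrow> f x \<in> carrier N"
    and "x \<in> carrier M \<Longrightarrow> y \<in> carrier M \<Longrightarrow> f (x \<oplus>\<^bsub>M\<^esub> y) = f x \<oplus>\<^bsub>N\<^esub> f y"
    and "a \<in> carrier R \<Longrightarrow> x \<in> carrier M \<Longrightarrow> f (a \<odot>\<^bsub>M\<^esub> x) = a \<odot>\<^bsub>N\<^esub> f x"
  using assms by (auto simp: mod_hom_def additive_map_def)

lemma mod_homI:
  assumes "\<And>x. x \<in> carrier M \<Longrightarrow> f x \<in> carrier N"
    and "\<And>x y. x \<in> carrier M \<Longrightarrow> y \<in> carrier M \<Longrightarrow> f (x \<oplus>\<^bsub>M\<^esub> y) = f x \<oplus>\<^bsub>N\<^esub> f y"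
    and "\<And>a x. a \<in> carrier R \<Longrightarrow> x \<in> carrier M \<Longrightarrow> f (a \<odot>\<^bsub>M\<^esub> x) = a \<odot>\<^bsub>N\<^esub> f x"
  shows "f \<in> mod_hom R M N"
  using assms by (auto simp: mod_hom_def)

lemma functionals_comp_mod_hom:
  assumes "f \<in> functionals R N" "h \<in> mod_hom R M N"
  shows "(\<lambda>x. f (h x)) \<in> functionals R M"
  by (intro functionalsI) (simp_all add: functionalsD[OF assms(1)] mod_homD[OF assms(2)])

text \<open>The dual basis criterion for finitely generated projective modules, which has no
  reference to a free module and is easy to transport. The index type is arbitrary, so that disjoint
  sums can index the bases of sums and corners.\<close>

definition dual_basis ::
  "'r gr_alg \<Rightarrow> ('r, 'm) module \<Rightarrow> 'k set \<Rightarrow> ('k \<Rightarrow> 'm) \<Rightarrow> ('k \<Rightarrow> 'm \<Rightarrow> 'r) \<Rightarrow> bool" where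
  "dual_basis R M K xs fs \<longleftrightarrow> finite K \<and> (\<forall>k\<in>K. xs k \<in> carrier M \<and> fs k \<in> functionals R M) \<and>
     (\<forall>x\<in>carrier M. (\<Oplus>\<^bsub>M\<^esub>k\<in>K. fs k x \<odot>\<^bsub>M\<^esub> xs k) = x)"

lemma dual_basisD:
  assumes "dual_basis R M K xs fs"
  shows "finite K" and "k \<in> K \<Longrightarrow> xs k \<in> carrier M" and "k \<in> K \<Longrightarrow> fs k \<in> functionals R M"
    and "k \<in> K \<Longrightarrow> x \<in> carrier M \<Longrightarrow> fs k x \<in> carrier R"
    and "x \<in> carrier M \<Longrightarrow> (\<Oplus>\<^bsub>M\<^esub>k\<in>K. fs k x \<odot>\<^bsub>M\<^esub> xs k) = x"
proof -
  show f: "k \<in> K \<Longrightarrow> fs k \<in> functionals R M"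
    using assms by (simp add: dual_basis_def)
  show "k \<in> K \<Longrightarrow> x \<in> carrier M \<Longrightarrow> fs k x \<in> carrier R"
    using functionalsD(2)[OF f] .
qed (use assms in \<open>simp_all add: dual_basis_def\<close>)

lemma free_module_simps [simp]:
  "carrier (free_module R n) = {..<n} \<rightarrow>\<^sub>E carrier R"
  "\<zero>\<^bsub>free_module R n\<^esub> = (\<lambda>k\<in>{..<n}. \<zero>\<^bsub>R\<^esub>)"
  "x \<oplus>\<^bsub>free_module R n\<^esub> y = (\<lambda>k\<in>{..<n}. x k \<oplus>\<^bsub>R\<^esub> y k)"
  "a \<odot>\<^bsub>free_module R n\<^esub> x = (\<lambda>k\<in>{..<n}. a \<otimes>\<^bsub>R\<^esub> x k)"
  by (simp_all add: free_module_def)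

lemma free_module_abelian_group:
  fixes R (structure)
  assumes "ring R"
  shows "abelian_group (free_module R n)"
proof (rule abelian_groupI)
  interpret ring R by fact
  fix x assume x: "x \<in> carrier (free_module R n)"
  show "\<exists>y\<in>carrier (free_module R n). y \<oplus>\<^bsub>free_module R n\<^esub> x = \<zero>\<^bsub>free_module R n\<^esub>"
  proof
    show "(\<lambda>k\<in>{..<n}. \<ominus> x k) \<in> carrier (free_module R n)"
      using x by (auto simp: PiE_iff)
    show "(\<lambda>k\<in>{..<n}. \<ominus> x k) \<oplus>\<^bsub>free_module R n\<^esub> x = \<zero>\<^bsub>free_module R n\<^esub>"
      using x by (auto simp: PiE_iff l_neg intro!: restrict_ext)
  qed
qed (use assms in \<open>auto simp: PiE_iff ring.ring_simprules restrict_def fun_eq_iff extensional_def\<close>)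

definition unit_vector :: "('r, 'x) ring_scheme \<Rightarrow> nat \<Rightarrow> nat \<Rightarrow> nat \<Rightarrow> 'r" where
  "unit_vector R n k = (\<lambda>j\<in>{..<n}. if j = k then \<one>\<^bsub>R\<^esub> else \<zero>\<^bsub>R\<^esub>)"

lemma (in ring) unit_vector_closed [simp]: "unit_vector R n k \<in> {..<n} \<rightarrow>\<^sub>E carrier R"
  by (auto simp: unit_vector_def)

lemma free_module_expand:
  fixes R (structure)
  assumes "ring R" and v: "v \<in> carrier (free_module R n)"
  shows "(\<Oplus>\<^bsub>free_module R n\<^esub>k\<in>{..<n}. v k \<odot>\<^bsub>free_module R n\<^esub> unit_vector R n k) = v"
proof -
  interpret ring R by fact
  interpret F: abelian_group "free_module R n" by (rule free_module_abelian_group) fact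
  define s where "s = (\<Oplus>\<^bsub>free_module R n\<^esub>k\<in>{..<n}. v k \<odot>\<^bsub>free_module R n\<^esub> unit_vector R n k)"
  have c: "v k \<odot>\<^bsub>free_module R n\<^esub> unit_vector R n k \<in> carrier (free_module R n)" if "k < n" for k
    using v that by (auto simp: PiE_iff unit_vector_def)
  have s: "s \<in> carrier (free_module R n)"
    unfolding s_def by (rule F.finsum_closed) (use c in auto)
  show ?thesis
    unfolding s_def[symmetric]
  proof (rule PiE_ext[of _ "{..<n}" "\<lambda>_. carrier R"])
    show "s \<in> {..<n} \<rightarrow>\<^sub>E carrier R" "v \<in> {..<n} \<rightarrow>\<^sub>E carrier R"
      using s v by simp_all
    fix j assume j: "j \<in> {..<n}"
    have "additive_map (free_module R n) R (\<lambda>v. v j)"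
      by (rule additive_mapI) (use j in \<open>auto simp: PiE_iff\<close>)
    then have "s j = (\<Oplus>k\<in>{..<n}. (v k \<odot>\<^bsub>free_module R n\<^esub> unit_vector R n k) j)"
      unfolding s_def
      by (intro additive_map_finsum[where f = "\<lambda>v. v j"] F.abelian_group_axioms abelian_group_axioms) (use c in auto)
    also have "\<dots> = (\<Oplus>k\<in>{..<n}. if j = k then v k else \<zero>)"
      using v j by (intro finsum_cong') (auto simp: PiE_iff unit_vector_def)
    also have "\<dots> = v j"
      using v j by (intro finsum_singleton) (auto simp: PiE_iff)
    finally show "s j = v j" .
  qed
qed

text \<open>The generators are the projected unit vectors, the functionals are the coordinates of
  the inclusion; projecting the expansion in the free module gives the one in \<open>M\<close>.
  These functionals are the ones whose norms add up to \<open>mod_nrm\<close>.\<close>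

lemma summand_dual_basis:
  assumes "left_module R M" "is_summand R M (n, \<iota>, \<pi>)"
  shows "dual_basis R M {..<n} (\<lambda>k. \<pi> (unit_vector R n k)) (\<lambda>k x. \<iota> x k)"
proof -
  interpret M: left_module R M by fact
  have i: "\<iota> \<in> mod_hom R M (free_module R n)" and p: "\<pi> \<in> mod_hom R (free_module R n) M"
    and ip: "\<And>x. x \<in> carrier M \<Longrightarrow> \<pi> (\<iota> x) = x"
    using assms(2) by (auto simp: is_summand_def)
  have ic: "\<And>x. x \<in> carrier M \<Longrightarrow> \<iota> x \<in> {..<n} \<rightarrow>\<^sub>E carrier R"
    using mod_homD(2)[OF i] by simp
  have uc: "unit_vector R n k \<in> carrier (free_module R n)" for k
    by simp
  show ?thesis
    unfolding dual_basis_def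
  proof (intro conjI ballI)
    fix k assume "k \<in> {..<n}"
    then show "(\<lambda>x. \<iota> x k) \<in> functionals R M"
      using mod_homD[OF i] ic by (intro functionalsI) (auto simp: PiE_iff)
    show "\<pi> (unit_vector R n k) \<in> carrier M"
      using mod_homD(2)[OF p uc] .
  next
    fix x assume x: "x \<in> carrier M"
    have "x = \<pi> (\<Oplus>\<^bsub>free_module R n\<^esub>k\<in>{..<n}. \<iota> x k \<odot>\<^bsub>free_module R n\<^esub> unit_vector R n k)"
      using free_module_expand[OF M.R.ring_axioms, of "\<iota> x" n] ic[OF x] ip[OF x] by simp
    also have "\<dots> = (\<Oplus>\<^bsub>M\<^esub>k\<in>{..<n}. \<pi> (\<iota> x k \<odot>\<^bsub>free_module R n\<^esub> unit_vector R n k))"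
      by (rule additive_map_finsum[OF free_module_abelian_group[OF M.R.ring_axioms] M.M.abelian_group_axioms mod_homD(1)[OF p]])
        (use ic[OF x] in \<open>auto simp: unit_vector_def PiE_iff\<close>)
    also have "\<dots> = (\<Oplus>\<^bsub>M\<^esub>k\<in>{..<n}. \<iota> x k \<odot>\<^bsub>M\<^esub> \<pi> (unit_vector R n k))"
      using ic[OF x] mod_homD(4)[OF p _ uc] mod_homD(2)[OF p uc]
      by (intro M.M.finsum_cong') (auto simp: PiE_iff intro!: M.smult_closed)
    finally show "(\<Oplus>\<^bsub>M\<^esub>k\<in>{..<n}. \<iota> x k \<odot>\<^bsub>M\<^esub> \<pi> (unit_vector R n k)) = x" by simp
  qed simp
qed

lemma fg_projective_dual_basis:
  assumes "fg_projective R M"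
  obtains n :: nat and xs fs where "left_module R M" "dual_basis R M {..<n} xs fs"
proof -
  obtain n \<iota> \<pi> where s: "is_summand R M (n, \<iota>, \<pi>)"
    using assms by (auto simp: fg_projective_def)
  show ?thesis
    using that summand_dual_basis[OF _ s] assms by (auto simp: fg_projective_def)
qed

text \<open>The functionals assemble into an inclusion and the generators into a projection of a
  free module. The finite index set is renumbered by \<open>h\<close>, because
  \<open>is_summand\<close> speaks of free modules indexed by natural numbers.\<close>

lemma fg_projectiveI:
  fixes xs :: "'k \<Rightarrow> 'm"
  assumes "left_module R M" "dual_basis R M K xs fs"
  shows "fg_projective R M"
proof -
  interpret M: left_module R M by fact
  have fin: "finite K" and xs: "\<And>k. k \<in> K \<Longrightarrow> xs k \<in> carrier M"
    and fs: "\<And>k. k \<in> K \<Longrightarrow> fs k \<in> functionals R M"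
    and exp: "\<And>x. x \<in> carrier M \<Longrightarrow> (\<Oplus>\<^bsub>M\<^esub>k\<in>K. fs k x \<odot>\<^bsub>M\<^esub> xs k) = x"
    using assms(2) by (auto simp: dual_basis_def)
  define n where "n = card K"
  obtain h where h: "bij_betw h {..<n} K"
    using ex_bij_betw_nat_finite[OF fin] by (auto simp: n_def atLeast0LessThan)
  have hK: "\<And>j. j < n \<Longrightarrow> h j \<in> K"
    using h by (auto simp: bij_betw_def)
  define \<iota> where "\<iota> x = (\<lambda>j\<in>{..<n}. fs (h j) x)" for x
  define \<pi> where "\<pi> v = (\<Oplus>\<^bsub>M\<^esub>j\<in>{..<n}. v j \<odot>\<^bsub>M\<^esub> xs (h j))" for v
  have "\<iota> \<in> mod_hom R M (free_module R n)"
    by (rule mod_homI)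
      (auto simp: \<iota>_def functionalsD[OF fs[OF hK]] intro!: restrict_ext)
  moreover have "\<pi> \<in> mod_hom R (free_module R n) M"
  proof (rule mod_homI)
    have c: "v j \<odot>\<^bsub>M\<^esub> xs (h j) \<in> carrier M" if "v \<in> carrier (free_module R n)" "j < n" for v j
      using that xs[OF hK] by (auto simp: PiE_iff intro!: M.smult_closed)
    fix v assume v: "v \<in> carrier (free_module R n)"
    show "\<pi> v \<in> carrier M"
      unfolding \<pi>_def by (rule M.M.finsum_closed) (use c[OF v] in auto)
    show "\<pi> (a \<odot>\<^bsub>free_module R n\<^esub> v) = a \<odot>\<^bsub>M\<^esub> \<pi> v" if a: "a \<in> carrier R" for a
      unfolding \<pi>_def using v xs hK a c[OF v]
      by (subst M.smult_finsum)
        (auto simp: PiE_iff M.smult_assoc intro!: M.M.finsum_cong' M.smult_closed)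
    fix w assume w: "w \<in> carrier (free_module R n)"
    show "\<pi> (v \<oplus>\<^bsub>free_module R n\<^esub> w) = \<pi> v \<oplus>\<^bsub>M\<^esub> \<pi> w"
    proof -
      have "\<pi> v \<oplus>\<^bsub>M\<^esub> \<pi> w = (\<Oplus>\<^bsub>M\<^esub>j\<in>{..<n}. v j \<odot>\<^bsub>M\<^esub> xs (h j) \<oplus>\<^bsub>M\<^esub> w j \<odot>\<^bsub>M\<^esub> xs (h j))"
        unfolding \<pi>_def by (rule M.M.finsum_addf[symmetric]) (use c[OF v] c[OF w] in auto)
      also have "\<dots> = \<pi> (v \<oplus>\<^bsub>free_module R n\<^esub> w)"
        unfolding \<pi>_def using v w xs hK c[OF v] c[OF w]
        by (intro M.M.finsum_cong') (auto simp: PiE_iff M.smult_l_distr)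
      finally show ?thesis by simp
    qed
  qed
  moreover have "\<pi> (\<iota> x) = x" if x: "x \<in> carrier M" for x
  proof -
    have c: "fs k x \<odot>\<^bsub>M\<^esub> xs k \<in> carrier M" if "k \<in> K" for k
      using that functionalsD(2)[OF fs x] xs M.smult_closed by blast
    have "\<pi> (\<iota> x) = (\<Oplus>\<^bsub>M\<^esub>j\<in>{..<n}. fs (h j) x \<odot>\<^bsub>M\<^esub> xs (h j))"
      unfolding \<pi>_def \<iota>_def by (intro M.M.finsum_cong') (use c hK in auto)
    also have "\<dots> = (\<Oplus>\<^bsub>M\<^esub>k\<in>h ` {..<n}. fs k x \<odot>\<^bsub>M\<^esub> xs k)"
      using h c hK by (intro M.M.finsum_reindex[symmetric]) (auto simp: bij_betw_def)
    also have "\<dots> = x"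
      using h exp[OF x] by (simp add: bij_betw_def)
    finally show ?thesis .
  qed
  ultimately have "is_summand R M (n, \<iota>, \<pi>)"
    by (simp add: is_summand_def)
  then show ?thesis
    using assms(1) by (auto simp: fg_projective_def)
qed

section \<open>Skewlinear maps\<close>

text \<open>With \<open>parity\<close> one identity over all scalars takes the place of the separate
  homogeneous cases of \<open>skewlinear\<close>. Real linearity is contained in it, since real
  multiples of the unit are even.\<close>

definition skew_map :: "'r gr_alg \<Rightarrow> ('r, 'm) module \<Rightarrow> ('m \<Rightarrow> 'm) \<Rightarrow> bool" where
  "skew_map R M T \<longleftrightarrow> additive_map M M T \<and>
     (\<forall>a\<in>carrier R. \<forall>x\<in>carrier M. T (a \<odot>\<^bsub>M\<^esub> x) = parity R a \<odot>\<^bsub>M\<^esub> T x)"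

lemma skew_mapI:
  assumes "\<And>x. x \<in> carrier M \<Longrightarrow> T x \<in> carrier M"
    and "\<And>x y. x \<in> carrier M \<Longrightarrow> y \<in> carrier M \<Longrightarrow> T (x \<oplus>\<^bsub>M\<^esub> y) = T x \<oplus>\<^bsub>M\<^esub> T y"
    and "\<And>a x. a \<in> carrier R \<Longrightarrow> x \<in> carrier M \<Longrightarrow> T (a \<odot>\<^bsub>M\<^esub> x) = parity R a \<odot>\<^bsub>M\<^esub> T x"
  shows "skew_map R M T"
  using assms by (auto simp: skew_map_def additive_map_def)

lemma skew_mapD:
  assumes "skew_map R M T"
  shows "additive_map M M T"
    and "x \<in> carrier M \<Longrightarrow> T x \<in> carrier M"
    and "x \<in> carrier M \<Longrightarrow> y \<in> carrier M \<Longrightarrow> T (x \<oplus>\<^bsub>M\<^esub> y) = T x \<oplus>\<^bsub>M\<^esub> T y"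
    and "a \<in> carrier R \<Longrightarrow> x \<in> carrier M \<Longrightarrow> T (a \<odot>\<^bsub>M\<^esub> x) = parity R a \<odot>\<^bsub>M\<^esub> T x"
  using assms by (auto simp: skew_map_def additive_map_def)

lemma (in normed_graded_ring) skewlinear_iff:
  assumes "left_module R M"
  shows "T \<in> skewlinear R M \<longleftrightarrow> T \<in> extensional (carrier M) \<and> skew_map R M T"
proof -
  interpret M: left_module R M by fact
  show ?thesis
  proof
    assume T: "T \<in> skewlinear R M"
    then have c: "T \<in> carrier M \<rightarrow>\<^sub>E carrier M" and
      add: "\<And>x y. x \<in> carrier M \<Longrightarrow> y \<in> carrier M \<Longrightarrow> T (x \<oplus>\<^bsub>M\<^esub> y) = T x \<oplus>\<^bsub>M\<^esub> T y" and
      hom: "\<And>i a x. i \<in> {0, 1} \<Longrightarrow> a \<in> part R i \<Longrightarrow> x \<in> carrier M \<Longrightarrow>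
        T (a \<odot>\<^bsub>M\<^esub> x) = parity R a \<odot>\<^bsub>M\<^esub> T x"
      unfolding skewlinear_def by (auto simp: parity_homogeneous[of _ _, simplified])
    have "skew_map R M T"
    proof (rule skew_mapI)
      show "T x \<in> carrier M" if "x \<in> carrier M" for x
        using c that by auto
      show "T (x \<oplus>\<^bsub>M\<^esub> y) = T x \<oplus>\<^bsub>M\<^esub> T y" if "x \<in> carrier M" "y \<in> carrier M" for x y
        using add that .
      fix a x assume a: "a \<in> carrier R" and x: "x \<in> carrier M"
      define a0 a1 where "a0 = hcomp R 0 a" and "a1 = hcomp R 1 a"
      have p: "a0 \<in> part R 0" "a1 \<in> part R 1" and e: "a = a0 \<oplus> a1"
        unfolding a0_def a1_def using hcomp_part[OF a] by auto
      have ac: "a0 \<in> carrier R" "a1 \<in> carrier R"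
        using p part_closed_carrier by auto
      have Tx: "T x \<in> carrier M"
        using c x by auto
      have "T (a \<odot>\<^bsub>M\<^esub> x) = T (a0 \<odot>\<^bsub>M\<^esub> x) \<oplus>\<^bsub>M\<^esub> T (a1 \<odot>\<^bsub>M\<^esub> x)"
        unfolding e using ac x add by (simp add: M.smult_l_distr M.smult_closed)
      also have "\<dots> = parity R a \<odot>\<^bsub>M\<^esub> T x"
        unfolding e using ac x Tx hom[of 0 a0] hom[of 1 a1] p
        by (simp add: parity_add M.smult_l_distr)
      finally show "T (a \<odot>\<^bsub>M\<^esub> x) = parity R a \<odot>\<^bsub>M\<^esub> T x" .
    qed
    then show "T \<in> extensional (carrier M) \<and> skew_map R M T"
      using c by (auto simp: PiE_def)
  next
    assume T: "T \<in> extensional (carrier M) \<and> skew_map R M T"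
    then show "T \<in> skewlinear R M"
      unfolding skewlinear_def
      using part_closed_carrier
      by (auto simp: PiE_def skew_mapD parity_even parity_odd scale_minus_one)
  qed
qed

text \<open>Polarizations and gradings differ only in this square; the theory of triples, their
  groups and base change treats both kinds at once.\<close>

definition sym_square :: "symmetry_kind \<Rightarrow> ('r, 'm) module \<Rightarrow> 'm \<Rightarrow> 'm" where
  "sym_square k M x = (case k of Polarization \<Rightarrow> \<ominus>\<^bsub>M\<^esub> x | Grading \<Rightarrow> x)"

lemma symmetry_space_skewlinear:
  "symmetry_space k R M = {J \<in> skewlinear R M. \<forall>x\<in>carrier M. J (J x) = sym_square k M x}"
  by (cases k) (auto simp: symmetry_space_def Pol_def Grad_def sym_square_def)

lemma (in normed_graded_ring) symmetry_space_iff: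
  assumes "left_module R M"
  shows "J \<in> symmetry_space k R M \<longleftrightarrow> J \<in> extensional (carrier M) \<and> skew_map R M J \<and>
    (\<forall>x\<in>carrier M. J (J x) = sym_square k M x)"
  using skewlinear_iff[OF assms] by (auto simp: symmetry_space_skewlinear)

section \<open>Paths of symmetries\<close>

text \<open>Norm continuity on the unit interval, stated with limits within the interval so that
  values of the path elsewhere never matter.\<close>

definition cont_path :: "'r gr_alg \<Rightarrow> (real \<Rightarrow> 'r) \<Rightarrow> bool" where
  "cont_path R g \<longleftrightarrow>
     (\<forall>s\<in>{0..1}. ((\<lambda>t. nrm R (g t \<ominus>\<^bsub>R\<^esub> g s)) \<longlongrightarrow> 0) (at s within {0..1}))"

lemma eventually_within_unit: "\<forall>\<^sub>F t in at s within {0..1::real}. t \<in> {0..1}"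
  by (simp add: eventually_at_filter)

context normed_graded_ring
begin

lemma cont_path_const: "c \<in> carrier R \<Longrightarrow> cont_path R (\<lambda>_. c)"
  by (simp add: cont_path_def)

lemma cont_path_cong:
  assumes "cont_path R g" "\<And>t. t \<in> {0..1} \<Longrightarrow> g t = h t"
  shows "cont_path R h"
  unfolding cont_path_def
proof
  fix s :: real assume s: "s \<in> {0..1}"
  have "((\<lambda>t. nrm R (g t \<ominus> g s)) \<longlongrightarrow> 0) (at s within {0..1})"
    using assms(1) s by (auto simp: cont_path_def)
  moreover have "\<forall>\<^sub>F t in at s within {0..1}. nrm R (g t \<ominus> g s) = nrm R (h t \<ominus> h s)"
    using eventually_within_unit by eventually_elim (use s assms(2) in auto)
  ultimately show "((\<lambda>t. nrm R (h t \<ominus> h s)) \<longlongrightarrow> 0) (at s within {0..1})"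
    using tendsto_cong by force
qed

lemma cont_path_bound:
  assumes "cont_path R' g" "\<And>s t. s \<in> {0..1} \<Longrightarrow> t \<in> {0..1} \<Longrightarrow>
     nrm R (h t \<ominus> h s) \<le> C * nrm R' (g t \<ominus>\<^bsub>R'\<^esub> g s)"
    and "\<And>t. t \<in> {0..1} \<Longrightarrow> h t \<in> carrier R"
  shows "cont_path R h"
  unfolding cont_path_def
proof
  fix s :: real assume s: "s \<in> {0..1}"
  have "((\<lambda>t. C * nrm R' (g t \<ominus>\<^bsub>R'\<^esub> g s)) \<longlongrightarrow> 0) (at s within {0..1})"
    using assms(1) s by (intro tendsto_mult_right_zero) (auto simp: cont_path_def)
  moreover have "\<forall>\<^sub>F t in at s within {0..1}. norm (nrm R (h t \<ominus> h s)) \<le> C * nrm R' (g t \<ominus>\<^bsub>R'\<^esub> g s)"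
    using eventually_within_unit by eventually_elim (use s assms(2,3) in auto)
  ultimately show "((\<lambda>t. nrm R (h t \<ominus> h s)) \<longlongrightarrow> 0) (at s within {0..1})"
    by (rule Lim_null_comparison[rotated])
qed

lemma cont_path_image:
  assumes "normed_graded_ring R'" "cont_path R' g" "additive_map R' R F"
    and "\<And>a. a \<in> carrier R' \<Longrightarrow> nrm R (F a) \<le> C * nrm R' a"
    and "\<And>t. t \<in> {0..1} \<Longrightarrow> g t \<in> carrier R'"
  shows "cont_path R (\<lambda>t. F (g t))"
proof (rule cont_path_bound[OF assms(2)])
  interpret R': normed_graded_ring R' by fact
  fix s t :: real assume t: "s \<in> {0..1}" "t \<in> {0..1}"
  show "nrm R (F (g t) \<ominus> F (g s)) \<le> C * nrm R' (g t \<ominus>\<^bsub>R'\<^esub> g s)"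
    using assms(4)[of "g t \<ominus>\<^bsub>R'\<^esub> g s"] assms(5) t
      additive_map_diff[OF R'.abelian_group_axioms abelian_group_axioms assms(3), of "g t" "g s"]
    by simp
next
  show "F (g t) \<in> carrier R" if "t \<in> {0..1}" for t
    using additive_mapD(1)[OF assms(3)] assms(5)[OF that] .
qed

lemma cont_path_add:
  assumes "cont_path R g" "cont_path R h"
    and "\<And>t. t \<in> {0..1} \<Longrightarrow> g t \<in> carrier R" "\<And>t. t \<in> {0..1} \<Longrightarrow> h t \<in> carrier R"
  shows "cont_path R (\<lambda>t. g t \<oplus> h t)"
  unfolding cont_path_def
proof
  fix s :: real assume s: "s \<in> {0..1}"
  have "((\<lambda>t. nrm R (g t \<ominus> g s) + nrm R (h t \<ominus> h s)) \<longlongrightarrow> 0) (at s within {0..1})"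
    using assms(1,2) s by (intro tendsto_add_zero) (auto simp: cont_path_def)
  moreover have "\<forall>\<^sub>F t in at s within {0..1}. norm (nrm R ((g t \<oplus> h t) \<ominus> (g s \<oplus> h s)))
      \<le> nrm R (g t \<ominus> g s) + nrm R (h t \<ominus> h s)"
    using eventually_within_unit
  proof eventually_elim
    case (elim t)
    have c: "g t \<in> carrier R" "h t \<in> carrier R" "g s \<in> carrier R" "h s \<in> carrier R"
      using assms(3,4) s elim by blast+
    then have "(g t \<oplus> h t) \<ominus> (g s \<oplus> h s) = (g t \<ominus> g s) \<oplus> (h t \<ominus> h s)"
      by (simp add: abelian_simps)
    then show ?case
      using nrm_triangle[of "g t \<ominus> g s" "h t \<ominus> h s"] c by simp
  qed
  ultimately show "((\<lambda>t. nrm R ((g t \<oplus> h t) \<ominus> (g s \<oplus> h s))) \<longlongrightarrow> 0) (at s within {0..1})"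
    by (rule Lim_null_comparison[rotated])
qed

lemma cont_path_scale:
  assumes "continuous_on {0..1} c" "a \<in> carrier R"
  shows "cont_path R (\<lambda>t. rscale R (c t) a)"
  unfolding cont_path_def
proof
  fix s :: real assume s: "s \<in> {0..1}"
  have "rscale R (c t) a \<ominus> rscale R (c s) a = rscale R (c t - c s) a" for t
    using scale_add_left[of a "c t" "- c s"] assms(2) by (simp add: scale_minus minus_eq)
  then have e: "nrm R (rscale R (c t) a \<ominus> rscale R (c s) a) = \<bar>c t - c s\<bar> * nrm R a" for t
    using nrm_scale[OF assms(2)] by simp
  have "((\<lambda>t. c t - c s) \<longlongrightarrow> 0) (at s within {0..1})"
    using assms(1) s by (auto simp: continuous_on_def intro: LIM_zero)
  then have "((\<lambda>t. \<bar>c t - c s\<bar> * nrm R a) \<longlongrightarrow> 0) (at s within {0..1})"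
    by (intro tendsto_mult_left_zero tendsto_rabs_zero)
  then show "((\<lambda>t. nrm R (rscale R (c t) a \<ominus> rscale R (c s) a)) \<longlongrightarrow> 0) (at s within {0..1})"
    by (simp add: e)
qed

lemma cont_path_finsum:
  assumes "finite K" "\<And>k. k \<in> K \<Longrightarrow> cont_path R (g k)"
    and "\<And>k t. k \<in> K \<Longrightarrow> t \<in> {0..1} \<Longrightarrow> g k t \<in> carrier R"
  shows "cont_path R (\<lambda>t. \<Oplus>k\<in>K. g k t)"
  using assms
proof (induction K)
  case empty
  then show ?case by (simp add: cont_path_const)
next
  case (insert k K)
  have "cont_path R (\<lambda>t. g k t \<oplus> (\<Oplus>k\<in>K. g k t))"
    using insert by (intro cont_path_add) (auto intro!: finsum_closed)
  then show ?case
    by (rule cont_path_cong) (use insert in \<open>simp add: finsum_insert Pi_def\<close>)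
qed

lemma cont_path_mult_right:
  assumes "cont_path R g" "a \<in> carrier R" "\<And>t. t \<in> {0..1} \<Longrightarrow> g t \<in> carrier R"
  shows "cont_path R (\<lambda>t. g t \<otimes> a)"
proof -
  obtain C where "\<And>x. x \<in> carrier R \<Longrightarrow> nrm R (x \<otimes> a) \<le> C * nrm R x * nrm R a"
    using nrm_mult_bounded assms(2) by blast
  then have C: "\<And>x. x \<in> carrier R \<Longrightarrow> nrm R (x \<otimes> a) \<le> (C * nrm R a) * nrm R x"
    by (simp add: mult_ac)
  show ?thesis
    by (rule cont_path_image[OF normed_graded_ring_axioms assms(1) _ C assms(3)])
      (auto intro!: additive_mapI simp: assms(2) l_distr)
qed

end

lemma (in Metric_space) pathin_iff:
  "pathin mtopology g \<longleftrightarrow> (\<forall>t\<in>{0..1}. g t \<in> M) \<and>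
     (\<forall>s\<in>{0..1}. ((\<lambda>t. d (g s) (g t)) \<longlongrightarrow> 0) (at s within {0..1}))"
proof
  assume "pathin mtopology g"
  then have c: "continuous_map (top_of_set {0..1}) mtopology g"
    by (simp add: pathin_def)
  have m: "\<forall>t\<in>{0..1}. g t \<in> M"
    using c by (auto simp: continuous_map_def)
  moreover have "((\<lambda>t. d (g s) (g t)) \<longlongrightarrow> 0) (at s within {0..1})" if s: "s \<in> {0..1}" for s
  proof (rule tendstoI)
    fix e :: real assume "e > 0"
    then obtain U where U: "openin (top_of_set {0..1}) U" "s \<in> U" "\<forall>y\<in>U. g y \<in> mball (g s) e"
      using c s unfolding continuous_map_to_metric topspace_euclidean_subtopology by blast
    then obtain T where T: "open T" "U = {0..1} \<inter> T"
      by (auto simp: openin_open)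
    show "\<forall>\<^sub>F t in at s within {0..1}. dist (d (g s) (g t)) 0 < e"
      unfolding eventually_at_topological using T U by (intro exI[of _ T]) auto
  qed
  ultimately show "(\<forall>t\<in>{0..1}. g t \<in> M) \<and>
     (\<forall>s\<in>{0..1}. ((\<lambda>t. d (g s) (g t)) \<longlongrightarrow> 0) (at s within {0..1}))" by blast
next
  assume A: "(\<forall>t\<in>{0..1}. g t \<in> M) \<and>
     (\<forall>s\<in>{0..1}. ((\<lambda>t. d (g s) (g t)) \<longlongrightarrow> 0) (at s within {0..1}))"
  show "pathin mtopology g"
    unfolding pathin_def continuous_map_to_metric
  proof (intro ballI allI impI)
    fix s e :: real assume "s \<in> topspace (top_of_set {0..1})" and e: "e > 0"
    then have s: "s \<in> {0..1}" by simp
    then have "\<forall>\<^sub>F t in at s within {0..1}. dist (d (g s) (g t)) 0 < e"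
      using A e tendstoD by blast
    then obtain T where T: "open T" "s \<in> T" "\<forall>t\<in>T. t \<noteq> s \<longrightarrow> t \<in> {0..1} \<longrightarrow> d (g s) (g t) < e"
      unfolding eventually_at_topological by auto
    \<comment> \<open>The limit is punctured at \<open>s\<close>, so the point \<open>s\<close>
      itself has to be supplied separately for the neighbourhood.\<close>
    have "d (g s) (g s) < e" using A s e by simp
    then show "\<exists>U. openin (top_of_set {0..1}) U \<and> s \<in> U \<and> (\<forall>y\<in>U. g y \<in> mball (g s) e)"
    proof (intro exI conjI ballI)
      show "openin (top_of_set {0..1}) ({0..1} \<inter> T)"
        using T(1) by (auto simp: openin_open)
      show "s \<in> {0..1} \<inter> T" using T s by simp
      fix y assume y: "y \<in> {0..1} \<inter> T"
      then have "d (g s) (g y) < e"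
        using T(3) \<open>d (g s) (g s) < e\<close> by (cases "y = s") auto
      then show "g y \<in> mball (g s) e"
        using A s y by auto
    qed
  qed
qed

text \<open>Since \<open>M\<close> is finitely generated projective, continuity in the operator norm can be tested
  pointwise, and after composition with functionals. This removes all norms on modules.\<close>

definition sym_path ::
  "symmetry_kind \<Rightarrow> 'r gr_alg \<Rightarrow> ('r, 'm) module \<Rightarrow> ('m \<Rightarrow> 'm) \<Rightarrow> ('m \<Rightarrow> 'm) \<Rightarrow> bool" where
  "sym_path k R M J1 J2 \<longleftrightarrow> (\<exists>p. p 0 = J1 \<and> p 1 = J2 \<and>
     (\<forall>t\<in>{0..1::real}. p t \<in> symmetry_space k R M) \<and>
     (\<forall>x\<in>carrier M. \<forall>f\<in>functionals R M. cont_path R (\<lambda>t. f (p t x))))"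

section \<open>Operator norms on finitely generated projective modules\<close>

locale fg_projective_module = normed_graded_ring R
  for R :: "'r gr_alg" (structure) +
  fixes M :: "('r, 'm) module"
  assumes fg_projective: "fg_projective R M"

sublocale fg_projective_module \<subseteq> mod: left_module R M
  using fg_projective by (simp add: fg_projective_def)

context fg_projective_module
begin

text \<open>\<open>mod_nrm\<close> rests on an arbitrary choice of a realization as a summand. What
  is used of it from here on is only that some dual basis expresses the norm.\<close>

lemma mod_nrm_basis:
  obtains n :: nat and xs fs where "dual_basis R M {..<n} xs fs"
    and "\<And>x. mod_nrm R M x = (\<Sum>k<n. nrm R (fs k x))"
proof -
  obtain n \<iota> \<pi> where e: "(SOME s. is_summand R M s) = (n, \<iota>, \<pi>)"
    by (metis prod_cases3)
  have "\<exists>s. is_summand R M s"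
    using fg_projective by (simp add: fg_projective_def)
  then have "is_summand R M (n, \<iota>, \<pi>)"
    unfolding e[symmetric] by (rule someI_ex)
  then have "dual_basis R M {..<n} (\<lambda>k. \<pi> (unit_vector R n k)) (\<lambda>k x. \<iota> x k)"
    by (rule summand_dual_basis[OF mod.left_module_axioms])
  moreover have "mod_nrm R M x = (\<Sum>k<n. nrm R (\<iota> x k))" for x
    by (simp add: mod_nrm_def e)
  ultimately show ?thesis using that by blast
qed

lemma mod_nrm_nonneg: "x \<in> carrier M \<Longrightarrow> 0 \<le> mod_nrm R M x"
  by (rule mod_nrm_basis) (auto intro!: sum_nonneg nrm_nonneg dest: dual_basisD(4))

lemma mod_nrm_zero [simp]: "mod_nrm R M \<zero>\<^bsub>M\<^esub> = 0"
proof (rule mod_nrm_basis)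
  fix n :: nat and xs fs assume b: "dual_basis R M {..<n} xs fs" "\<And>x. mod_nrm R M x = (\<Sum>k<n. nrm R (fs k x))"
  then have "fs k \<zero>\<^bsub>M\<^esub> = \<zero>" if "k < n" for k
    using that additive_map_zero[OF mod.M.abelian_group_axioms abelian_group_axioms]
      dual_basisD(3)[OF b(1)] functionalsD(1) by blast
  then show ?thesis by (simp add: b)
qed

lemma mod_nrm_eq_0:
  assumes "x \<in> carrier M" "mod_nrm R M x = 0"
  shows "x = \<zero>\<^bsub>M\<^esub>"
proof (rule mod_nrm_basis)
  fix n :: nat and xs fs assume b: "dual_basis R M {..<n} xs fs" "\<And>x. mod_nrm R M x = (\<Sum>k<n. nrm R (fs k x))"
  have c: "fs k x \<in> carrier R" if "k < n" for k
    using dual_basisD(4)[OF b(1) _ assms(1)] that by simp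
  then have "fs k x = \<zero>" if "k < n" for k
    using assms(2) that unfolding b(2)
    by (subst (asm) sum_nonneg_eq_0_iff) (auto simp: nrm_eq_0)
  then have "(\<Oplus>\<^bsub>M\<^esub>k\<in>{..<n}. fs k x \<odot>\<^bsub>M\<^esub> xs k) = (\<Oplus>\<^bsub>M\<^esub>k\<in>{..<n}. \<zero>\<^bsub>M\<^esub>)"
    using dual_basisD(2)[OF b(1)] by (intro mod.M.finsum_cong') auto
  then show ?thesis
    using b assms(1) by (simp add: dual_basis_def mod.M.finsum_zero)
qed

lemma mod_nrm_triangle:
  assumes "x \<in> carrier M" "y \<in> carrier M"
  shows "mod_nrm R M (x \<oplus>\<^bsub>M\<^esub> y) \<le> mod_nrm R M x + mod_nrm R M y"
proof (rule mod_nrm_basis)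
  fix n :: nat and xs fs assume b: "dual_basis R M {..<n} xs fs" "\<And>x. mod_nrm R M x = (\<Sum>k<n. nrm R (fs k x))"
  have "nrm R (fs k (x \<oplus>\<^bsub>M\<^esub> y)) \<le> nrm R (fs k x) + nrm R (fs k y)" if "k < n" for k
    using functionalsD(2,3)[OF dual_basisD(3)[OF b(1)], of k] that assms by (simp add: nrm_triangle)
  then show ?thesis
    by (auto simp: b sum.distrib[symmetric] intro!: sum_mono)
qed

lemma mod_nrm_smult_bound:
  obtains C where "C \<ge> 0" "\<And>a x. a \<in> carrier R \<Longrightarrow> x \<in> carrier M \<Longrightarrow>
    mod_nrm R M (a \<odot>\<^bsub>M\<^esub> x) \<le> C * nrm R a * mod_nrm R M x"
proof (rule mod_nrm_basis)
  fix n :: nat and xs fs assume b: "dual_basis R M {..<n} xs fs" "\<And>x. mod_nrm R M x = (\<Sum>k<n. nrm R (fs k x))"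
  obtain C where C: "\<And>a b. a \<in> carrier R \<Longrightarrow> b \<in> carrier R \<Longrightarrow> nrm R (a \<otimes> b) \<le> C * nrm R a * nrm R b"
    using nrm_mult_bounded by blast
  have "mod_nrm R M (a \<odot>\<^bsub>M\<^esub> x) \<le> \<bar>C\<bar> * nrm R a * mod_nrm R M x"
    if a: "a \<in> carrier R" and x: "x \<in> carrier M" for a x
  proof -
    have "nrm R (fs k (a \<odot>\<^bsub>M\<^esub> x)) \<le> \<bar>C\<bar> * nrm R a * nrm R (fs k x)" if "k < n" for k
    proof -
      have f: "fs k \<in> functionals R M" using b that by (auto simp: dual_basis_def)
      have "nrm R (fs k (a \<odot>\<^bsub>M\<^esub> x)) \<le> C * nrm R a * nrm R (fs k x)"
        using C a functionalsD[OF f] x by simp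
      also have "\<dots> \<le> \<bar>C\<bar> * nrm R a * nrm R (fs k x)"
        using a functionalsD(2)[OF f x] by (intro mult_right_mono) auto
      finally show ?thesis .
    qed
    then show ?thesis
      unfolding b sum_distrib_left by (intro sum_mono) auto
  qed
  then show ?thesis using that[of "\<bar>C\<bar>"] by simp
qed

lemma mod_nrm_scale:
  assumes "x \<in> carrier M"
  shows "mod_nrm R M (rscale R r \<one> \<odot>\<^bsub>M\<^esub> x) = \<bar>r\<bar> * mod_nrm R M x"
proof (rule mod_nrm_basis)
  fix n :: nat and xs fs assume b: "dual_basis R M {..<n} xs fs" "\<And>x. mod_nrm R M x = (\<Sum>k<n. nrm R (fs k x))"
  have "nrm R (fs k (rscale R r \<one> \<odot>\<^bsub>M\<^esub> x)) = \<bar>r\<bar> * nrm R (fs k x)" if "k < n" for k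
  proof -
    have f: "fs k \<in> functionals R M" using b that by (auto simp: dual_basis_def)
    show ?thesis
      using functionalsD[OF f] assms by (simp add: scale_mult_left nrm_scale)
  qed
  then show ?thesis by (simp add: b sum_distrib_left)
qed

lemma mod_nrm_neg:
  assumes "x \<in> carrier M" shows "mod_nrm R M (\<ominus>\<^bsub>M\<^esub> x) = mod_nrm R M x"
  using mod_nrm_scale[OF assms, of "-1"] assms
  by (simp add: scale_minus_one mod.smult_neg_left mod.smult_one)

lemma mod_nrm_diff_commute:
  assumes "x \<in> carrier M" "y \<in> carrier M"
  shows "mod_nrm R M (x \<ominus>\<^bsub>M\<^esub> y) = mod_nrm R M (y \<ominus>\<^bsub>M\<^esub> x)"
  using mod_nrm_neg[of "x \<ominus>\<^bsub>M\<^esub> y"] assms by (simp add: mod.M.abelian_simps)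

lemma mod_nrm_finsum:
  assumes "finite K" "\<And>k. k \<in> K \<Longrightarrow> f k \<in> carrier M"
  shows "mod_nrm R M (finsum M f K) \<le> (\<Sum>k\<in>K. mod_nrm R M (f k))"
  using assms
proof (induction K)
  case (insert x F)
  then have "mod_nrm R M (finsum M f (insert x F)) \<le> mod_nrm R M (f x) + mod_nrm R M (finsum M f F)"
    by (simp add: mod.M.finsum_insert Pi_def mod_nrm_triangle)
  then show ?case
    using insert by auto
qed auto

text \<open>Expanded in the dual basis, \<open>f x\<close> is a sum of products of the coordinates
  of \<open>x\<close> with the fixed elements \<open>f (xs k)\<close>; the coordinates are what
  \<open>mod_nrm\<close> measures.\<close>

lemma functional_bounded:
  assumes "f \<in> functionals R M"
  obtains C where "C \<ge> 0" "\<And>x. x \<in> carrier M \<Longrightarrow> nrm R (f x) \<le> C * mod_nrm R M x"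
proof (rule mod_nrm_basis)
  fix n :: nat and xs fs assume b: "dual_basis R M {..<n} xs fs" "\<And>x. mod_nrm R M x = (\<Sum>k<n. nrm R (fs k x))"
  note f = functionalsD[OF assms]
  obtain C where C: "\<And>a b. a \<in> carrier R \<Longrightarrow> b \<in> carrier R \<Longrightarrow> nrm R (a \<otimes> b) \<le> C * nrm R a * nrm R b"
    using nrm_mult_bounded by blast
  have xs: "xs k \<in> carrier M" "fs k \<in> functionals R M" if "k < n" for k
    using b that by (auto simp: dual_basis_def)
  define D where "D = (\<Sum>k<n. \<bar>C\<bar> * nrm R (f (xs k)))"
  have Dk: "\<bar>C\<bar> * nrm R (f (xs k)) \<le> D" if "k < n" for k
    unfolding D_def using that xs f
    by (intro member_le_sum[of k _ "\<lambda>k. \<bar>C\<bar> * nrm R (f (xs k))"]) auto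
  have D0: "D \<ge> 0" unfolding D_def using xs f by (intro sum_nonneg) auto
  have "nrm R (f x) \<le> D * mod_nrm R M x" if x: "x \<in> carrier M" for x
  proof -
    have c: "fs k x \<in> carrier R" if "k < n" for k
      using functionalsD(2)[OF xs(2)[OF that] x] .
    have "f x = f (\<Oplus>\<^bsub>M\<^esub>k\<in>{..<n}. fs k x \<odot>\<^bsub>M\<^esub> xs k)"
      using b x by (simp add: dual_basis_def)
    also have "\<dots> = (\<Oplus>k\<in>{..<n}. f (fs k x \<odot>\<^bsub>M\<^esub> xs k))"
      by (rule additive_map_finsum[OF mod.M.abelian_group_axioms abelian_group_axioms f(1)])
        (use c xs in \<open>auto intro: mod.smult_closed\<close>)
    finally have e: "f x = (\<Oplus>k\<in>{..<n}. f (fs k x \<odot>\<^bsub>M\<^esub> xs k))" .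
    have "nrm R (f x) \<le> (\<Sum>k<n. nrm R (f (fs k x \<odot>\<^bsub>M\<^esub> xs k)))"
      unfolding e by (rule nrm_finsum) (use c xs f in \<open>auto intro: mod.smult_closed\<close>)
    also have "\<dots> \<le> (\<Sum>k<n. D * nrm R (fs k x))"
    proof (rule sum_mono)
      fix k assume "k \<in> {..<n}"
      then have k: "k < n" by simp
      have "nrm R (f (fs k x \<odot>\<^bsub>M\<^esub> xs k)) \<le> C * nrm R (fs k x) * nrm R (f (xs k))"
        using f xs[OF k] c[OF k] C by simp
      also have "\<dots> = C * nrm R (f (xs k)) * nrm R (fs k x)" by simp
      also have "\<dots> \<le> \<bar>C\<bar> * nrm R (f (xs k)) * nrm R (fs k x)"
        using f xs[OF k] c[OF k] by (intro mult_right_mono) auto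
      also have "\<dots> \<le> D * nrm R (fs k x)"
        using Dk[OF k] c[OF k] by (intro mult_right_mono) auto
      finally show "nrm R (f (fs k x \<odot>\<^bsub>M\<^esub> xs k)) \<le> D * nrm R (fs k x)" .
    qed
    also have "\<dots> = D * mod_nrm R M x" by (simp add: b sum_distrib_left)
    finally show ?thesis .
  qed
  then show ?thesis using that[OF D0] by blast
qed

text \<open>A skew map is determined by its values on the generators, and boundedness of
  \<open>parity\<close> controls the twisted coordinates. The constant and the generators do not
  depend on the map \<open>D\<close>, which is what makes pointwise continuity imply continuity in
  the operator norm.\<close>

lemma skew_map_bounded:
  obtains C n and xs :: "nat \<Rightarrow> 'm" where "C \<ge> 0" "\<And>k. k < n \<Longrightarrow> xs k \<in> carrier M"
    "\<And>D x. skew_map R M D \<Longrightarrow> x \<in> carrier M \<Longrightarrow>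
      mod_nrm R M (D x) \<le> C * (\<Sum>k<n. mod_nrm R M (D (xs k))) * mod_nrm R M x"
proof (rule mod_nrm_basis)
  fix n :: nat and xs fs assume b: "dual_basis R M {..<n} xs fs" "\<And>x. mod_nrm R M x = (\<Sum>k<n. nrm R (fs k x))"
  obtain C where C: "C \<ge> 0" "\<And>a x. a \<in> carrier R \<Longrightarrow> x \<in> carrier M \<Longrightarrow>
    mod_nrm R M (a \<odot>\<^bsub>M\<^esub> x) \<le> C * nrm R a * mod_nrm R M x"
    by (rule mod_nrm_smult_bound, blast)
  obtain C0 where "\<And>a. a \<in> carrier R \<Longrightarrow> nrm R (parity R a) \<le> C0 * nrm R a"
    using nrm_parity_bounded by blast
  then have C': "\<And>a. a \<in> carrier R \<Longrightarrow> nrm R (parity R a) \<le> \<bar>C0\<bar> * nrm R a"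
    by (meson abs_ge_self mult_right_mono nrm_nonneg order_trans)
  have xs: "xs k \<in> carrier M" "fs k \<in> functionals R M" if "k < n" for k
    using b that by (auto simp: dual_basis_def)
  have "mod_nrm R M (D x) \<le> C * \<bar>C0\<bar> * (\<Sum>k<n. mod_nrm R M (D (xs k))) * mod_nrm R M x"
    if D: "skew_map R M D" and x: "x \<in> carrier M" for D x
  proof -
    note d = skew_mapD[OF D]
    have c: "fs k x \<in> carrier R" if "k < n" for k
      using functionalsD(2)[OF xs(2)[OF that] x] .
    have "D x = D (\<Oplus>\<^bsub>M\<^esub>k\<in>{..<n}. fs k x \<odot>\<^bsub>M\<^esub> xs k)"
      using b x by (simp add: dual_basis_def)
    also have "\<dots> = (\<Oplus>\<^bsub>M\<^esub>k\<in>{..<n}. D (fs k x \<odot>\<^bsub>M\<^esub> xs k))"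
      by (rule additive_map_finsum[OF mod.M.abelian_group_axioms mod.M.abelian_group_axioms d(1)])
        (use c xs in \<open>auto intro: mod.smult_closed\<close>)
    finally have e: "D x = (\<Oplus>\<^bsub>M\<^esub>k\<in>{..<n}. D (fs k x \<odot>\<^bsub>M\<^esub> xs k))" .
    have "mod_nrm R M (D x) \<le> (\<Sum>k<n. mod_nrm R M (D (fs k x \<odot>\<^bsub>M\<^esub> xs k)))"
      unfolding e by (rule mod_nrm_finsum) (use c xs d in \<open>auto intro: mod.smult_closed\<close>)
    also have "\<dots> \<le> (\<Sum>k<n. C * \<bar>C0\<bar> * mod_nrm R M (D (xs k)) * mod_nrm R M x)"
    proof (rule sum_mono)
      fix k assume "k \<in> {..<n}"
      then have k: "k < n" by simp
      have nn: "0 \<le> mod_nrm R M (D (xs k))"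
        using mod_nrm_nonneg d xs[OF k] by blast
      have le: "nrm R (fs k x) \<le> mod_nrm R M x"
        unfolding b using k c by (intro member_le_sum[of k _ "\<lambda>k. nrm R (fs k x)"]) auto
      have "mod_nrm R M (D (fs k x \<odot>\<^bsub>M\<^esub> xs k)) = mod_nrm R M (parity R (fs k x) \<odot>\<^bsub>M\<^esub> D (xs k))"
        using d xs[OF k] c[OF k] by simp
      also have "\<dots> \<le> C * nrm R (parity R (fs k x)) * mod_nrm R M (D (xs k))"
        using C d xs[OF k] c[OF k] by simp
      also have "\<dots> \<le> C * (\<bar>C0\<bar> * mod_nrm R M x) * mod_nrm R M (D (xs k))"
      proof (intro mult_right_mono mult_left_mono)
        show "nrm R (parity R (fs k x)) \<le> \<bar>C0\<bar> * mod_nrm R M x"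
          using C'[OF c[OF k]] mult_left_mono[OF le, of "\<bar>C0\<bar>"] by simp
      qed (use C(1) nn in auto)
      also have "\<dots> = C * \<bar>C0\<bar> * mod_nrm R M (D (xs k)) * mod_nrm R M x" by simp
      finally show "mod_nrm R M (D (fs k x \<odot>\<^bsub>M\<^esub> xs k))
        \<le> C * \<bar>C0\<bar> * mod_nrm R M (D (xs k)) * mod_nrm R M x" .
    qed
    also have "\<dots> = C * \<bar>C0\<bar> * (\<Sum>k<n. mod_nrm R M (D (xs k))) * mod_nrm R M x"
      by (simp add: sum_distrib_left sum_distrib_right)
    finally show ?thesis .
  qed
  moreover have "C * \<bar>C0\<bar> \<ge> 0" using C(1) by simp
  ultimately show ?thesis by (intro that[of "C * \<bar>C0\<bar>" n xs] xs(1))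
qed

lemma skew_map_diff:
  assumes "skew_map R M S" "skew_map R M T"
  shows "skew_map R M (\<lambda>x. S x \<ominus>\<^bsub>M\<^esub> T x)"
proof -
  note s = skew_mapD[OF assms(1)] and t = skew_mapD[OF assms(2)]
  show ?thesis
    by (rule skew_mapI)
      (simp_all add: s t mod.smult_diff_right, simp add: s t mod.M.abelian_simps)
qed

lemma skewlinearD:
  assumes "S \<in> skewlinear R M"
  shows "skew_map R M S" "x \<in> carrier M \<Longrightarrow> S x \<in> carrier M"
  using assms skewlinear_iff[OF mod.left_module_axioms] skew_mapD(2) by auto

lemma op_dist_bound:
  assumes S: "S \<in> skewlinear R M" and T: "T \<in> skewlinear R M" and x: "x \<in> carrier M"
  shows "mod_nrm R M (S x \<ominus>\<^bsub>M\<^esub> T x) \<le> op_dist R M S T * mod_nrm R M x"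
proof -
  have st: "skew_map R M S" "skew_map R M T"
    using S T skewlinear_iff[OF mod.left_module_axioms] by auto
  define D where "D = (\<lambda>x. S x \<ominus>\<^bsub>M\<^esub> T x)"
  have D: "skew_map R M D"
    unfolding D_def using skew_map_diff st .
  define B where "B = {x \<in> carrier M. mod_nrm R M x \<le> 1}"
  obtain C n and xs :: "nat \<Rightarrow> 'm" where C: "C \<ge> 0" "\<And>k. k < n \<Longrightarrow> xs k \<in> carrier M"
    "\<And>D x. skew_map R M D \<Longrightarrow> x \<in> carrier M \<Longrightarrow>
      mod_nrm R M (D x) \<le> C * (\<Sum>k<n. mod_nrm R M (D (xs k))) * mod_nrm R M x"
    by (rule skew_map_bounded, blast)
  define c where "c = C * (\<Sum>k<n. mod_nrm R M (D (xs k)))"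
  have "c \<ge> 0"
    unfolding c_def using C(1,2) skew_mapD(2)[OF D]
    by (intro mult_nonneg_nonneg sum_nonneg mod_nrm_nonneg) auto
  \<comment> \<open>The supremum in \<open>op_dist\<close> dominates the individual values only if
    they are bounded above; the estimate by finitely many generators provides the bound.\<close>
  have bdd: "bdd_above ((\<lambda>x. mod_nrm R M (D x)) ` B)"
  proof (rule bdd_aboveI2)
    fix y assume "y \<in> B"
    then show "mod_nrm R M (D y) \<le> c"
      using C(3)[OF D, of y] mult_left_mono[of "mod_nrm R M y" 1 c] \<open>c \<ge> 0\<close>
      by (simp add: B_def c_def)
  qed
  have od: "op_dist R M S T = (SUP x\<in>B. mod_nrm R M (D x))"
    by (simp add: op_dist_def S T B_def D_def)
  show ?thesis
  proof (cases "mod_nrm R M x = 0")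
    case True
    then show ?thesis
      using C(3)[OF D x] by (simp add: D_def)
  next
    case False
    define r where "r = mod_nrm R M x"
    have r: "r > 0" using False mod_nrm_nonneg[OF x] by (simp add: r_def)
    \<comment> \<open>A vector of positive norm is scaled to norm 1, where the supremum applies; the
      map \<open>D\<close> commutes with real scalars, so the inequality scales back.\<close>
    define y where "y = rscale R (1/r) \<one> \<odot>\<^bsub>M\<^esub> x"
    have y: "y \<in> carrier M" "y \<in> B"
      using x r by (simp_all add: y_def B_def mod.smult_closed mod_nrm_scale r_def)
    have "D y = rscale R (1/r) \<one> \<odot>\<^bsub>M\<^esub> D x"
      using skew_mapD(4)[OF D] x by (simp add: y_def)
    then have "mod_nrm R M (D y) = mod_nrm R M (D x) / r"
      using r skew_mapD(2)[OF D x] by (simp add: mod_nrm_scale)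
    moreover have "mod_nrm R M (D y) \<le> op_dist R M S T"
      unfolding od using y bdd by (intro cSUP_upper)
    ultimately show ?thesis
      using r by (simp add: D_def r_def field_simps)
  qed
qed

lemma op_dist_le:
  assumes S: "S \<in> skewlinear R M" and T: "T \<in> skewlinear R M" and "B \<ge> 0"
    and le: "\<And>x. x \<in> carrier M \<Longrightarrow> mod_nrm R M (S x \<ominus>\<^bsub>M\<^esub> T x) \<le> B * mod_nrm R M x"
  shows "op_dist R M S T \<le> B"
proof -
  have "(SUP x\<in>{x \<in> carrier M. mod_nrm R M x \<le> 1}. mod_nrm R M (S x \<ominus>\<^bsub>M\<^esub> T x)) \<le> B"
  proof (rule cSUP_least)
    have "\<zero>\<^bsub>M\<^esub> \<in> {x \<in> carrier M. mod_nrm R M x \<le> 1}" by simp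
    then show "{x \<in> carrier M. mod_nrm R M x \<le> 1} \<noteq> {}" by blast
    fix x assume "x \<in> {x \<in> carrier M. mod_nrm R M x \<le> 1}"
    then show "mod_nrm R M (S x \<ominus>\<^bsub>M\<^esub> T x) \<le> B"
      using le[of x] mult_left_mono[of "mod_nrm R M x" 1 B] \<open>B \<ge> 0\<close> by simp
  qed
  then show ?thesis by (simp add: op_dist_def S T)
qed

lemma op_dist_nonneg: "0 \<le> op_dist R M S T"
proof (cases "S \<in> skewlinear R M \<and> T \<in> skewlinear R M")
  case True
  then have st: "skew_map R M S" "skew_map R M T"
    using skewlinear_iff[OF mod.left_module_axioms] by auto
  show ?thesis
  proof (cases "\<exists>x\<in>carrier M. mod_nrm R M x \<noteq> 0")
    case True
    then obtain x where x: "x \<in> carrier M" "mod_nrm R M x > 0"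
      using mod_nrm_nonneg by (metis order_le_less)
    have "0 \<le> mod_nrm R M (S x \<ominus>\<^bsub>M\<^esub> T x)"
      using x skew_mapD(2)[OF st(1)] skew_mapD(2)[OF st(2)] by (intro mod_nrm_nonneg) simp
    then have "0 \<le> op_dist R M S T * mod_nrm R M x"
      using op_dist_bound[of S T x] \<open>S \<in> _ \<and> T \<in> _\<close> x by linarith
    then show ?thesis using x(2) by (simp add: zero_le_mult_iff)
  next
    case False
    \<comment> \<open>Here every element has norm zero, so the supremum runs over the constant 0;
      the unit ball is nonempty because it contains the zero element.\<close>
    have "mod_nrm R M (S x \<ominus>\<^bsub>M\<^esub> T x) = 0" if "x \<in> carrier M" for x
      using False skew_mapD(2)[OF st(1) that] skew_mapD(2)[OF st(2) that] by simp
    then have "(SUP x\<in>{x \<in> carrier M. mod_nrm R M x \<le> 1}. mod_nrm R M (S x \<ominus>\<^bsub>M\<^esub> T x))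
        = (SUP x\<in>{x \<in> carrier M. mod_nrm R M x \<le> 1}. 0)"
      by (intro SUP_cong) auto
    also have "\<dots> = 0"
      using mod.M.zero_closed mod_nrm_zero by (intro cSUP_const) force
    finally show ?thesis by (simp add: op_dist_def)
  qed
qed (auto simp: op_dist_def)

text \<open>Nonnegativity and symmetry are demanded for arbitrary pairs of functions and hold
  outside the skewlinear maps through the default value 0. That distance zero means equality relies
  on symmetries being extensional.\<close>

lemma op_dist_metric: "Metric_space (symmetry_space k R M) (op_dist R M)"
proof
  fix S T U
  show "0 \<le> op_dist R M S T" by (rule op_dist_nonneg)
  have le: "op_dist R M S T \<le> op_dist R M T S" if st: "S \<in> skewlinear R M" "T \<in> skewlinear R M" for S T
  proof (rule op_dist_le[OF st op_dist_nonneg])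
    fix x assume x: "x \<in> carrier M"
    have "S x \<in> carrier M" "T x \<in> carrier M"
      using skewlinearD(2) st x by auto
    then show "mod_nrm R M (S x \<ominus>\<^bsub>M\<^esub> T x) \<le> op_dist R M T S * mod_nrm R M x"
      using op_dist_bound[OF st(2,1) x] mod_nrm_diff_commute[of "S x" "T x"] by simp
  qed
  show "op_dist R M S T = op_dist R M T S"
  proof (cases "S \<in> skewlinear R M \<and> T \<in> skewlinear R M")
    case True
    then show ?thesis using le[of S T] le[of T S] by simp
  qed (auto simp: op_dist_def)
  assume "S \<in> symmetry_space k R M" "T \<in> symmetry_space k R M"
  then have st: "S \<in> skewlinear R M" "T \<in> skewlinear R M"
    by (auto simp: symmetry_space_skewlinear)
  then have ST: "skew_map R M S" "skew_map R M T" "S \<in> extensional (carrier M)" "T \<in> extensional (carrier M)"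
    using skewlinear_iff[OF mod.left_module_axioms] by auto
  have c: "S x \<in> carrier M" "T x \<in> carrier M" if "x \<in> carrier M" for x
    using skewlinearD(2)[OF st(1) that] skewlinearD(2)[OF st(2) that] by auto
  show "op_dist R M S T = 0 \<longleftrightarrow> S = T"
  proof
    assume 0: "op_dist R M S T = 0"
    show "S = T"
    proof (rule extensionalityI[OF ST(3,4)])
      fix x assume x: "x \<in> carrier M"
      then have "mod_nrm R M (S x \<ominus>\<^bsub>M\<^esub> T x) = 0"
        using op_dist_bound[OF st x] mod_nrm_nonneg[of "S x \<ominus>\<^bsub>M\<^esub> T x"] c[OF x] 0 by simp
      then show "S x = T x"
        using mod_nrm_eq_0[of "S x \<ominus>\<^bsub>M\<^esub> T x"] c[OF x] by simp
    qed
  next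
    assume "S = T"
    then have "op_dist R M S T \<le> 0"
      using c by (intro op_dist_le st) auto
    then show "op_dist R M S T = 0"
      using op_dist_nonneg[of S T] by simp
  qed
  assume "U \<in> symmetry_space k R M"
  then have u: "U \<in> skewlinear R M"
    by (auto simp: symmetry_space_skewlinear)
  show "op_dist R M S U \<le> op_dist R M S T + op_dist R M T U"
  proof (rule op_dist_le[OF st(1) u])
    fix x assume x: "x \<in> carrier M"
    have ux: "U x \<in> carrier M"
      using skewlinearD(2)[OF u x] .
    have "S x \<ominus>\<^bsub>M\<^esub> U x = (S x \<ominus>\<^bsub>M\<^esub> T x) \<oplus>\<^bsub>M\<^esub> (T x \<ominus>\<^bsub>M\<^esub> U x)"
      using c[OF x] ux by (simp add: mod.M.abelian_simps)
    then have "mod_nrm R M (S x \<ominus>\<^bsub>M\<^esub> U x) \<le> mod_nrm R M (S x \<ominus>\<^bsub>M\<^esub> T x) + mod_nrm R M (T x \<ominus>\<^bsub>M\<^esub> U x)"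
      using mod_nrm_triangle[of "S x \<ominus>\<^bsub>M\<^esub> T x" "T x \<ominus>\<^bsub>M\<^esub> U x"] c[OF x] ux by simp
    then show "mod_nrm R M (S x \<ominus>\<^bsub>M\<^esub> U x) \<le> (op_dist R M S T + op_dist R M T U) * mod_nrm R M x"
      using op_dist_bound[OF st x] op_dist_bound[OF st(2) u x] by (simp add: algebra_simps)
  qed (simp add: op_dist_nonneg)
qed

text \<open>In one direction a functional is bounded, so the operator distance controls its values
  along the path. In the other, the operator distance is at most a constant times the sum of
  finitely many coordinates at finitely many generators, each of which tends to zero.\<close>

theorem path_component_iff:
  "path_component_of (symmetry_topology k R M) J1 J2 \<longleftrightarrow> sym_path k R M J1 J2"
proof -
  interpret T: Metric_space "symmetry_space k R M" "op_dist R M"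
    by (rule op_dist_metric)
  have skew: "S \<in> skewlinear R M" "skew_map R M S" "x \<in> carrier M \<Longrightarrow> S x \<in> carrier M"
    if "S \<in> symmetry_space k R M" for S x
    using that skewlinearD[of S] by (auto simp: symmetry_space_skewlinear)
  have 1: "cont_path R (\<lambda>t. f (p t x))"
    if p: "\<forall>t\<in>{0..1}. p t \<in> symmetry_space k R M"
      and lim: "\<forall>s\<in>{0..1}. ((\<lambda>t. op_dist R M (p s) (p t)) \<longlongrightarrow> 0) (at s within {0..1})"
      and x: "x \<in> carrier M" and f: "f \<in> functionals R M" for p x f
    unfolding cont_path_def
  proof
    fix s :: real assume s: "s \<in> {0..1}"
    obtain C where C: "C \<ge> 0" "\<And>x. x \<in> carrier M \<Longrightarrow> nrm R (f x) \<le> C * mod_nrm R M x"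
      by (rule functional_bounded[OF f], blast)
    have "((\<lambda>t. C * (op_dist R M (p s) (p t) * mod_nrm R M x)) \<longlongrightarrow> 0) (at s within {0..1})"
      using lim s by (intro tendsto_mult_right_zero tendsto_mult_left_zero) auto
    moreover have "\<forall>\<^sub>F t in at s within {0..1}.
        norm (nrm R (f (p t x) \<ominus> f (p s x))) \<le> C * (op_dist R M (p s) (p t) * mod_nrm R M x)"
      using eventually_within_unit
    proof eventually_elim
      case (elim t)
      have c: "p t x \<in> carrier M" "p s x \<in> carrier M"
        using skew(3)[OF _ x] p elim s by auto
      have "nrm R (f (p t x) \<ominus> f (p s x)) = nrm R (f (p t x \<ominus>\<^bsub>M\<^esub> p s x))"
        using additive_map_diff[OF mod.M.abelian_group_axioms abelian_group_axioms functionalsD(1)[OF f] c]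
        by simp
      also have "\<dots> \<le> C * mod_nrm R M (p t x \<ominus>\<^bsub>M\<^esub> p s x)"
        using C c by simp
      also have "\<dots> \<le> C * (op_dist R M (p s) (p t) * mod_nrm R M x)"
        using op_dist_bound[of "p t" "p s" x] p elim s x skew(1) C(1) T.commute[of "p s" "p t"]
        by (intro mult_left_mono) auto
      finally show ?case
        using c functionalsD(2)[OF f] by simp
    qed
    ultimately show "((\<lambda>t. nrm R (f (p t x) \<ominus> f (p s x))) \<longlongrightarrow> 0) (at s within {0..1})"
      by (rule Lim_null_comparison[rotated])
  qed
  have 2: "((\<lambda>t. op_dist R M (p s) (p t)) \<longlongrightarrow> 0) (at s within {0..1})"
    if p: "\<forall>t\<in>{0..1}. p t \<in> symmetry_space k R M"
      and con: "\<forall>x\<in>carrier M. \<forall>f\<in>functionals R M. cont_path R (\<lambda>t. f (p t x))"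
      and s: "s \<in> {0..1}" for p s
  proof (rule mod_nrm_basis)
    fix n :: nat and xs fs assume b: "dual_basis R M {..<n} xs fs" "\<And>x. mod_nrm R M x = (\<Sum>k<n. nrm R (fs k x))"
    obtain C m and ys :: "nat \<Rightarrow> 'm" where C: "C \<ge> 0" "\<And>k. k < m \<Longrightarrow> ys k \<in> carrier M"
      "\<And>D x. skew_map R M D \<Longrightarrow> x \<in> carrier M \<Longrightarrow>
        mod_nrm R M (D x) \<le> C * (\<Sum>k<m. mod_nrm R M (D (ys k))) * mod_nrm R M x"
      by (rule skew_map_bounded, blast)
    define F where "F t = C * (\<Sum>k<m. \<Sum>j<n. nrm R (fs j (p t (ys k)) \<ominus> fs j (p s (ys k))))" for t
    have fs: "fs j \<in> functionals R M" if "j < n" for j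
      using b that by (auto simp: dual_basis_def)
    have "((\<lambda>t. nrm R (fs j (p t (ys k)) \<ominus> fs j (p s (ys k)))) \<longlongrightarrow> 0) (at s within {0..1})"
      if "k < m" "j < n" for k j
      using con C(2)[OF that(1)] fs[OF that(2)] s by (auto simp: cont_path_def)
    then have "(F \<longlongrightarrow> 0) (at s within {0..1})"
      unfolding F_def by (intro tendsto_mult_right_zero tendsto_null_sum) auto
    moreover have "\<forall>\<^sub>F t in at s within {0..1}. norm (op_dist R M (p s) (p t)) \<le> F t"
      using eventually_within_unit
    proof eventually_elim
      case (elim t)
      have pt: "p t \<in> symmetry_space k R M" "p s \<in> symmetry_space k R M"
        using p elim s by auto
      have D: "skew_map R M (\<lambda>x. p t x \<ominus>\<^bsub>M\<^esub> p s x)"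
        using pt skew(2) by (intro skew_map_diff) auto
      have "mod_nrm R M (p t (ys k) \<ominus>\<^bsub>M\<^esub> p s (ys k))
          = (\<Sum>j<n. nrm R (fs j (p t (ys k)) \<ominus> fs j (p s (ys k))))" if "k < m" for k
        unfolding b using fs C(2)[OF that] pt skew(3)
        by (intro sum.cong refl) (simp add: functionalsD(1)
            additive_map_diff[OF mod.M.abelian_group_axioms abelian_group_axioms])
      then have F: "F t = C * (\<Sum>k<m. mod_nrm R M (p t (ys k) \<ominus>\<^bsub>M\<^esub> p s (ys k)))"
        by (simp add: F_def)
      have "op_dist R M (p t) (p s) \<le> F t"
        unfolding F
      proof (rule op_dist_le)
        show "0 \<le> C * (\<Sum>k<m. mod_nrm R M (p t (ys k) \<ominus>\<^bsub>M\<^esub> p s (ys k)))"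
          using C(1,2) skew_mapD(2)[OF D] by (intro mult_nonneg_nonneg sum_nonneg mod_nrm_nonneg) auto
      qed (use C(3)[OF D] pt skew(1) in auto)
      then show ?case
        using T.commute[of "p s" "p t"] op_dist_nonneg by simp
    qed
    ultimately show ?thesis
      by (rule Lim_null_comparison[rotated])
  qed
  show ?thesis
    unfolding path_component_of_def symmetry_topology_def T.pathin_iff sym_path_def
  proof (rule ex_cong1)
    fix p
    have "(\<forall>s\<in>{0..1}. ((\<lambda>t. op_dist R M (p s) (p t)) \<longlongrightarrow> 0) (at s within {0..1})) \<longleftrightarrow>
        (\<forall>x\<in>carrier M. \<forall>f\<in>functionals R M. cont_path R (\<lambda>t. f (p t x)))"
      if p: "\<forall>t\<in>{0..1}. p t \<in> symmetry_space k R M"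
      using 1[OF p] 2[OF p] by blast
    then show "((\<forall>t\<in>{0..1}. p t \<in> symmetry_space k R M) \<and>
         (\<forall>s\<in>{0..1}. ((\<lambda>t. op_dist R M (p s) (p t)) \<longlongrightarrow> 0) (at s within {0..1}))) \<and>
        p 0 = J1 \<and> p 1 = J2 \<longleftrightarrow>
      p 0 = J1 \<and> p 1 = J2 \<and> (\<forall>t\<in>{0..1}. p t \<in> symmetry_space k R M) \<and>
        (\<forall>x\<in>carrier M. \<forall>f\<in>functionals R M. cont_path R (\<lambda>t. f (p t x)))"
      by blast
  qed
qed

end

section \<open>Triples\<close>

lemma is_triple_iff:
  "is_triple k R (M, J1, J2) \<longleftrightarrow>
     fg_projective R M \<and> J1 \<in> symmetry_space k R M \<and> J2 \<in> symmetry_space k R M"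
  by (simp add: is_triple_def)

lemma triple_isoI:
  assumes "f \<in> mod_hom R M N" "bij_betw f (carrier M) (carrier N)"
    and "\<And>x. x \<in> carrier M \<Longrightarrow> f (J1 x) = J1' (f x)" "\<And>x. x \<in> carrier M \<Longrightarrow> f (J2 x) = J2' (f x)"
  shows "triple_iso R (M, J1, J2) (N, J1', J2')"
  using assms by (auto simp: triple_iso_def)

lemma triple_isoE:
  assumes "triple_iso R (M, J1, J2) (N, J1', J2')"
  obtains f where "f \<in> mod_hom R M N" "bij_betw f (carrier M) (carrier N)"
    "\<And>x. x \<in> carrier M \<Longrightarrow> f (J1 x) = J1' (f x)" "\<And>x. x \<in> carrier M \<Longrightarrow> f (J2 x) = J2' (f x)"
  using assms by (auto simp: triple_iso_def)

lemma triple_iso_refl: "triple_iso R T T"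
proof -
  obtain M J1 J2 where T: "T = (M, J1, J2)" by (rule prod_cases3)
  show ?thesis
    unfolding T by (rule triple_isoI[of id]) (auto simp: mod_hom_def)
qed

lemma triple_iso_trans:
  assumes "triple_iso R T S" "triple_iso R S U"
  shows "triple_iso R T U"
proof -
  obtain M J1 J2 where T: "T = (M, J1, J2)" by (rule prod_cases3)
  obtain N J1' J2' where S: "S = (N, J1', J2')" by (rule prod_cases3)
  obtain P J1'' J2'' where U: "U = (P, J1'', J2'')" by (rule prod_cases3)
  obtain f where f: "f \<in> mod_hom R M N" "bij_betw f (carrier M) (carrier N)"
    "\<And>x. x \<in> carrier M \<Longrightarrow> f (J1 x) = J1' (f x)" "\<And>x. x \<in> carrier M \<Longrightarrow> f (J2 x) = J2' (f x)"
    using assms(1) unfolding T S by (rule triple_isoE, blast)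
  obtain g where g: "g \<in> mod_hom R N P" "bij_betw g (carrier N) (carrier P)"
    "\<And>x. x \<in> carrier N \<Longrightarrow> g (J1' x) = J1'' (g x)" "\<And>x. x \<in> carrier N \<Longrightarrow> g (J2' x) = J2'' (g x)"
    using assms(2) unfolding S U by (rule triple_isoE, blast)
  note fh = mod_homD[OF f(1)] and gh = mod_homD[OF g(1)]
  show ?thesis
    unfolding T U
  proof (rule triple_isoI)
    show "g \<circ> f \<in> mod_hom R M P"
      by (rule mod_homI) (simp_all add: fh gh)
    show "bij_betw (g \<circ> f) (carrier M) (carrier P)"
      using f(2) g(2) by (rule bij_betw_trans)
  qed (simp_all add: f g fh)
qed

lemma module_sum_simps [simp]:
  "carrier (module_sum M N) = carrier M \<times> carrier N"
  "\<zero>\<^bsub>module_sum M N\<^esub> = (\<zero>\<^bsub>M\<^esub>, \<zero>\<^bsub>N\<^esub>)"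
  "(x, y) \<oplus>\<^bsub>module_sum M N\<^esub> (x', y') = (x \<oplus>\<^bsub>M\<^esub> x', y \<oplus>\<^bsub>N\<^esub> y')"
  "a \<odot>\<^bsub>module_sum M N\<^esub> (x, y) = (a \<odot>\<^bsub>M\<^esub> x, a \<odot>\<^bsub>N\<^esub> y)"
  by (simp_all add: module_sum_def)

lemma triple_sum_eq:
  "triple_sum (M, J1, J2) (N, J1', J2') =
     (module_sum M N, restrict (map_prod J1 J1') (carrier M \<times> carrier N),
      restrict (map_prod J2 J2') (carrier M \<times> carrier N))"
  by (simp add: triple_sum_def)

lemma module_sum_abelian_group:
  assumes "abelian_group M" "abelian_group N"
  shows "abelian_group (module_sum M N)"
proof (rule abelian_groupI)
  interpret M: abelian_group M by fact
  interpret N: abelian_group N by fact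
  fix z assume "z \<in> carrier (module_sum M N)"
  then obtain x y where "z = (x, y)" "x \<in> carrier M" "y \<in> carrier N" by auto
  then show "\<exists>w\<in>carrier (module_sum M N). w \<oplus>\<^bsub>module_sum M N\<^esub> z = \<zero>\<^bsub>module_sum M N\<^esub>"
    by (intro bexI[of _ "(\<ominus>\<^bsub>M\<^esub> x, \<ominus>\<^bsub>N\<^esub> y)"]) (auto simp: M.l_neg N.l_neg)
next
  interpret M: abelian_group M by fact
  interpret N: abelian_group N by fact
  show "\<zero>\<^bsub>module_sum M N\<^esub> \<in> carrier (module_sum M N)" by simp
  fix u v w assume "u \<in> carrier (module_sum M N)" "v \<in> carrier (module_sum M N)"
    "w \<in> carrier (module_sum M N)"
  then show "u \<oplus>\<^bsub>module_sum M N\<^esub> v \<in> carrier (module_sum M N)"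
    "(u \<oplus>\<^bsub>module_sum M N\<^esub> v) \<oplus>\<^bsub>module_sum M N\<^esub> w = u \<oplus>\<^bsub>module_sum M N\<^esub> (v \<oplus>\<^bsub>module_sum M N\<^esub> w)"
    "u \<oplus>\<^bsub>module_sum M N\<^esub> v = v \<oplus>\<^bsub>module_sum M N\<^esub> u"
    "\<zero>\<^bsub>module_sum M N\<^esub> \<oplus>\<^bsub>module_sum M N\<^esub> u = u"
    by (auto simp: M.a_ac N.a_ac)
qed

lemma module_sum_left_module:
  assumes "left_module R M" "left_module R N"
  shows "left_module R (module_sum M N)"
proof -
  interpret M: left_module R M by fact
  interpret N: left_module R N by fact
  show ?thesis
    by (rule left_moduleI[OF M.R.ring_axioms
          module_sum_abelian_group[OF M.M.abelian_group_axioms N.M.abelian_group_axioms]])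
      (auto simp: M.smult_closed N.smult_closed M.smult_l_distr N.smult_l_distr M.smult_r_distr
        N.smult_r_distr M.smult_assoc N.smult_assoc M.smult_one N.smult_one)
qed

lemma fg_projective_module_sum:
  assumes "fg_projective R M" "fg_projective R N"
  shows "fg_projective R (module_sum M N)"
proof -
  obtain m :: nat and xs fs where M: "left_module R M" "dual_basis R M {..<m} xs fs"
    using fg_projective_dual_basis[OF assms(1)] .
  obtain n :: nat and ys gs where N: "left_module R N" "dual_basis R N {..<n} ys gs"
    using fg_projective_dual_basis[OF assms(2)] .
  interpret M: left_module R M by fact
  interpret N: left_module R N by fact
  interpret S: left_module R "module_sum M N" by (rule module_sum_left_module) fact+
  note xs = dual_basisD(2-4)[OF M(2)] and ys = dual_basisD(2-4)[OF N(2)]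
  define zs where "zs = case_sum (\<lambda>k. (xs k, \<zero>\<^bsub>N\<^esub>)) (\<lambda>k. (\<zero>\<^bsub>M\<^esub>, ys k))"
  define hs where "hs = case_sum (\<lambda>k z. fs k (fst z)) (\<lambda>k z. gs k (snd z))"
  show ?thesis
  proof (rule fg_projectiveI[OF S.left_module_axioms])
    show "dual_basis R (module_sum M N) (Inl ` {..<m} \<union> Inr ` {..<n}) zs hs"
      unfolding dual_basis_def
    proof (intro conjI ballI)
      show "finite (Inl ` {..<m} \<union> Inr ` {..<n} :: (nat + nat) set)" by simp
      fix k :: "nat + nat" assume k: "k \<in> Inl ` {..<m} \<union> Inr ` {..<n}"
      then show "zs k \<in> carrier (module_sum M N)"
        using xs(1) ys(1) by (auto simp: zs_def)
      show "hs k \<in> functionals R (module_sum M N)"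
        using k functionalsD[OF xs(2)] functionalsD[OF ys(2)]
        by (intro functionalsI) (auto simp: hs_def)
    next
      fix z assume "z \<in> carrier (module_sum M N)"
      then obtain x y where z: "z = (x, y)" "x \<in> carrier M" "y \<in> carrier N" by auto
      have t: "hs k z \<odot>\<^bsub>module_sum M N\<^esub> zs k \<in> carrier (module_sum M N)"
        if "k \<in> Inl ` {..<m} \<union> Inr ` {..<n}" for k
        using that z xs ys by (auto simp: hs_def zs_def M.smult_closed N.smult_closed)
      have inl: "additive_map M (module_sum M N) (\<lambda>u. (u, \<zero>\<^bsub>N\<^esub>))"
        and inr: "additive_map N (module_sum M N) (\<lambda>u. (\<zero>\<^bsub>M\<^esub>, u))"
        by (auto simp: additive_map_def)
      have "(\<Oplus>\<^bsub>module_sum M N\<^esub>k\<in>Inl ` {..<m}. hs k z \<odot>\<^bsub>module_sum M N\<^esub> zs k)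
          = (\<Oplus>\<^bsub>module_sum M N\<^esub>k\<in>{..<m}. hs (Inl k) z \<odot>\<^bsub>module_sum M N\<^esub> zs (Inl k))"
        using t by (intro S.M.finsum_reindex) auto
      also have "\<dots> = (\<Oplus>\<^bsub>module_sum M N\<^esub>k\<in>{..<m}. (fs k x \<odot>\<^bsub>M\<^esub> xs k, \<zero>\<^bsub>N\<^esub>))"
        using z xs ys by (intro S.M.finsum_cong') (auto simp: hs_def zs_def M.smult_closed)
      also have "\<dots> = (\<Oplus>\<^bsub>M\<^esub>k\<in>{..<m}. fs k x \<odot>\<^bsub>M\<^esub> xs k, \<zero>\<^bsub>N\<^esub>)"
        using z xs by (intro additive_map_finsum[OF M.M.abelian_group_axioms
              S.M.abelian_group_axioms inl, symmetric]) (auto simp: M.smult_closed)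
      finally have 1: "(\<Oplus>\<^bsub>module_sum M N\<^esub>k\<in>Inl ` {..<m}. hs k z \<odot>\<^bsub>module_sum M N\<^esub> zs k) = (x, \<zero>\<^bsub>N\<^esub>)"
        using dual_basisD(5)[OF M(2) z(2)] by simp
      have "(\<Oplus>\<^bsub>module_sum M N\<^esub>k\<in>Inr ` {..<n}. hs k z \<odot>\<^bsub>module_sum M N\<^esub> zs k)
          = (\<Oplus>\<^bsub>module_sum M N\<^esub>k\<in>{..<n}. hs (Inr k) z \<odot>\<^bsub>module_sum M N\<^esub> zs (Inr k))"
        using t by (intro S.M.finsum_reindex) auto
      also have "\<dots> = (\<Oplus>\<^bsub>module_sum M N\<^esub>k\<in>{..<n}. (\<zero>\<^bsub>M\<^esub>, gs k y \<odot>\<^bsub>N\<^esub> ys k))"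
        using z xs ys by (intro S.M.finsum_cong') (auto simp: hs_def zs_def N.smult_closed)
      also have "\<dots> = (\<zero>\<^bsub>M\<^esub>, \<Oplus>\<^bsub>N\<^esub>k\<in>{..<n}. gs k y \<odot>\<^bsub>N\<^esub> ys k)"
        using z ys by (intro additive_map_finsum[OF N.M.abelian_group_axioms
              S.M.abelian_group_axioms inr, symmetric]) (auto simp: N.smult_closed)
      finally have 2: "(\<Oplus>\<^bsub>module_sum M N\<^esub>k\<in>Inr ` {..<n}. hs k z \<odot>\<^bsub>module_sum M N\<^esub> zs k) = (\<zero>\<^bsub>M\<^esub>, y)"
        using dual_basisD(5)[OF N(2) z(3)] by simp
      show "(\<Oplus>\<^bsub>module_sum M N\<^esub>k\<in>Inl ` {..<m} \<union> Inr ` {..<n}. hs k z \<odot>\<^bsub>module_sum M N\<^esub> zs k) = z"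
      proof -
        have "(\<Oplus>\<^bsub>module_sum M N\<^esub>k\<in>Inl ` {..<m} \<union> Inr ` {..<n}. hs k z \<odot>\<^bsub>module_sum M N\<^esub> zs k)
          = (x, \<zero>\<^bsub>N\<^esub>) \<oplus>\<^bsub>module_sum M N\<^esub> (\<zero>\<^bsub>M\<^esub>, y)"
          unfolding 1[symmetric] 2[symmetric]
          by (rule S.M.finsum_Un_disjoint) (use t in auto)
        then show ?thesis using z by simp
      qed
    qed
  qed
qed

lemma module_sum_neg:
  assumes "left_module R M" "left_module R N" "x \<in> carrier M" "y \<in> carrier N"
  shows "\<ominus>\<^bsub>module_sum M N\<^esub> (x, y) = (\<ominus>\<^bsub>M\<^esub> x, \<ominus>\<^bsub>N\<^esub> y)"
proof -
  interpret M: left_module R M by fact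
  interpret N: left_module R N by fact
  interpret S: left_module R "module_sum M N" by (rule module_sum_left_module) fact+
  show ?thesis
    by (rule S.M.minus_equality) (use assms(3,4) in \<open>auto simp: M.M.l_neg N.M.l_neg\<close>)
qed

lemma sym_square_sum:
  assumes "left_module R M" "left_module R N" "x \<in> carrier M" "y \<in> carrier N"
  shows "sym_square k (module_sum M N) (x, y) = (sym_square k M x, sym_square k N y)"
  using module_sum_neg[OF assms] by (cases k) (auto simp: sym_square_def)

lemma mod_hom_sym_square:
  assumes "left_module R M" "left_module R N" "f \<in> mod_hom R M N" "x \<in> carrier M"
  shows "f (sym_square k M x) = sym_square k N (f x)"
  using additive_map_neg[OF left_module_abelian_group[OF assms(1)] left_module_abelian_group[OF assms(2)]
      mod_homD(1)[OF assms(3)] assms(4)]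
  by (cases k) (auto simp: sym_square_def)

text \<open>The target is a bare record about which nothing is known, so the image of zero has to be
  prescribed; all axioms are then carried over along the bijection.\<close>

lemma left_module_iso:
  assumes "left_module R M" "f \<in> mod_hom R M N" "bij_betw f (carrier M) (carrier N)"
    and "f \<zero>\<^bsub>M\<^esub> = \<zero>\<^bsub>N\<^esub>"
  shows "left_module R N"
proof -
  interpret M: left_module R M by fact
  note f = mod_homD[OF assms(2)]
  have surj: "\<exists>x\<in>carrier M. y = f x" if "y \<in> carrier N" for y
    using assms(3) that by (auto simp: bij_betw_def)
  show ?thesis
  proof (rule left_moduleI[OF M.R.ring_axioms])
    show "abelian_group N"
    proof (rule abelian_groupI)
      show "\<zero>\<^bsub>N\<^esub> \<in> carrier N" using f(2)[of "\<zero>\<^bsub>M\<^esub>"] assms(4) by simp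
      fix u assume "u \<in> carrier N"
      then obtain x where x: "x \<in> carrier M" "u = f x" using surj by blast
      show "\<exists>w\<in>carrier N. w \<oplus>\<^bsub>N\<^esub> u = \<zero>\<^bsub>N\<^esub>"
        using x f(2) f(3)[of "\<ominus>\<^bsub>M\<^esub> x" x] assms(4) by (intro bexI[of _ "f (\<ominus>\<^bsub>M\<^esub> x)"]) (auto simp: M.M.l_neg)
      show "\<zero>\<^bsub>N\<^esub> \<oplus>\<^bsub>N\<^esub> u = u"
        using x f(3)[of "\<zero>\<^bsub>M\<^esub>" x] assms(4) by simp
      fix v assume "v \<in> carrier N"
      then obtain y where y: "y \<in> carrier M" "v = f y" using surj by blast
      show "u \<oplus>\<^bsub>N\<^esub> v \<in> carrier N" "u \<oplus>\<^bsub>N\<^esub> v = v \<oplus>\<^bsub>N\<^esub> u"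
        using x y by (simp_all add: f(2) f(3)[symmetric] M.M.a_comm)
      fix w assume "w \<in> carrier N"
      then obtain z where z: "z \<in> carrier M" "w = f z" using surj by blast
      show "u \<oplus>\<^bsub>N\<^esub> v \<oplus>\<^bsub>N\<^esub> w = u \<oplus>\<^bsub>N\<^esub> (v \<oplus>\<^bsub>N\<^esub> w)"
        using x y z by (simp add: f(3)[symmetric] M.M.a_assoc)
    qed
  next
    fix a u assume a: "a \<in> carrier R" and "u \<in> carrier N"
    then obtain x where x: "x \<in> carrier M" "u = f x" using surj by blast
    show "a \<odot>\<^bsub>N\<^esub> u \<in> carrier N"
      using a x by (simp add: f(4)[symmetric] f(2) M.smult_closed)
    show "(a \<otimes>\<^bsub>R\<^esub> b) \<odot>\<^bsub>N\<^esub> u = a \<odot>\<^bsub>N\<^esub> (b \<odot>\<^bsub>N\<^esub> u)" if "b \<in> carrier R" for b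
      using a x that by (simp add: f(4)[symmetric] M.smult_closed M.smult_assoc)
    show "(a \<oplus>\<^bsub>R\<^esub> b) \<odot>\<^bsub>N\<^esub> u = a \<odot>\<^bsub>N\<^esub> u \<oplus>\<^bsub>N\<^esub> b \<odot>\<^bsub>N\<^esub> u" if "b \<in> carrier R" for b
      using a x that by (simp add: f(4)[symmetric] f(3)[symmetric] M.smult_closed M.smult_l_distr)
    fix v assume "v \<in> carrier N"
    then obtain y where y: "y \<in> carrier M" "v = f y" using surj by blast
    show "a \<odot>\<^bsub>N\<^esub> (u \<oplus>\<^bsub>N\<^esub> v) = a \<odot>\<^bsub>N\<^esub> u \<oplus>\<^bsub>N\<^esub> a \<odot>\<^bsub>N\<^esub> v"
      using a x y by (simp add: f(4)[symmetric] f(3)[symmetric] M.smult_closed M.smult_r_distr)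
  next
    fix u assume "u \<in> carrier N"
    then obtain x where x: "x \<in> carrier M" "u = f x" using surj by blast
    then show "\<one>\<^bsub>R\<^esub> \<odot>\<^bsub>N\<^esub> u = u"
      by (simp add: f(4)[symmetric] M.smult_one)
  qed
qed

lemma mod_hom_inverse:
  assumes "left_module R M" "f \<in> mod_hom R M N" "bij_betw f (carrier M) (carrier N)"
  shows "inv_into (carrier M) f \<in> mod_hom R N M"
proof -
  interpret M: left_module R M by fact
  note f = mod_homD[OF assms(2)]
  define g where "g = inv_into (carrier M) f"
  have g: "g y \<in> carrier M" "f (g y) = y" if "y \<in> carrier N" for y
    using that assms(3) by (auto simp: g_def bij_betw_def inv_into_into f_inv_into_f)
  have gf: "g (f x) = x" if "x \<in> carrier M" for x
    using that assms(3) by (simp add: g_def bij_betw_def)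
  have "g \<in> mod_hom R N M"
  proof (rule mod_homI)
    fix u v assume "u \<in> carrier N" "v \<in> carrier N"
    then show "g (u \<oplus>\<^bsub>N\<^esub> v) = g u \<oplus>\<^bsub>M\<^esub> g v"
      using f(3)[of "g u" "g v"] gf[of "g u \<oplus>\<^bsub>M\<^esub> g v"] g by simp
  next
    fix a u assume "a \<in> carrier R" "u \<in> carrier N"
    then show "g (a \<odot>\<^bsub>N\<^esub> u) = a \<odot>\<^bsub>M\<^esub> g u"
      using f(4)[of a "g u"] gf[of "a \<odot>\<^bsub>M\<^esub> g u"] g M.smult_closed by simp
  qed (use g in auto)
  then show ?thesis by (simp add: g_def)
qed

lemma fg_projective_iso:
  assumes "fg_projective R M" "f \<in> mod_hom R M N" "bij_betw f (carrier M) (carrier N)"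
    and "f \<zero>\<^bsub>M\<^esub> = \<zero>\<^bsub>N\<^esub>"
  shows "fg_projective R N"
proof -
  obtain n :: nat and xs fs where M: "left_module R M" "dual_basis R M {..<n} xs fs"
    using fg_projective_dual_basis[OF assms(1)] .
  interpret M: left_module R M by fact
  have N: "left_module R N"
    using left_module_iso[OF M(1) assms(2-4)] .
  interpret N: left_module R N by fact
  define g where "g = inv_into (carrier M) f"
  have gh: "g \<in> mod_hom R N M"
    unfolding g_def by (rule mod_hom_inverse) fact+
  note f = mod_homD[OF assms(2)] and xs = dual_basisD(2-4)[OF M(2)]
  have g: "g y \<in> carrier M" "f (g y) = y" if "y \<in> carrier N" for y
    using that assms(3) by (auto simp: g_def bij_betw_def inv_into_into f_inv_into_f)
  show ?thesis
  proof (rule fg_projectiveI[OF N])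
    show "dual_basis R N {..<n} (\<lambda>k. f (xs k)) (\<lambda>k y. fs k (g y))"
      unfolding dual_basis_def
    proof (intro conjI ballI)
      fix k assume k: "k \<in> {..<n}"
      show "f (xs k) \<in> carrier N" using f(2) xs(1) k by blast
      show "(\<lambda>y. fs k (g y)) \<in> functionals R N"
        using functionals_comp_mod_hom[OF xs(2)[OF k] gh] .
    next
      fix y assume y: "y \<in> carrier N"
      have "y = f (\<Oplus>\<^bsub>M\<^esub>k\<in>{..<n}. fs k (g y) \<odot>\<^bsub>M\<^esub> xs k)"
        using dual_basisD(5)[OF M(2) g(1)[OF y]] g(2)[OF y] by simp
      also have "\<dots> = (\<Oplus>\<^bsub>N\<^esub>k\<in>{..<n}. f (fs k (g y) \<odot>\<^bsub>M\<^esub> xs k))"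
        using xs g(1)[OF y]
        by (intro additive_map_finsum[OF M.M.abelian_group_axioms N.M.abelian_group_axioms f(1)])
          (auto simp: M.smult_closed)
      also have "\<dots> = (\<Oplus>\<^bsub>N\<^esub>k\<in>{..<n}. fs k (g y) \<odot>\<^bsub>N\<^esub> f (xs k))"
        using xs g(1)[OF y] f by (intro N.M.finsum_cong') (auto simp: N.smult_closed)
      finally show "(\<Oplus>\<^bsub>N\<^esub>k\<in>{..<n}. fs k (g y) \<odot>\<^bsub>N\<^esub> f (xs k)) = y" by simp
    qed simp
  qed
qed

context normed_graded_ring
begin

lemma symmetryD:
  assumes "left_module R M" "J \<in> symmetry_space k R M"
  shows "J \<in> extensional (carrier M)" "skew_map R M J"
    "x \<in> carrier M \<Longrightarrow> J x \<in> carrier M"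
    "x \<in> carrier M \<Longrightarrow> y \<in> carrier M \<Longrightarrow> J (x \<oplus>\<^bsub>M\<^esub> y) = J x \<oplus>\<^bsub>M\<^esub> J y"
    "a \<in> carrier R \<Longrightarrow> x \<in> carrier M \<Longrightarrow> J (a \<odot>\<^bsub>M\<^esub> x) = parity R a \<odot>\<^bsub>M\<^esub> J x"
    "x \<in> carrier M \<Longrightarrow> J (J x) = sym_square k M x"
  using assms(2) skew_mapD[of R M J] unfolding symmetry_space_iff[OF assms(1)] by auto

lemma symmetryI:
  assumes "left_module R M" "J \<in> extensional (carrier M)"
    and "\<And>x. x \<in> carrier M \<Longrightarrow> J x \<in> carrier M"
    and "\<And>x y. x \<in> carrier M \<Longrightarrow> y \<in> carrier M \<Longrightarrow> J (x \<oplus>\<^bsub>M\<^esub> y) = J x \<oplus>\<^bsub>M\<^esub> J y"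
    and "\<And>a x. a \<in> carrier R \<Longrightarrow> x \<in> carrier M \<Longrightarrow> J (a \<odot>\<^bsub>M\<^esub> x) = parity R a \<odot>\<^bsub>M\<^esub> J x"
    and "\<And>x. x \<in> carrier M \<Longrightarrow> J (J x) = sym_square k M x"
  shows "J \<in> symmetry_space k R M"
  unfolding symmetry_space_iff[OF assms(1)] using assms by (auto intro: skew_mapI)

lemma elementary_iff:
  "elementary k R (M, J1, J2) \<longleftrightarrow> is_triple k R (M, J1, J2) \<and> sym_path k R M J1 J2"
proof (cases "fg_projective R M")
  case True
  then interpret fg_projective_module R M by unfold_locales
  show ?thesis by (simp add: elementary_def path_component_iff)
qed (simp add: elementary_def is_triple_def)

lemma elementary_is_triple: "elementary k R T \<Longrightarrow> is_triple k R T"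
  by (cases T) (simp add: elementary_iff)

lemma is_triple_left_module: "is_triple k R (M, J1, J2) \<Longrightarrow> left_module R M"
  by (simp add: is_triple_iff fg_projective_def)

lemma sym_path_refl:
  assumes "left_module R M" "J \<in> symmetry_space k R M"
  shows "sym_path k R M J J"
  unfolding sym_path_def
proof (intro exI[of _ "\<lambda>_. J"] conjI ballI refl assms(2))
  fix x h assume x: "x \<in> carrier M" and h: "h \<in> functionals R M"
  show "cont_path R (\<lambda>t. h (J x))"
    by (rule cont_path_const[OF functionalsD(2)[OF h symmetryD(3)[OF assms x]]])
qed

lemma symmetry_iso:
  assumes "left_module R M" "left_module R N" "f \<in> mod_hom R M N" "bij_betw f (carrier M) (carrier N)"
    and "J \<in> symmetry_space k R M" "J' \<in> extensional (carrier N)"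
    and "\<And>x. x \<in> carrier M \<Longrightarrow> f (J x) = J' (f x)"
  shows "J' \<in> symmetry_space k R N"
proof -
  interpret M: left_module R M by fact
  note f = mod_homD[OF assms(3)] and J = symmetryD[OF assms(1,5)]
  have surj: "\<exists>x\<in>carrier M. y = f x" if "y \<in> carrier N" for y
    using assms(4) that by (auto simp: bij_betw_def)
  note [simp] = assms(7)[symmetric] f(3)[symmetric] f(4)[symmetric]
  show ?thesis
  proof (rule symmetryI[OF assms(2,6)])
    fix u assume "u \<in> carrier N"
    then obtain x where x: "x \<in> carrier M" "u = f x" using surj by blast
    show "J' u \<in> carrier N" using x by (simp add: f(2) J)
    show "J' (J' u) = sym_square k N u"
      using x J by (simp add: mod_hom_sym_square[OF assms(1-3), symmetric])
    show "J' (a \<odot>\<^bsub>N\<^esub> u) = parity R a \<odot>\<^bsub>N\<^esub> J' u" if "a \<in> carrier R" for a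
      using x that J by (simp add: M.smult_closed)
    fix v assume "v \<in> carrier N"
    then obtain y where y: "y \<in> carrier M" "v = f y" using surj by blast
    show "J' (u \<oplus>\<^bsub>N\<^esub> v) = J' u \<oplus>\<^bsub>N\<^esub> J' v"
      using x y J by simp
  qed
qed

lemma is_triple_iso:
  assumes "is_triple k R (M, J1, J2)" "f \<in> mod_hom R M N" "bij_betw f (carrier M) (carrier N)"
    and "f \<zero>\<^bsub>M\<^esub> = \<zero>\<^bsub>N\<^esub>" "J1' \<in> extensional (carrier N)" "J2' \<in> extensional (carrier N)"
    and "\<And>x. x \<in> carrier M \<Longrightarrow> f (J1 x) = J1' (f x)" "\<And>x. x \<in> carrier M \<Longrightarrow> f (J2 x) = J2' (f x)"
  shows "is_triple k R (N, J1', J2')"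
proof -
  have M: "fg_projective R M" "left_module R M"
    using assms(1) by (auto simp: is_triple_iff fg_projective_def)
  have N: "left_module R N" "fg_projective R N"
    using left_module_iso[OF M(2) assms(2-4)] fg_projective_iso[OF M(1) assms(2-4)] .
  show ?thesis
    using N symmetry_iso[OF M(2) N(1) assms(2,3) _ assms(5,7)]
      symmetry_iso[OF M(2) N(1) assms(2,3) _ assms(6,8)] assms(1)
    by (auto simp: is_triple_iff)
qed

text \<open>The path is conjugated with the isomorphism. A functional on the target composed with
  the isomorphism is one on the source, so the functional test for continuity carries over
  directly.\<close>

lemma elementary_iso:
  assumes "elementary k R T" "triple_iso R T S" "is_triple k R S"
  shows "elementary k R S"
proof -
  obtain M J1 J2 where T: "T = (M, J1, J2)" by (rule prod_cases3)
  obtain N J1' J2' where S: "S = (N, J1', J2')" by (rule prod_cases3)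
  obtain f where f: "f \<in> mod_hom R M N" "bij_betw f (carrier M) (carrier N)"
    "\<And>x. x \<in> carrier M \<Longrightarrow> f (J1 x) = J1' (f x)" "\<And>x. x \<in> carrier M \<Longrightarrow> f (J2 x) = J2' (f x)"
    using assms(2) unfolding T S by (rule triple_isoE, blast)
  have MN: "left_module R M" "left_module R N"
    using is_triple_left_module assms(3) elementary_is_triple[OF assms(1)] unfolding T S by blast+
  obtain p where p: "p 0 = J1" "p 1 = J2" "\<And>t. t \<in> {0..1::real} \<Longrightarrow> p t \<in> symmetry_space k R M"
    "\<And>x h. x \<in> carrier M \<Longrightarrow> h \<in> functionals R M \<Longrightarrow> cont_path R (\<lambda>t. h (p t x))"
    using assms(1) unfolding T elementary_iff sym_path_def by blast
  define g where "g = inv_into (carrier M) f"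
  have g: "g y \<in> carrier M" "f (g y) = y" if "y \<in> carrier N" for y
    using that f(2) by (auto simp: g_def bij_betw_def inv_into_into f_inv_into_f)
  have gf: "g (f x) = x" if "x \<in> carrier M" for x
    using that f(2) by (simp add: g_def bij_betw_def)
  note fh = mod_homD[OF f(1)]
  have J': "J1' \<in> extensional (carrier N)" "J2' \<in> extensional (carrier N)"
    using assms(3) symmetryD(1)[OF MN(2)] unfolding S is_triple_iff by blast+
  define q where "q t = (\<lambda>y\<in>carrier N. f (p t (g y)))" for t
  have "sym_path k R N J1' J2'"
    unfolding sym_path_def
  proof (intro exI[of _ q] conjI ballI)
    show "q 0 = J1'"
      by (rule extensionalityI[OF _ J'(1)]) (use f(3)[OF g(1)] g(2) in \<open>auto simp: q_def p\<close>)
    show "q 1 = J2'"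
      by (rule extensionalityI[OF _ J'(2)]) (use f(4)[OF g(1)] g(2) in \<open>auto simp: q_def p\<close>)
  next
    fix t :: real assume t: "t \<in> {0..1}"
    show "q t \<in> symmetry_space k R N"
      by (rule symmetry_iso[OF MN f(1,2) p(3)[OF t]]) (auto simp: q_def gf fh)
  next
    fix y h assume y: "y \<in> carrier N" and h: "h \<in> functionals R N"
    then show "cont_path R (\<lambda>t. h (q t y))"
      using p(4)[OF g(1)[OF y] functionals_comp_mod_hom[OF h f(1)]] by (simp add: q_def)
  qed
  then show ?thesis
    using assms(3) unfolding S elementary_iff by simp
qed

lemma triple_iso_sym:
  assumes "is_triple k R T" "triple_iso R T S"
  shows "triple_iso R S T"
proof -
  obtain M J1 J2 where T: "T = (M, J1, J2)" by (rule prod_cases3)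
  obtain N J1' J2' where S: "S = (N, J1', J2')" by (rule prod_cases3)
  obtain f where f: "f \<in> mod_hom R M N" "bij_betw f (carrier M) (carrier N)"
    "\<And>x. x \<in> carrier M \<Longrightarrow> f (J1 x) = J1' (f x)" "\<And>x. x \<in> carrier M \<Longrightarrow> f (J2 x) = J2' (f x)"
    using assms(2) unfolding T S by (rule triple_isoE, blast)
  have M: "left_module R M"
    using is_triple_left_module assms(1) unfolding T by blast
  have J: "J1 x \<in> carrier M" "J2 x \<in> carrier M" if "x \<in> carrier M" for x
    using assms(1) symmetryD(3)[OF M _ that] unfolding T is_triple_iff by blast+
  define g where "g = inv_into (carrier M) f"
  have g: "g y \<in> carrier M" "f (g y) = y" if "y \<in> carrier N" for y
    using that f(2) by (auto simp: g_def bij_betw_def inv_into_into f_inv_into_f)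
  have gf: "g (f x) = x" if "x \<in> carrier M" for x
    using that f(2) by (simp add: g_def bij_betw_def)
  show ?thesis
    unfolding T S
  proof (rule triple_isoI)
    show "g \<in> mod_hom R N M"
      unfolding g_def by (rule mod_hom_inverse[OF M f(1,2)])
    show "bij_betw g (carrier N) (carrier M)"
      unfolding g_def using f(2) by (rule bij_betw_inv_into)
    fix y assume y: "y \<in> carrier N"
    show "g (J1' y) = J1 (g y)" "g (J2' y) = J2 (g y)"
      using f(3,4)[OF g(1)[OF y]] gf J g[OF y] by metis+
  qed
qed

lemma symmetry_sum:
  assumes "left_module R M" "left_module R N" "J \<in> symmetry_space k R M" "J' \<in> symmetry_space k R N"
  shows "restrict (map_prod J J') (carrier M \<times> carrier N) \<in> symmetry_space k R (module_sum M N)"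
proof -
  interpret M: left_module R M by fact
  interpret N: left_module R N by fact
  note J = symmetryD[OF assms(1,3)] and J' = symmetryD[OF assms(2,4)]
  show ?thesis
    by (rule symmetryI[OF module_sum_left_module[OF assms(1,2)]])
      (auto simp: J J' M.smult_closed N.smult_closed sym_square_sum[OF assms(1,2)])
qed

lemma is_triple_sum:
  assumes "is_triple k R T" "is_triple k R S"
  shows "is_triple k R (triple_sum T S)"
proof -
  obtain M J1 J2 where T: "T = (M, J1, J2)" by (rule prod_cases3)
  obtain N J1' J2' where S: "S = (N, J1', J2')" by (rule prod_cases3)
  show ?thesis
    using assms[unfolded T S, THEN is_triple_left_module] assms
    unfolding T S triple_sum_eq is_triple_iff
    by (blast intro: fg_projective_module_sum symmetry_sum)
qed

text \<open>A functional on a direct sum splits into its restrictions. Hence both continuity of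
  paths and the kernel condition of base change can be checked on the summands.\<close>

lemma functionals_sum:
  assumes "left_module R M" "left_module R N" "h \<in> functionals R (module_sum M N)"
  shows "(\<lambda>x. h (x, \<zero>\<^bsub>N\<^esub>)) \<in> functionals R M" "(\<lambda>y. h (\<zero>\<^bsub>M\<^esub>, y)) \<in> functionals R N"
    and "x \<in> carrier M \<Longrightarrow> y \<in> carrier N \<Longrightarrow> h (x, y) = h (x, \<zero>\<^bsub>N\<^esub>) \<oplus> h (\<zero>\<^bsub>M\<^esub>, y)"
proof -
  interpret M: left_module R M by fact
  interpret N: left_module R N by fact
  note h = functionalsD[OF assms(3)]
  show "(\<lambda>x. h (x, \<zero>\<^bsub>N\<^esub>)) \<in> functionals R M"
    using h(2)[of "(_, \<zero>\<^bsub>N\<^esub>)"] h(3)[of "(_, \<zero>\<^bsub>N\<^esub>)" "(_, \<zero>\<^bsub>N\<^esub>)"] h(4)[of _ "(_, \<zero>\<^bsub>N\<^esub>)"]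
    by (intro functionalsI) auto
  show "(\<lambda>y. h (\<zero>\<^bsub>M\<^esub>, y)) \<in> functionals R N"
    using h(2)[of "(\<zero>\<^bsub>M\<^esub>, _)"] h(3)[of "(\<zero>\<^bsub>M\<^esub>, _)" "(\<zero>\<^bsub>M\<^esub>, _)"] h(4)[of _ "(\<zero>\<^bsub>M\<^esub>, _)"]
    by (intro functionalsI) auto
  show "x \<in> carrier M \<Longrightarrow> y \<in> carrier N \<Longrightarrow> h (x, y) = h (x, \<zero>\<^bsub>N\<^esub>) \<oplus> h (\<zero>\<^bsub>M\<^esub>, y)"
    using h(3)[of "(x, \<zero>\<^bsub>N\<^esub>)" "(\<zero>\<^bsub>M\<^esub>, y)"] by simp
qed

lemma elementary_sum:
  assumes "elementary k R T" "elementary k R S"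
  shows "elementary k R (triple_sum T S)"
proof -
  obtain M J1 J2 where T: "T = (M, J1, J2)" by (rule prod_cases3)
  obtain N J1' J2' where S: "S = (N, J1', J2')" by (rule prod_cases3)
  have MN: "left_module R M" "left_module R N"
    using is_triple_left_module elementary_is_triple assms unfolding T S by blast+
  obtain p where p: "p 0 = J1" "p 1 = J2" "\<And>t. t \<in> {0..1::real} \<Longrightarrow> p t \<in> symmetry_space k R M"
    "\<And>x h. x \<in> carrier M \<Longrightarrow> h \<in> functionals R M \<Longrightarrow> cont_path R (\<lambda>t. h (p t x))"
    using assms(1) unfolding T elementary_iff sym_path_def by blast
  obtain q where q: "q 0 = J1'" "q 1 = J2'" "\<And>t. t \<in> {0..1::real} \<Longrightarrow> q t \<in> symmetry_space k R N"
    "\<And>x h. x \<in> carrier N \<Longrightarrow> h \<in> functionals R N \<Longrightarrow> cont_path R (\<lambda>t. h (q t x))"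
    using assms(2) unfolding S elementary_iff sym_path_def by blast
  define r where "r t = restrict (map_prod (p t) (q t)) (carrier M \<times> carrier N)" for t
  have "sym_path k R (module_sum M N) (r 0) (r 1)"
    unfolding sym_path_def
  proof (intro exI[of _ r] conjI ballI refl)
    show "r t \<in> symmetry_space k R (module_sum M N)" if "t \<in> {0..1}" for t
      unfolding r_def using symmetry_sum[OF MN p(3)[OF that] q(3)[OF that]] .
    fix z h assume "z \<in> carrier (module_sum M N)" and h: "h \<in> functionals R (module_sum M N)"
    then obtain x y where z: "z = (x, y)" "x \<in> carrier M" "y \<in> carrier N" by auto
    note hs = functionals_sum[OF MN h]
    have c: "p t x \<in> carrier M" "q t y \<in> carrier N" if "t \<in> {0..1}" for t
      using symmetryD(3)[OF MN(1) p(3)] symmetryD(3)[OF MN(2) q(3)] z that by auto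
    have "cont_path R (\<lambda>t. h (p t x, \<zero>\<^bsub>N\<^esub>) \<oplus> h (\<zero>\<^bsub>M\<^esub>, q t y))"
      using c functionalsD(2)[OF hs(1)] functionalsD(2)[OF hs(2)]
      by (intro cont_path_add p(4)[OF z(2) hs(1)] q(4)[OF z(3) hs(2)]) auto
    then show "cont_path R (\<lambda>t. h (r t z))"
      by (rule cont_path_cong) (use c hs(3) z in \<open>simp add: r_def\<close>)
  qed
  then have "elementary k R (module_sum M N, r 0, r 1)"
    using is_triple_sum[OF assms[THEN elementary_is_triple]]
    unfolding elementary_iff T S triple_sum_eq by (simp add: r_def p q)
  then show ?thesis
    unfolding T S triple_sum_eq by (simp add: r_def p q)
qed

lemma triple_sum_cong:
  assumes "triple_iso R T T'" "triple_iso R S S'"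
  shows "triple_iso R (triple_sum T S) (triple_sum T' S')"
proof -
  obtain M J1 J2 where T: "T = (M, J1, J2)" by (rule prod_cases3)
  obtain N K1 K2 where S: "S = (N, K1, K2)" by (rule prod_cases3)
  obtain M' J1' J2' where T': "T' = (M', J1', J2')" by (rule prod_cases3)
  obtain N' K1' K2' where S': "S' = (N', K1', K2')" by (rule prod_cases3)
  obtain f where f: "f \<in> mod_hom R M M'" "bij_betw f (carrier M) (carrier M')"
    "\<And>x. x \<in> carrier M \<Longrightarrow> f (J1 x) = J1' (f x)" "\<And>x. x \<in> carrier M \<Longrightarrow> f (J2 x) = J2' (f x)"
    using assms(1) unfolding T T' by (rule triple_isoE, blast)
  obtain g where g: "g \<in> mod_hom R N N'" "bij_betw g (carrier N) (carrier N')"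
    "\<And>x. x \<in> carrier N \<Longrightarrow> g (K1 x) = K1' (g x)" "\<And>x. x \<in> carrier N \<Longrightarrow> g (K2 x) = K2' (g x)"
    using assms(2) unfolding S S' by (rule triple_isoE, blast)
  note fh = mod_homD[OF f(1)] and gh = mod_homD[OF g(1)]
  show ?thesis
    unfolding T S T' S' triple_sum_eq
  proof (rule triple_isoI)
    show "map_prod f g \<in> mod_hom R (module_sum M N) (module_sum M' N')"
      by (rule mod_homI) (auto simp: fh gh)
    show "bij_betw (map_prod f g) (carrier (module_sum M N)) (carrier (module_sum M' N'))"
      using bij_betw_map_prod[OF f(2) g(2)] by simp
  qed (auto simp: f g fh gh)
qed

lemma triple_sum_comm:
  assumes "is_triple k R T" "is_triple k R S"
  shows "triple_iso R (triple_sum T S) (triple_sum S T)"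
proof -
  obtain M J1 J2 where T: "T = (M, J1, J2)" by (rule prod_cases3)
  obtain N K1 K2 where S: "S = (N, K1, K2)" by (rule prod_cases3)
  show ?thesis
    unfolding T S triple_sum_eq
  proof (rule triple_isoI[where f = prod.swap])
    show "bij_betw prod.swap (carrier (module_sum M N)) (carrier (module_sum N M))"
      by (auto simp: bij_betw_def inj_on_def image_iff)
  qed (auto simp: mod_hom_def)
qed

lemma triple_sum_assoc:
  assumes "is_triple k R T" "is_triple k R S" "is_triple k R U"
  shows "triple_iso R (triple_sum (triple_sum T S) U) (triple_sum T (triple_sum S U))"
proof -
  obtain M J1 J2 where T: "T = (M, J1, J2)" by (rule prod_cases3)
  obtain N K1 K2 where S: "S = (N, K1, K2)" by (rule prod_cases3)
  obtain P L1 L2 where U: "U = (P, L1, L2)" by (rule prod_cases3)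
  have J: "J1 x \<in> carrier M" "J2 x \<in> carrier M" if "x \<in> carrier M" for x
    using assms(1) symmetryD(3)[of M J1] symmetryD(3)[of M J2] that unfolding T is_triple_iff
    by (auto simp: fg_projective_def)
  have K: "K1 x \<in> carrier N" "K2 x \<in> carrier N" if "x \<in> carrier N" for x
    using assms(2) symmetryD(3)[of N K1] symmetryD(3)[of N K2] that unfolding S is_triple_iff
    by (auto simp: fg_projective_def)
  show ?thesis
    unfolding T S U triple_sum_eq
  proof (rule triple_isoI[where f = "\<lambda>((x, y), z). (x, (y, z))"])
    show "bij_betw (\<lambda>((x, y), z). (x, (y, z))) (carrier (module_sum (module_sum M N) P))
       (carrier (module_sum M (module_sum N P)))"
      by (auto simp: bij_betw_def inj_on_def image_iff)
  qed (auto simp: mod_hom_def J K)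
qed

lemma triple_sum_interchange:
  assumes "is_triple k R T" "is_triple k R S" "is_triple k R U" "is_triple k R V"
  shows "triple_iso R (triple_sum (triple_sum T S) (triple_sum U V))
    (triple_sum (triple_sum T U) (triple_sum S V))"
proof -
  obtain M J1 J2 where T: "T = (M, J1, J2)" by (rule prod_cases3)
  obtain N K1 K2 where S: "S = (N, K1, K2)" by (rule prod_cases3)
  obtain P L1 L2 where U: "U = (P, L1, L2)" by (rule prod_cases3)
  obtain Q I1 I2 where V: "V = (Q, I1, I2)" by (rule prod_cases3)
  show ?thesis
    unfolding T S U V triple_sum_eq
  proof (rule triple_isoI[where f = "\<lambda>((x, y), (z, w)). ((x, z), (y, w))"])
    show "bij_betw (\<lambda>((x, y), (z, w)). ((x, z), (y, w)))
       (carrier (module_sum (module_sum M N) (module_sum P Q)))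
       (carrier (module_sum (module_sum M P) (module_sum N Q)))"
      by (auto simp: bij_betw_def inj_on_def image_iff)
  qed (auto simp: mod_hom_def)
qed

end

lemma zero_triple_simps:
  "zero_triple = (fst zero_triple, id, id)"
  "carrier (fst zero_triple) = UNIV"
  by (simp_all add: zero_triple_def)

context normed_graded_ring
begin

lemma zero_triple_elementary: "elementary k R (zero_triple :: ('r, unit) triple)"
proof -
  define Z :: "('r, unit) module" where "Z = fst zero_triple"
  have Z: "zero_triple = (Z, id, id)" "carrier Z = UNIV"
    using zero_triple_simps by (auto simp: Z_def)
  have ag: "abelian_group Z"
    by (rule abelian_groupI) (auto simp: Z)
  have lm: "left_module R Z"
    by (rule left_moduleI[OF ring_axioms ag]) (auto simp: Z)
  have "dual_basis R Z ({} :: nat set) (\<lambda>_. ()) (\<lambda>_ _. \<zero>)"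
    by (auto simp: dual_basis_def)
  then have fg: "fg_projective R Z"
    using fg_projectiveI[OF lm] by blast
  have s: "id \<in> symmetry_space k R Z"
    by (rule symmetryI[OF lm]) (auto simp: Z)
  show ?thesis
    unfolding Z elementary_iff is_triple_iff using fg s sym_path_refl[OF lm s] by auto
qed

lemmas zero_triple_is_triple = elementary_is_triple[OF zero_triple_elementary]

lemma triple_sum_zero:
  assumes "is_triple k R T"
  shows "triple_iso R (triple_sum zero_triple T) T"
proof -
  obtain M J1 J2 where T: "T = (M, J1, J2)" by (rule prod_cases3)
  define Z :: "('r, unit) module" where "Z = fst zero_triple"
  have Z: "zero_triple = (Z, id, id)" "carrier Z = UNIV"
    using zero_triple_simps by (auto simp: Z_def)
  show ?thesis
    unfolding T Z triple_sum_eq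
  proof (rule triple_isoI[where f = snd])
    show "bij_betw snd (carrier (module_sum Z M)) (carrier M)"
      by (auto simp: bij_betw_def inj_on_def image_iff Z)
  qed (auto simp: mod_hom_def Z)
qed

end

text \<open>A copy of \<open>M\<close> in another type along an injection \<open>g\<close>, with
  operations pulled back through \<open>inv_into\<close>. It serves to bring modules into the type
  in which classes are formed.\<close>

definition transport_module :: "('m \<Rightarrow> 'n) \<Rightarrow> ('r, 'm) module \<Rightarrow> ('r, 'n) module" where
  "transport_module g M =
     \<lparr>carrier = g ` carrier M, monoid.mult = undefined, monoid.one = undefined,
      ring.zero = g \<zero>\<^bsub>M\<^esub>,
      ring.add = (\<lambda>u v. g (inv_into (carrier M) g u \<oplus>\<^bsub>M\<^esub> inv_into (carrier M) g v)),
      module.smult = (\<lambda>a u. g (a \<odot>\<^bsub>M\<^esub> inv_into (carrier M) g u))\<rparr>"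

context normed_graded_ring
begin

lemma transport_triple:
  fixes g :: "'m \<Rightarrow> 'n"
  assumes T: "is_triple k R (M, J1, J2)" and inj: "inj_on g (carrier M)"
  obtains S :: "('r, 'n) triple" where "is_triple k R S" "triple_iso R (M, J1, J2) S"
proof -
  define N where "N = transport_module g M"
  define h where "h = inv_into (carrier M) g"
  define tr where "tr J = (\<lambda>u\<in>carrier N. g (J (h u)))" for J :: "'m \<Rightarrow> 'm"
  have hg: "h (g x) = x" if "x \<in> carrier M" for x
    using inj that by (simp add: h_def)
  have hom: "g \<in> mod_hom R M N"
    by (rule mod_homI) (auto simp: N_def transport_module_def hg[unfolded h_def])
  have bij: "bij_betw g (carrier M) (carrier N)"
    using inj by (simp add: bij_betw_def N_def transport_module_def)
  have z: "g \<zero>\<^bsub>M\<^esub> = \<zero>\<^bsub>N\<^esub>"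
    by (simp add: N_def transport_module_def)
  have i: "g (J x) = tr J (g x)" if "x \<in> carrier M" for J x
    using that mod_homD(2)[OF hom that] by (simp add: tr_def hg)
  show ?thesis
  proof (rule that)
    show "is_triple k R (N, tr J1, tr J2)"
      by (rule is_triple_iso[OF T hom bij z]) (auto simp: i, auto simp: tr_def)
    show "triple_iso R (M, J1, J2) (N, tr J1, tr J2)"
      by (rule triple_isoI[OF hom bij]) (auto simp: i)
  qed
qed

text \<open>The inclusion of a summand into a free module is injective and takes values in the
  canonical type, so it is a ready-made injection for \<open>transport_triple\<close>.\<close>

lemma normalize_triple:
  assumes "is_triple k R T"
  obtains S :: "('r, nat \<Rightarrow> 'r) triple" where "is_triple k R S" "triple_iso R T S"
proof -
  obtain M J1 J2 where T: "T = (M, J1, J2)" by (rule prod_cases3)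
  obtain n \<iota> \<pi> where "is_summand R M (n, \<iota>, \<pi>)"
    using assms unfolding T is_triple_iff fg_projective_def by auto
  then have "inj_on \<iota> (carrier M)"
    unfolding is_summand_def by (intro inj_on_inverseI[of _ \<pi>]) auto
  then show ?thesis
    using transport_triple[of k M J1 J2 \<iota>] assms that unfolding T by blast
qed

lemma normalize_elementary:
  assumes "elementary k R T"
  obtains S :: "('r, nat \<Rightarrow> 'r) triple" where "elementary k R S" "triple_iso R T S"
proof -
  obtain S :: "('r, nat \<Rightarrow> 'r) triple" where "is_triple k R S" "triple_iso R T S"
    using normalize_triple[OF elementary_is_triple[OF assms]] .
  then show ?thesis
    using that elementary_iso[OF assms] by blast
qed

end

section \<open>Stable equivalence and the difference group\<close>

declare triple_iso_trans [trans]

context normed_graded_ring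
begin

text \<open>Conjugating \<open>J1 \<oplus> J2\<close> with the rotation by the angle \<open>\<pi>t/2\<close> of \<open>M \<oplus> M\<close> gives a path
  to \<open>J2 \<oplus> J1\<close>.\<close>

lemma rotation_elementary:
  assumes T: "is_triple k R (M, J1, J2)"
  shows "elementary k R (triple_sum (M, J1, J2) (M, J2, J1))"
proof -
  have lm: "left_module R M"
    using is_triple_left_module[OF T] .
  interpret M: left_module R M by fact
  define S where "S = module_sum M M"
  have lmS: "left_module R S"
    unfolding S_def by (rule module_sum_left_module[OF lm lm])
  have Sc: "carrier S = carrier M \<times> carrier M" by (simp add: S_def)
  \<comment> \<open>Real scalars act through multiples of the unit. These are even and central, so
    \<open>sc r\<close> commutes with module scalars and with every symmetry.\<close>
  define sc where "sc r x = rscale R r \<one> \<odot>\<^bsub>M\<^esub> x" for r x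
  have sc [simp]: "sc r x \<in> carrier M" if "x \<in> carrier M" for r x
    using that by (simp add: sc_def M.smult_closed)
  have sc_add: "sc r (x \<oplus>\<^bsub>M\<^esub> y) = sc r x \<oplus>\<^bsub>M\<^esub> sc r y" if "x \<in> carrier M" "y \<in> carrier M" for r x y
    using that by (simp add: sc_def M.smult_r_distr)
  have sc_plus: "sc r x \<oplus>\<^bsub>M\<^esub> sc s x = sc (r + s) x" if "x \<in> carrier M" for r s x
    using that by (simp add: sc_def M.smult_l_distr scale_add_left)
  have sc_sc: "sc r (sc s x) = sc (r * s) x" if "x \<in> carrier M" for r s x
    using that by (simp add: sc_def M.smult_assoc[symmetric] scale_mult_left scale_scale)
  have sc_1: "sc 1 x = x" and sc_0: "sc 0 x = \<zero>\<^bsub>M\<^esub>" if "x \<in> carrier M" for x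
    using that by (simp_all add: sc_def M.smult_one)
  have sc_a: "a \<odot>\<^bsub>M\<^esub> sc r x = sc r (a \<odot>\<^bsub>M\<^esub> x)" if "a \<in> carrier R" "x \<in> carrier M" for a r x
    using that by (simp add: sc_def M.smult_assoc[symmetric] scale_mult_left scale_mult_right)
  have sc_J: "J (sc r x) = sc r (J x)" if "J \<in> symmetry_space k R M" "x \<in> carrier M" for J r x
    using that symmetryD(5)[OF lm that(1)] by (simp add: sc_def)
  have sc_h: "h (sc r x) = rscale R r (h x)" if "h \<in> functionals R M" "x \<in> carrier M" for h r x
    using that functionalsD(2,4)[OF that(1)] by (simp add: sc_def scale_mult_left)
  have J: "J1 \<in> symmetry_space k R M" "J2 \<in> symmetry_space k R M"
    using T by (simp_all add: is_triple_iff)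
  note J1 = symmetryD[OF lm J(1)] and J2 = symmetryD[OF lm J(2)]
  \<comment> \<open>The rotation matrix with cosine \<open>a\<close> and sine \<open>b\<close>;
    \<open>U a (- b)\<close> is its inverse when \<open>a * a + b * b = 1\<close>.\<close>
  define U where "U a b = (\<lambda>(x, y). (sc a x \<oplus>\<^bsub>M\<^esub> sc (- b) y, sc b x \<oplus>\<^bsub>M\<^esub> sc a y))" for a b
  have U_hom: "U a b \<in> mod_hom R S S" for a b
  proof (rule mod_homI)
    fix z assume "z \<in> carrier S"
    then obtain x y where z: "z = (x, y)" "x \<in> carrier M" "y \<in> carrier M" by (auto simp: Sc)
    show "U a b z \<in> carrier S" using z by (simp add: U_def Sc)
    show "U a b (c \<odot>\<^bsub>S\<^esub> z) = c \<odot>\<^bsub>S\<^esub> U a b z" if "c \<in> carrier R" for c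
      using z that by (simp add: U_def S_def sc_a M.smult_r_distr M.smult_closed)
    fix z' assume "z' \<in> carrier S"
    then obtain x' y' where z': "z' = (x', y')" "x' \<in> carrier M" "y' \<in> carrier M" by (auto simp: Sc)
    show "U a b (z \<oplus>\<^bsub>S\<^esub> z') = U a b z \<oplus>\<^bsub>S\<^esub> U a b z'"
      using z z' by (simp add: U_def S_def sc_add M.a_ac)
  qed
  have UU: "U a b (U a (- b) z) = z" if zS: "z \<in> carrier S" and ab: "a * a + b * b = 1" for a b z
  proof -
    obtain x y where z: "z = (x, y)" "x \<in> carrier M" "y \<in> carrier M" using zS by (auto simp: Sc)
    have "(sc (a * a) x \<oplus>\<^bsub>M\<^esub> sc (a * b) y) \<oplus>\<^bsub>M\<^esub> (sc (b * b) x \<oplus>\<^bsub>M\<^esub> sc (- (b * a)) y)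
      = (sc (a * a) x \<oplus>\<^bsub>M\<^esub> sc (b * b) x) \<oplus>\<^bsub>M\<^esub> (sc (a * b) y \<oplus>\<^bsub>M\<^esub> sc (- (b * a)) y)"
      using z by (simp add: M.a_ac)
    moreover have "(sc (b * a) x \<oplus>\<^bsub>M\<^esub> sc (b * b) y) \<oplus>\<^bsub>M\<^esub> (sc (- (a * b)) x \<oplus>\<^bsub>M\<^esub> sc (a * a) y)
      = (sc (b * a) x \<oplus>\<^bsub>M\<^esub> sc (- (a * b)) x) \<oplus>\<^bsub>M\<^esub> (sc (b * b) y \<oplus>\<^bsub>M\<^esub> sc (a * a) y)"
      using z by (simp add: M.a_ac)
    moreover have "b * b + a * a = 1" using ab by simp
    ultimately show ?thesis
      using z ab by (simp add: U_def sc_add sc_sc sc_plus sc_1 sc_0 mult.commute)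
  qed
  have U_bij: "bij_betw (U a b) (carrier S) (carrier S)" if "a * a + b * b = 1" for a b
    by (rule bij_betw_byWitness[where f' = "U a (- b)"])
      (use UU[of _ a b] UU[of _ a "- b"] that mod_homD(2)[OF U_hom] in auto)
  define K where "K = restrict (map_prod J1 J2) (carrier M \<times> carrier M)"
  have K: "K \<in> symmetry_space k R S"
    unfolding K_def S_def by (rule symmetry_sum[OF lm lm J])
  define c s :: "real \<Rightarrow> real" where "c t = cos (pi / 2 * t)" and "s t = sin (pi / 2 * t)" for t
  have cs: "c t * c t + s t * s t = 1" for t
    using sin_cos_squared_add2[of "pi / 2 * t"] by (simp add: c_def s_def power2_eq_square)
  define p where "p t = (\<lambda>z\<in>carrier S. U (c t) (s t) (K (U (c t) (- s t) z)))" for t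
  have p: "p t \<in> symmetry_space k R S" for t
  proof (rule symmetry_iso[OF lmS lmS U_hom U_bij[OF cs] K])
    show "p t \<in> extensional (carrier S)" by (simp add: p_def)
    fix z assume z: "z \<in> carrier S"
    have "U (c t) (- s t) (U (c t) (s t) z) = z"
      using UU[OF z, of "c t" "- s t"] cs by simp
    then show "U (c t) (s t) (K z) = p t (U (c t) (s t) z)"
      using mod_homD(2)[OF U_hom z] by (simp add: p_def)
  qed
  have pxy: "p t (x, y) =
      (sc (c t) (sc (c t) (J1 x) \<oplus>\<^bsub>M\<^esub> sc (s t) (J1 y)) \<oplus>\<^bsub>M\<^esub> sc (- s t) (sc (- s t) (J2 x) \<oplus>\<^bsub>M\<^esub> sc (c t) (J2 y)),
       sc (s t) (sc (c t) (J1 x) \<oplus>\<^bsub>M\<^esub> sc (s t) (J1 y)) \<oplus>\<^bsub>M\<^esub> sc (c t) (sc (- s t) (J2 x) \<oplus>\<^bsub>M\<^esub> sc (c t) (J2 y)))"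
    if "x \<in> carrier M" "y \<in> carrier M" for t x y
    using that by (simp add: p_def Sc U_def K_def J1 J2 sc_J J)
  have "sym_path k R S K (restrict (map_prod J2 J1) (carrier M \<times> carrier M))"
    unfolding sym_path_def
  proof (intro exI[of _ p] conjI ballI p)
    have "K \<in> extensional (carrier S)" by (simp add: K_def Sc)
    then show "p 0 = K"
    proof (rule extensionalityI[rotated])
      show "p 0 \<in> extensional (carrier S)" by (simp add: p_def)
      fix z assume "z \<in> carrier S"
      then obtain x y where z: "z = (x, y)" "x \<in> carrier M" "y \<in> carrier M" by (auto simp: Sc)
      show "p 0 z = K z"
        using z by (simp add: pxy c_def s_def sc_1 sc_0 J1 J2 K_def)
    qed
    show "p 1 = restrict (map_prod J2 J1) (carrier M \<times> carrier M)"
    proof (rule extensionalityI)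
      show "p 1 \<in> extensional (carrier S)" by (simp add: p_def)
      show "restrict (map_prod J2 J1) (carrier M \<times> carrier M) \<in> extensional (carrier S)"
        by (simp add: Sc)
      fix z assume "z \<in> carrier S"
      then obtain x y where z: "z = (x, y)" "x \<in> carrier M" "y \<in> carrier M" by (auto simp: Sc)
      show "p 1 z = restrict (map_prod J2 J1) (carrier M \<times> carrier M) z"
        using z by (simp add: pxy c_def s_def sc_1 sc_0 J1 J2 sc_sc)
    qed
    fix z h assume "z \<in> carrier S" and h: "h \<in> functionals R S"
    then obtain x y where z: "z = (x, y)" "x \<in> carrier M" "y \<in> carrier M" by (auto simp: Sc)
    define g where "g = (\<lambda>x. h (x, \<zero>\<^bsub>M\<^esub>))"
    define g' where "g' = (\<lambda>x. h (\<zero>\<^bsub>M\<^esub>, x))"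
    have hg: "h (u, v) = g u \<oplus> g' v" if "u \<in> carrier M" "v \<in> carrier M" for u v
      unfolding g_def g'_def by (rule functionals_sum(3)[OF lm lm h[unfolded S_def] that])
    have gf: "g \<in> functionals R M" "g' \<in> functionals R M"
      using functionals_sum(1,2)[OF lm lm h[unfolded S_def]] by (simp_all add: g_def g'_def)
    note g = functionalsD(2,3)[OF gf(1)] and g' = functionalsD(2,3)[OF gf(2)]
    have cont: "continuous_on {0..1} c" "continuous_on {0..1} s"
      unfolding c_def s_def by (intro continuous_intros)+
    \<comment> \<open>Through a functional, the path becomes a sum of eight fixed elements of
      \<open>R\<close> with products of sines and cosines as real coefficients, so continuity is
      that of real functions.\<close>
    let ?f = "\<lambda>t. (rscale R (c t * c t) (g (J1 x)) \<oplus> rscale R (c t * s t) (g (J1 y)))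
       \<oplus> (rscale R (s t * s t) (g (J2 x)) \<oplus> rscale R (- (s t * c t)) (g (J2 y)))
       \<oplus> ((rscale R (s t * c t) (g' (J1 x)) \<oplus> rscale R (s t * s t) (g' (J1 y)))
       \<oplus> (rscale R (- (c t * s t)) (g' (J2 x)) \<oplus> rscale R (c t * c t) (g' (J2 y))))"
    have "h (p t z) = ?f t" for t
      using z by (simp add: pxy hg g g' J1 J2 sc_h[OF gf(1)] sc_h[OF gf(2)] scale_add_right scale_scale)
    moreover have "cont_path R ?f"
      using z g g' J1 J2 cont
      by (intro cont_path_add cont_path_scale continuous_intros) auto
    ultimately show "cont_path R (\<lambda>t. h (p t z))" by simp
  qed
  then show ?thesis
    using is_triple_sum[OF T, of "(M, J2, J1)"] T
    unfolding triple_sum_eq elementary_iff K_def S_def by (simp add: is_triple_iff)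
qed

text \<open>\<open>stably_equiv\<close> quantifies over elementary triples in the canonical type;
  here the stabilizing summands may live anywhere, since they can be replaced by normalized
  copies.\<close>

lemma stably_equivI:
  assumes "is_triple k R T" "is_triple k R S" "elementary k R E" "elementary k R F"
    and "triple_iso R (triple_sum T E) (triple_sum S F)"
  shows "stably_equiv k R T S"
proof -
  obtain E' :: "('r, nat \<Rightarrow> 'r) triple" where E: "elementary k R E'" "triple_iso R E E'"
    using normalize_elementary[OF assms(3)] .
  obtain F' :: "('r, nat \<Rightarrow> 'r) triple" where F: "elementary k R F'" "triple_iso R F F'"
    using normalize_elementary[OF assms(4)] .
  have "triple_iso R (triple_sum T E') (triple_sum T E)"
    by (rule triple_sum_cong[OF triple_iso_refl triple_iso_sym[OF elementary_is_triple[OF assms(3)] E(2)]])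
  also note assms(5)
  also have "triple_iso R (triple_sum S F) (triple_sum S F')"
    using F by (intro triple_sum_cong triple_iso_refl)
  finally show ?thesis
    unfolding stably_equiv_def using E F by blast
qed

lemma stably_equivE:
  assumes "stably_equiv k R T S"
  obtains E F :: "('r, nat \<Rightarrow> 'r) triple" where "elementary k R E" "elementary k R F"
    "triple_iso R (triple_sum T E) (triple_sum S F)"
  using assms unfolding stably_equiv_def by blast

lemma triple_iso_stably_equiv:
  assumes "is_triple k R T" "is_triple k R S" "triple_iso R T S"
  shows "stably_equiv k R T S"
  by (rule stably_equivI[OF assms(1,2) zero_triple_elementary zero_triple_elementary])
    (intro triple_sum_cong assms(3) triple_iso_refl)

lemma stably_equiv_refl: "is_triple k R T \<Longrightarrow> stably_equiv k R T T"
  by (rule triple_iso_stably_equiv[OF _ _ triple_iso_refl])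

lemma stably_equiv_sym:
  assumes "is_triple k R T" "stably_equiv k R T S"
  shows "stably_equiv k R S T"
proof -
  obtain E F :: "('r, nat \<Rightarrow> 'r) triple" where EF: "elementary k R E" "elementary k R F"
    "triple_iso R (triple_sum T E) (triple_sum S F)"
    using assms(2) by (rule stably_equivE)
  then have "triple_iso R (triple_sum S F) (triple_sum T E)"
    using triple_iso_sym is_triple_sum[OF assms(1) elementary_is_triple[OF EF(1)]] by blast
  then show ?thesis
    using EF unfolding stably_equiv_def by blast
qed

text \<open>The middle triple is not cancelled: adding \<open>G\<close> to the first isomorphism and
  \<open>F\<close> to the second makes the middle terms agree, and sums of elementary triples are
  elementary.\<close>

lemma stably_equiv_trans:
  assumes T: "is_triple k R T" and S: "is_triple k R S" and U: "is_triple k R U"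
    and "stably_equiv k R T S" "stably_equiv k R S U"
  shows "stably_equiv k R T U"
proof -
  obtain E F :: "('r, nat \<Rightarrow> 'r) triple" where EF: "elementary k R E" "elementary k R F"
    "triple_iso R (triple_sum T E) (triple_sum S F)"
    using assms(4) by (rule stably_equivE)
  obtain G H :: "('r, nat \<Rightarrow> 'r) triple" where GH: "elementary k R G" "elementary k R H"
    "triple_iso R (triple_sum S G) (triple_sum U H)"
    using assms(5) by (rule stably_equivE)
  note t = EF(1,2)[THEN elementary_is_triple] GH(1,2)[THEN elementary_is_triple]
  have "triple_iso R (triple_sum T (triple_sum E G)) (triple_sum (triple_sum T E) G)"
    by (rule triple_iso_sym[OF is_triple_sum[OF is_triple_sum[OF T t(1)] t(3)] triple_sum_assoc[OF T t(1) t(3)]])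
  also have "triple_iso R (triple_sum (triple_sum T E) G) (triple_sum (triple_sum S F) G)"
    by (intro triple_sum_cong EF(3) triple_iso_refl)
  also have "triple_iso R (triple_sum (triple_sum S F) G) (triple_sum S (triple_sum F G))"
    by (rule triple_sum_assoc) fact+
  also have "triple_iso R (triple_sum S (triple_sum F G)) (triple_sum S (triple_sum G F))"
    by (rule triple_sum_cong[OF triple_iso_refl triple_sum_comm[OF t(2,3)]])
  also have "triple_iso R (triple_sum S (triple_sum G F)) (triple_sum (triple_sum S G) F)"
    by (rule triple_iso_sym[OF is_triple_sum[OF is_triple_sum[OF S t(3)] t(2)] triple_sum_assoc[OF S t(3) t(2)]])
  also have "triple_iso R (triple_sum (triple_sum S G) F) (triple_sum (triple_sum U H) F)"
    by (intro triple_sum_cong GH(3) triple_iso_refl)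
  also have "triple_iso R (triple_sum (triple_sum U H) F) (triple_sum U (triple_sum H F))"
    by (rule triple_sum_assoc) fact+
  finally show ?thesis
    by (rule stably_equivI[OF T U elementary_sum[OF EF(1) GH(1)] elementary_sum[OF GH(2) EF(2)]])
qed

lemma stably_equiv_sum:
  assumes "is_triple k R T" "is_triple k R S" "is_triple k R U" "is_triple k R V"
    and "stably_equiv k R T S" "stably_equiv k R U V"
  shows "stably_equiv k R (triple_sum T U) (triple_sum S V)"
proof -
  obtain E F :: "('r, nat \<Rightarrow> 'r) triple" where EF: "elementary k R E" "elementary k R F"
    "triple_iso R (triple_sum T E) (triple_sum S F)"
    using assms(5) by (rule stably_equivE)
  obtain G H :: "('r, nat \<Rightarrow> 'r) triple" where GH: "elementary k R G" "elementary k R H"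
    "triple_iso R (triple_sum U G) (triple_sum V H)"
    using assms(6) by (rule stably_equivE)
  note t = EF(1,2)[THEN elementary_is_triple] GH(1,2)[THEN elementary_is_triple]
  have "triple_iso R (triple_sum (triple_sum T U) (triple_sum E G)) (triple_sum (triple_sum T E) (triple_sum U G))"
    by (rule triple_sum_interchange) fact+
  also have "triple_iso R \<dots> (triple_sum (triple_sum S F) (triple_sum V H))"
    by (intro triple_sum_cong EF(3) GH(3))
  also have "triple_iso R \<dots> (triple_sum (triple_sum S V) (triple_sum F H))"
    by (rule triple_sum_interchange) fact+
  finally show ?thesis
    by (rule stably_equivI[OF is_triple_sum[OF assms(1,3)] is_triple_sum[OF assms(2,4)]
          elementary_sum[OF EF(1) GH(1)] elementary_sum[OF EF(2) GH(2)]])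
qed

text \<open>The swap of \<open>E\<close> plus zero with zero plus \<open>E\<close> displays
  \<open>E\<close> itself as the elementary summand on the other side.\<close>

lemma elementary_stably_zero:
  assumes "elementary k R E"
  shows "stably_equiv k R E zero_triple"
  by (rule stably_equivI[OF elementary_is_triple[OF assms] zero_triple_is_triple
        zero_triple_elementary assms])
    (rule triple_sum_comm[OF elementary_is_triple[OF assms] zero_triple_is_triple])

lemma triple_class_eq:
  assumes "is_triple k R T" "is_triple k R S" "stably_equiv k R T S"
  shows "triple_class k R T = triple_class k R S"
  using assms stably_equiv_trans[OF _ assms(1,2)] stably_equiv_trans[OF _ assms(2,1)]
    stably_equiv_sym[OF assms(1,3)]
  by (auto simp: triple_class_def)

text \<open>A class contains only triples in the canonical type, so \<open>T\<close> may not be a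
  member of its own class. A normalized copy is, and it links the two sides.\<close>

lemma triple_class_eq_iff:
  assumes T: "is_triple k R T" and S: "is_triple k R S"
  shows "triple_class k R T = triple_class k R S \<longleftrightarrow> stably_equiv k R T S"
proof
  assume eq: "triple_class k R T = triple_class k R S"
  obtain T' :: "('r, nat \<Rightarrow> 'r) triple" where T': "is_triple k R T'" "triple_iso R T T'"
    using normalize_triple[OF T] .
  have 1: "stably_equiv k R T T'"
    by (rule triple_iso_stably_equiv[OF T T'])
  then have "T' \<in> triple_class k R T"
    using stably_equiv_sym[OF T] T' by (simp add: triple_class_def)
  then have "stably_equiv k R T' S"
    unfolding eq by (simp add: triple_class_def)
  then show "stably_equiv k R T S"
    using stably_equiv_trans[OF T T'(1) S 1] by blast
qed (rule triple_class_eq[OF T S])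

lemma triple_class_in_carrier:
  assumes "is_triple k R T"
  shows "triple_class k R T \<in> carrier (difference_group k R)"
proof -
  obtain T' :: "('r, nat \<Rightarrow> 'r) triple" where T': "is_triple k R T'" "triple_iso R T T'"
    using normalize_triple[OF assms] .
  then have "triple_class k R T = triple_class k R T'"
    using triple_class_eq triple_iso_stably_equiv assms by blast
  then show ?thesis
    using T' by (auto simp: difference_group_def)
qed

lemma difference_group_carrierE:
  assumes "U \<in> carrier (difference_group k R)"
  obtains T :: "('r, nat \<Rightarrow> 'r) triple" where "is_triple k R T" "U = triple_class k R T"
  using assms by (auto simp: difference_group_def)

lemma triple_class_self:
  fixes T :: "('r, nat \<Rightarrow> 'r) triple"
  shows "is_triple k R T \<Longrightarrow> T \<in> triple_class k R T"
  by (simp add: triple_class_def stably_equiv_refl)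

text \<open>The product is defined as a union over all representatives. Compatibility of stable
  equivalence with sums makes all terms of the union equal, and normalized copies of
  \<open>T\<close> and \<open>S\<close> show that it is not empty.\<close>

lemma triple_class_mult:
  assumes T: "is_triple k R T" and S: "is_triple k R S"
  shows "triple_class k R T \<otimes>\<^bsub>difference_group k R\<^esub> triple_class k R S = triple_class k R (triple_sum T S)"
proof -
  have eq: "triple_class k R (triple_sum T' S') = triple_class k R (triple_sum T S)"
    if "T' \<in> triple_class k R T" "S' \<in> triple_class k R S" for T' S'
    using that T S
    by (intro triple_class_eq is_triple_sum stably_equiv_sum) (auto simp: triple_class_def)
  obtain T' :: "('r, nat \<Rightarrow> 'r) triple" where T': "is_triple k R T'" "triple_iso R T T'"
    using normalize_triple[OF T] .
  obtain S' :: "('r, nat \<Rightarrow> 'r) triple" where S': "is_triple k R S'" "triple_iso R S S'"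
    using normalize_triple[OF S] .
  have "T' \<in> triple_class k R T" "S' \<in> triple_class k R S"
    using T' S' stably_equiv_sym[OF T triple_iso_stably_equiv[OF T T']]
      stably_equiv_sym[OF S triple_iso_stably_equiv[OF S S']]
    by (simp_all add: triple_class_def)
  then have "(\<Union>T'\<in>triple_class k R T. \<Union>S'\<in>triple_class k R S. triple_class k R (triple_sum T' S'))
      = triple_class k R (triple_sum T S)"
    using eq by blast
  then show ?thesis
    by (simp add: difference_group_def)
qed

lemma difference_group_one: "\<one>\<^bsub>difference_group k R\<^esub> = triple_class k R zero_triple"
  by (simp add: difference_group_def)

theorem difference_group_comm_group: "comm_group (difference_group k R)"
proof (rule comm_groupI)
  let ?G = "difference_group k R"
  show "\<one>\<^bsub>?G\<^esub> \<in> carrier ?G"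
    unfolding difference_group_one by (rule triple_class_in_carrier[OF zero_triple_is_triple])
  fix x assume "x \<in> carrier ?G"
  then obtain T :: "('r, nat \<Rightarrow> 'r) triple" where T: "is_triple k R T" "x = triple_class k R T"
    by (rule difference_group_carrierE)
  show "\<one>\<^bsub>?G\<^esub> \<otimes>\<^bsub>?G\<^esub> x = x"
    unfolding difference_group_one T(2) triple_class_mult[OF zero_triple_is_triple T(1)]
    by (rule triple_class_eq[OF is_triple_sum[OF zero_triple_is_triple T(1)] T(1)
          triple_iso_stably_equiv[OF is_triple_sum[OF zero_triple_is_triple T(1)] T(1)
            triple_sum_zero[OF T(1)]]])
  \<comment> \<open>The inverse exchanges the two symmetries; that the sum is elementary is the
    rotation argument.\<close>
  show "\<exists>y\<in>carrier ?G. y \<otimes>\<^bsub>?G\<^esub> x = \<one>\<^bsub>?G\<^esub>"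
  proof -
    obtain M J1 J2 where M: "T = (M, J1, J2)" by (rule prod_cases3)
    have T': "is_triple k R (M, J2, J1)"
      using T(1) unfolding M by (simp add: is_triple_iff)
    have "elementary k R (triple_sum (M, J2, J1) T)"
      unfolding M by (rule rotation_elementary[OF T'])
    then have "triple_class k R (M, J2, J1) \<otimes>\<^bsub>?G\<^esub> x = \<one>\<^bsub>?G\<^esub>"
      unfolding T(2) triple_class_mult[OF T' T(1)] difference_group_one
      by (intro triple_class_eq is_triple_sum T' T(1) zero_triple_is_triple elementary_stably_zero)
    then show ?thesis
      using triple_class_in_carrier[OF T'] by blast
  qed
  fix y assume "y \<in> carrier ?G"
  then obtain S :: "('r, nat \<Rightarrow> 'r) triple" where S: "is_triple k R S" "y = triple_class k R S"
    by (rule difference_group_carrierE)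
  show "x \<otimes>\<^bsub>?G\<^esub> y \<in> carrier ?G"
    unfolding T(2) S(2) triple_class_mult[OF T(1) S(1)]
    by (rule triple_class_in_carrier[OF is_triple_sum[OF T(1) S(1)]])
  show "x \<otimes>\<^bsub>?G\<^esub> y = y \<otimes>\<^bsub>?G\<^esub> x"
    unfolding T(2) S(2) triple_class_mult[OF T(1) S(1)] triple_class_mult[OF S(1) T(1)]
    by (intro triple_class_eq is_triple_sum T S
        triple_iso_stably_equiv[OF is_triple_sum[OF T(1) S(1)] is_triple_sum[OF S(1) T(1)]]
        triple_sum_comm[OF T(1) S(1)])
  fix z assume "z \<in> carrier ?G"
  then obtain U :: "('r, nat \<Rightarrow> 'r) triple" where U: "is_triple k R U" "z = triple_class k R U"
    by (rule difference_group_carrierE)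
  note TS = is_triple_sum[OF T(1) S(1)] and SU = is_triple_sum[OF S(1) U(1)]
  show "x \<otimes>\<^bsub>?G\<^esub> y \<otimes>\<^bsub>?G\<^esub> z = x \<otimes>\<^bsub>?G\<^esub> (y \<otimes>\<^bsub>?G\<^esub> z)"
    unfolding T(2) S(2) U(2) triple_class_mult[OF T(1) S(1)] triple_class_mult[OF S(1) U(1)]
      triple_class_mult[OF TS U(1)] triple_class_mult[OF T(1) SU]
    by (rule triple_class_eq[OF is_triple_sum[OF TS U(1)] is_triple_sum[OF T(1) SU]
        triple_iso_stably_equiv[OF is_triple_sum[OF TS U(1)] is_triple_sum[OF T(1) SU]
          triple_sum_assoc[OF T(1) S(1) U(1)]]])
qed

end

section \<open>Maps induced by functors on triples\<close>

text \<open>\<open>\<Phi>\<close> is applied only to triples in the canonical type, which a direct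
  sum of such triples does not have. The triple \<open>W\<close> in the axiom for sums is therefore
  a copy of the sum inside that type.\<close>

locale triple_functor =
  src: normed_graded_ring R + tgt: normed_graded_ring R'
  for R :: "'r gr_alg" and R' :: "'s gr_alg" +
  fixes k k' :: symmetry_kind
    and \<Phi> :: "('r, nat \<Rightarrow> 'r) triple \<Rightarrow> ('s, 'p) triple"
  assumes is_triple_functor: "is_triple k R T \<Longrightarrow> is_triple k' R' (\<Phi> T)"
    and sum_functor: "is_triple k R T \<Longrightarrow> is_triple k R S \<Longrightarrow> is_triple k R W \<Longrightarrow>
      triple_iso R (triple_sum T S) W \<Longrightarrow> stably_equiv k' R' (triple_sum (\<Phi> T) (\<Phi> S)) (\<Phi> W)"
    and elementary_functor: "elementary k R E \<Longrightarrow> stably_equiv k' R' (\<Phi> E) zero_triple"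
begin

definition class_map :: "('r, nat \<Rightarrow> 'r) triple set \<Rightarrow> ('s, nat \<Rightarrow> 's) triple set" where
  "class_map U = (\<Union>T\<in>U. triple_class k' R' (\<Phi> T))"

lemma class_sum:
  assumes "is_triple k R T" "is_triple k R S" "is_triple k R W" "triple_iso R (triple_sum T S) W"
  shows "triple_class k' R' (\<Phi> T) \<otimes>\<^bsub>difference_group k' R'\<^esub> triple_class k' R' (\<Phi> S) = triple_class k' R' (\<Phi> W)"
  using assms sum_functor[OF assms] is_triple_functor
  by (simp add: tgt.triple_class_mult tgt.triple_class_eq tgt.is_triple_sum)

lemma class_sum_elementary:
  fixes E :: "('r, nat \<Rightarrow> 'r) triple"
  assumes "is_triple k R T" "elementary k R E" "is_triple k R W" "triple_iso R (triple_sum T E) W"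
  shows "triple_class k' R' (\<Phi> W) = triple_class k' R' (\<Phi> T)"
proof -
  interpret G: comm_group "difference_group k' R'"
    by (rule tgt.difference_group_comm_group)
  note E = src.elementary_is_triple[OF assms(2)]
  have "triple_class k' R' (\<Phi> E) = \<one>\<^bsub>difference_group k' R'\<^esub>"
    unfolding tgt.difference_group_one
    by (rule tgt.triple_class_eq[OF is_triple_functor[OF E] tgt.zero_triple_is_triple
          elementary_functor[OF assms(2)]])
  then show ?thesis
    using class_sum[OF assms(1) E assms(3,4)]
      tgt.triple_class_in_carrier[OF is_triple_functor[OF assms(1)]] by simp
qed

text \<open>A stable isomorphism gives \<open>triple_sum T E\<close> and
  \<open>triple_sum S F\<close> a common normalized copy \<open>W\<close>. Since elementary summands
  become trivial, both sides have the class of \<open>\<Phi> W\<close>.\<close>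

lemma functor_stable:
  assumes T: "is_triple k R T" and S: "is_triple k R S" and "stably_equiv k R T S"
  shows "triple_class k' R' (\<Phi> T) = triple_class k' R' (\<Phi> S)"
proof -
  obtain E F :: "('r, nat \<Rightarrow> 'r) triple" where EF: "elementary k R E" "elementary k R F"
    "triple_iso R (triple_sum T E) (triple_sum S F)"
    using assms(3) by (rule src.stably_equivE)
  have SF: "is_triple k R (triple_sum S F)"
    using src.is_triple_sum[OF S src.elementary_is_triple[OF EF(2)]] .
  obtain W :: "('r, nat \<Rightarrow> 'r) triple" where W: "is_triple k R W" "triple_iso R (triple_sum S F) W"
    using src.normalize_triple[OF SF] .
  show ?thesis
    using class_sum_elementary[OF T EF(1) W(1) triple_iso_trans[OF EF(3) W(2)]]
      class_sum_elementary[OF S EF(2) W] by simp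
qed

lemma class_map_class:
  assumes "is_triple k R T"
  shows "class_map (triple_class k R T) = triple_class k' R' (\<Phi> T)"
proof -
  have "triple_class k' R' (\<Phi> S) = triple_class k' R' (\<Phi> T)" if "S \<in> triple_class k R T" for S
    using that functor_stable assms by (simp add: triple_class_def)
  then show ?thesis
    using src.triple_class_self[OF assms] unfolding class_map_def by blast
qed

lemma class_map_hom: "class_map \<in> hom (difference_group k R) (difference_group k' R')"
proof (rule homI)
  fix x assume "x \<in> carrier (difference_group k R)"
  then obtain T :: "('r, nat \<Rightarrow> 'r) triple" where T: "is_triple k R T" "x = triple_class k R T"
    by (rule src.difference_group_carrierE)
  show "class_map x \<in> carrier (difference_group k' R')"
    unfolding T(2) class_map_class[OF T(1)]
    by (rule tgt.triple_class_in_carrier[OF is_triple_functor[OF T(1)]])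
  fix y assume "y \<in> carrier (difference_group k R)"
  then obtain S :: "('r, nat \<Rightarrow> 'r) triple" where S: "is_triple k R S" "y = triple_class k R S"
    by (rule src.difference_group_carrierE)
  obtain W :: "('r, nat \<Rightarrow> 'r) triple" where W: "is_triple k R W" "triple_iso R (triple_sum T S) W"
    using src.normalize_triple[OF src.is_triple_sum[OF T(1) S(1)]] .
  have "x \<otimes>\<^bsub>difference_group k R\<^esub> y = triple_class k R W"
    unfolding T(2) S(2) src.triple_class_mult[OF T(1) S(1)]
    by (intro src.triple_class_eq src.is_triple_sum T S W
        src.triple_iso_stably_equiv[OF src.is_triple_sum[OF T(1) S(1)] W])
  then show "class_map (x \<otimes>\<^bsub>difference_group k R\<^esub> y) = class_map x \<otimes>\<^bsub>difference_group k' R'\<^esub> class_map y"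
    using class_map_class T S W class_sum[OF T(1) S(1) W] by simp
qed

text \<open>Injectivity asks that stable equivalence be reflected, not only isomorphism, because the
  stabilizing summands over \<open>R'\<close> need not come from \<open>R\<close>.\<close>

lemma class_map_iso:
  assumes inj: "\<And>T S. is_triple k R T \<Longrightarrow> is_triple k R S \<Longrightarrow>
      stably_equiv k' R' (\<Phi> T) (\<Phi> S) \<Longrightarrow> stably_equiv k R T S"
    and surj: "\<And>S :: ('s, nat \<Rightarrow> 's) triple. is_triple k' R' S \<Longrightarrow>
      \<exists>T. is_triple k R T \<and> stably_equiv k' R' (\<Phi> T) S"
  shows "class_map \<in> iso (difference_group k R) (difference_group k' R')"
proof (rule isoI[OF class_map_hom])
  show "bij_betw class_map (carrier (difference_group k R)) (carrier (difference_group k' R'))"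
    unfolding bij_betw_def
  proof (intro conjI equalityI subsetI)
    show "inj_on class_map (carrier (difference_group k R))"
    proof (rule inj_onI)
      fix x y assume "x \<in> carrier (difference_group k R)" "y \<in> carrier (difference_group k R)"
        and eq: "class_map x = class_map y"
      then obtain T S :: "('r, nat \<Rightarrow> 'r) triple" where T: "is_triple k R T" "x = triple_class k R T"
        and S: "is_triple k R S" "y = triple_class k R S"
        by (metis src.difference_group_carrierE)
      have "stably_equiv k' R' (\<Phi> T) (\<Phi> S)"
        using eq tgt.triple_class_eq_iff[OF is_triple_functor[OF T(1)] is_triple_functor[OF S(1)]]
          T S class_map_class by simp
      then show "x = y"
        unfolding T(2) S(2) by (intro src.triple_class_eq[OF T(1) S(1)] inj[OF T(1) S(1)])
    qed
    fix y assume "y \<in> class_map ` carrier (difference_group k R)"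
    then show "y \<in> carrier (difference_group k' R')"
      using class_map_hom by (auto simp: hom_def)
  next
    fix y assume "y \<in> carrier (difference_group k' R')"
    then obtain S :: "('s, nat \<Rightarrow> 's) triple" where S: "is_triple k' R' S" "y = triple_class k' R' S"
      by (rule tgt.difference_group_carrierE)
    obtain T where T: "is_triple k R T" "stably_equiv k' R' (\<Phi> T) S"
      using surj[OF S(1)] by blast
    have "class_map (triple_class k R T) = y"
      unfolding S(2) class_map_class[OF T(1)]
      by (rule tgt.triple_class_eq[OF is_triple_functor[OF T(1)] S(1) T(2)])
    then show "y \<in> class_map ` carrier (difference_group k R)"
      using src.triple_class_in_carrier[OF T(1)] by blast
  qed
qed

end

section \<open>Base change\<close>

text \<open>The instances are the augmentation \<open>snd\<close> of a unitization and the map it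
  induces on Clifford tensor products. Preservation of the unit follows from surjectivity.\<close>

locale graded_surjection =
  src: normed_graded_ring B + tgt: normed_graded_ring C
  for B :: "'b gr_alg" and C :: "'c gr_alg" +
  fixes \<phi> :: "'b \<Rightarrow> 'c"
  assumes \<phi>_surj: "\<phi> ` carrier B = carrier C"
    and \<phi>_add: "a \<in> carrier B \<Longrightarrow> b \<in> carrier B \<Longrightarrow> \<phi> (a \<oplus>\<^bsub>B\<^esub> b) = \<phi> a \<oplus>\<^bsub>C\<^esub> \<phi> b"
    and \<phi>_mult: "a \<in> carrier B \<Longrightarrow> b \<in> carrier B \<Longrightarrow> \<phi> (a \<otimes>\<^bsub>B\<^esub> b) = \<phi> a \<otimes>\<^bsub>C\<^esub> \<phi> b"
    and \<phi>_parity: "a \<in> carrier B \<Longrightarrow> \<phi> (parity B a) = parity C (\<phi> a)"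
    and \<phi>_bounded: "\<exists>K. \<forall>a\<in>carrier B. nrm C (\<phi> a) \<le> K * nrm B a"
begin

lemma \<phi>_closed [simp]: "a \<in> carrier B \<Longrightarrow> \<phi> a \<in> carrier C"
  using \<phi>_surj by blast

lemma \<phi>_additive: "additive_map B C \<phi>"
  by (rule additive_mapI) (simp_all add: \<phi>_add)

lemma \<phi>_zero [simp]: "\<phi> \<zero>\<^bsub>B\<^esub> = \<zero>\<^bsub>C\<^esub>"
  by (rule additive_map_zero[OF src.abelian_group_axioms tgt.abelian_group_axioms \<phi>_additive])

lemma \<phi>_one [simp]: "\<phi> \<one>\<^bsub>B\<^esub> = \<one>\<^bsub>C\<^esub>"
proof -
  obtain e where e: "e \<in> carrier B" "\<phi> e = \<one>\<^bsub>C\<^esub>"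
    using \<phi>_surj tgt.one_closed by (metis imageE)
  have "\<phi> \<one>\<^bsub>B\<^esub> = \<phi> \<one>\<^bsub>B\<^esub> \<otimes>\<^bsub>C\<^esub> \<phi> e"
    using e by simp
  also have "\<dots> = \<phi> (\<one>\<^bsub>B\<^esub> \<otimes>\<^bsub>B\<^esub> e)"
    by (rule \<phi>_mult[symmetric]) (use e in simp_all)
  finally show ?thesis using e by simp
qed

lemma \<phi>_lift:
  assumes "c \<in> carrier C"
  obtains b where "b \<in> carrier B" "c = \<phi> b"
  using assms \<phi>_surj by blast

text \<open>\<open>u : M \<rightarrow> P\<close> exhibits \<open>P\<close> as the quotient of \<open>M\<close> by \<open>(ker \<phi>) M\<close>, which is the base change
  because \<open>\<phi>\<close> is surjective. The last condition expresses \<open>ker u \<subseteq> (ker \<phi>) M\<close> by functionals.\<close>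

definition is_base_change ::
  "('b, 'm) triple \<Rightarrow> ('c, 'p) triple \<Rightarrow> ('m \<Rightarrow> 'p) \<Rightarrow> bool" where
  "is_base_change = (\<lambda>(M, J1, J2) (P, K1, K2) u.
     u ` carrier M = carrier P \<and> u \<zero>\<^bsub>M\<^esub> = \<zero>\<^bsub>P\<^esub> \<and>
     (\<forall>x\<in>carrier M. \<forall>y\<in>carrier M. u (x \<oplus>\<^bsub>M\<^esub> y) = u x \<oplus>\<^bsub>P\<^esub> u y) \<and>
     (\<forall>b\<in>carrier B. \<forall>x\<in>carrier M. u (b \<odot>\<^bsub>M\<^esub> x) = \<phi> b \<odot>\<^bsub>P\<^esub> u x) \<and>
     K1 \<in> extensional (carrier P) \<and> K2 \<in> extensional (carrier P) \<and>
     (\<forall>x\<in>carrier M. u (J1 x) = K1 (u x)) \<and> (\<forall>x\<in>carrier M. u (J2 x) = K2 (u x)) \<and>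
     (\<forall>x\<in>carrier M. u x = \<zero>\<^bsub>P\<^esub> \<longrightarrow> (\<forall>f\<in>functionals B M. \<phi> (f x) = \<zero>\<^bsub>C\<^esub>)))"

lemma is_base_changeD:
  assumes "is_base_change (M, J1, J2) (P, K1, K2) u"
  shows "u ` carrier M = carrier P" "u \<zero>\<^bsub>M\<^esub> = \<zero>\<^bsub>P\<^esub>"
    "x \<in> carrier M \<Longrightarrow> y \<in> carrier M \<Longrightarrow> u (x \<oplus>\<^bsub>M\<^esub> y) = u x \<oplus>\<^bsub>P\<^esub> u y"
    "b \<in> carrier B \<Longrightarrow> x \<in> carrier M \<Longrightarrow> u (b \<odot>\<^bsub>M\<^esub> x) = \<phi> b \<odot>\<^bsub>P\<^esub> u x"
    "K1 \<in> extensional (carrier P)" "K2 \<in> extensional (carrier P)"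
    "x \<in> carrier M \<Longrightarrow> u (J1 x) = K1 (u x)" "x \<in> carrier M \<Longrightarrow> u (J2 x) = K2 (u x)"
    "x \<in> carrier M \<Longrightarrow> u x = \<zero>\<^bsub>P\<^esub> \<Longrightarrow> f \<in> functionals B M \<Longrightarrow> \<phi> (f x) = \<zero>\<^bsub>C\<^esub>"
    "x \<in> carrier M \<Longrightarrow> u x \<in> carrier P"
    "additive_map M P u"
    "p \<in> carrier P \<Longrightarrow> \<exists>x\<in>carrier M. p = u x"
  using assms by (auto simp: is_base_change_def additive_map_def)

lemma is_base_change_left_module:
  assumes "left_module B M" "is_base_change (M, J1, J2) (P, K1, K2) u"
  shows "left_module C P"
proof -
  interpret M: left_module B M by fact
  note u = is_base_changeD[OF assms(2)]
  show ?thesis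
  proof (rule left_moduleI[OF tgt.ring_axioms])
    show "abelian_group P"
    proof (rule abelian_groupI)
      show "\<zero>\<^bsub>P\<^esub> \<in> carrier P" using u(10)[of "\<zero>\<^bsub>M\<^esub>"] u(2) by simp
      fix p assume "p \<in> carrier P"
      then obtain x where x: "x \<in> carrier M" "p = u x" using u(12) by blast
      show "\<exists>w\<in>carrier P. w \<oplus>\<^bsub>P\<^esub> p = \<zero>\<^bsub>P\<^esub>"
        using x u(2) u(3)[of "\<ominus>\<^bsub>M\<^esub> x" x] u(10) by (intro bexI[of _ "u (\<ominus>\<^bsub>M\<^esub> x)"]) (auto simp: M.M.l_neg)
      show "\<zero>\<^bsub>P\<^esub> \<oplus>\<^bsub>P\<^esub> p = p"
        using x u(3)[of "\<zero>\<^bsub>M\<^esub>" x] u(2) by simp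
      fix q assume "q \<in> carrier P"
      then obtain y where y: "y \<in> carrier M" "q = u y" using u(12) by blast
      show "p \<oplus>\<^bsub>P\<^esub> q \<in> carrier P" "p \<oplus>\<^bsub>P\<^esub> q = q \<oplus>\<^bsub>P\<^esub> p"
        using x y by (simp_all add: u(10) u(3)[symmetric] M.M.a_comm)
      fix r assume "r \<in> carrier P"
      then obtain z where z: "z \<in> carrier M" "r = u z" using u(12) by blast
      show "p \<oplus>\<^bsub>P\<^esub> q \<oplus>\<^bsub>P\<^esub> r = p \<oplus>\<^bsub>P\<^esub> (q \<oplus>\<^bsub>P\<^esub> r)"
        using x y z by (simp add: u(3)[symmetric] M.M.a_assoc)
    qed
  next
    fix c p assume c: "c \<in> carrier C" and "p \<in> carrier P"
    then obtain x where x: "x \<in> carrier M" "p = u x" using u(12) by blast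
    obtain a where a: "a \<in> carrier B" "c = \<phi> a" using \<phi>_lift[OF c] .
    show "c \<odot>\<^bsub>P\<^esub> p \<in> carrier P"
      using a x by (simp add: u(4)[symmetric] u(10) M.smult_closed)
    fix q assume "q \<in> carrier P"
    then obtain y where y: "y \<in> carrier M" "q = u y" using u(12) by blast
    show "c \<odot>\<^bsub>P\<^esub> (p \<oplus>\<^bsub>P\<^esub> q) = c \<odot>\<^bsub>P\<^esub> p \<oplus>\<^bsub>P\<^esub> c \<odot>\<^bsub>P\<^esub> q"
      using a x y by (simp add: u(4)[symmetric] u(3)[symmetric] M.smult_closed M.smult_r_distr)
  next
    fix c d p assume c: "c \<in> carrier C" and d: "d \<in> carrier C" and "p \<in> carrier P"
    then obtain x where x: "x \<in> carrier M" "p = u x" using u(12) by blast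
    obtain a where a: "a \<in> carrier B" "c = \<phi> a" using \<phi>_lift[OF c] .
    obtain b where b: "b \<in> carrier B" "d = \<phi> b" using \<phi>_lift[OF d] .
    show "(c \<otimes>\<^bsub>C\<^esub> d) \<odot>\<^bsub>P\<^esub> p = c \<odot>\<^bsub>P\<^esub> (d \<odot>\<^bsub>P\<^esub> p)"
      using a b x by (simp add: u(4)[symmetric] \<phi>_mult[symmetric] M.smult_closed M.smult_assoc)
    show "(c \<oplus>\<^bsub>C\<^esub> d) \<odot>\<^bsub>P\<^esub> p = c \<odot>\<^bsub>P\<^esub> p \<oplus>\<^bsub>P\<^esub> d \<odot>\<^bsub>P\<^esub> p"
      using a b x by (simp add: u(4)[symmetric] u(3)[symmetric] \<phi>_add[symmetric] M.smult_closed M.smult_l_distr)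
  next
    fix p assume "p \<in> carrier P"
    then obtain x where x: "x \<in> carrier M" "p = u x" using u(12) by blast
    then show "\<one>\<^bsub>C\<^esub> \<odot>\<^bsub>P\<^esub> p = p"
      using u(4)[of "\<one>\<^bsub>B\<^esub>" x] by (simp add: M.smult_one)
  qed
qed

text \<open>Converse of the last condition in \<open>is_base_change\<close>: in the dual basis
  expansion of \<open>x\<close> all coefficients are killed by \<open>\<phi>\<close>, and
  \<open>u\<close> turns scalars \<open>b\<close> into \<open>\<phi> b\<close>.\<close>

lemma base_change_kernel:
  assumes "is_triple k B (M, J1, J2)" "is_base_change (M, J1, J2) (P, K1, K2) u" "x \<in> carrier M"
    and "\<And>f. f \<in> functionals B M \<Longrightarrow> \<phi> (f x) = \<zero>\<^bsub>C\<^esub>"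
  shows "u x = \<zero>\<^bsub>P\<^esub>"
proof -
  obtain n :: nat and xs fs where M: "left_module B M" "dual_basis B M {..<n} xs fs"
    using fg_projective_dual_basis assms(1) by (metis is_triple_iff)
  interpret M: left_module B M by fact
  interpret P: left_module C P using is_base_change_left_module[OF M(1) assms(2)] .
  note u = is_base_changeD[OF assms(2)] and d = dual_basisD[OF M(2)]
  have "u x = u (\<Oplus>\<^bsub>M\<^esub>k\<in>{..<n}. fs k x \<odot>\<^bsub>M\<^esub> xs k)"
    using d(5)[OF assms(3)] by simp
  also have "\<dots> = (\<Oplus>\<^bsub>P\<^esub>k\<in>{..<n}. u (fs k x \<odot>\<^bsub>M\<^esub> xs k))"
    using d assms(3) by (intro additive_map_finsum[OF M.M.abelian_group_axioms P.M.abelian_group_axioms u(11)])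
      (auto intro!: M.smult_closed)
  also have "\<dots> = (\<Oplus>\<^bsub>P\<^esub>k\<in>{..<n}. \<zero>\<^bsub>P\<^esub>)"
    using d assms(3,4) u by (intro P.M.finsum_cong') auto
  finally show ?thesis by (simp add: P.M.finsum_zero)
qed

text \<open>The kernel of \<open>u\<close> is detected by functionals. For a functional
  \<open>f\<close> the map \<open>parity B (f (J z))\<close> is again a functional, since the two
  twists cancel; hence \<open>J\<close> preserves the kernel.\<close>

lemma base_change_symmetry_well_defined:
  assumes T: "is_triple k B (M, J1, J2)" and bc: "is_base_change (M, J1, J2) (P, K1, K2) u"
    and J: "J \<in> symmetry_space k B M" and x: "x \<in> carrier M" and y: "y \<in> carrier M" and eq: "u x = u y"
  shows "u (J x) = u (J y)"
proof -
  have lm: "left_module B M" using src.is_triple_left_module[OF T] .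
  interpret M: left_module B M by fact
  interpret P: left_module C P using is_base_change_left_module[OF lm bc] .
  note u = is_base_changeD[OF bc] and J = src.symmetryD[OF lm J]
  note ud = additive_map_diff[OF M.M.abelian_group_axioms P.M.abelian_group_axioms u(11)]
  have "u (x \<ominus>\<^bsub>M\<^esub> y) = \<zero>\<^bsub>P\<^esub>"
    using ud[OF x y] eq u(10)[OF y] by simp
  then have 0: "\<phi> (f (x \<ominus>\<^bsub>M\<^esub> y)) = \<zero>\<^bsub>C\<^esub>" if "f \<in> functionals B M" for f
    using u(9) that x y by simp
  have "u (J (x \<ominus>\<^bsub>M\<^esub> y)) = \<zero>\<^bsub>P\<^esub>"
  proof (rule base_change_kernel[OF T bc])
    show "J (x \<ominus>\<^bsub>M\<^esub> y) \<in> carrier M" using J(3) x y by simp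
    fix f assume f: "f \<in> functionals B M"
    note fd = functionalsD(2-4)[OF f]
    have "(\<lambda>z. parity B (f (J z))) \<in> functionals B M"
      by (rule functionalsI) (simp_all add: fd J src.parity_add src.parity_mult)
    then have "\<phi> (parity B (f (J (x \<ominus>\<^bsub>M\<^esub> y)))) = \<zero>\<^bsub>C\<^esub>"
      by (rule 0)
    then have "parity C (parity C (\<phi> (f (J (x \<ominus>\<^bsub>M\<^esub> y))))) = parity C \<zero>\<^bsub>C\<^esub>"
      using fd J x y by (simp add: \<phi>_parity)
    then show "\<phi> (f (J (x \<ominus>\<^bsub>M\<^esub> y))) = \<zero>\<^bsub>C\<^esub>"
      using fd J x y by simp
  qed
  moreover have "J (x \<ominus>\<^bsub>M\<^esub> y) = J x \<ominus>\<^bsub>M\<^esub> J y"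
    using additive_map_diff[OF M.M.abelian_group_axioms M.M.abelian_group_axioms skew_mapD(1)[OF J(2)] x y] .
  ultimately show ?thesis
    using ud[OF J(3)[OF x] J(3)[OF y]] u(10)[OF J(3)[OF x]] u(10)[OF J(3)[OF y]] by simp
qed

lemma base_change_symmetry:
  assumes T: "is_triple k B (M, J1, J2)" and bc: "is_base_change (M, J1, J2) (P, K1, K2) u"
    and J: "J \<in> symmetry_space k B M" and K: "K \<in> extensional (carrier P)"
    and uJ: "\<And>x. x \<in> carrier M \<Longrightarrow> u (J x) = K (u x)"
  shows "K \<in> symmetry_space k C P"
proof -
  have lm: "left_module B M" using src.is_triple_left_module[OF T] .
  interpret M: left_module B M by fact
  interpret P: left_module C P using is_base_change_left_module[OF lm bc] .
  note u = is_base_changeD[OF bc] and J = src.symmetryD[OF lm J]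
  show ?thesis
  proof (rule tgt.symmetryI[OF P.left_module_axioms K])
    fix p assume "p \<in> carrier P"
    then obtain x where x: "x \<in> carrier M" "p = u x" using u(12) by blast
    show "K p \<in> carrier P" using x by (simp add: uJ[symmetric] u(10) J)
    have "u (\<ominus>\<^bsub>M\<^esub> x) = \<ominus>\<^bsub>P\<^esub> u x"
      by (rule additive_map_neg[OF M.M.abelian_group_axioms P.M.abelian_group_axioms u(11) x(1)])
    then show "K (K p) = sym_square k P p"
      using x J by (cases k) (simp_all add: uJ[symmetric] sym_square_def)
    show "K (c \<odot>\<^bsub>P\<^esub> p) = parity C c \<odot>\<^bsub>P\<^esub> K p" if c: "c \<in> carrier C" for c
    proof -
      obtain a where a: "a \<in> carrier B" "c = \<phi> a" using \<phi>_lift[OF c] .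
      then have "K (c \<odot>\<^bsub>P\<^esub> p) = u (parity B a \<odot>\<^bsub>M\<^esub> J x)"
        using x J by (simp add: u(4)[symmetric] uJ[symmetric] M.smult_closed)
      also have "\<dots> = parity C c \<odot>\<^bsub>P\<^esub> K p"
        using a x J u(4) by (simp add: \<phi>_parity uJ)
      finally show ?thesis .
    qed
    fix q assume "q \<in> carrier P"
    then obtain y where y: "y \<in> carrier M" "q = u y" using u(12) by blast
    show "K (p \<oplus>\<^bsub>P\<^esub> q) = K p \<oplus>\<^bsub>P\<^esub> K q"
      using x y J by (simp add: u(3)[symmetric] uJ[symmetric])
  qed
qed

text \<open>By the kernel condition \<open>\<phi> (f x)\<close> depends only on \<open>u x\<close>,
  so the functional descends along \<open>u\<close>; any preimage chosen by \<open>inv_into\<close>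
  will do.\<close>

lemma base_change_functional:
  assumes lm: "left_module B M" and bc: "is_base_change (M, J1, J2) (P, K1, K2) u"
    and f: "f \<in> functionals B M"
  obtains g where "g \<in> functionals C P" "\<And>x. x \<in> carrier M \<Longrightarrow> g (u x) = \<phi> (f x)"
proof -
  interpret M: left_module B M by fact
  interpret P: left_module C P using is_base_change_left_module[OF lm bc] .
  note u = is_base_changeD[OF bc] and fd = functionalsD[OF f]
  define g where "g p = \<phi> (f (inv_into (carrier M) u p))" for p
  have gu: "g (u x) = \<phi> (f x)" if x: "x \<in> carrier M" for x
  proof -
    define y where "y = inv_into (carrier M) u (u x)"
    have y: "y \<in> carrier M" "u y = u x"
      unfolding y_def using x by (auto intro: inv_into_into f_inv_into_f)
    have "u (x \<ominus>\<^bsub>M\<^esub> y) = \<zero>\<^bsub>P\<^esub>"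
      using additive_map_diff[OF M.M.abelian_group_axioms P.M.abelian_group_axioms u(11) x y(1)] y u(10)[OF x]
      by simp
    then have "\<phi> (f (x \<ominus>\<^bsub>M\<^esub> y)) = \<zero>\<^bsub>C\<^esub>"
      using u(9) x y f by simp
    moreover have "\<phi> (f (x \<ominus>\<^bsub>M\<^esub> y)) = \<phi> (f x) \<ominus>\<^bsub>C\<^esub> \<phi> (f y)"
      using x y fd
      by (simp add: additive_map_diff[OF M.M.abelian_group_axioms src.abelian_group_axioms fd(1)]
          additive_map_diff[OF src.abelian_group_axioms tgt.abelian_group_axioms \<phi>_additive])
    ultimately have "\<phi> (f x) = \<phi> (f y)"
      using fd(2) x y by (simp only: tgt.diff_eq_zero \<phi>_closed)
    then show ?thesis
      by (simp add: g_def y_def)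
  qed
  have "g \<in> functionals C P"
  proof (rule functionalsI)
    fix p assume "p \<in> carrier P"
    then obtain x where x: "x \<in> carrier M" "p = u x" using u(12) by blast
    then show "g p \<in> carrier C" using fd by (simp add: gu)
    fix q assume "q \<in> carrier P"
    then obtain y where y: "y \<in> carrier M" "q = u y" using u(12) by blast
    show "g (p \<oplus>\<^bsub>P\<^esub> q) = g p \<oplus>\<^bsub>C\<^esub> g q"
      using x y fd by (simp add: u(3)[symmetric] gu \<phi>_add)
  next
    fix c p assume c: "c \<in> carrier C" and "p \<in> carrier P"
    then obtain x where x: "x \<in> carrier M" "p = u x" using u(12) by blast
    obtain a where a: "a \<in> carrier B" "c = \<phi> a" using \<phi>_lift[OF c] .
    then show "g (c \<odot>\<^bsub>P\<^esub> p) = c \<otimes>\<^bsub>C\<^esub> g p"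
      using x fd by (simp add: u(4)[symmetric] gu \<phi>_mult M.smult_closed)
  qed
  then show ?thesis using that gu by blast
qed

lemma base_change_is_triple:
  assumes T: "is_triple k B T" and bc: "is_base_change T S u"
  shows "is_triple k C S"
proof -
  obtain M J1 J2 where TM: "T = (M, J1, J2)" by (rule prod_cases3)
  obtain P K1 K2 where SP: "S = (P, K1, K2)" by (rule prod_cases3)
  note T = T[unfolded TM] and bc = bc[unfolded TM SP]
  obtain n :: nat and xs fs where M: "left_module B M" "dual_basis B M {..<n} xs fs"
    using fg_projective_dual_basis T by (metis is_triple_iff)
  interpret M: left_module B M by fact
  interpret P: left_module C P using is_base_change_left_module[OF M(1) bc] .
  note u = is_base_changeD[OF bc] and d = dual_basisD[OF M(2)]
  have "\<exists>g. g \<in> functionals C P \<and> (\<forall>x\<in>carrier M. g (u x) = \<phi> (fs k x))" if k: "k < n" for k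
    using base_change_functional[OF M(1) bc d(3)] k by (metis lessThan_iff)
  then obtain gs where gs: "\<And>k. k < n \<Longrightarrow> gs k \<in> functionals C P"
    "\<And>k x. k < n \<Longrightarrow> x \<in> carrier M \<Longrightarrow> gs k (u x) = \<phi> (fs k x)"
    by metis
  have "dual_basis C P {..<n} (\<lambda>k. u (xs k)) gs"
    unfolding dual_basis_def
  proof (intro conjI ballI)
    fix p assume "p \<in> carrier P"
    then obtain x where x: "x \<in> carrier M" "p = u x" using u(12) by blast
    have "(\<Oplus>\<^bsub>P\<^esub>k\<in>{..<n}. gs k p \<odot>\<^bsub>P\<^esub> u (xs k)) = (\<Oplus>\<^bsub>P\<^esub>k\<in>{..<n}. u (fs k x \<odot>\<^bsub>M\<^esub> xs k))"
      using d u x gs by (intro P.M.finsum_cong') (auto simp: M.smult_closed intro!: P.smult_closed)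
    also have "\<dots> = u (\<Oplus>\<^bsub>M\<^esub>k\<in>{..<n}. fs k x \<odot>\<^bsub>M\<^esub> xs k)"
      using d x by (intro additive_map_finsum[OF M.M.abelian_group_axioms P.M.abelian_group_axioms u(11), symmetric])
        (auto intro!: M.smult_closed)
    finally show "(\<Oplus>\<^bsub>P\<^esub>k\<in>{..<n}. gs k p \<odot>\<^bsub>P\<^esub> u (xs k)) = p"
      using d(5)[OF x(1)] x by simp
  qed (use gs d u in auto)
  then have "fg_projective C P"
    by (rule fg_projectiveI[OF P.left_module_axioms])
  then show ?thesis
    using base_change_symmetry[OF T bc _ u(5) u(7)] base_change_symmetry[OF T bc _ u(6) u(8)] T
    unfolding SP is_triple_iff by blast
qed

text \<open>The path descends because symmetries preserve the kernel of \<open>u\<close>. A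
  functional \<open>h\<close> on \<open>P\<close> is not lifted to \<open>M\<close>; instead the
  lifted path is expanded in a dual basis, which writes its image under \<open>h\<close> as a finite
  sum of \<open>\<phi>\<close> of paths in \<open>B\<close> times the constants
  \<open>h (u (xs k))\<close>.\<close>

lemma base_change_elementary:
  assumes T: "elementary k B T" and bc: "is_base_change T S u"
  shows "elementary k C S"
proof -
  obtain M J1 J2 where TM: "T = (M, J1, J2)" by (rule prod_cases3)
  obtain P K1 K2 where SP: "S = (P, K1, K2)" by (rule prod_cases3)
  have S: "is_triple k C S"
    using base_change_is_triple[OF src.elementary_is_triple[OF T] bc] .
  note bc = bc[unfolded TM SP] and t = src.elementary_is_triple[OF T, unfolded TM]
  obtain n :: nat and xs fs where M: "left_module B M" "dual_basis B M {..<n} xs fs"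
    using fg_projective_dual_basis t by (metis is_triple_iff)
  interpret M: left_module B M by fact
  interpret P: left_module C P using is_base_change_left_module[OF M(1) bc] .
  note u = is_base_changeD[OF bc] and d = dual_basisD[OF M(2)]
  obtain p where p: "p 0 = J1" "p 1 = J2" "\<And>t. t \<in> {0..1::real} \<Longrightarrow> p t \<in> symmetry_space k B M"
    "\<And>x h. x \<in> carrier M \<Longrightarrow> h \<in> functionals B M \<Longrightarrow> cont_path B (\<lambda>t. h (p t x))"
    using T unfolding TM src.elementary_iff sym_path_def by blast
  define v where "v = inv_into (carrier M) u"
  have v: "v q \<in> carrier M" "u (v q) = q" if "q \<in> carrier P" for q
    using that u(1) unfolding v_def by (auto intro: inv_into_into f_inv_into_f)
  define r where "r t = (\<lambda>q\<in>carrier P. u (p t (v q)))" for t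
  have ru: "u (p t x) = r t (u x)" if "t \<in> {0..1}" "x \<in> carrier M" for t x
    using base_change_symmetry_well_defined[OF t bc p(3)[OF that(1)] that(2) v(1)[OF u(10)[OF that(2)]]]
      v(2)[OF u(10)[OF that(2)]] u(10)[OF that(2)] by (simp add: r_def)
  have "sym_path k C P K1 K2"
    unfolding sym_path_def
  proof (intro exI[of _ r] conjI ballI)
    show "r 0 = K1"
      by (rule extensionalityI[OF _ u(5)]) (use u(7) v in \<open>auto simp: r_def p\<close>)
    show "r 1 = K2"
      by (rule extensionalityI[OF _ u(6)]) (use u(8) v in \<open>auto simp: r_def p\<close>)
    fix t :: real assume t': "t \<in> {0..1}"
    show "r t \<in> symmetry_space k C P"
      by (rule base_change_symmetry[OF t bc p(3)[OF t'] _ ru[OF t']])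
        (unfold r_def, rule restrict_extensional)
  next
    fix q h assume q: "q \<in> carrier P" and h: "h \<in> functionals C P"
    note hd = functionalsD[OF h]
    have pc: "p t (v q) \<in> carrier M" if "t \<in> {0..1}" for t
      using src.symmetryD(3)[OF M(1) p(3)[OF that] v(1)[OF q]] .
    obtain K where K: "\<And>a. a \<in> carrier B \<Longrightarrow> nrm C (\<phi> a) \<le> K * nrm B a"
      using \<phi>_bounded by blast
    have "cont_path C (\<lambda>t. \<Oplus>\<^bsub>C\<^esub>k\<in>{..<n}. \<phi> (fs k (p t (v q))) \<otimes>\<^bsub>C\<^esub> h (u (xs k)))"
    proof (rule tgt.cont_path_finsum)
      fix k assume k: "k \<in> {..<n}"
      have "cont_path C (\<lambda>t. \<phi> (fs k (p t (v q))))"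
        by (rule tgt.cont_path_image[OF src.normed_graded_ring_axioms p(4)[OF v(1)[OF q] d(3)[OF k]] \<phi>_additive K])
          (use d(4)[OF k] pc in auto)
      then show "cont_path C (\<lambda>t. \<phi> (fs k (p t (v q))) \<otimes>\<^bsub>C\<^esub> h (u (xs k)))"
        by (rule tgt.cont_path_mult_right) (use d(4)[OF k] pc d(2)[OF k] u hd in auto)
      show "\<phi> (fs k (p t (v q))) \<otimes>\<^bsub>C\<^esub> h (u (xs k)) \<in> carrier C" if "t \<in> {0..1}" for t
        using d(4)[OF k] pc[OF that] d(2)[OF k] u hd by auto
    qed simp
    then show "cont_path C (\<lambda>t. h (r t q))"
    proof (rule tgt.cont_path_cong)
      fix t :: real assume t': "t \<in> {0..1}"
      have y: "p t (v q) \<in> carrier M" by (rule pc[OF t'])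
      have "h (r t q) = h (u (\<Oplus>\<^bsub>M\<^esub>k\<in>{..<n}. fs k (p t (v q)) \<odot>\<^bsub>M\<^esub> xs k))"
        using d(5)[OF y] q by (simp add: r_def)
      also have "\<dots> = (\<Oplus>\<^bsub>C\<^esub>k\<in>{..<n}. h (u (fs k (p t (v q)) \<odot>\<^bsub>M\<^esub> xs k)))"
        using d y
        by (intro additive_map_finsum[OF M.M.abelian_group_axioms tgt.abelian_group_axioms
              additive_map_comp[OF u(11) hd(1)]]) (auto intro!: M.smult_closed)
      also have "\<dots> = (\<Oplus>\<^bsub>C\<^esub>k\<in>{..<n}. \<phi> (fs k (p t (v q))) \<otimes>\<^bsub>C\<^esub> h (u (xs k)))"
        using d y u hd by (intro tgt.finsum_cong') auto
      finally show "(\<Oplus>\<^bsub>C\<^esub>k\<in>{..<n}. \<phi> (fs k (p t (v q))) \<otimes>\<^bsub>C\<^esub> h (u (xs k))) = h (r t q)" by simp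
    qed
  qed
  then show ?thesis
    using S unfolding SP tgt.elementary_iff by blast
qed

lemma is_base_change_sum:
  assumes T: "is_triple k B T" "is_triple k B T'" and bc: "is_base_change T S u" "is_base_change T' S' u'"
  shows "is_base_change (triple_sum T T') (triple_sum S S') (map_prod u u')"
proof -
  obtain M J1 J2 where TM: "T = (M, J1, J2)" by (rule prod_cases3)
  obtain P K1 K2 where SP: "S = (P, K1, K2)" by (rule prod_cases3)
  obtain M' J1' J2' where TM': "T' = (M', J1', J2')" by (rule prod_cases3)
  obtain P' K1' K2' where SP': "S' = (P', K1', K2')" by (rule prod_cases3)
  note bc = bc[unfolded TM SP TM' SP']
  have lm: "left_module B M" "left_module B M'"
    using T[unfolded TM TM', THEN src.is_triple_left_module] by auto
  note u = is_base_changeD[OF bc(1)] and u' = is_base_changeD[OF bc(2)]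
  have im: "map_prod u u' ` (carrier M \<times> carrier M') = carrier P \<times> carrier P'"
    using u(1) u'(1) map_prod_surj_on[of u "carrier M" "carrier P" u' "carrier M'" "carrier P'"] by simp
  have "\<phi> (f (x, y)) = \<zero>\<^bsub>C\<^esub>"
    if x: "x \<in> carrier M" "y \<in> carrier M'" and 0: "u x = \<zero>\<^bsub>P\<^esub>" "u' y = \<zero>\<^bsub>P'\<^esub>"
      and f: "f \<in> functionals B (module_sum M M')" for x y f
  proof -
    note fs = functionalsD[OF f] src.functionals_sum[OF lm f]
    have "\<phi> (f (x, \<zero>\<^bsub>M'\<^esub>)) = \<zero>\<^bsub>C\<^esub>" "\<phi> (f (\<zero>\<^bsub>M\<^esub>, y)) = \<zero>\<^bsub>C\<^esub>"
      using u(9)[OF x(1) 0(1) src.functionals_sum(1)[OF lm f]] u'(9)[OF x(2) 0(2) src.functionals_sum(2)[OF lm f]] .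
    moreover have "f (x, \<zero>\<^bsub>M'\<^esub>) \<in> carrier B" "f (\<zero>\<^bsub>M\<^esub>, y) \<in> carrier B"
      using functionalsD(2)[OF src.functionals_sum(1)[OF lm f] x(1)]
        functionalsD(2)[OF src.functionals_sum(2)[OF lm f] x(2)] .
    ultimately show ?thesis
      using src.functionals_sum(3)[OF lm f x] \<phi>_add[of "f (x, \<zero>\<^bsub>M'\<^esub>)" "f (\<zero>\<^bsub>M\<^esub>, y)"] by simp
  qed
  then show ?thesis
    unfolding TM SP TM' SP' triple_sum_eq
    unfolding is_base_change_def
    using im by (auto simp: u u')
qed

text \<open>Composition of the quotient map with the isomorphism; the kernel condition is moved back
  by composing functionals with the inverse.\<close>

lemma is_base_change_iso:
  assumes T: "is_triple k B T" "is_triple k B T'" and iso: "triple_iso B T T'" and bc: "is_base_change T' S u"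
  obtains w where "is_base_change T S w"
proof -
  obtain M J1 J2 where TM: "T = (M, J1, J2)" by (rule prod_cases3)
  obtain P K1 K2 where SP: "S = (P, K1, K2)" by (rule prod_cases3)
  obtain M' J1' J2' where TM': "T' = (M', J1', J2')" by (rule prod_cases3)
  note bc = bc[unfolded SP TM']
  obtain g where g: "g \<in> mod_hom B M M'" "bij_betw g (carrier M) (carrier M')"
    "\<And>x. x \<in> carrier M \<Longrightarrow> g (J1 x) = J1' (g x)" "\<And>x. x \<in> carrier M \<Longrightarrow> g (J2 x) = J2' (g x)"
    using iso unfolding TM TM' by (rule triple_isoE, blast)
  have lm: "left_module B M" "left_module B M'"
    using T[unfolded TM TM', THEN src.is_triple_left_module] by auto
  note u = is_base_changeD[OF bc] and gh = mod_homD[OF g(1)]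
  have g0: "g \<zero>\<^bsub>M\<^esub> = \<zero>\<^bsub>M'\<^esub>"
    by (rule additive_map_zero[OF lm[THEN left_module_abelian_group] gh(1)])
  have gim: "g ` carrier M = carrier M'" using g(2) by (simp add: bij_betw_def)
  define h where "h = inv_into (carrier M) g"
  have hh: "h \<in> mod_hom B M' M"
    unfolding h_def by (rule mod_hom_inverse[OF lm(1) g(1,2)])
  have hg: "h (g x) = x" if "x \<in> carrier M" for x
    using g(2) that by (simp add: h_def bij_betw_def)
  have "\<phi> (f x) = \<zero>\<^bsub>C\<^esub>" if "x \<in> carrier M" "u (g x) = \<zero>\<^bsub>P\<^esub>" "f \<in> functionals B M" for x f
    using u(9)[OF gh(2)[OF that(1)] that(2) functionals_comp_mod_hom[OF that(3) hh]] hg[OF that(1)] by simp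
  then have "is_base_change T S (\<lambda>x. u (g x))"
    unfolding TM SP is_base_change_def
    using g0 gh g u(1) gim by (auto simp: u image_image[symmetric])
  then show ?thesis by (rule that)
qed

text \<open>Both kernels consist of the elements that every functional sends into the kernel of
  \<open>\<phi>\<close>, so the two quotient maps have the same fibres and induce a
  bijection.\<close>

lemma is_base_change_unique:
  assumes T: "is_triple k B T" and bc: "is_base_change T S u" "is_base_change T S' u'"
  shows "triple_iso C S S'"
proof -
  obtain M J1 J2 where TM: "T = (M, J1, J2)" by (rule prod_cases3)
  obtain P K1 K2 where SP: "S = (P, K1, K2)" by (rule prod_cases3)
  obtain P' K1' K2' where SP': "S' = (P', K1', K2')" by (rule prod_cases3)
  note T = T[unfolded TM] and bc = bc[unfolded TM SP SP']
  have lm: "left_module B M" using src.is_triple_left_module[OF T] .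
  interpret M: left_module B M by fact
  note u = is_base_changeD[OF bc(1)] and u' = is_base_changeD[OF bc(2)]
  have eq: "u x = \<zero>\<^bsub>P\<^esub> \<longleftrightarrow> u' x = \<zero>\<^bsub>P'\<^esub>" if "x \<in> carrier M" for x
    using base_change_kernel[OF T bc(1) that] base_change_kernel[OF T bc(2) that] u(9) u'(9) that by blast
  interpret P: left_module C P using is_base_change_left_module[OF lm bc(1)] .
  interpret P': left_module C P' using is_base_change_left_module[OF lm bc(2)] .
  have eq2: "u x = u y \<longleftrightarrow> u' x = u' y" if "x \<in> carrier M" "y \<in> carrier M" for x y
    using eq[of "x \<ominus>\<^bsub>M\<^esub> y"] that u(10) u'(10)
      additive_map_diff[OF M.M.abelian_group_axioms P.M.abelian_group_axioms u(11) that]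
      additive_map_diff[OF M.M.abelian_group_axioms P'.M.abelian_group_axioms u'(11) that] by simp
  define f where "f p = u' (inv_into (carrier M) u p)" for p
  have fu: "f (u x) = u' x" if x: "x \<in> carrier M" for x
  proof -
    have "inv_into (carrier M) u (u x) \<in> carrier M" "u (inv_into (carrier M) u (u x)) = u x"
      using x by (auto intro: inv_into_into f_inv_into_f)
    then show ?thesis using eq2 x by (simp add: f_def)
  qed
  have J: "J1 x \<in> carrier M" "J2 x \<in> carrier M" if "x \<in> carrier M" for x
    using T src.symmetryD(3)[OF lm _ that] unfolding is_triple_iff by blast+
  show ?thesis
    unfolding SP SP'
  proof (rule triple_isoI[of f])
    show "f \<in> mod_hom C P P'"
    proof (rule mod_homI)
      fix p assume "p \<in> carrier P"
      then obtain x where x: "x \<in> carrier M" "p = u x" using u(12) by blast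
      show "f p \<in> carrier P'" using x u'(10) by (simp add: fu)
      fix q assume "q \<in> carrier P"
      then obtain y where y: "y \<in> carrier M" "q = u y" using u(12) by blast
      show "f (p \<oplus>\<^bsub>P\<^esub> q) = f p \<oplus>\<^bsub>P'\<^esub> f q"
        using x y by (simp add: u(3)[symmetric] fu u'(3))
    next
      fix c p assume c: "c \<in> carrier C" and "p \<in> carrier P"
      then obtain x where x: "x \<in> carrier M" "p = u x" using u(12) by blast
      obtain a where a: "a \<in> carrier B" "c = \<phi> a" using \<phi>_lift[OF c] .
      then show "f (c \<odot>\<^bsub>P\<^esub> p) = c \<odot>\<^bsub>P'\<^esub> f p"
        using x by (simp add: u(4)[symmetric] fu u'(4) M.smult_closed)
    qed
    show "bij_betw f (carrier P) (carrier P')"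
      unfolding bij_betw_def
    proof
      show "inj_on f (carrier P)"
        by (rule inj_onI) (use u(12) fu eq2 in metis)
      show "f ` carrier P = carrier P'"
        unfolding u(1)[symmetric] u'(1)[symmetric] image_image by (rule image_cong[OF refl fu])
    qed
    fix p assume "p \<in> carrier P"
    then obtain x where x: "x \<in> carrier M" "p = u x" using u(12) by blast
    show "f (K1 p) = K1' (f p)" "f (K2 p) = K2' (f p)"
      using x J by (simp_all add: u(7,8)[symmetric] fu u'(7,8)[symmetric])
  qed
qed

text \<open>Sending \<open>y\<close> to the tensor of the unit with \<open>y\<close> is onto,
  because the scalar in a tensor can be lifted along \<open>\<phi>\<close> and moved into the second
  factor. Its kernel is controlled by evaluating functionals on the tensor product.\<close>

lemma tensor_is_base_change:
  assumes T: "is_triple k B (M, J1, J2)"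
  shows "is_base_change (M, J1, J2) (triple_base_change \<phi> B C (M, J1, J2))
     (\<lambda>y. tensor_relations \<phi> B C M #>\<^bsub>free_Abelian_group (carrier C \<times> carrier M)\<^esub> frag_of (\<one>\<^bsub>C\<^esub>, y))"
proof -
  have lm: "left_module B M" using src.is_triple_left_module[OF T] .
  interpret M: left_module B M by fact
  define H where "H = free_Abelian_group (carrier C \<times> carrier M)"
  define L where "L = tensor_relations \<phi> B C M"
  define G where "G = {frag_of (c \<oplus>\<^bsub>C\<^esub> c', x) - frag_of (c, x) - frag_of (c', x) | c c' x.
         c \<in> carrier C \<and> c' \<in> carrier C \<and> x \<in> carrier M} \<union>
      {frag_of (c, x \<oplus>\<^bsub>M\<^esub> y) - frag_of (c, x) - frag_of (c, y) | c x y.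
         c \<in> carrier C \<and> x \<in> carrier M \<and> y \<in> carrier M} \<union>
      {frag_of (c \<otimes>\<^bsub>C\<^esub> \<phi> b, x) - frag_of (c, b \<odot>\<^bsub>M\<^esub> x) | c b x.
         c \<in> carrier C \<and> b \<in> carrier B \<and> x \<in> carrier M}"
  have GI: "c \<in> carrier C \<Longrightarrow> c' \<in> carrier C \<Longrightarrow> x \<in> carrier M \<Longrightarrow>
      frag_of (c \<oplus>\<^bsub>C\<^esub> c', x) - frag_of (c, x) - frag_of (c', x) \<in> G"
    "c \<in> carrier C \<Longrightarrow> x \<in> carrier M \<Longrightarrow> y \<in> carrier M \<Longrightarrow>
      frag_of (c, x \<oplus>\<^bsub>M\<^esub> y) - frag_of (c, x) - frag_of (c, y) \<in> G"
    "c \<in> carrier C \<Longrightarrow> b \<in> carrier B \<Longrightarrow> x \<in> carrier M \<Longrightarrow>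
      frag_of (c \<otimes>\<^bsub>C\<^esub> \<phi> b, x) - frag_of (c, b \<odot>\<^bsub>M\<^esub> x) \<in> G" for c c' b x y
    unfolding G_def by blast+
  have G_cases [consumes 1]: thesis if "w \<in> G"
    "\<And>c c' x. w = frag_of (c \<oplus>\<^bsub>C\<^esub> c', x) - frag_of (c, x) - frag_of (c', x) \<Longrightarrow>
      c \<in> carrier C \<Longrightarrow> c' \<in> carrier C \<Longrightarrow> x \<in> carrier M \<Longrightarrow> thesis"
    "\<And>c x y. w = frag_of (c, x \<oplus>\<^bsub>M\<^esub> y) - frag_of (c, x) - frag_of (c, y) \<Longrightarrow>
      c \<in> carrier C \<Longrightarrow> x \<in> carrier M \<Longrightarrow> y \<in> carrier M \<Longrightarrow> thesis"
    "\<And>c b x. w = frag_of (c \<otimes>\<^bsub>C\<^esub> \<phi> b, x) - frag_of (c, b \<odot>\<^bsub>M\<^esub> x) \<Longrightarrow>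
      c \<in> carrier C \<Longrightarrow> b \<in> carrier B \<Longrightarrow> x \<in> carrier M \<Longrightarrow> thesis" for w thesis
    using that unfolding G_def by blast
  have L: "L = generate H G"
    by (simp add: L_def H_def G_def tensor_relations_def)
  interpret H: comm_group H
    unfolding H_def by (rule abelian_free_Abelian_group)
  have Hm: "x \<otimes>\<^bsub>H\<^esub> y = x + y" and H1: "\<one>\<^bsub>H\<^esub> = 0" for x y
    by (simp_all add: H_def)
  have Hi: "inv\<^bsub>H\<^esub> x = - x" if "x \<in> carrier H" for x
    using that by (simp add: H_def)
  have Hf [simp]: "frag_of (c, x) \<in> carrier H" if "c \<in> carrier C" "x \<in> carrier M" for c x
    using that by (simp add: H_def)
  have Hadd: "x + y \<in> carrier H" and Hneg: "- x \<in> carrier H" if "x \<in> carrier H" "y \<in> carrier H" for x y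
    using H.m_closed[OF that] H.inv_closed[OF that(1)] Hi[OF that(1)] by (simp_all add: Hm)
  have Hdiff [simp]: "x - y \<in> carrier H" if "x \<in> carrier H" "y \<in> carrier H" for x y
    using Hadd[OF that(1) Hneg[OF that(2,1)]] by simp
  have GH: "G \<subseteq> carrier H"
    unfolding G_def by (auto simp: M.smult_closed)
  have sub: "subgroup L H"
    unfolding L by (rule H.generate_is_subgroup[OF GH])
  have LH: "L \<subseteq> carrier H" using subgroup.subset[OF sub] .
  have G_L: "x \<in> L" if "x \<in> G" for x
    unfolding L using that by (rule generate.incl)
  have L0: "0 \<in> L" using subgroup.one_closed[OF sub] by (simp add: H1)
  have Ladd: "x + y \<in> L" if "x \<in> L" "y \<in> L" for x y
    using subgroup.m_closed[OF sub that] by (simp add: Hm)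
  have Lneg: "- x \<in> L" if "x \<in> L" for x
    using subgroup.m_inv_closed[OF sub that] Hi that LH by auto
  have Ldiff: "x - y \<in> L" if "x \<in> L" "y \<in> L" for x y
    using Ladd[OF that(1) Lneg[OF that(2)]] by simp
  have subI: "subgroup {w \<in> carrier H. P w} H"
    if "P 0" "\<And>x y. P x \<Longrightarrow> P y \<Longrightarrow> x \<in> carrier H \<Longrightarrow> y \<in> carrier H \<Longrightarrow> P (x + y)"
      "\<And>x. P x \<Longrightarrow> x \<in> carrier H \<Longrightarrow> P (- x)" for P
    by (rule H.subgroupI) (use that H.one_closed in \<open>auto simp: Hm H1 Hi Hadd Hneg\<close>)
  \<comment> \<open>Induction over the generated subgroup: the elements satisfying \<open>P\<close>
    form a subgroup that contains the generators.\<close>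
  have L_induct: "P w" if "w \<in> L" "P 0"
      "\<And>x y. P x \<Longrightarrow> P y \<Longrightarrow> x \<in> carrier H \<Longrightarrow> y \<in> carrier H \<Longrightarrow> P (x + y)"
      "\<And>x. P x \<Longrightarrow> x \<in> carrier H \<Longrightarrow> P (- x)" "\<And>x. x \<in> G \<Longrightarrow> P x" for P w
    using H.generate_subgroup_incl[of G "{w \<in> carrier H. P w}"] subI[of P, OF that(2-4)] that(1,5) GH
    unfolding L by blast
  \<comment> \<open>Cosets are handled as congruence classes modulo \<open>L\<close>; elements of
    the free group are integer-valued functions, so membership is a condition on an ordinary
    difference.\<close>
  define cos where "cos z = L #>\<^bsub>H\<^esub> z" for z
  have cos_mem: "w \<in> cos z \<longleftrightarrow> w - z \<in> L" for w z
    by (auto simp: cos_def r_coset_def Hm) (metis diff_add_cancel)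
  have cos_eq: "cos z = cos w \<longleftrightarrow> z - w \<in> L" for z w
  proof
    assume "cos z = cos w"
    moreover have "z \<in> cos z" by (simp add: cos_mem L0)
    ultimately show "z - w \<in> L" by (simp add: cos_mem)
  next
    assume zw: "z - w \<in> L"
    have "x - z \<in> L \<longleftrightarrow> x - w \<in> L" for x
      using Ladd[OF _ zw, of "x - z"] Ldiff[OF _ zw, of "x - w"] by auto
    then show "cos z = cos w" by (auto simp: cos_mem)
  qed
  interpret N: normal L H
    by (rule H.subgroup_imp_normal[OF sub])
  have cos_add: "cos z <#>\<^bsub>H\<^esub> cos w = cos (z + w)" if "z \<in> carrier H" "w \<in> carrier H" for z w
    using N.rcos_sum[OF that] by (simp add: cos_def Hm)
  define Q where "Q = base_change \<phi> B C M"
  have Qc: "carrier Q = cos ` carrier H"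
    unfolding Q_def base_change_def L_def[symmetric] H_def[symmetric]
    by (auto simp: Let_def FactGroup_def RCOSETS_def cos_def)
  have Qz: "\<zero>\<^bsub>Q\<^esub> = L"
    unfolding Q_def base_change_def L_def[symmetric] H_def[symmetric] by (simp add: Let_def FactGroup_def)
  have Qa: "z \<oplus>\<^bsub>Q\<^esub> w = z <#>\<^bsub>H\<^esub> w" for z w
    unfolding Q_def base_change_def L_def[symmetric] H_def[symmetric] by (simp add: Let_def FactGroup_def)
  have Qs: "c \<odot>\<^bsub>Q\<^esub> z = tensor_map \<phi> B C M (\<lambda>c'. c \<otimes>\<^bsub>C\<^esub> c') (\<lambda>x. x) z" for c z
    unfolding Q_def base_change_def by (simp add: Let_def)
  have L_cos: "L = cos 0" by (auto simp: cos_mem)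
  \<comment> \<open>\<open>\<sigma>\<close> is the twist with which both \<open>g\<close> and
    \<open>h\<close> pass a scalar, so that the balancing relation goes to a balancing relation. It
    is the identity for scalar multiplication and the parity for symmetries.\<close>
  have tensor_map_cos: "tensor_map \<phi> B C M g h (cos z) = cos (frag_extend (\<lambda>(c, x). frag_of (g c, h x)) z)"
    if g: "\<And>c. c \<in> carrier C \<Longrightarrow> g c \<in> carrier C"
        "\<And>c c'. c \<in> carrier C \<Longrightarrow> c' \<in> carrier C \<Longrightarrow> g (c \<oplus>\<^bsub>C\<^esub> c') = g c \<oplus>\<^bsub>C\<^esub> g c'"
        "\<And>c b. c \<in> carrier C \<Longrightarrow> b \<in> carrier B \<Longrightarrow> g (c \<otimes>\<^bsub>C\<^esub> \<phi> b) = g c \<otimes>\<^bsub>C\<^esub> \<phi> (\<sigma> b)"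
      and \<sigma>: "\<And>b. b \<in> carrier B \<Longrightarrow> \<sigma> b \<in> carrier B"
      and h: "\<And>x. x \<in> carrier M \<Longrightarrow> h x \<in> carrier M"
        "\<And>x y. x \<in> carrier M \<Longrightarrow> y \<in> carrier M \<Longrightarrow> h (x \<oplus>\<^bsub>M\<^esub> y) = h x \<oplus>\<^bsub>M\<^esub> h y"
        "\<And>x b. x \<in> carrier M \<Longrightarrow> b \<in> carrier B \<Longrightarrow> h (b \<odot>\<^bsub>M\<^esub> x) = \<sigma> b \<odot>\<^bsub>M\<^esub> h x"
    for g \<sigma> h z
  proof -
    define F where "F = frag_extend (\<lambda>(c, x). frag_of (g c, h x) :: _ \<Rightarrow>\<^sub>0 int)"
    have FL: "F w \<in> L" if "w \<in> L" for w
    proof (rule L_induct[OF that])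
      show "F 0 \<in> L" by (simp add: F_def L0)
      show "F (x + y) \<in> L" if "F x \<in> L" "F y \<in> L" for x y
        using Ladd that by (simp add: F_def frag_extend_add)
      show "F (- x) \<in> L" if "F x \<in> L" for x
        using Lneg that by (simp add: F_def frag_extend_minus)
      fix x assume x: "x \<in> G"
      have "F x \<in> G"
        using x
      proof (cases rule: G_cases)
        case (1 c c' y)
        then show ?thesis using GI(1)[of "g c" "g c'" "h y"] by (simp add: F_def frag_extend_diff g h)
      next
        case (2 c y z)
        then show ?thesis using GI(2)[of "g c" "h y" "h z"] by (simp add: F_def frag_extend_diff g h)
      next
        case (3 c b y)
        then show ?thesis using GI(3)[of "g c" "\<sigma> b" "h y"] by (simp add: F_def frag_extend_diff g h \<sigma>)
      qed
      then show "F x \<in> L" by (rule G_L)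
    qed
    have "cos (F w) = cos (F z)" if "w \<in> cos z" for w
      using FL[of "w - z"] that by (simp add: cos_eq cos_mem F_def frag_extend_diff)
    moreover have "z \<in> cos z" by (simp add: cos_mem L0)
    moreover have "tensor_map \<phi> B C M g h (cos z) = (\<Union>w\<in>cos z. cos (F w))"
      by (simp add: tensor_map_def F_def cos_def L_def H_def)
    ultimately show ?thesis
      unfolding F_def by blast
  qed
  define u where "u y = cos (frag_of (\<one>\<^bsub>C\<^esub>, y))" for y
  note rel2 = G_L[OF GI(2)] and rel3 = G_L[OF GI(3)]
  have u0: "u \<zero>\<^bsub>M\<^esub> = \<zero>\<^bsub>Q\<^esub>"
  proof -
    have "- frag_of (\<one>\<^bsub>C\<^esub>, \<zero>\<^bsub>M\<^esub>) \<in> L" using rel2[of "\<one>\<^bsub>C\<^esub>" "\<zero>\<^bsub>M\<^esub>" "\<zero>\<^bsub>M\<^esub>"] by simp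
    from Lneg[OF this] show ?thesis by (simp add: Qz L_cos u_def cos_eq)
  qed
  have u_add: "u (x \<oplus>\<^bsub>M\<^esub> y) = u x \<oplus>\<^bsub>Q\<^esub> u y" if "x \<in> carrier M" "y \<in> carrier M" for x y
    using rel2[of "\<one>\<^bsub>C\<^esub>" x y] that by (simp add: Qa u_def cos_add cos_eq diff_diff_eq)
  \<comment> \<open>Differences collapse by additivity in the second factor, and a generator
    \<open>(c, x)\<close> with \<open>c = \<phi> b\<close> is congruent to the unit paired with the
    multiple of \<open>x\<close> by \<open>b\<close>.\<close>
  have surj: "\<exists>y\<in>carrier M. cos z = u y" if z: "z \<in> carrier H" for z
  proof -
    have "Poly_Mapping.keys z \<subseteq> carrier C \<times> carrier M" using z by (simp add: H_def)
    then show ?thesis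
    proof (rule free_Abelian_group_induct[where P = "\<lambda>z. \<exists>y\<in>carrier M. cos z = u y"])
      show "\<exists>y\<in>carrier M. cos 0 = u y" using u0 by (auto simp: Qz L_cos intro!: bexI[of _ "\<zero>\<^bsub>M\<^esub>"])
    next
      fix z w assume "\<exists>y\<in>carrier M. cos z = u y" "\<exists>y\<in>carrier M. cos w = u y"
      then obtain x y where xy: "x \<in> carrier M" "cos z = u x" "y \<in> carrier M" "cos w = u y" by blast
      have "frag_of (\<one>\<^bsub>C\<^esub>, x) - frag_of (\<one>\<^bsub>C\<^esub>, x \<ominus>\<^bsub>M\<^esub> y) - frag_of (\<one>\<^bsub>C\<^esub>, y) \<in> L"
        using rel2[of "\<one>\<^bsub>C\<^esub>" "x \<ominus>\<^bsub>M\<^esub> y" y] xy by (simp add: M.M.abelian_simps)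
      moreover have "(z - frag_of (\<one>\<^bsub>C\<^esub>, x)) - (w - frag_of (\<one>\<^bsub>C\<^esub>, y)) \<in> L"
        using Ldiff[of "z - frag_of (\<one>\<^bsub>C\<^esub>, x)" "w - frag_of (\<one>\<^bsub>C\<^esub>, y)"] xy by (simp add: u_def cos_eq)
      ultimately have "(z - frag_of (\<one>\<^bsub>C\<^esub>, x)) - (w - frag_of (\<one>\<^bsub>C\<^esub>, y)) +
         (frag_of (\<one>\<^bsub>C\<^esub>, x) - frag_of (\<one>\<^bsub>C\<^esub>, x \<ominus>\<^bsub>M\<^esub> y) - frag_of (\<one>\<^bsub>C\<^esub>, y)) \<in> L"
        by (rule Ladd[rotated])
      then have "z - w - frag_of (\<one>\<^bsub>C\<^esub>, x \<ominus>\<^bsub>M\<^esub> y) \<in> L" by (simp add: algebra_simps)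
      then show "\<exists>y\<in>carrier M. cos (z - w) = u y"
        using xy by (intro bexI[of _ "x \<ominus>\<^bsub>M\<^esub> y"]) (simp_all add: u_def cos_eq)
    next
      fix a assume "a \<in> carrier C \<times> carrier M"
      then obtain c x where a: "a = (c, x)" "c \<in> carrier C" "x \<in> carrier M" by auto
      obtain b where b: "b \<in> carrier B" "c = \<phi> b" using \<phi>_lift[OF a(2)] .
      show "\<exists>y\<in>carrier M. cos (frag_of a) = u y"
        using rel3[of "\<one>\<^bsub>C\<^esub>" b x] a b
        by (intro bexI[of _ "b \<odot>\<^bsub>M\<^esub> x"]) (simp_all add: u_def cos_eq M.smult_closed)
    qed
  qed
  have uQ: "u y \<in> carrier Q" if "y \<in> carrier M" for y
    using that by (simp add: Qc u_def)
  have u_smult: "u (b \<odot>\<^bsub>M\<^esub> x) = \<phi> b \<odot>\<^bsub>Q\<^esub> u x" if "b \<in> carrier B" "x \<in> carrier M" for b x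
  proof -
    have "\<phi> b \<odot>\<^bsub>Q\<^esub> u x = cos (frag_of (\<phi> b, x))"
      unfolding Qs u_def using that
      by (subst tensor_map_cos[of "\<lambda>c'. \<phi> b \<otimes>\<^bsub>C\<^esub> c'" "\<lambda>b. b" "\<lambda>x. x"]) (simp_all add: tgt.r_distr tgt.m_assoc)
    also have "\<dots> = u (b \<odot>\<^bsub>M\<^esub> x)"
      using rel3[of "\<one>\<^bsub>C\<^esub>" b x] that by (simp add: u_def cos_eq)
    finally show ?thesis by simp
  qed
  have u_J: "u (J x) = restrict (tensor_map \<phi> B C M (parity C) J) (carrier Q) (u x)"
    if J: "J \<in> symmetry_space k B M" and x: "x \<in> carrier M" for J x
  proof -
    note Jd = src.symmetryD[OF lm J]
    have "tensor_map \<phi> B C M (parity C) J (u x) = cos (frag_of (parity C \<one>\<^bsub>C\<^esub>, J x))"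
      unfolding u_def using x
      by (subst tensor_map_cos[of "parity C" "parity B" J])
        (simp_all add: tgt.parity_add tgt.parity_mult \<phi>_parity Jd)
    then show ?thesis
      using uQ[OF x] by (simp add: u_def)
  qed
  have ker: "\<phi> (f x) = \<zero>\<^bsub>C\<^esub>"
    if x: "x \<in> carrier M" and ux: "u x = \<zero>\<^bsub>Q\<^esub>" and f: "f \<in> functionals B M" for x f
  proof -
    note fd = functionalsD(2-4)[OF f]
    \<comment> \<open>The universal property of the free group extends this to an additive map that
      kills all relations and sends the unit tensor \<open>x\<close> to \<open>\<phi> (f x)\<close>;
      a vanishing tensor thus forces this value to vanish.\<close>
    have "(\<lambda>(c, x). c \<otimes>\<^bsub>C\<^esub> \<phi> (f x)) ` (carrier C \<times> carrier M) \<subseteq> carrier (add_monoid C)"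
      using fd by auto
    then obtain ev where ev: "ev \<in> hom H (add_monoid C)"
      "\<And>z. z \<in> carrier C \<times> carrier M \<Longrightarrow> ev (frag_of z) = (\<lambda>(c, x). c \<otimes>\<^bsub>C\<^esub> \<phi> (f x)) z"
      unfolding H_def by (rule comm_group.free_Abelian_group_universal[OF tgt.a_comm_group], blast)
    have evc: "ev z \<in> carrier C" if "z \<in> carrier H" for z
      using ev(1) that by (auto simp: hom_def)
    have ev_add: "ev (z + w) = ev z \<oplus>\<^bsub>C\<^esub> ev w" if "z \<in> carrier H" "w \<in> carrier H" for z w
      using ev(1) that by (auto simp: hom_def Hm)
    have ev_diff: "ev (z - w) = ev z \<ominus>\<^bsub>C\<^esub> ev w" if "z \<in> carrier H" "w \<in> carrier H" for z w
      using ev_add[OF Hdiff[OF that] that(2)] evc[OF that(1)] evc[OF that(2)] evc[OF Hdiff[OF that]]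
      by (simp add: tgt.abelian_simps)
    have ev0: "ev 0 = \<zero>\<^bsub>C\<^esub>"
      using ev_diff[of "frag_of (\<one>\<^bsub>C\<^esub>, x)" "frag_of (\<one>\<^bsub>C\<^esub>, x)"] x evc[of "frag_of (\<one>\<^bsub>C\<^esub>, x)"] by simp
    have H0: "0 \<in> carrier H" using H.one_closed by (simp add: H1)
    have evL: "ev w = \<zero>\<^bsub>C\<^esub>" if "w \<in> L" for w
    proof (rule L_induct[OF that])
      show "ev (x + y) = \<zero>\<^bsub>C\<^esub>" if "ev x = \<zero>\<^bsub>C\<^esub>" "ev y = \<zero>\<^bsub>C\<^esub>" "x \<in> carrier H" "y \<in> carrier H" for x y
        using that by (simp add: ev_add)
      show "ev (- x) = \<zero>\<^bsub>C\<^esub>" if "ev x = \<zero>\<^bsub>C\<^esub>" "x \<in> carrier H" for x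
        using ev_diff[OF H0 that(2)] that ev0 by simp
      fix w assume "w \<in> G"
      then show "ev w = \<zero>\<^bsub>C\<^esub>"
        unfolding G_def
        by (elim UnE CollectE exE conjE)
          (simp_all add: ev_diff ev(2) fd \<phi>_add \<phi>_mult M.smult_closed tgt.l_distr tgt.r_distr
            tgt.m_assoc, simp_all add: fd tgt.abelian_simps)
    qed (rule ev0)
    have "frag_of (\<one>\<^bsub>C\<^esub>, x) \<in> L"
      using ux by (simp add: Qz L_cos u_def cos_eq)
    from evL[OF this] show ?thesis
      using x fd by (simp add: ev(2))
  qed
  have "u ` carrier M = carrier Q"
    using uQ surj unfolding Qc by blast
  moreover have "J1 \<in> symmetry_space k B M" "J2 \<in> symmetry_space k B M"
    using T by (simp_all add: is_triple_iff)
  ultimately have "is_base_change (M, J1, J2) (triple_base_change \<phi> B C (M, J1, J2)) u"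
    unfolding triple_base_change_def Q_def[symmetric] is_base_change_def
    using u0 u_add u_smult u_J ker by (simp add: Q_def[symmetric])
  moreover have "u = (\<lambda>y. tensor_relations \<phi> B C M #>\<^bsub>free_Abelian_group (carrier C \<times> carrier M)\<^esub> frag_of (\<one>\<^bsub>C\<^esub>, y))"
    by (auto simp: u_def cos_def L_def H_def)
  ultimately show ?thesis by simp
qed

lemma base_change_exists:
  assumes "is_triple k B T"
  obtains u where "is_base_change T (triple_base_change \<phi> B C T) u"
proof -
  obtain M J1 J2 where TM: "T = (M, J1, J2)" by (rule prod_cases3)
  show ?thesis
    using tensor_is_base_change assms that unfolding TM by blast
qed

lemma base_change_functor: "triple_functor B C k k (triple_base_change \<phi> B C)"
proof
  fix T S W :: "('b, nat \<Rightarrow> 'b) triple"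
  assume T: "is_triple k B T"
  obtain u where u: "is_base_change T (triple_base_change \<phi> B C T) u"
    using base_change_exists[OF T] .
  show T': "is_triple k C (triple_base_change \<phi> B C T)"
    by (rule base_change_is_triple[OF T u])
  assume S: "is_triple k B S"
  obtain v where v: "is_base_change S (triple_base_change \<phi> B C S) v"
    using base_change_exists[OF S] .
  have S': "is_triple k C (triple_base_change \<phi> B C S)"
    by (rule base_change_is_triple[OF S v])
  assume W: "is_triple k B W" and iso: "triple_iso B (triple_sum T S) W"
  obtain w where w: "is_base_change W (triple_base_change \<phi> B C W) w"
    using base_change_exists[OF W] .
  have TS: "is_triple k B (triple_sum T S)" by (rule src.is_triple_sum[OF T S])
  obtain w' where w': "is_base_change (triple_sum T S) (triple_base_change \<phi> B C W) w'"
    using is_base_change_iso[OF TS W iso w] .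
  have "triple_iso C (triple_sum (triple_base_change \<phi> B C T) (triple_base_change \<phi> B C S)) (triple_base_change \<phi> B C W)"
    by (rule is_base_change_unique[OF TS is_base_change_sum[OF T S u v] w'])
  then show "stably_equiv k C (triple_sum (triple_base_change \<phi> B C T) (triple_base_change \<phi> B C S)) (triple_base_change \<phi> B C W)"
    by (rule tgt.triple_iso_stably_equiv[OF tgt.is_triple_sum[OF T' S'] base_change_is_triple[OF W w]])
next
  fix E :: "('b, nat \<Rightarrow> 'b) triple" assume E: "elementary k B E"
  obtain u where u: "is_base_change E (triple_base_change \<phi> B C E) u"
    using base_change_exists[OF src.elementary_is_triple[OF E]] .
  show "stably_equiv k C (triple_base_change \<phi> B C E) zero_triple"
    by (rule tgt.elementary_stably_zero[OF base_change_elementary[OF E u]])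
qed

lemma induced_map_hom:
  "induced_map k \<phi> B C \<in> hom (difference_group k B) (difference_group k C)"
proof -
  interpret triple_functor B C k k "triple_base_change \<phi> B C" by (rule base_change_functor)
  have "class_map = induced_map k \<phi> B C"
    by (rule ext) (simp add: class_map_def induced_map_def)
  then show ?thesis using class_map_hom by simp
qed

text \<open>Any model of the base change computes the induced map, not only the tensor product. This
  permits the use of models adapted to corners.\<close>

lemma induced_map_class:
  fixes T :: "('b, nat \<Rightarrow> 'b) triple"
  assumes T: "is_triple k B T" and bc: "is_base_change T S u"
  shows "induced_map k \<phi> B C (triple_class k B T) = triple_class k C S"
proof -
  interpret triple_functor B C k k "triple_base_change \<phi> B C" by (rule base_change_functor)
  obtain v where v: "is_base_change T (triple_base_change \<phi> B C T) v"
    using base_change_exists[OF T] .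
  have S: "is_triple k C S" "is_triple k C (triple_base_change \<phi> B C T)"
    using base_change_is_triple[OF T] bc v by blast+
  have "induced_map k \<phi> B C (triple_class k B T) = class_map (triple_class k B T)"
    by (simp add: class_map_def induced_map_def)
  also have "\<dots> = triple_class k C (triple_base_change \<phi> B C T)"
    by (rule class_map_class[OF T])
  also have "\<dots> = triple_class k C S"
    by (rule tgt.triple_class_eq[OF S(2,1) tgt.triple_iso_stably_equiv[OF S(2,1) is_base_change_unique[OF T v bc]]])
  finally show ?thesis .
qed

end

section \<open>Morita equivalence with two-by-two matrices\<close>

text \<open>\<open>B\<close> is the algebra of \<open>2 \<times> 2\<close> matrices over \<open>A\<close>, graded in such a way that the grading
  involution is the entrywise one followed by conjugation with the matrix \<open>(0, 1; -1, 0)\<close>.\<close>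

locale matrix_ring_iso =
  A: normed_graded_ring A + B: normed_graded_ring B
  for A :: "'a gr_alg" (structure) and B :: "'b gr_alg" +
  fixes mat :: "'a \<Rightarrow> 'a \<Rightarrow> 'a \<Rightarrow> 'a \<Rightarrow> 'b" and e11 e12 e21 e22 :: "'b \<Rightarrow> 'a"
  assumes mat_closed [simp]: "a \<in> carrier A \<Longrightarrow> b \<in> carrier A \<Longrightarrow> c \<in> carrier A \<Longrightarrow> d \<in> carrier A \<Longrightarrow>
      mat a b c d \<in> carrier B"
    and entries_closed [simp]: "x \<in> carrier B \<Longrightarrow> e11 x \<in> carrier A" "x \<in> carrier B \<Longrightarrow> e12 x \<in> carrier A"
      "x \<in> carrier B \<Longrightarrow> e21 x \<in> carrier A" "x \<in> carrier B \<Longrightarrow> e22 x \<in> carrier A"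
    and mat_entries: "x \<in> carrier B \<Longrightarrow> mat (e11 x) (e12 x) (e21 x) (e22 x) = x"
    and entries_mat [simp]:
      "a \<in> carrier A \<Longrightarrow> b \<in> carrier A \<Longrightarrow> c \<in> carrier A \<Longrightarrow> d \<in> carrier A \<Longrightarrow> e11 (mat a b c d) = a"
      "a \<in> carrier A \<Longrightarrow> b \<in> carrier A \<Longrightarrow> c \<in> carrier A \<Longrightarrow> d \<in> carrier A \<Longrightarrow> e12 (mat a b c d) = b"
      "a \<in> carrier A \<Longrightarrow> b \<in> carrier A \<Longrightarrow> c \<in> carrier A \<Longrightarrow> d \<in> carrier A \<Longrightarrow> e21 (mat a b c d) = c"
      "a \<in> carrier A \<Longrightarrow> b \<in> carrier A \<Longrightarrow> c \<in> carrier A \<Longrightarrow> d \<in> carrier A \<Longrightarrow> e22 (mat a b c d) = d"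
    and entries_add: "x \<in> carrier B \<Longrightarrow> y \<in> carrier B \<Longrightarrow> e11 (x \<oplus>\<^bsub>B\<^esub> y) = e11 x \<oplus> e11 y"
      "x \<in> carrier B \<Longrightarrow> y \<in> carrier B \<Longrightarrow> e12 (x \<oplus>\<^bsub>B\<^esub> y) = e12 x \<oplus> e12 y"
      "x \<in> carrier B \<Longrightarrow> y \<in> carrier B \<Longrightarrow> e21 (x \<oplus>\<^bsub>B\<^esub> y) = e21 x \<oplus> e21 y"
      "x \<in> carrier B \<Longrightarrow> y \<in> carrier B \<Longrightarrow> e22 (x \<oplus>\<^bsub>B\<^esub> y) = e22 x \<oplus> e22 y"
    and entries_mult:
      "x \<in> carrier B \<Longrightarrow> y \<in> carrier B \<Longrightarrow> e11 (x \<otimes>\<^bsub>B\<^esub> y) = e11 x \<otimes> e11 y \<oplus> e12 x \<otimes> e21 y"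
      "x \<in> carrier B \<Longrightarrow> y \<in> carrier B \<Longrightarrow> e12 (x \<otimes>\<^bsub>B\<^esub> y) = e11 x \<otimes> e12 y \<oplus> e12 x \<otimes> e22 y"
      "x \<in> carrier B \<Longrightarrow> y \<in> carrier B \<Longrightarrow> e21 (x \<otimes>\<^bsub>B\<^esub> y) = e21 x \<otimes> e11 y \<oplus> e22 x \<otimes> e21 y"
      "x \<in> carrier B \<Longrightarrow> y \<in> carrier B \<Longrightarrow> e22 (x \<otimes>\<^bsub>B\<^esub> y) = e21 x \<otimes> e12 y \<oplus> e22 x \<otimes> e22 y"
    and entries_parity: "x \<in> carrier B \<Longrightarrow> e11 (parity B x) = parity A (e22 x)"
      "x \<in> carrier B \<Longrightarrow> e12 (parity B x) = \<ominus> parity A (e21 x)"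
      "x \<in> carrier B \<Longrightarrow> e21 (parity B x) = \<ominus> parity A (e12 x)"
      "x \<in> carrier B \<Longrightarrow> e22 (parity B x) = parity A (e11 x)"
    and entries_bounded: "\<exists>K. \<forall>x\<in>carrier B. nrm A (e11 x) \<le> K * nrm B x \<and> nrm A (e12 x) \<le> K * nrm B x \<and>
        nrm A (e21 x) \<le> K * nrm B x \<and> nrm A (e22 x) \<le> K * nrm B x"
    and mat_bounded: "\<exists>K. \<forall>a\<in>carrier A. \<forall>b\<in>carrier A. \<forall>c\<in>carrier A. \<forall>d\<in>carrier A.
        nrm B (mat a b c d) \<le> K * (nrm A a + nrm A b + nrm A c + nrm A d)"
begin

abbreviation "E11 \<equiv> mat \<one> \<zero> \<zero> \<zero>"
abbreviation "E12 \<equiv> mat \<zero> \<one> \<zero> \<zero>"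
abbreviation "E21 \<equiv> mat \<zero> \<zero> \<one> \<zero>"

lemma matrix_eqI:
  assumes "x \<in> carrier B" "y \<in> carrier B" "e11 x = e11 y" "e12 x = e12 y" "e21 x = e21 y" "e22 x = e22 y"
  shows "x = y"
  by (subst mat_entries[OF assms(1), symmetric], subst mat_entries[OF assms(2), symmetric])
    (simp only: assms(3-6))

lemma mat_mult:
  assumes "a \<in> carrier A" "b \<in> carrier A" "c \<in> carrier A" "d \<in> carrier A"
    "a' \<in> carrier A" "b' \<in> carrier A" "c' \<in> carrier A" "d' \<in> carrier A"
  shows "mat a b c d \<otimes>\<^bsub>B\<^esub> mat a' b' c' d' =
     mat (a \<otimes> a' \<oplus> b \<otimes> c') (a \<otimes> b' \<oplus> b \<otimes> d') (c \<otimes> a' \<oplus> d \<otimes> c') (c \<otimes> b' \<oplus> d \<otimes> d')"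
  by (rule matrix_eqI) (simp_all add: assms entries_mult)

lemma mat_add:
  assumes "a \<in> carrier A" "b \<in> carrier A" "c \<in> carrier A" "d \<in> carrier A"
    "a' \<in> carrier A" "b' \<in> carrier A" "c' \<in> carrier A" "d' \<in> carrier A"
  shows "mat a b c d \<oplus>\<^bsub>B\<^esub> mat a' b' c' d' = mat (a \<oplus> a') (b \<oplus> b') (c \<oplus> c') (d \<oplus> d')"
  by (rule matrix_eqI) (simp_all add: assms entries_add)

lemma mat_parity:
  assumes "a \<in> carrier A" "b \<in> carrier A" "c \<in> carrier A" "d \<in> carrier A"
  shows "parity B (mat a b c d) = mat (parity A d) (\<ominus> parity A c) (\<ominus> parity A b) (parity A a)"
  by (rule matrix_eqI) (simp_all add: assms entries_parity)

lemma mat_zero: "mat \<zero> \<zero> \<zero> \<zero> = \<zero>\<^bsub>B\<^esub>"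
proof -
  have "mat \<zero> \<zero> \<zero> \<zero> \<oplus>\<^bsub>B\<^esub> mat \<zero> \<zero> \<zero> \<zero> = mat \<zero> \<zero> \<zero> \<zero> \<oplus>\<^bsub>B\<^esub> \<zero>\<^bsub>B\<^esub>"
    by (simp add: mat_add)
  then show ?thesis by (simp only: B.add.l_cancel mat_closed A.zero_closed B.zero_closed)
qed

lemma mat_neg:
  assumes "a \<in> carrier A" "b \<in> carrier A" "c \<in> carrier A" "d \<in> carrier A"
  shows "\<ominus>\<^bsub>B\<^esub> mat a b c d = mat (\<ominus> a) (\<ominus> b) (\<ominus> c) (\<ominus> d)"
  by (rule B.minus_equality) (simp_all add: assms mat_add mat_zero A.l_neg)

text \<open>Multiplied by the unit of \<open>B\<close> from the right the matrix gives itself, while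
  by its entries it acts as a left unit.\<close>

lemma mat_one: "mat \<one> \<zero> \<zero> \<one> = \<one>\<^bsub>B\<^esub>"
proof -
  have "mat \<one> \<zero> \<zero> \<one> \<otimes>\<^bsub>B\<^esub> \<one>\<^bsub>B\<^esub> = \<one>\<^bsub>B\<^esub>"
    by (rule matrix_eqI) (simp_all add: entries_mult del: B.r_one)
  then show ?thesis by simp
qed

lemma entries_one: "e11 \<one>\<^bsub>B\<^esub> = \<one>" "e12 \<one>\<^bsub>B\<^esub> = \<zero>" "e21 \<one>\<^bsub>B\<^esub> = \<zero>" "e22 \<one>\<^bsub>B\<^esub> = \<one>"
  unfolding mat_one[symmetric] by simp_all

text \<open>A matrix is the sum of its four one-entry matrices, and each of these depends on its
  entry through a bounded additive map.\<close>

lemma cont_path_mat: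
  assumes "cont_path A a" "cont_path A b" "cont_path A c" "cont_path A d"
    and "\<And>t. t \<in> {0..1} \<Longrightarrow> a t \<in> carrier A" "\<And>t. t \<in> {0..1} \<Longrightarrow> b t \<in> carrier A"
    and "\<And>t. t \<in> {0..1} \<Longrightarrow> c t \<in> carrier A" "\<And>t. t \<in> {0..1} \<Longrightarrow> d t \<in> carrier A"
  shows "cont_path B (\<lambda>t. mat (a t) (b t) (c t) (d t))"
proof -
  obtain K where K: "\<And>a b c d. a \<in> carrier A \<Longrightarrow> b \<in> carrier A \<Longrightarrow> c \<in> carrier A \<Longrightarrow> d \<in> carrier A \<Longrightarrow>
      nrm B (mat a b c d) \<le> K * (nrm A a + nrm A b + nrm A c + nrm A d)"
    using mat_bounded by blast
  have "cont_path B (\<lambda>t. mat (a t) \<zero> \<zero> \<zero>)"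
    by (rule B.cont_path_image[OF A.normed_graded_ring_axioms assms(1), where F = "\<lambda>x. mat x \<zero> \<zero> \<zero>" and C = K])
      (use K[of _ \<zero> \<zero> \<zero>] assms(5) in \<open>auto simp: additive_map_def mat_add\<close>)
  moreover have "cont_path B (\<lambda>t. mat \<zero> (b t) \<zero> \<zero>)"
    by (rule B.cont_path_image[OF A.normed_graded_ring_axioms assms(2), where F = "\<lambda>x. mat \<zero> x \<zero> \<zero>" and C = K])
      (use K[of \<zero> _ \<zero> \<zero>] assms(6) in \<open>auto simp: additive_map_def mat_add\<close>)
  moreover have "cont_path B (\<lambda>t. mat \<zero> \<zero> (c t) \<zero>)"
    by (rule B.cont_path_image[OF A.normed_graded_ring_axioms assms(3), where F = "\<lambda>x. mat \<zero> \<zero> x \<zero>" and C = K])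
      (use K[of \<zero> \<zero> _ \<zero>] assms(7) in \<open>auto simp: additive_map_def mat_add\<close>)
  moreover have "cont_path B (\<lambda>t. mat \<zero> \<zero> \<zero> (d t))"
    by (rule B.cont_path_image[OF A.normed_graded_ring_axioms assms(4), where F = "\<lambda>x. mat \<zero> \<zero> \<zero> x" and C = K])
      (use K[of \<zero> \<zero> \<zero>] assms(8) in \<open>auto simp: additive_map_def mat_add\<close>)
  ultimately have "cont_path B (\<lambda>t. (mat (a t) \<zero> \<zero> \<zero> \<oplus>\<^bsub>B\<^esub> mat \<zero> (b t) \<zero> \<zero>) \<oplus>\<^bsub>B\<^esub> (mat \<zero> \<zero> (c t) \<zero> \<oplus>\<^bsub>B\<^esub> mat \<zero> \<zero> \<zero> (d t)))"
    using assms(5-8) by (intro B.cont_path_add) auto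
  then show ?thesis
    by (rule B.cont_path_cong) (use assms(5-8) in \<open>simp add: mat_add\<close>)
qed

subsection \<open>From \<open>B\<close>-modules to \<open>A\<close>-modules\<close>

text \<open>The image of the idempotent \<open>E11\<close>, described as its fixed points so that
  membership is an equation.\<close>

definition corner :: "('b, 'm) module \<Rightarrow> ('a, 'm) module" where
  "corner N =
     \<lparr>carrier = {x \<in> carrier N. E11 \<odot>\<^bsub>N\<^esub> x = x}, monoid.mult = undefined, monoid.one = undefined,
      ring.zero = \<zero>\<^bsub>N\<^esub>, ring.add = (\<oplus>\<^bsub>N\<^esub>), module.smult = (\<lambda>a x. mat a \<zero> \<zero> \<zero> \<odot>\<^bsub>N\<^esub> x)\<rparr>"

text \<open>With \<open>w = (0, 1; -1, 0)\<close>, this is the restriction of \<open>w \<epsilon>\<close>, which commutes with all matrices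
  over the real numbers.\<close>

definition corner_sym :: "('b, 'm) module \<Rightarrow> ('m \<Rightarrow> 'm) \<Rightarrow> 'm \<Rightarrow> 'm" where
  "corner_sym N \<epsilon> = (\<lambda>x\<in>carrier (corner N). E12 \<odot>\<^bsub>N\<^esub> \<epsilon> x)"

definition corner_triple :: "('b, 'm) triple \<Rightarrow> ('a, 'm) triple" where
  "corner_triple = (\<lambda>(N, \<epsilon>1, \<epsilon>2). (corner N, corner_sym N \<epsilon>1, corner_sym N \<epsilon>2))"

lemma corner_simps [simp]:
  "x \<in> carrier (corner N) \<longleftrightarrow> x \<in> carrier N \<and> E11 \<odot>\<^bsub>N\<^esub> x = x"
  "\<zero>\<^bsub>corner N\<^esub> = \<zero>\<^bsub>N\<^esub>" "x \<oplus>\<^bsub>corner N\<^esub> y = x \<oplus>\<^bsub>N\<^esub> y" "a \<odot>\<^bsub>corner N\<^esub> x = mat a \<zero> \<zero> \<zero> \<odot>\<^bsub>N\<^esub> x"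
  by (simp_all add: corner_def)

lemma corner_triple_eq: "corner_triple (N, \<epsilon>1, \<epsilon>2) = (corner N, corner_sym N \<epsilon>1, corner_sym N \<epsilon>2)"
  by (simp add: corner_triple_def)

context
  fixes N :: "('b, 'm) module"
  assumes N: "left_module B N"
begin

interpretation N: left_module B N by (rule N)

lemma mat_smult_closed [simp]:
  "a \<in> carrier A \<Longrightarrow> b \<in> carrier A \<Longrightarrow> c \<in> carrier A \<Longrightarrow> d \<in> carrier A \<Longrightarrow> x \<in> carrier N \<Longrightarrow>
    mat a b c d \<odot>\<^bsub>N\<^esub> x \<in> carrier N"
  by (simp add: N.smult_closed)

lemma mat_smult_smult:
  assumes "a \<in> carrier A" "b \<in> carrier A" "c \<in> carrier A" "d \<in> carrier A"
    "a' \<in> carrier A" "b' \<in> carrier A" "c' \<in> carrier A" "d' \<in> carrier A" "x \<in> carrier N"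
  shows "mat a b c d \<odot>\<^bsub>N\<^esub> (mat a' b' c' d' \<odot>\<^bsub>N\<^esub> x) =
     mat (a \<otimes> a' \<oplus> b \<otimes> c') (a \<otimes> b' \<oplus> b \<otimes> d') (c \<otimes> a' \<oplus> d \<otimes> c') (c \<otimes> b' \<oplus> d \<otimes> d') \<odot>\<^bsub>N\<^esub> x"
  using assms by (simp add: N.smult_assoc[symmetric] mat_mult)

lemma mat_smult_add:
  assumes "a \<in> carrier A" "b \<in> carrier A" "c \<in> carrier A" "d \<in> carrier A"
    "a' \<in> carrier A" "b' \<in> carrier A" "c' \<in> carrier A" "d' \<in> carrier A" "x \<in> carrier N"
  shows "mat a b c d \<odot>\<^bsub>N\<^esub> x \<oplus>\<^bsub>N\<^esub> mat a' b' c' d' \<odot>\<^bsub>N\<^esub> x =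
     mat (a \<oplus> a') (b \<oplus> b') (c \<oplus> c') (d \<oplus> d') \<odot>\<^bsub>N\<^esub> x"
  using assms by (simp add: N.smult_l_distr[symmetric] mat_add)

lemma mat_one_smult: "x \<in> carrier N \<Longrightarrow> mat \<one> \<zero> \<zero> \<one> \<odot>\<^bsub>N\<^esub> x = x"
  by (simp add: mat_one N.smult_one)

lemma corner_projections:
  assumes "x \<in> carrier N" "a \<in> carrier A" "b \<in> carrier A"
  shows "mat a b \<zero> \<zero> \<odot>\<^bsub>N\<^esub> x \<in> carrier (corner N)"
  using assms by (simp add: mat_smult_smult)

text \<open>\<open>E21\<close> times \<open>E12\<close> is the idempotent complementary to
  \<open>E11\<close>, so \<open>N\<close> is recovered from two copies of its corner: the elements
  \<open>E11\<close> and \<open>E12\<close> times \<open>x\<close>.\<close>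

lemma corner_decomposition:
  assumes "x \<in> carrier N"
  shows "E11 \<odot>\<^bsub>N\<^esub> x \<oplus>\<^bsub>N\<^esub> E21 \<odot>\<^bsub>N\<^esub> (E12 \<odot>\<^bsub>N\<^esub> x) = x"
  using assms by (simp add: mat_smult_smult mat_smult_add mat_one_smult)

lemma corner_left_module: "left_module A (corner N)"
proof (rule left_moduleI[OF A.ring_axioms])
  show "abelian_group (corner N)"
  proof (rule abelian_groupI)
    fix x assume x: "x \<in> carrier (corner N)"
    then show "\<exists>y\<in>carrier (corner N). y \<oplus>\<^bsub>corner N\<^esub> x = \<zero>\<^bsub>corner N\<^esub>"
      by (intro bexI[of _ "\<ominus>\<^bsub>N\<^esub> x"]) (auto simp: N.M.l_neg N.smult_neg_right)
    fix y z assume y: "y \<in> carrier (corner N)" "z \<in> carrier (corner N)"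
    show "x \<oplus>\<^bsub>corner N\<^esub> y \<oplus>\<^bsub>corner N\<^esub> z = x \<oplus>\<^bsub>corner N\<^esub> (y \<oplus>\<^bsub>corner N\<^esub> z)"
      using x y by (simp add: N.M.a_assoc)
  next
    fix x y assume "x \<in> carrier (corner N)" "y \<in> carrier (corner N)"
    then show "x \<oplus>\<^bsub>corner N\<^esub> y = y \<oplus>\<^bsub>corner N\<^esub> x"
      by (simp add: N.M.a_comm)
  qed (auto simp: N.smult_r_distr)
qed (auto simp: mat_smult_smult N.smult_r_distr mat_smult_add)

lemma corner_neg:
  assumes "x \<in> carrier (corner N)"
  shows "\<ominus>\<^bsub>corner N\<^esub> x = \<ominus>\<^bsub>N\<^esub> x"
proof -
  interpret P: left_module A "corner N" by (rule corner_left_module)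
  show ?thesis
    using assms by (intro P.M.minus_equality) (auto simp: N.M.l_neg N.smult_neg_right)
qed

text \<open>Applying \<open>h\<close> to the two corner components of \<open>y\<close> gives a
  column, placed in the first column of a matrix so that \<open>B\<close> acts on it from the left.
  Every functional on the corner thus occurs as an entry of one on \<open>N\<close>, which is how
  continuity and kernels are compared.\<close>

lemma corner_functional:
  assumes h: "h \<in> functionals A (corner N)"
  shows "(\<lambda>y. mat (h (E11 \<odot>\<^bsub>N\<^esub> y)) \<zero> (h (E12 \<odot>\<^bsub>N\<^esub> y)) \<zero>) \<in> functionals B N"
proof -
  note hd = functionalsD(2-4)[OF h]
  have hc: "h (E11 \<odot>\<^bsub>N\<^esub> y) \<in> carrier A" "h (E12 \<odot>\<^bsub>N\<^esub> y) \<in> carrier A"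
    if "y \<in> carrier N" for y
    using hd(1) corner_projections that by auto
  have h2: "h (mat a b \<zero> \<zero> \<odot>\<^bsub>N\<^esub> y) = a \<otimes> h (E11 \<odot>\<^bsub>N\<^esub> y) \<oplus> b \<otimes> h (E12 \<odot>\<^bsub>N\<^esub> y)"
    if "y \<in> carrier N" "a \<in> carrier A" "b \<in> carrier A" for a b y
  proof -
    have "mat a b \<zero> \<zero> \<odot>\<^bsub>N\<^esub> y = a \<odot>\<^bsub>corner N\<^esub> (E11 \<odot>\<^bsub>N\<^esub> y) \<oplus>\<^bsub>corner N\<^esub> b \<odot>\<^bsub>corner N\<^esub> (E12 \<odot>\<^bsub>N\<^esub> y)"
      using that by (simp add: mat_smult_smult mat_smult_add)
    moreover have "a \<odot>\<^bsub>corner N\<^esub> (E11 \<odot>\<^bsub>N\<^esub> y) \<in> carrier (corner N)"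
      "b \<odot>\<^bsub>corner N\<^esub> (E12 \<odot>\<^bsub>N\<^esub> y) \<in> carrier (corner N)"
      using that by (simp_all add: mat_smult_smult)
    ultimately have "h (mat a b \<zero> \<zero> \<odot>\<^bsub>N\<^esub> y) = h (a \<odot>\<^bsub>corner N\<^esub> (E11 \<odot>\<^bsub>N\<^esub> y))
        \<oplus> h (b \<odot>\<^bsub>corner N\<^esub> (E12 \<odot>\<^bsub>N\<^esub> y))"
      using hd(2) by (simp only:)
    also have "\<dots> = a \<otimes> h (E11 \<odot>\<^bsub>N\<^esub> y) \<oplus> b \<otimes> h (E12 \<odot>\<^bsub>N\<^esub> y)"
      using hd(3)[OF that(2) corner_projections[OF that(1), of \<one> \<zero>]]
        hd(3)[OF that(3) corner_projections[OF that(1), of \<zero> \<one>]] by simp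
    finally show ?thesis .
  qed
  show ?thesis
  proof (rule functionalsI)
    fix y assume y: "y \<in> carrier N"
    show "mat (h (E11 \<odot>\<^bsub>N\<^esub> y)) \<zero> (h (E12 \<odot>\<^bsub>N\<^esub> y)) \<zero> \<in> carrier B"
      using hc[OF y] by simp
    fix z assume z: "z \<in> carrier N"
    have "h (mat a b \<zero> \<zero> \<odot>\<^bsub>N\<^esub> (y \<oplus>\<^bsub>N\<^esub> z)) = h (mat a b \<zero> \<zero> \<odot>\<^bsub>N\<^esub> y) \<oplus> h (mat a b \<zero> \<zero> \<odot>\<^bsub>N\<^esub> z)"
      if "a \<in> carrier A" "b \<in> carrier A" for a b
      using hd(2)[OF corner_projections[OF y that] corner_projections[OF z that]] that y z
      by (simp add: N.smult_r_distr)
    then show "mat (h (E11 \<odot>\<^bsub>N\<^esub> (y \<oplus>\<^bsub>N\<^esub> z))) \<zero> (h (E12 \<odot>\<^bsub>N\<^esub> (y \<oplus>\<^bsub>N\<^esub> z))) \<zero>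
      = mat (h (E11 \<odot>\<^bsub>N\<^esub> y)) \<zero> (h (E12 \<odot>\<^bsub>N\<^esub> y)) \<zero> \<oplus>\<^bsub>B\<^esub>
        mat (h (E11 \<odot>\<^bsub>N\<^esub> z)) \<zero> (h (E12 \<odot>\<^bsub>N\<^esub> z)) \<zero>"
      using hc[OF y] hc[OF z] by (simp add: mat_add)
  next
    fix b y assume b: "b \<in> carrier B" and y: "y \<in> carrier N"
    define p q r s where "p = e11 b" and "q = e12 b" and "r = e21 b" and "s = e22 b"
    have e: "b = mat p q r s" and c: "p \<in> carrier A" "q \<in> carrier A" "r \<in> carrier A" "s \<in> carrier A"
      using mat_entries[OF b] b by (simp_all add: p_def q_def r_def s_def)
    show "mat (h (E11 \<odot>\<^bsub>N\<^esub> (b \<odot>\<^bsub>N\<^esub> y))) \<zero> (h (E12 \<odot>\<^bsub>N\<^esub> (b \<odot>\<^bsub>N\<^esub> y))) \<zero>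
      = b \<otimes>\<^bsub>B\<^esub> mat (h (E11 \<odot>\<^bsub>N\<^esub> y)) \<zero> (h (E12 \<odot>\<^bsub>N\<^esub> y)) \<zero>"
      unfolding e using c y hc[OF y] h2[OF y c(1,2)] h2[OF y c(3,4)]
      by (simp add: mat_smult_smult mat_mult)
  qed
qed

text \<open>Each pair of a dual basis of \<open>N\<close> yields two for the corner:
  \<open>E11\<close> times the term with coefficient \<open>fs k x\<close> involves only the first
  row of this coefficient, with \<open>e11\<close> multiplying \<open>E11\<close> times
  \<open>xs k\<close> and \<open>e12\<close> multiplying \<open>E12\<close> times
  \<open>xs k\<close>.\<close>

lemma corner_fg_projective:
  assumes "fg_projective B N"
  shows "fg_projective A (corner N)"
proof -
  obtain n :: nat and xs fs where d: "dual_basis B N {..<n} xs fs"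
    using fg_projective_dual_basis[OF assms] by metis
  note d = dual_basisD[OF d]
  interpret P: left_module A "corner N" by (rule corner_left_module)
  define ys where "ys = case_sum (\<lambda>k. E11 \<odot>\<^bsub>N\<^esub> xs k) (\<lambda>k. E12 \<odot>\<^bsub>N\<^esub> xs k)"
  define gs where "gs = case_sum (\<lambda>k x. e11 (fs k x)) (\<lambda>k x. e12 (fs k x))"
  have ys: "ys k \<in> carrier (corner N)" if "k \<in> Inl ` {..<n} \<union> Inr ` {..<n}" for k
    using that d(2) corner_projections[of _ \<one> \<zero>] corner_projections[of _ \<zero> \<one>] by (auto simp: ys_def)
  have gs: "gs k \<in> functionals A (corner N)" if k: "k \<in> Inl ` {..<n} \<union> Inr ` {..<n}" for k
  proof (rule functionalsI)
    obtain j where j: "j < n" "k = Inl j \<or> k = Inr j" using k by auto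
    note f = functionalsD(2-4)[OF d(3), of j] d(4)[of j]
    fix x assume x: "x \<in> carrier (corner N)"
    show "gs k x \<in> carrier A" using j f x by (auto simp: gs_def)
    show "gs k (a \<odot>\<^bsub>corner N\<^esub> x) = a \<otimes> gs k x" if "a \<in> carrier A" for a
      using j x that f(3)[of "mat a \<zero> \<zero> \<zero>" x] f(1)[of x] by (auto simp: gs_def entries_mult)
    fix y assume y: "y \<in> carrier (corner N)"
    show "gs k (x \<oplus>\<^bsub>corner N\<^esub> y) = gs k x \<oplus> gs k y"
      using j x y f(2)[of x y] f(1)[of x] f(1)[of y] by (auto simp: gs_def entries_add)
  qed
  have "dual_basis A (corner N) (Inl ` {..<n} \<union> Inr ` {..<n}) ys gs"
    unfolding dual_basis_def
  proof (intro conjI ballI ys gs)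
    fix x assume x: "x \<in> carrier (corner N)"
    have t: "gs k x \<odot>\<^bsub>corner N\<^esub> ys k \<in> carrier (corner N)" if "k \<in> Inl ` {..<n} \<union> Inr ` {..<n}" for k
      by (rule P.smult_closed[OF functionalsD(2)[OF gs[OF that] x] ys[OF that]])
    have inc: "additive_map (corner N) N (\<lambda>x. x)"
      by (auto simp: additive_map_def)
    have "(\<Oplus>\<^bsub>corner N\<^esub>k\<in>Inl ` {..<n} \<union> Inr ` {..<n}. gs k x \<odot>\<^bsub>corner N\<^esub> ys k)
      = (\<Oplus>\<^bsub>corner N\<^esub>k\<in>Inl ` {..<n}. gs k x \<odot>\<^bsub>corner N\<^esub> ys k) \<oplus>\<^bsub>corner N\<^esub>
        (\<Oplus>\<^bsub>corner N\<^esub>k\<in>Inr ` {..<n}. gs k x \<odot>\<^bsub>corner N\<^esub> ys k)"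
      by (rule P.M.finsum_Un_disjoint) (use t in auto)
    also have "(\<Oplus>\<^bsub>corner N\<^esub>k\<in>Inl ` {..<n}. gs k x \<odot>\<^bsub>corner N\<^esub> ys k)
        = (\<Oplus>\<^bsub>corner N\<^esub>k\<in>{..<n}. gs (Inl k) x \<odot>\<^bsub>corner N\<^esub> ys (Inl k))"
      using t by (intro P.M.finsum_reindex) auto
    also have "(\<Oplus>\<^bsub>corner N\<^esub>k\<in>Inr ` {..<n}. gs k x \<odot>\<^bsub>corner N\<^esub> ys k)
        = (\<Oplus>\<^bsub>corner N\<^esub>k\<in>{..<n}. gs (Inr k) x \<odot>\<^bsub>corner N\<^esub> ys (Inr k))"
      using t by (intro P.M.finsum_reindex) auto
    also have "(\<Oplus>\<^bsub>corner N\<^esub>k\<in>{..<n}. gs (Inl k) x \<odot>\<^bsub>corner N\<^esub> ys (Inl k)) \<oplus>\<^bsub>corner N\<^esub>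
        (\<Oplus>\<^bsub>corner N\<^esub>k\<in>{..<n}. gs (Inr k) x \<odot>\<^bsub>corner N\<^esub> ys (Inr k))
      = (\<Oplus>\<^bsub>corner N\<^esub>k\<in>{..<n}. gs (Inl k) x \<odot>\<^bsub>corner N\<^esub> ys (Inl k) \<oplus>\<^bsub>corner N\<^esub> gs (Inr k) x \<odot>\<^bsub>corner N\<^esub> ys (Inr k))"
      by (rule P.M.finsum_addf[symmetric]) (use t in \<open>auto simp del: corner_simps\<close>)
    also have "\<dots> = (\<Oplus>\<^bsub>N\<^esub>k\<in>{..<n}. gs (Inl k) x \<odot>\<^bsub>corner N\<^esub> ys (Inl k) \<oplus>\<^bsub>corner N\<^esub> gs (Inr k) x \<odot>\<^bsub>corner N\<^esub> ys (Inr k))"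
      by (rule additive_map_finsum[OF P.M.abelian_group_axioms N.M.abelian_group_axioms inc])
        (use t in \<open>auto simp del: corner_simps\<close>)
    also have "\<dots> = (\<Oplus>\<^bsub>N\<^esub>k\<in>{..<n}. E11 \<odot>\<^bsub>N\<^esub> (fs k x \<odot>\<^bsub>N\<^esub> xs k))"
    proof (rule N.M.finsum_cong')
      fix k assume k: "k \<in> {..<n}"
      have fx: "fs k x \<in> carrier B" using d(4)[OF k] x by simp
      define p q r s where "p = e11 (fs k x)" and "q = e12 (fs k x)" and "r = e21 (fs k x)" and "s = e22 (fs k x)"
      have e: "fs k x = mat p q r s" and c: "p \<in> carrier A" "q \<in> carrier A" "r \<in> carrier A" "s \<in> carrier A"
        using mat_entries[OF fx] fx by (simp_all add: p_def q_def r_def s_def)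
      show "gs (Inl k) x \<odot>\<^bsub>corner N\<^esub> ys (Inl k) \<oplus>\<^bsub>corner N\<^esub> gs (Inr k) x \<odot>\<^bsub>corner N\<^esub> ys (Inr k)
         = E11 \<odot>\<^bsub>N\<^esub> (fs k x \<odot>\<^bsub>N\<^esub> xs k)"
        using c d(2)[OF k] by (simp add: gs_def ys_def e mat_smult_smult mat_smult_add)
    qed (use d x in \<open>auto intro!: N.smult_closed\<close>)
    also have "\<dots> = E11 \<odot>\<^bsub>N\<^esub> (\<Oplus>\<^bsub>N\<^esub>k\<in>{..<n}. fs k x \<odot>\<^bsub>N\<^esub> xs k)"
      by (rule N.smult_finsum[symmetric]) (use d x in \<open>auto intro!: N.smult_closed\<close>)
    also have "\<dots> = x"
      using d(5)[of x] x by simp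
    finally show "(\<Oplus>\<^bsub>corner N\<^esub>k\<in>Inl ` {..<n} \<union> Inr ` {..<n}. gs k x \<odot>\<^bsub>corner N\<^esub> ys k) = x" .
  qed simp
  then show ?thesis
    by (rule fg_projectiveI[OF corner_left_module])
qed

lemma symmetry_mat:
  assumes "\<epsilon> \<in> symmetry_space k B N" "x \<in> carrier N"
    "a \<in> carrier A" "b \<in> carrier A" "c \<in> carrier A" "d \<in> carrier A"
  shows "\<epsilon> (mat a b c d \<odot>\<^bsub>N\<^esub> x) = mat (parity A d) (\<ominus> parity A c) (\<ominus> parity A b) (parity A a) \<odot>\<^bsub>N\<^esub> \<epsilon> x"
  using B.symmetryD(5)[OF N assms(1)] assms(2-6) by (simp add: mat_parity)

lemma corner_symmetry:
  assumes "\<epsilon> \<in> symmetry_space Grading B N"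
  shows "corner_sym N \<epsilon> \<in> symmetry_space Polarization A (corner N)"
proof -
  note \<epsilon> = B.symmetryD[OF N assms] and \<epsilon>m = symmetry_mat[OF assms]
  have J: "corner_sym N \<epsilon> x = E12 \<odot>\<^bsub>N\<^esub> \<epsilon> x" if "x \<in> carrier (corner N)" for x
    using that by (simp add: corner_sym_def)
  have Jc: "E12 \<odot>\<^bsub>N\<^esub> \<epsilon> x \<in> carrier (corner N)" if "x \<in> carrier (corner N)" for x
    using that \<epsilon>(3) corner_projections[of "\<epsilon> x" \<zero> \<one>] by simp
  show ?thesis
  proof (rule A.symmetryI[OF corner_left_module])
    show "corner_sym N \<epsilon> \<in> extensional (carrier (corner N))"
      unfolding corner_sym_def by (rule restrict_extensional)
    fix x assume x: "x \<in> carrier (corner N)"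
    then have xN: "x \<in> carrier N" by simp
    show "corner_sym N \<epsilon> x \<in> carrier (corner N)"
      using Jc[OF x] J[OF x] by simp
    have "corner_sym N \<epsilon> (corner_sym N \<epsilon> x) = E12 \<odot>\<^bsub>N\<^esub> \<epsilon> (E12 \<odot>\<^bsub>N\<^esub> \<epsilon> x)"
      using J[OF x] J[OF Jc[OF x]] by simp
    \<comment> \<open>By skewlinearity \<open>\<epsilon>\<close> passes \<open>E12\<close> as its
      parity, which is the negative of \<open>E21\<close>, and \<open>\<epsilon>\<close> squares to
      the identity. As \<open>E12\<close> times \<open>E21\<close> is \<open>E11\<close>, the sign
      of the square comes out negative.\<close>
    also have "\<dots> = mat (\<ominus> \<one>) \<zero> \<zero> \<zero> \<odot>\<^bsub>N\<^esub> x"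
      using xN \<epsilon>(3,6) by (simp add: \<epsilon>m mat_smult_smult sym_square_def)
    also have "\<dots> = (\<ominus>\<^bsub>B\<^esub> E11) \<odot>\<^bsub>N\<^esub> x"
      by (simp add: mat_neg)
    also have "\<dots> = \<ominus>\<^bsub>N\<^esub> x"
      using x by (simp add: N.smult_neg_left)
    finally show "corner_sym N \<epsilon> (corner_sym N \<epsilon> x) = sym_square Polarization (corner N) x"
      using corner_neg[OF x] by (simp add: sym_square_def)
    show "corner_sym N \<epsilon> (a \<odot>\<^bsub>corner N\<^esub> x) = parity A a \<odot>\<^bsub>corner N\<^esub> corner_sym N \<epsilon> x" if a: "a \<in> carrier A" for a
    proof -
      have "a \<odot>\<^bsub>corner N\<^esub> x \<in> carrier (corner N)"
        using left_module.smult_closed[OF corner_left_module a x] .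
      then show ?thesis
        using J[OF x] J[of "a \<odot>\<^bsub>corner N\<^esub> x"] a xN \<epsilon>(3) by (simp add: \<epsilon>m mat_smult_smult)
    qed
    fix y assume y: "y \<in> carrier (corner N)"
    have "x \<oplus>\<^bsub>corner N\<^esub> y \<in> carrier (corner N)"
      using x y by (simp add: N.smult_r_distr)
    then show "corner_sym N \<epsilon> (x \<oplus>\<^bsub>corner N\<^esub> y) = corner_sym N \<epsilon> x \<oplus>\<^bsub>corner N\<^esub> corner_sym N \<epsilon> y"
      using J[OF x] J[OF y] J[of "x \<oplus>\<^bsub>corner N\<^esub> y"] x y \<epsilon>(3,4) by (simp add: N.smult_r_distr)
  qed
qed

end

lemma corner_is_triple:
  assumes "is_triple Grading B T"
  shows "is_triple Polarization A (corner_triple T)"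
proof -
  obtain N \<epsilon>1 \<epsilon>2 where T: "T = (N, \<epsilon>1, \<epsilon>2)" by (rule prod_cases3)
  have N: "left_module B N"
    using B.is_triple_left_module assms unfolding T by blast
  show ?thesis
    using assms corner_fg_projective[OF N] corner_symmetry[OF N]
    unfolding T corner_triple_eq is_triple_iff by blast
qed

lemma corner_elementary:
  assumes "elementary Grading B T"
  shows "elementary Polarization A (corner_triple T)"
proof -
  obtain N \<epsilon>1 \<epsilon>2 where T: "T = (N, \<epsilon>1, \<epsilon>2)" by (rule prod_cases3)
  have t: "is_triple Grading B (N, \<epsilon>1, \<epsilon>2)"
    using B.elementary_is_triple assms unfolding T by blast
  have N: "left_module B N" using B.is_triple_left_module[OF t] .
  obtain p where p: "p 0 = \<epsilon>1" "p 1 = \<epsilon>2" "\<And>t. t \<in> {0..1::real} \<Longrightarrow> p t \<in> symmetry_space Grading B N"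
    "\<And>x h. x \<in> carrier N \<Longrightarrow> h \<in> functionals B N \<Longrightarrow> cont_path B (\<lambda>t. h (p t x))"
    using assms unfolding T B.elementary_iff sym_path_def by blast
  have "sym_path Polarization A (corner N) (corner_sym N \<epsilon>1) (corner_sym N \<epsilon>2)"
    unfolding sym_path_def
  proof (intro exI[of _ "\<lambda>t. corner_sym N (p t)"] conjI ballI)
    show "corner_sym N (p 0) = corner_sym N \<epsilon>1" "corner_sym N (p 1) = corner_sym N \<epsilon>2"
      by (simp_all add: p)
    show "corner_sym N (p t) \<in> symmetry_space Polarization A (corner N)" if "t \<in> {0..1}" for t
      by (rule corner_symmetry[OF N p(3)[OF that]])
    fix x h assume x: "x \<in> carrier (corner N)" and h: "h \<in> functionals A (corner N)"
    then have xN: "x \<in> carrier N" by simp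
    have pc: "p t x \<in> carrier N" if "t \<in> {0..1}" for t
      using B.symmetryD(3)[OF N p(3)[OF that] xN] .
    \<comment> \<open>The value of \<open>h\<close> on the corner symmetry is the entry
      \<open>e21\<close> of this extended functional at \<open>p t x\<close>, so the given path in
      \<open>B\<close> yields the path in \<open>A\<close>.\<close>
    define g where "g = (\<lambda>y. mat (h (E11 \<odot>\<^bsub>N\<^esub> y)) \<zero> (h (E12 \<odot>\<^bsub>N\<^esub> y)) \<zero>)"
    have g: "g \<in> functionals B N"
      unfolding g_def by (rule corner_functional[OF N h])
    obtain K where K: "\<And>x. x \<in> carrier B \<Longrightarrow> nrm A (e21 x) \<le> K * nrm B x"
      using entries_bounded by blast
    have "cont_path A (\<lambda>t. e21 (g (p t x)))"
      by (rule A.cont_path_image[OF B.normed_graded_ring_axioms p(4)[OF xN g] _ K])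
        (use functionalsD(2)[OF g pc] in \<open>auto simp: additive_map_def entries_add\<close>)
    then show "cont_path A (\<lambda>t. h (corner_sym N (p t) x))"
    proof (rule A.cont_path_cong)
      fix t :: real assume t: "t \<in> {0..1}"
      have "h (E11 \<odot>\<^bsub>N\<^esub> p t x) \<in> carrier A" "h (E12 \<odot>\<^bsub>N\<^esub> p t x) \<in> carrier A"
        using functionalsD(2)[OF h corner_projections[OF N pc[OF t]]] by simp_all
      then show "e21 (g (p t x)) = h (corner_sym N (p t) x)"
        using x by (simp add: g_def corner_sym_def)
    qed
  qed
  then show ?thesis
    using corner_is_triple[OF t] unfolding T corner_triple_eq A.elementary_iff by blast
qed

lemma corner_iso:
  assumes t: "is_triple Grading B T" "is_triple Grading B T'" and iso: "triple_iso B T T'"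
  shows "triple_iso A (corner_triple T) (corner_triple T')"
proof -
  obtain N \<epsilon>1 \<epsilon>2 where T: "T = (N, \<epsilon>1, \<epsilon>2)" by (rule prod_cases3)
  obtain N' \<epsilon>1' \<epsilon>2' where T': "T' = (N', \<epsilon>1', \<epsilon>2')" by (rule prod_cases3)
  have N: "left_module B N" "left_module B N'"
    using t[unfolded T T', THEN B.is_triple_left_module] by auto
  obtain f where f: "f \<in> mod_hom B N N'" "bij_betw f (carrier N) (carrier N')"
    "\<And>x. x \<in> carrier N \<Longrightarrow> f (\<epsilon>1 x) = \<epsilon>1' (f x)" "\<And>x. x \<in> carrier N \<Longrightarrow> f (\<epsilon>2 x) = \<epsilon>2' (f x)"
    using iso unfolding T T' by (rule triple_isoE, blast)
  note fh = mod_homD[OF f(1)]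
  have \<epsilon>: "\<epsilon>1 x \<in> carrier N" "\<epsilon>2 x \<in> carrier N" if "x \<in> carrier N" for x
    using t(1) B.symmetryD(3)[OF N(1) _ that] unfolding T is_triple_iff by blast+
  have inj: "f x = f y \<longleftrightarrow> x = y" if "x \<in> carrier N" "y \<in> carrier N" for x y
    by (rule inj_on_eq_iff[OF bij_betw_imp_inj_on[OF f(2)] that])
  have fe: "f x \<in> carrier (corner N') \<longleftrightarrow> x \<in> carrier (corner N)" if "x \<in> carrier N" for x
    using that fh(2)[OF that] fh(4)[of "E11" x] inj[of "E11 \<odot>\<^bsub>N\<^esub> x" x] mat_smult_closed[OF N(1)] by simp
  show ?thesis
    unfolding T T' corner_triple_eq
  proof (rule triple_isoI)
    show "f \<in> mod_hom A (corner N) (corner N')"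
    proof (rule mod_homI)
      show "f x \<in> carrier (corner N')" if "x \<in> carrier (corner N)" for x
        using fe[of x] that by simp
    qed (simp_all add: fh)
    have "\<exists>x\<in>carrier (corner N). f x = y" if y: "y \<in> carrier (corner N')" for y
    proof -
      have "y \<in> f ` carrier N"
        using y by (simp add: bij_betw_imp_surj_on[OF f(2)])
      then show ?thesis using fe y by blast
    qed
    then show "bij_betw f (carrier (corner N)) (carrier (corner N'))"
      unfolding bij_betw_def using fe inj by (auto simp: inj_on_def simp del: corner_simps) (auto simp: fe)
    fix x assume x: "x \<in> carrier (corner N)"
    then have fx: "x \<in> carrier N" "f x \<in> carrier (corner N')" using fe by auto
    show "f (corner_sym N \<epsilon>1 x) = corner_sym N' \<epsilon>1' (f x)" "f (corner_sym N \<epsilon>2 x) = corner_sym N' \<epsilon>2' (f x)"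
      using x fx \<epsilon> by (simp_all add: corner_sym_def fh f)
  qed
qed

lemma corner_sum:
  assumes t: "is_triple Grading B T" "is_triple Grading B T'"
  shows "triple_iso A (corner_triple (triple_sum T T')) (triple_sum (corner_triple T) (corner_triple T'))"
proof -
  obtain N \<epsilon>1 \<epsilon>2 where T: "T = (N, \<epsilon>1, \<epsilon>2)" by (rule prod_cases3)
  obtain N' \<epsilon>1' \<epsilon>2' where T': "T' = (N', \<epsilon>1', \<epsilon>2')" by (rule prod_cases3)
  have c: "carrier (corner (module_sum N N')) = carrier (corner N) \<times> carrier (corner N')"
    by auto
  show ?thesis
    unfolding T T' triple_sum_eq corner_triple_eq
  proof (rule triple_isoI[where f = "\<lambda>z. z"])
    show "(\<lambda>z. z) \<in> mod_hom A (corner (module_sum N N')) (module_sum (corner N) (corner N'))"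
      by (auto simp: mod_hom_def)
    show "bij_betw (\<lambda>z. z) (carrier (corner (module_sum N N'))) (carrier (module_sum (corner N) (corner N')))"
      using c by (simp add: bij_betw_def inj_on_def del: corner_simps)
  qed (auto simp: corner_sym_def)
qed

text \<open>Since an element of \<open>N\<close> is determined by its two corner components, an
  isomorphism \<open>f\<close> of corners extends by applying it to both and reassembling with
  \<open>E21\<close>. The gradings are matched because each of them is determined by its corner
  symmetry.\<close>

lemma corner_iso_lift:
  assumes t: "is_triple Grading B T" "is_triple Grading B T'"
    and iso: "triple_iso A (corner_triple T) (corner_triple T')"
  shows "triple_iso B T T'"
proof -
  obtain N \<epsilon>1 \<epsilon>2 where T: "T = (N, \<epsilon>1, \<epsilon>2)" by (rule prod_cases3)
  obtain N' \<epsilon>1' \<epsilon>2' where T': "T' = (N', \<epsilon>1', \<epsilon>2')" by (rule prod_cases3)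
  note t = t[unfolded T T']
  have lm: "left_module B N" "left_module B N'"
    using t[THEN B.is_triple_left_module] by auto
  interpret N: left_module B N by (rule lm)
  interpret N': left_module B N' by (rule lm)
  obtain f where f: "f \<in> mod_hom A (corner N) (corner N')" "bij_betw f (carrier (corner N)) (carrier (corner N'))"
    "\<And>x. x \<in> carrier (corner N) \<Longrightarrow> f (corner_sym N \<epsilon>1 x) = corner_sym N' \<epsilon>1' (f x)"
    "\<And>x. x \<in> carrier (corner N) \<Longrightarrow> f (corner_sym N \<epsilon>2 x) = corner_sym N' \<epsilon>2' (f x)"
    using iso unfolding T T' corner_triple_eq by (rule triple_isoE, blast)
  note fh = mod_homD(2-4)[OF f(1)]
  note [simp] = mat_smult_closed[OF lm(1)] mat_smult_closed[OF lm(2)]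
  note ss = mat_smult_smult[OF lm(1)] mat_smult_smult[OF lm(2)]
  note sa = mat_smult_add[OF lm(1)] mat_smult_add[OF lm(2)]
  have inj: "f x = f y \<longleftrightarrow> x = y" if "x \<in> carrier (corner N)" "y \<in> carrier (corner N)" for x y
    by (rule inj_on_eq_iff[OF bij_betw_imp_inj_on[OF f(2)] that])
  define up dn where "up x = f (E11 \<odot>\<^bsub>N\<^esub> x)" and "dn x = f (E12 \<odot>\<^bsub>N\<^esub> x)" for x
  have pc: "E11 \<odot>\<^bsub>N\<^esub> x \<in> carrier (corner N)" "E12 \<odot>\<^bsub>N\<^esub> x \<in> carrier (corner N)"
    if "x \<in> carrier N" for x
    using corner_projections[OF lm(1) that, of \<one> \<zero>] corner_projections[OF lm(1) that, of \<zero> \<one>] by simp_all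
  have uc: "up x \<in> carrier (corner N')" "dn x \<in> carrier (corner N')" if "x \<in> carrier N" for x
    unfolding up_def dn_def using fh(1)[OF pc(1)[OF that]] fh(1)[OF pc(2)[OF that]] .
  have ucN [simp]: "up x \<in> carrier N'" "dn x \<in> carrier N'" if "x \<in> carrier N" for x
    using uc[OF that] by simp_all
  have u1: "E11 \<odot>\<^bsub>N'\<^esub> up x = up x" "E11 \<odot>\<^bsub>N'\<^esub> dn x = dn x" if "x \<in> carrier N" for x
    using uc[OF that] by simp_all
  \<comment> \<open>The second column of a matrix does not matter on the corner, where
    multiplication by \<open>E11\<close> can be inserted first.\<close>
  have u2: "mat a b c d \<odot>\<^bsub>N'\<^esub> up x = mat a \<zero> c \<zero> \<odot>\<^bsub>N'\<^esub> up x" "mat a b c d \<odot>\<^bsub>N'\<^esub> dn x = mat a \<zero> c \<zero> \<odot>\<^bsub>N'\<^esub> dn x"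
    if "x \<in> carrier N" "a \<in> carrier A" "b \<in> carrier A" "c \<in> carrier A" "d \<in> carrier A" for x a b c d
  proof -
    have "mat a b c d \<odot>\<^bsub>N'\<^esub> y = mat a \<zero> c \<zero> \<odot>\<^bsub>N'\<^esub> y" if "y \<in> carrier (corner N')" for y
    proof -
      have "mat a b c d \<odot>\<^bsub>N'\<^esub> y = mat a b c d \<odot>\<^bsub>N'\<^esub> (E11 \<odot>\<^bsub>N'\<^esub> y)"
        using that by simp
      also have "\<dots> = mat a \<zero> c \<zero> \<odot>\<^bsub>N'\<^esub> y"
        using that \<open>a \<in> carrier A\<close> \<open>b \<in> carrier A\<close> \<open>c \<in> carrier A\<close> \<open>d \<in> carrier A\<close>
        by (subst ss(2)) auto
      finally show ?thesis .
    qed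
    then show "mat a b c d \<odot>\<^bsub>N'\<^esub> up x = mat a \<zero> c \<zero> \<odot>\<^bsub>N'\<^esub> up x" "mat a b c d \<odot>\<^bsub>N'\<^esub> dn x = mat a \<zero> c \<zero> \<odot>\<^bsub>N'\<^esub> dn x"
      using uc[OF that(1)] by blast+
  qed
  have fab: "f (mat a b \<zero> \<zero> \<odot>\<^bsub>N\<^esub> x) = mat a \<zero> \<zero> \<zero> \<odot>\<^bsub>N'\<^esub> up x \<oplus>\<^bsub>N'\<^esub> mat b \<zero> \<zero> \<zero> \<odot>\<^bsub>N'\<^esub> dn x"
    if "x \<in> carrier N" "a \<in> carrier A" "b \<in> carrier A" for a b x
  proof -
    have "mat a b \<zero> \<zero> \<odot>\<^bsub>N\<^esub> x = a \<odot>\<^bsub>corner N\<^esub> (E11 \<odot>\<^bsub>N\<^esub> x) \<oplus>\<^bsub>corner N\<^esub> b \<odot>\<^bsub>corner N\<^esub> (E12 \<odot>\<^bsub>N\<^esub> x)"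
      using that by (simp add: ss sa)
    moreover have "a \<odot>\<^bsub>corner N\<^esub> (E11 \<odot>\<^bsub>N\<^esub> x) \<in> carrier (corner N)"
      "b \<odot>\<^bsub>corner N\<^esub> (E12 \<odot>\<^bsub>N\<^esub> x) \<in> carrier (corner N)"
      using that by (simp_all add: ss)
    ultimately show ?thesis
      using fh(2) fh(3)[OF that(2) pc(1)[OF that(1)]] fh(3)[OF that(3) pc(2)[OF that(1)]]
      by (simp add: up_def dn_def del: corner_simps(1))
  qed
  define F where "F x = up x \<oplus>\<^bsub>N'\<^esub> E21 \<odot>\<^bsub>N'\<^esub> dn x" for x
  have Fc: "F x \<in> carrier N'" if "x \<in> carrier N" for x
    using that by (simp add: F_def)
  have F_proj: "E11 \<odot>\<^bsub>N'\<^esub> F x = up x" "E12 \<odot>\<^bsub>N'\<^esub> F x = dn x" if "x \<in> carrier N" for x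
  proof -
    have "E12 \<odot>\<^bsub>N'\<^esub> up x = \<zero>\<^bsub>N'\<^esub>"
      using u2(1)[OF that, of \<zero> \<one> \<zero> \<zero>] that by (simp add: mat_zero)
    then show "E11 \<odot>\<^bsub>N'\<^esub> F x = up x" "E12 \<odot>\<^bsub>N'\<^esub> F x = dn x"
      using that by (simp_all add: F_def N'.smult_r_distr ss u1 mat_zero)
  qed
  have F_hom: "F \<in> mod_hom B N N'"
  proof (rule mod_homI)
    fix x assume x: "x \<in> carrier N"
    show "F x \<in> carrier N'" by (rule Fc[OF x])
    show "F (b \<odot>\<^bsub>N\<^esub> x) = b \<odot>\<^bsub>N'\<^esub> F x" if b: "b \<in> carrier B" for b
    proof -
      define p q r s where "p = e11 b" and "q = e12 b" and "r = e21 b" and "s = e22 b"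
      have e: "b = mat p q r s" and c: "p \<in> carrier A" "q \<in> carrier A" "r \<in> carrier A" "s \<in> carrier A"
        using mat_entries[OF b] b by (simp_all add: p_def q_def r_def s_def)
      have "up (b \<odot>\<^bsub>N\<^esub> x) = mat p \<zero> \<zero> \<zero> \<odot>\<^bsub>N'\<^esub> up x \<oplus>\<^bsub>N'\<^esub> mat q \<zero> \<zero> \<zero> \<odot>\<^bsub>N'\<^esub> dn x"
        "dn (b \<odot>\<^bsub>N\<^esub> x) = mat r \<zero> \<zero> \<zero> \<odot>\<^bsub>N'\<^esub> up x \<oplus>\<^bsub>N'\<^esub> mat s \<zero> \<zero> \<zero> \<odot>\<^bsub>N'\<^esub> dn x"
        using fab[OF x c(1,2)] fab[OF x c(3,4)] c x unfolding up_def dn_def e by (simp_all add: ss)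
      then have "F (b \<odot>\<^bsub>N\<^esub> x) = (mat p \<zero> \<zero> \<zero> \<odot>\<^bsub>N'\<^esub> up x \<oplus>\<^bsub>N'\<^esub> mat \<zero> \<zero> r \<zero> \<odot>\<^bsub>N'\<^esub> up x)
          \<oplus>\<^bsub>N'\<^esub> (mat q \<zero> \<zero> \<zero> \<odot>\<^bsub>N'\<^esub> dn x \<oplus>\<^bsub>N'\<^esub> mat \<zero> \<zero> s \<zero> \<odot>\<^bsub>N'\<^esub> dn x)"
        using c x by (simp add: F_def N'.smult_r_distr ss N'.M.a_ac)
      also have "\<dots> = mat p \<zero> r \<zero> \<odot>\<^bsub>N'\<^esub> up x \<oplus>\<^bsub>N'\<^esub> mat q \<zero> s \<zero> \<odot>\<^bsub>N'\<^esub> dn x"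
        using c x by (simp add: sa)
      also have "\<dots> = b \<odot>\<^bsub>N'\<^esub> F x"
        unfolding e F_def using c x u2(1)[OF x c] by (simp add: N'.smult_r_distr ss)
      finally show ?thesis .
    qed
    fix y assume y: "y \<in> carrier N"
    have "up (x \<oplus>\<^bsub>N\<^esub> y) = up x \<oplus>\<^bsub>N'\<^esub> up y" "dn (x \<oplus>\<^bsub>N\<^esub> y) = dn x \<oplus>\<^bsub>N'\<^esub> dn y"
      using fh(2)[OF pc(1)[OF x] pc(1)[OF y]] fh(2)[OF pc(2)[OF x] pc(2)[OF y]] x y
      by (simp_all add: up_def dn_def N.smult_r_distr)
    then show "F (x \<oplus>\<^bsub>N\<^esub> y) = F x \<oplus>\<^bsub>N'\<^esub> F y"
      using x y by (simp add: F_def N'.smult_r_distr N'.M.a_ac)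
  qed
  have F_bij: "bij_betw F (carrier N) (carrier N')"
    unfolding bij_betw_def
  proof (intro conjI equalityI subsetI)
    show "inj_on F (carrier N)"
    proof (rule inj_onI)
      fix x y assume xy: "x \<in> carrier N" "y \<in> carrier N" "F x = F y"
      then have "up x = up y" "dn x = dn y"
        using F_proj[OF xy(1)] F_proj[OF xy(2)] by simp_all
      then have e: "E11 \<odot>\<^bsub>N\<^esub> x = E11 \<odot>\<^bsub>N\<^esub> y" "E12 \<odot>\<^bsub>N\<^esub> x = E12 \<odot>\<^bsub>N\<^esub> y"
        unfolding up_def dn_def inj[OF pc(1)[OF xy(1)] pc(1)[OF xy(2)]] inj[OF pc(2)[OF xy(1)] pc(2)[OF xy(2)]] .
      have "x = E11 \<odot>\<^bsub>N\<^esub> x \<oplus>\<^bsub>N\<^esub> E21 \<odot>\<^bsub>N\<^esub> (E12 \<odot>\<^bsub>N\<^esub> x)"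
        by (rule corner_decomposition[OF lm(1) xy(1), symmetric])
      also have "\<dots> = y"
        unfolding e by (rule corner_decomposition[OF lm(1) xy(2)])
      finally show "x = y" .
    qed
    show "y \<in> carrier N'" if "y \<in> F ` carrier N" for y using that Fc by blast
    fix y assume y: "y \<in> carrier N'"
    have pc': "E11 \<odot>\<^bsub>N'\<^esub> y \<in> carrier (corner N')" "E12 \<odot>\<^bsub>N'\<^esub> y \<in> carrier (corner N')"
      using corner_projections[OF lm(2) y, of \<one> \<zero>] corner_projections[OF lm(2) y, of \<zero> \<one>] by simp_all
    then have "E11 \<odot>\<^bsub>N'\<^esub> y \<in> f ` carrier (corner N)" "E12 \<odot>\<^bsub>N'\<^esub> y \<in> f ` carrier (corner N)"
      unfolding bij_betw_imp_surj_on[OF f(2)] .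
    then obtain u v where uv: "u \<in> carrier (corner N)" "f u = E11 \<odot>\<^bsub>N'\<^esub> y"
      "v \<in> carrier (corner N)" "f v = E12 \<odot>\<^bsub>N'\<^esub> y"
      by (elim imageE) metis
    then have uvN: "u \<in> carrier N" "v \<in> carrier N" "E11 \<odot>\<^bsub>N\<^esub> u = u" "E11 \<odot>\<^bsub>N\<^esub> v = v"
      by simp_all
    have u0: "E12 \<odot>\<^bsub>N\<^esub> u = \<zero>\<^bsub>N\<^esub>"
      using ss(1)[of \<zero> \<one> \<zero> \<zero> \<one> \<zero> \<zero> \<zero> u] uvN by (simp add: mat_zero)
    define x where "x = u \<oplus>\<^bsub>N\<^esub> E21 \<odot>\<^bsub>N\<^esub> v"
    have x: "x \<in> carrier N" using uvN by (simp add: x_def)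
    have "E11 \<odot>\<^bsub>N\<^esub> x = u" "E12 \<odot>\<^bsub>N\<^esub> x = v"
      using uvN u0 by (simp_all add: x_def N.smult_r_distr ss mat_zero)
    then have "F x = y"
      using uv corner_decomposition[OF lm(2) y] by (simp add: F_def up_def dn_def)
    then show "y \<in> F ` carrier N" using x by blast
  qed
  \<comment> \<open>In the components \<open>up\<close> and \<open>dn\<close> a grading with corner
    symmetry \<open>J\<close> sends \<open>(u, v)\<close> to \<open>(- J v, J u)\<close>. As
    \<open>f\<close> respects the corner symmetries, \<open>F\<close> respects the gradings.\<close>
  have F_sym: "F (\<epsilon> x) = \<epsilon>' (F x)"
    if s: "\<epsilon> \<in> symmetry_space Grading B N" "\<epsilon>' \<in> symmetry_space Grading B N'"
      and i: "\<And>x. x \<in> carrier (corner N) \<Longrightarrow> f (corner_sym N \<epsilon> x) = corner_sym N' \<epsilon>' (f x)"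
      and x: "x \<in> carrier N" for \<epsilon> \<epsilon>' x
  proof -
    note \<epsilon> = B.symmetryD[OF lm(1) s(1)] and \<epsilon>' = B.symmetryD[OF lm(2) s(2)]
    note m = symmetry_mat[OF lm(1) s(1)] symmetry_mat[OF lm(2) s(2)]
    have "corner_sym N \<epsilon> (E11 \<odot>\<^bsub>N\<^esub> x) = E12 \<odot>\<^bsub>N\<^esub> \<epsilon> x"
      using x \<epsilon>(3) pc(1)[OF x] unfolding corner_sym_def by (simp add: m ss)
    then have 1: "dn (\<epsilon> x) = E12 \<odot>\<^bsub>N'\<^esub> \<epsilon>' (up x)"
      using i[OF pc(1)[OF x]] uc(1)[OF x] by (simp add: dn_def up_def corner_sym_def)
    have "corner_sym N \<epsilon> (E12 \<odot>\<^bsub>N\<^esub> x) = mat (\<ominus> \<one>) \<zero> \<zero> \<zero> \<odot>\<^bsub>N\<^esub> \<epsilon> x"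
      using x \<epsilon>(3) pc(2)[OF x] unfolding corner_sym_def by (simp add: m ss)
    then have "f (mat (\<ominus> \<one>) \<zero> \<zero> \<zero> \<odot>\<^bsub>N\<^esub> \<epsilon> x) = E12 \<odot>\<^bsub>N'\<^esub> \<epsilon>' (dn x)"
      using i[OF pc(2)[OF x]] uc(2)[OF x] by (simp add: dn_def corner_sym_def)
    then have "mat (\<ominus> \<one>) \<zero> \<zero> \<zero> \<odot>\<^bsub>N'\<^esub> up (\<epsilon> x) = E12 \<odot>\<^bsub>N'\<^esub> \<epsilon>' (dn x)"
      using fab[OF \<epsilon>(3)[OF x], of "\<ominus> \<one>" \<zero>] \<epsilon>(3)[OF x] by (simp add: mat_zero)
    then have "mat (\<ominus> \<one>) \<zero> \<zero> \<zero> \<odot>\<^bsub>N'\<^esub> (mat (\<ominus> \<one>) \<zero> \<zero> \<zero> \<odot>\<^bsub>N'\<^esub> up (\<epsilon> x))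
      = mat (\<ominus> \<one>) \<zero> \<zero> \<zero> \<odot>\<^bsub>N'\<^esub> (E12 \<odot>\<^bsub>N'\<^esub> \<epsilon>' (dn x))" by simp
    then have 2: "up (\<epsilon> x) = mat \<zero> (\<ominus> \<one>) \<zero> \<zero> \<odot>\<^bsub>N'\<^esub> \<epsilon>' (dn x)"
      using \<epsilon>(3)[OF x] \<epsilon>'(3) x by (simp add: ss u1 A.l_minus)
    \<comment> \<open>A grading takes the corner into its complement, because the parity of
      \<open>E11\<close> is the complementary idempotent.\<close>
    have 3: "mat \<zero> \<zero> \<zero> \<one> \<odot>\<^bsub>N'\<^esub> \<epsilon>' (up x) = \<epsilon>' (up x)"
      using m(2)[of "up x" \<one> \<zero> \<zero> \<zero>] u1(1)[OF x] x by simp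
    have "F (\<epsilon> x) = mat \<zero> (\<ominus> \<one>) \<zero> \<zero> \<odot>\<^bsub>N'\<^esub> \<epsilon>' (dn x) \<oplus>\<^bsub>N'\<^esub> \<epsilon>' (up x)"
      using \<epsilon>'(3) x 3 by (simp add: F_def 1 2 ss)
    moreover have "\<epsilon>' (F x) = \<epsilon>' (up x) \<oplus>\<^bsub>N'\<^esub> mat \<zero> (\<ominus> \<one>) \<zero> \<zero> \<odot>\<^bsub>N'\<^esub> \<epsilon>' (dn x)"
      using x by (simp add: F_def \<epsilon>'(4) m)
    ultimately show ?thesis
      using \<epsilon>'(3) x by (simp add: N'.M.a_comm)
  qed
  show ?thesis
    unfolding T T'
    by (rule triple_isoI[OF F_hom F_bij]) (use F_sym f(3,4) t in \<open>simp_all add: is_triple_iff del: corner_simps\<close>)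
qed

subsection \<open>From \<open>A\<close>-modules to \<open>B\<close>-modules\<close>

text \<open>Morita inverse of \<open>corner\<close>: columns with two entries in \<open>M\<close>,
  on which \<open>B\<close> acts by matrix multiplication.\<close>

definition double :: "('a, 'm) module \<Rightarrow> ('b, 'm \<times> 'm) module" where
  "double M =
     \<lparr>carrier = carrier M \<times> carrier M, monoid.mult = undefined, monoid.one = undefined,
      ring.zero = (\<zero>\<^bsub>M\<^esub>, \<zero>\<^bsub>M\<^esub>), ring.add = (\<lambda>(x, y) (x', y'). (x \<oplus>\<^bsub>M\<^esub> x', y \<oplus>\<^bsub>M\<^esub> y')),
      module.smult = (\<lambda>b (x, y). (e11 b \<odot>\<^bsub>M\<^esub> x \<oplus>\<^bsub>M\<^esub> e12 b \<odot>\<^bsub>M\<^esub> y, e21 b \<odot>\<^bsub>M\<^esub> x \<oplus>\<^bsub>M\<^esub> e22 b \<odot>\<^bsub>M\<^esub> y))\<rparr>"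

text \<open>The matrix \<open>(0, -J; J, 0)\<close>, whose square is the identity because
  \<open>J\<close> squares to minus the identity. The signs are forced by the requirement that
  \<open>E12\<close> after it restricts to \<open>J\<close> on columns
  \<open>(x, 0)\<close>.\<close>

definition double_sym :: "('a, 'm) module \<Rightarrow> ('m \<Rightarrow> 'm) \<Rightarrow> 'm \<times> 'm \<Rightarrow> 'm \<times> 'm" where
  "double_sym M J = (\<lambda>z\<in>carrier M \<times> carrier M. (\<ominus>\<^bsub>M\<^esub> J (snd z), J (fst z)))"

definition double_triple :: "('a, 'm) triple \<Rightarrow> ('b, 'm \<times> 'm) triple" where
  "double_triple = (\<lambda>(M, J1, J2). (double M, double_sym M J1, double_sym M J2))"

lemma double_simps [simp]:
  "carrier (double M) = carrier M \<times> carrier M" "\<zero>\<^bsub>double M\<^esub> = (\<zero>\<^bsub>M\<^esub>, \<zero>\<^bsub>M\<^esub>)"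
  "(x, y) \<oplus>\<^bsub>double M\<^esub> (x', y') = (x \<oplus>\<^bsub>M\<^esub> x', y \<oplus>\<^bsub>M\<^esub> y')"
  "b \<odot>\<^bsub>double M\<^esub> (x, y) = (e11 b \<odot>\<^bsub>M\<^esub> x \<oplus>\<^bsub>M\<^esub> e12 b \<odot>\<^bsub>M\<^esub> y, e21 b \<odot>\<^bsub>M\<^esub> x \<oplus>\<^bsub>M\<^esub> e22 b \<odot>\<^bsub>M\<^esub> y)"
  by (simp_all add: double_def)

lemma double_triple_eq: "double_triple (M, J1, J2) = (double M, double_sym M J1, double_sym M J2)"
  by (simp add: double_triple_def)

context
  fixes M :: "('a, 'm) module"
  assumes M: "left_module A M"
begin

interpretation M: left_module A M by (rule M)

lemma double_left_module: "left_module B (double M)"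
proof (rule left_moduleI[OF B.ring_axioms])
  show "abelian_group (double M)"
  proof (rule abelian_groupI)
    fix z assume "z \<in> carrier (double M)"
    then obtain x y where "z = (x, y)" "x \<in> carrier M" "y \<in> carrier M" by auto
    then show "\<exists>w\<in>carrier (double M). w \<oplus>\<^bsub>double M\<^esub> z = \<zero>\<^bsub>double M\<^esub>"
      by (intro bexI[of _ "(\<ominus>\<^bsub>M\<^esub> x, \<ominus>\<^bsub>M\<^esub> y)"]) (auto simp: M.M.l_neg)
  qed (auto simp: M.M.a_ac)
qed (auto simp: M.smult_closed M.smult_l_distr M.smult_r_distr M.smult_assoc M.smult_one M.M.a_ac
    entries_add entries_mult entries_one)

text \<open>One generator \<open>(xs k, 0)\<close> per index is enough: a coefficient matrix acts on
  it through its first column, which reaches both entries of a column of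
  \<open>double M\<close>.\<close>

lemma double_fg_projective:
  assumes "fg_projective A M"
  shows "fg_projective B (double M)"
proof -
  obtain n :: nat and xs fs where d: "dual_basis A M {..<n} xs fs"
    using fg_projective_dual_basis[OF assms] by metis
  note d = dual_basisD[OF d]
  interpret P: left_module B "double M" by (rule double_left_module)
  have "dual_basis B (double M) {..<n} (\<lambda>k. (xs k, \<zero>\<^bsub>M\<^esub>)) (\<lambda>k z. mat (fs k (fst z)) \<zero> (fs k (snd z)) \<zero>)"
    unfolding dual_basis_def
  proof (intro conjI ballI)
    fix k assume k: "k \<in> {..<n}"
    show "(xs k, \<zero>\<^bsub>M\<^esub>) \<in> carrier (double M)" using d(2)[OF k] by simp
    note f = functionalsD(2-4)[OF d(3)[OF k]]
    show "(\<lambda>z. mat (fs k (fst z)) \<zero> (fs k (snd z)) \<zero>) \<in> functionals B (double M)"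
    proof (rule functionalsI)
      fix b z assume b: "b \<in> carrier B" and "z \<in> carrier (double M)"
      then obtain x y where z: "z = (x, y)" "x \<in> carrier M" "y \<in> carrier M" by auto
      show "mat (fs k (fst (b \<odot>\<^bsub>double M\<^esub> z))) \<zero> (fs k (snd (b \<odot>\<^bsub>double M\<^esub> z))) \<zero>
        = b \<otimes>\<^bsub>B\<^esub> mat (fs k (fst z)) \<zero> (fs k (snd z)) \<zero>"
        by (rule matrix_eqI) (use b z f in \<open>simp_all add: M.smult_closed entries_mult\<close>)
    qed (auto simp: f mat_add)
  next
    fix z assume "z \<in> carrier (double M)"
    then obtain x y where z: "z = (x, y)" "x \<in> carrier M" "y \<in> carrier M" by auto
    have c: "fs k x \<in> carrier A" "fs k y \<in> carrier A" "xs k \<in> carrier M" if "k < n" for k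
      using d(2,4) z that by simp_all
    let ?s = "\<Oplus>\<^bsub>double M\<^esub>k\<in>{..<n}. mat (fs k (fst z)) \<zero> (fs k (snd z)) \<zero> \<odot>\<^bsub>double M\<^esub> (xs k, \<zero>\<^bsub>M\<^esub>)"
    have s: "?s = (\<Oplus>\<^bsub>double M\<^esub>k\<in>{..<n}. (fs k x \<odot>\<^bsub>M\<^esub> xs k, fs k y \<odot>\<^bsub>M\<^esub> xs k))"
      using c z by (intro P.M.finsum_cong') (auto simp: M.smult_closed)
    have "additive_map (double M) M fst" "additive_map (double M) M snd"
      by (auto simp: additive_map_def)
    then have "fst ?s = (\<Oplus>\<^bsub>M\<^esub>k\<in>{..<n}. fst (fs k x \<odot>\<^bsub>M\<^esub> xs k, fs k y \<odot>\<^bsub>M\<^esub> xs k))"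
      "snd ?s = (\<Oplus>\<^bsub>M\<^esub>k\<in>{..<n}. snd (fs k x \<odot>\<^bsub>M\<^esub> xs k, fs k y \<odot>\<^bsub>M\<^esub> xs k))"
      unfolding s
      by (intro additive_map_finsum[OF P.M.abelian_group_axioms M.M.abelian_group_axioms];
          use c in \<open>auto simp: M.smult_closed\<close>)+
    then show "?s = z"
      using d(5)[OF z(2)] d(5)[OF z(3)] z(1) by (simp add: prod_eq_iff)
  qed simp
  then show ?thesis by (rule fg_projectiveI[OF double_left_module])
qed

lemma double_symmetry:
  assumes "J \<in> symmetry_space Polarization A M"
  shows "double_sym M J \<in> symmetry_space Grading B (double M)"
proof -
  note J = A.symmetryD[OF M assms]
  have Jn: "J (\<ominus>\<^bsub>M\<^esub> x) = \<ominus>\<^bsub>M\<^esub> J x" if "x \<in> carrier M" for x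
    by (rule additive_map_neg[OF M.M.abelian_group_axioms M.M.abelian_group_axioms skew_mapD(1)[OF J(2)] that])
  show ?thesis
  proof (rule B.symmetryI[OF double_left_module])
    show "double_sym M J \<in> extensional (carrier (double M))"
      by (simp add: double_sym_def)
    fix z assume "z \<in> carrier (double M)"
    then obtain x y where z: "z = (x, y)" "x \<in> carrier M" "y \<in> carrier M" by auto
    show "double_sym M J z \<in> carrier (double M)"
      using z J by (simp add: double_sym_def)
    show "double_sym M J (double_sym M J z) = sym_square Grading (double M) z"
      using z J(3,6) Jn by (simp add: double_sym_def sym_square_def)
    show "double_sym M J (b \<odot>\<^bsub>double M\<^esub> z) = parity B b \<odot>\<^bsub>double M\<^esub> double_sym M J z" if "b \<in> carrier B" for b
      using z that J(3-5) by (simp add: double_sym_def M.smult_closed entries_parity M.smult_neg_left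
          M.smult_neg_right M.M.minus_add M.M.a_ac)
    fix w assume "w \<in> carrier (double M)"
    then obtain x' y' where w: "w = (x', y')" "x' \<in> carrier M" "y' \<in> carrier M" by auto
    show "double_sym M J (z \<oplus>\<^bsub>double M\<^esub> w) = double_sym M J z \<oplus>\<^bsub>double M\<^esub> double_sym M J w"
      using z w J(3,4) by (simp add: double_sym_def M.M.minus_add M.M.a_ac)
  qed
qed

text \<open>Linearity under \<open>E11\<close> shows that \<open>h (x, 0)\<close> has only a first
  row, and linearity under \<open>E21\<close> that \<open>h (0, y)\<close> is the first row of
  \<open>h (y, 0)\<close> moved down. So two functionals on \<open>M\<close> determine
  \<open>h\<close>.\<close>

lemma double_functional:
  assumes h: "h \<in> functionals B (double M)"
  shows "(\<lambda>x. e11 (h (x, \<zero>\<^bsub>M\<^esub>))) \<in> functionals A M" "(\<lambda>x. e12 (h (x, \<zero>\<^bsub>M\<^esub>))) \<in> functionals A M"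
    and "x \<in> carrier M \<Longrightarrow> y \<in> carrier M \<Longrightarrow>
      h (x, y) = mat (e11 (h (x, \<zero>\<^bsub>M\<^esub>))) (e12 (h (x, \<zero>\<^bsub>M\<^esub>))) (e11 (h (y, \<zero>\<^bsub>M\<^esub>))) (e12 (h (y, \<zero>\<^bsub>M\<^esub>)))"
proof -
  note hd = functionalsD(2-4)[OF h]
  have hc: "h (x, y) \<in> carrier B" if "x \<in> carrier M" "y \<in> carrier M" for x y
    using hd(1) that by simp
  have ha: "h (x \<oplus>\<^bsub>M\<^esub> y, \<zero>\<^bsub>M\<^esub>) = h (x, \<zero>\<^bsub>M\<^esub>) \<oplus>\<^bsub>B\<^esub> h (y, \<zero>\<^bsub>M\<^esub>)" if "x \<in> carrier M" "y \<in> carrier M" for x y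
    using hd(2)[of "(x, \<zero>\<^bsub>M\<^esub>)" "(y, \<zero>\<^bsub>M\<^esub>)"] that by simp
  have hs: "h (a \<odot>\<^bsub>M\<^esub> x, \<zero>\<^bsub>M\<^esub>) = mat a \<zero> \<zero> \<zero> \<otimes>\<^bsub>B\<^esub> h (x, \<zero>\<^bsub>M\<^esub>)" if "a \<in> carrier A" "x \<in> carrier M" for a x
    using hd(3)[of "mat a \<zero> \<zero> \<zero>" "(x, \<zero>\<^bsub>M\<^esub>)"] that by (simp add: M.smult_closed)
  show "(\<lambda>x. e11 (h (x, \<zero>\<^bsub>M\<^esub>))) \<in> functionals A M" "(\<lambda>x. e12 (h (x, \<zero>\<^bsub>M\<^esub>))) \<in> functionals A M"
    by (rule functionalsI; simp add: hc ha hs entries_add entries_mult)+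
  assume x: "x \<in> carrier M" and y: "y \<in> carrier M"
  have hy: "h (\<zero>\<^bsub>M\<^esub>, y) = E21 \<otimes>\<^bsub>B\<^esub> h (y, \<zero>\<^bsub>M\<^esub>)"
    using hd(3)[of "E21" "(y, \<zero>\<^bsub>M\<^esub>)"] y by (simp add: M.smult_one)
  have hx: "E11 \<otimes>\<^bsub>B\<^esub> h (x, \<zero>\<^bsub>M\<^esub>) = h (x, \<zero>\<^bsub>M\<^esub>)"
    using hd(3)[of "E11" "(x, \<zero>\<^bsub>M\<^esub>)"] x by (simp add: M.smult_one)
  have hxy: "h (x, y) = E11 \<otimes>\<^bsub>B\<^esub> h (x, \<zero>\<^bsub>M\<^esub>) \<oplus>\<^bsub>B\<^esub> E21 \<otimes>\<^bsub>B\<^esub> h (y, \<zero>\<^bsub>M\<^esub>)"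
    using hd(2)[of "(x, \<zero>\<^bsub>M\<^esub>)" "(\<zero>\<^bsub>M\<^esub>, y)"] x y hy hx by simp
  show "h (x, y) = mat (e11 (h (x, \<zero>\<^bsub>M\<^esub>))) (e12 (h (x, \<zero>\<^bsub>M\<^esub>))) (e11 (h (y, \<zero>\<^bsub>M\<^esub>))) (e12 (h (y, \<zero>\<^bsub>M\<^esub>)))"
    by (rule matrix_eqI) (use x y hc in \<open>simp_all add: hxy entries_add entries_mult\<close>)
qed

end

lemma double_is_triple:
  assumes "is_triple Polarization A T"
  shows "is_triple Grading B (double_triple T)"
proof -
  obtain M J1 J2 where T: "T = (M, J1, J2)" by (rule prod_cases3)
  have M: "left_module A M"
    using A.is_triple_left_module assms unfolding T by blast
  show ?thesis
    using assms double_fg_projective[OF M] double_symmetry[OF M]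
    unfolding T double_triple_eq is_triple_iff by blast
qed

lemma double_elementary:
  assumes "elementary Polarization A T"
  shows "elementary Grading B (double_triple T)"
proof -
  obtain M J1 J2 where T: "T = (M, J1, J2)" by (rule prod_cases3)
  have t: "is_triple Polarization A (M, J1, J2)"
    using A.elementary_is_triple assms unfolding T by blast
  have M: "left_module A M" using A.is_triple_left_module[OF t] .
  interpret M: left_module A M by (rule M)
  obtain p where p: "p 0 = J1" "p 1 = J2" "\<And>t. t \<in> {0..1::real} \<Longrightarrow> p t \<in> symmetry_space Polarization A M"
    "\<And>x h. x \<in> carrier M \<Longrightarrow> h \<in> functionals A M \<Longrightarrow> cont_path A (\<lambda>t. h (p t x))"
    using assms unfolding T A.elementary_iff sym_path_def by blast
  have "sym_path Grading B (double M) (double_sym M J1) (double_sym M J2)"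
    unfolding sym_path_def
  proof (intro exI[of _ "\<lambda>t. double_sym M (p t)"] conjI ballI)
    show "double_sym M (p 0) = double_sym M J1" "double_sym M (p 1) = double_sym M J2"
      by (simp_all add: p)
    show "double_sym M (p t) \<in> symmetry_space Grading B (double M)" if "t \<in> {0..1}" for t
      by (rule double_symmetry[OF M p(3)[OF that]])
    fix z h assume "z \<in> carrier (double M)" and h: "h \<in> functionals B (double M)"
    then obtain x y where z: "z = (x, y)" "x \<in> carrier M" "y \<in> carrier M" by auto
    note g = double_functional[OF M h]
    have pc: "p t x \<in> carrier M" "p t (\<ominus>\<^bsub>M\<^esub> y) \<in> carrier M" "p t (\<ominus>\<^bsub>M\<^esub> y) = \<ominus>\<^bsub>M\<^esub> p t y"
      if "t \<in> {0..1}" for t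
      using A.symmetryD(3)[OF M p(3)[OF that]] z
        additive_map_neg[OF M.M.abelian_group_axioms M.M.abelian_group_axioms
          skew_mapD(1)[OF A.symmetryD(2)[OF M p(3)[OF that]]] z(3)] by simp_all
    \<comment> \<open>The minus sign of \<open>double_sym\<close> is moved into the argument of the
      path by additivity, so that the given path is simply evaluated at the negative of
      \<open>y\<close>.\<close>
    have ny: "\<ominus>\<^bsub>M\<^esub> y \<in> carrier M" using z by simp
    have "cont_path B (\<lambda>t. mat (e11 (h (p t (\<ominus>\<^bsub>M\<^esub> y), \<zero>\<^bsub>M\<^esub>))) (e12 (h (p t (\<ominus>\<^bsub>M\<^esub> y), \<zero>\<^bsub>M\<^esub>)))
        (e11 (h (p t x, \<zero>\<^bsub>M\<^esub>))) (e12 (h (p t x, \<zero>\<^bsub>M\<^esub>))))"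
      by (intro cont_path_mat p(4)[OF z(2) g(1)] p(4)[OF z(2) g(2)] p(4)[OF ny g(1)] p(4)[OF ny g(2)]
          functionalsD(2)[OF g(1)] functionalsD(2)[OF g(2)] pc)
    then show "cont_path B (\<lambda>t. h (double_sym M (p t) z))"
    proof (rule B.cont_path_cong)
      fix t :: real assume t: "t \<in> {0..1}"
      show "mat (e11 (h (p t (\<ominus>\<^bsub>M\<^esub> y), \<zero>\<^bsub>M\<^esub>))) (e12 (h (p t (\<ominus>\<^bsub>M\<^esub> y), \<zero>\<^bsub>M\<^esub>)))
        (e11 (h (p t x, \<zero>\<^bsub>M\<^esub>))) (e12 (h (p t x, \<zero>\<^bsub>M\<^esub>))) = h (double_sym M (p t) z)"
        using g(3)[OF pc(2)[OF t] pc(1)[OF t]] pc(3)[OF t] z by (simp add: double_sym_def)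
    qed
  qed
  then show ?thesis
    using double_is_triple[OF t] unfolding T double_triple_eq B.elementary_iff by blast
qed

lemma corner_double:
  assumes t: "is_triple Polarization A T"
  shows "triple_iso A T (corner_triple (double_triple T))"
proof -
  obtain M J1 J2 where T: "T = (M, J1, J2)" by (rule prod_cases3)
  have M: "left_module A M"
    using A.is_triple_left_module t unfolding T by blast
  interpret M: left_module A M by (rule M)
  have J: "J1 \<in> symmetry_space Polarization A M" "J2 \<in> symmetry_space Polarization A M"
    using t unfolding T is_triple_iff by auto
  have J0: "J \<zero>\<^bsub>M\<^esub> = \<zero>\<^bsub>M\<^esub>" if "J \<in> symmetry_space Polarization A M" for J
    by (rule additive_map_zero[OF M.M.abelian_group_axioms M.M.abelian_group_axioms
          skew_mapD(1)[OF A.symmetryD(2)[OF M that]]])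
  note Jc = A.symmetryD(3)[OF M J(1)] A.symmetryD(3)[OF M J(2)]
  have c: "carrier (corner (double M)) = (\<lambda>x. (x, \<zero>\<^bsub>M\<^esub>)) ` carrier M"
    by (auto simp: M.smult_one image_iff)
  show ?thesis
    unfolding T double_triple_eq corner_triple_eq
  proof (rule triple_isoI[where f = "\<lambda>x. (x, \<zero>\<^bsub>M\<^esub>)"])
    show "(\<lambda>x. (x, \<zero>\<^bsub>M\<^esub>)) \<in> mod_hom A M (corner (double M))"
      by (rule mod_homI) (auto simp: M.smult_one M.smult_closed)
    show "bij_betw (\<lambda>x. (x, \<zero>\<^bsub>M\<^esub>)) (carrier M) (carrier (corner (double M)))"
      unfolding c by (simp add: bij_betw_def inj_on_def)
  qed (auto simp: corner_sym_def double_sym_def M.smult_one J0[OF J(1)] J0[OF J(2)] Jc)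
qed

sublocale corner: triple_functor B A Grading Polarization corner_triple
proof
  fix T S W :: "('b, nat \<Rightarrow> 'b) triple"
  assume T: "is_triple Grading B T"
  show "is_triple Polarization A (corner_triple T)" by (rule corner_is_triple[OF T])
  assume S: "is_triple Grading B S" and W: "is_triple Grading B W" and iso: "triple_iso B (triple_sum T S) W"
  note TS = B.is_triple_sum[OF T S]
  note cT = corner_is_triple[OF T] and cS = corner_is_triple[OF S]
  have "triple_iso A (triple_sum (corner_triple T) (corner_triple S)) (corner_triple (triple_sum T S))"
    by (rule A.triple_iso_sym[OF corner_is_triple[OF TS] corner_sum[OF T S]])
  also have "triple_iso A (corner_triple (triple_sum T S)) (corner_triple W)"
    by (rule corner_iso[OF TS W iso])
  finally show "stably_equiv Polarization A (triple_sum (corner_triple T) (corner_triple S)) (corner_triple W)"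
    by (rule A.triple_iso_stably_equiv[OF A.is_triple_sum[OF cT cS] corner_is_triple[OF W]])
next
  fix E :: "('b, nat \<Rightarrow> 'b) triple" assume E: "elementary Grading B E"
  show "stably_equiv Polarization A (corner_triple E) zero_triple"
    by (rule A.elementary_stably_zero[OF corner_elementary[OF E]])
qed

text \<open>The stabilizing summands over \<open>A\<close> are isomorphic to the corners of their
  doubles. After this replacement the stable isomorphism is one between corners, lifts to
  \<open>B\<close>, and the doubles are elementary there.\<close>

lemma corner_reflects_stable:
  fixes T S :: "('b, nat \<Rightarrow> 'b) triple"
  assumes T: "is_triple Grading B T" and S: "is_triple Grading B S"
    and st: "stably_equiv Polarization A (corner_triple T) (corner_triple S)"
  shows "stably_equiv Grading B T S"
proof -
  obtain E F :: "('a, nat \<Rightarrow> 'a) triple" where EF: "elementary Polarization A E" "elementary Polarization A F"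
    "triple_iso A (triple_sum (corner_triple T) E) (triple_sum (corner_triple S) F)"
    using st by (rule A.stably_equivE)
  note E = A.elementary_is_triple[OF EF(1)] and F = A.elementary_is_triple[OF EF(2)]
  note dE = double_is_triple[OF E] and dF = double_is_triple[OF F]
  note cdE = corner_is_triple[OF dE]
  have "triple_iso A (corner_triple (triple_sum T (double_triple E)))
      (triple_sum (corner_triple T) (corner_triple (double_triple E)))"
    by (rule corner_sum[OF T dE])
  also have "triple_iso A \<dots> (triple_sum (corner_triple T) E)"
    by (rule A.triple_sum_cong[OF triple_iso_refl A.triple_iso_sym[OF E corner_double[OF E]]])
  also note EF(3)
  also have "triple_iso A (triple_sum (corner_triple S) F) (triple_sum (corner_triple S) (corner_triple (double_triple F)))"
    by (rule A.triple_sum_cong[OF triple_iso_refl corner_double[OF F]])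
  also have "triple_iso A \<dots> (corner_triple (triple_sum S (double_triple F)))"
    by (rule A.triple_iso_sym[OF corner_is_triple[OF B.is_triple_sum[OF S dF]] corner_sum[OF S dF]])
  finally have "triple_iso B (triple_sum T (double_triple E)) (triple_sum S (double_triple F))"
    by (rule corner_iso_lift[OF B.is_triple_sum[OF T dE] B.is_triple_sum[OF S dF]])
  then show ?thesis
    by (rule B.stably_equivI[OF T S double_elementary[OF EF(1)] double_elementary[OF EF(2)]])
qed

lemma corner_surjective:
  fixes S :: "('a, nat \<Rightarrow> 'a) triple"
  assumes S: "is_triple Polarization A S"
  shows "\<exists>T :: ('b, nat \<Rightarrow> 'b) triple. is_triple Grading B T \<and> stably_equiv Polarization A (corner_triple T) S"
proof -
  note dS = double_is_triple[OF S]
  obtain T :: "('b, nat \<Rightarrow> 'b) triple" where T: "is_triple Grading B T" "triple_iso B (double_triple S) T"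
    using B.normalize_triple[OF dS] .
  note cdS = corner_is_triple[OF dS] and cT = corner_is_triple[OF T(1)]
  have "triple_iso A S (corner_triple (double_triple S))" by (rule corner_double[OF S])
  also have "triple_iso A \<dots> (corner_triple T)" by (rule corner_iso[OF dS T])
  finally have "stably_equiv Polarization A S (corner_triple T)"
    by (rule A.triple_iso_stably_equiv[OF S cT])
  then show ?thesis
    using A.stably_equiv_sym[OF S] T(1) by blast
qed

theorem corner_class_map_iso:
  "corner.class_map \<in> iso (difference_group Grading B) (difference_group Polarization A)"
  by (rule corner.class_map_iso[OF corner_reflects_stable corner_surjective])

end

section \<open>Compatibility with base change\<close>

locale matrix_ring_surjection =
  B: matrix_ring_iso A B mat e11 e12 e21 e22 + D: matrix_ring_iso C D mat' e11' e12' e21' e22' +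
  \<phi>: graded_surjection A C \<phi> + \<Phi>: graded_surjection B D \<Phi>
  for A :: "'a gr_alg" and B :: "'b gr_alg" and mat e11 e12 e21 e22
    and C :: "'c gr_alg" and D :: "'d gr_alg" and mat' e11' e12' e21' e22' and \<phi> \<Phi> +
  assumes entries_\<Phi>: "x \<in> carrier B \<Longrightarrow> e11' (\<Phi> x) = \<phi> (e11 x)" "x \<in> carrier B \<Longrightarrow> e12' (\<Phi> x) = \<phi> (e12 x)"
    "x \<in> carrier B \<Longrightarrow> e21' (\<Phi> x) = \<phi> (e21 x)" "x \<in> carrier B \<Longrightarrow> e22' (\<Phi> x) = \<phi> (e22 x)"
begin

lemma \<Phi>_mat:
  assumes "a \<in> carrier A" "b \<in> carrier A" "c \<in> carrier A" "d \<in> carrier A"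
  shows "\<Phi> (mat a b c d) = mat' (\<phi> a) (\<phi> b) (\<phi> c) (\<phi> d)"
  by (rule D.matrix_eqI) (use assms in \<open>simp_all add: entries_\<Phi>\<close>)

text \<open>The same quotient map works, restricted to the corner, because \<open>\<Phi>\<close>
  takes \<open>E11\<close> to \<open>E11\<close>. The kernel condition is read off the entry
  \<open>e11\<close> of the extension of a functional to \<open>N\<close>.\<close>

lemma corner_base_change:
  assumes T: "is_triple Grading B T" and bc: "\<Phi>.is_base_change T S u"
  shows "\<phi>.is_base_change (B.corner_triple T) (D.corner_triple S) u"
proof -
  obtain N \<epsilon>1 \<epsilon>2 where TN: "T = (N, \<epsilon>1, \<epsilon>2)" by (rule prod_cases3)
  obtain P \<eta>1 \<eta>2 where SP: "S = (P, \<eta>1, \<eta>2)" by (rule prod_cases3)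
  note bc = bc[unfolded TN SP] and T = T[unfolded TN]
  have N: "left_module B N" using B.B.is_triple_left_module[OF T] .
  have P: "left_module D P" using \<Phi>.is_base_change_left_module[OF N bc] .
  interpret P: left_module D P by (rule P)
  note u = \<Phi>.is_base_changeD[OF bc]
  have um: "u (mat a b c d \<odot>\<^bsub>N\<^esub> x) = mat' (\<phi> a) (\<phi> b) (\<phi> c) (\<phi> d) \<odot>\<^bsub>P\<^esub> u x"
    if "a \<in> carrier A" "b \<in> carrier A" "c \<in> carrier A" "d \<in> carrier A" "x \<in> carrier N" for a b c d x
    using u(4)[of "mat a b c d" x] that by (simp add: \<Phi>_mat)
  have \<epsilon>: "\<epsilon>1 x \<in> carrier N" "\<epsilon>2 x \<in> carrier N" if "x \<in> carrier N" for x
    using T B.B.symmetryD(3)[OF N _ that] unfolding is_triple_iff by blast+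
  have uc: "u x \<in> carrier (D.corner P)" if "x \<in> carrier (B.corner N)" for x
    using that um[of "\<one>\<^bsub>A\<^esub>" "\<zero>\<^bsub>A\<^esub>" "\<zero>\<^bsub>A\<^esub>" "\<zero>\<^bsub>A\<^esub>" x] u(10)[of x] by simp
  have surj: "u ` carrier (B.corner N) = carrier (D.corner P)"
  proof
    show "u ` carrier (B.corner N) \<subseteq> carrier (D.corner P)" using uc by blast
    show "carrier (D.corner P) \<subseteq> u ` carrier (B.corner N)"
    proof
      fix p assume p: "p \<in> carrier (D.corner P)"
      then obtain x where x: "x \<in> carrier N" "p = u x" using u(12) by auto
      have "p = u (mat \<one>\<^bsub>A\<^esub> \<zero>\<^bsub>A\<^esub> \<zero>\<^bsub>A\<^esub> \<zero>\<^bsub>A\<^esub> \<odot>\<^bsub>N\<^esub> x)"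
        using p x by (simp add: um)
      moreover have "mat \<one>\<^bsub>A\<^esub> \<zero>\<^bsub>A\<^esub> \<zero>\<^bsub>A\<^esub> \<zero>\<^bsub>A\<^esub> \<odot>\<^bsub>N\<^esub> x \<in> carrier (B.corner N)"
        by (rule B.corner_projections[OF N x(1)]) simp_all
      ultimately show "p \<in> u ` carrier (B.corner N)" by blast
    qed
  qed
  have sym: "u (B.corner_sym N \<epsilon> x) = D.corner_sym P \<eta> (u x)"
    if "x \<in> carrier (B.corner N)" "\<epsilon> x \<in> carrier N" "u (\<epsilon> x) = \<eta> (u x)" for \<epsilon> \<eta> x
    using that uc[OF that(1)] by (simp add: B.corner_sym_def D.corner_sym_def um)
  have ker: "\<phi> (f x) = \<zero>\<^bsub>C\<^esub>"
    if x: "x \<in> carrier (B.corner N)" and 0: "u x = \<zero>\<^bsub>P\<^esub>" and f: "f \<in> functionals A (B.corner N)" for x f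
  proof -
    define g where "g = (\<lambda>y. mat (f (mat \<one>\<^bsub>A\<^esub> \<zero>\<^bsub>A\<^esub> \<zero>\<^bsub>A\<^esub> \<zero>\<^bsub>A\<^esub> \<odot>\<^bsub>N\<^esub> y)) \<zero>\<^bsub>A\<^esub> (f (mat \<zero>\<^bsub>A\<^esub> \<one>\<^bsub>A\<^esub> \<zero>\<^bsub>A\<^esub> \<zero>\<^bsub>A\<^esub> \<odot>\<^bsub>N\<^esub> y)) \<zero>\<^bsub>A\<^esub>)"
    have g: "g \<in> functionals B N"
      unfolding g_def by (rule B.corner_functional[OF N f])
    have xN: "x \<in> carrier N" using x by simp
    have "\<Phi> (g x) = \<zero>\<^bsub>D\<^esub>" by (rule u(9)[OF xN 0 g])
    moreover have "e11' \<zero>\<^bsub>D\<^esub> = \<zero>\<^bsub>C\<^esub>"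
      unfolding D.mat_zero[symmetric] by simp
    ultimately have "\<phi> (e11 (g x)) = \<zero>\<^bsub>C\<^esub>"
      using entries_\<Phi>(1)[OF functionalsD(2)[OF g xN]] by simp
    moreover have "f (mat \<zero>\<^bsub>A\<^esub> \<one>\<^bsub>A\<^esub> \<zero>\<^bsub>A\<^esub> \<zero>\<^bsub>A\<^esub> \<odot>\<^bsub>N\<^esub> x) \<in> carrier A"
      by (rule functionalsD(2)[OF f B.corner_projections[OF N xN]]) simp_all
    ultimately show ?thesis
      using x functionalsD(2)[OF f x] by (simp add: g_def)
  qed
  show ?thesis
    unfolding TN SP B.corner_triple_eq D.corner_triple_eq \<phi>.is_base_change_def
    using surj sym ker u(2,3,7,8) \<epsilon> um
    by (auto simp del: B.corner_simps(1) D.corner_simps(1))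
      (auto simp: B.corner_sym_def D.corner_sym_def)
qed

text \<open>Both sides are represented by the corner of the base change of \<open>T\<close>. The
  copies \<open>S\<close> and \<open>U\<close> appear because class maps accept representatives in
  the canonical type only.\<close>

lemma class_map_naturality:
  assumes "x \<in> carrier (difference_group Grading B)"
  shows "induced_map Polarization \<phi> A C (B.corner.class_map x) = D.corner.class_map (induced_map Grading \<Phi> B D x)"
proof -
  obtain T :: "('b, nat \<Rightarrow> 'b) triple" where T: "is_triple Grading B T" "x = triple_class Grading B T"
    using B.B.difference_group_carrierE[OF assms] .
  obtain v where v: "\<Phi>.is_base_change T (triple_base_change \<Phi> B D T) v"
    using \<Phi>.base_change_exists[OF T(1)] .
  have bT: "is_triple Grading D (triple_base_change \<Phi> B D T)"
    by (rule \<Phi>.base_change_is_triple[OF T(1) v])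
  have ind: "induced_map Grading \<Phi> B D x = triple_class Grading D (triple_base_change \<Phi> B D T)"
    unfolding T(2) by (rule \<Phi>.induced_map_class[OF T(1) v])
  obtain S :: "('d, nat \<Rightarrow> 'd) triple" where S: "is_triple Grading D S" "triple_iso D (triple_base_change \<Phi> B D T) S"
    using D.B.normalize_triple[OF bT] .
  have cS: "is_triple Polarization C (D.corner_triple S)" by (rule D.corner_is_triple[OF S(1)])
  have cb: "is_triple Polarization C (D.corner_triple (triple_base_change \<Phi> B D T))"
    by (rule D.corner_is_triple[OF bT])
  have "D.corner.class_map (induced_map Grading \<Phi> B D x) = triple_class Polarization C (D.corner_triple S)"
    unfolding ind D.B.triple_class_eq[OF bT S(1) D.B.triple_iso_stably_equiv[OF bT S]]
    by (rule D.corner.class_map_class[OF S(1)])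
  also have "\<dots> = triple_class Polarization C (D.corner_triple (triple_base_change \<Phi> B D T))"
    by (rule D.A.triple_class_eq[OF cb cS D.A.triple_iso_stably_equiv[OF cb cS D.corner_iso[OF bT S]], symmetric])
  finally have 1: "D.corner.class_map (induced_map Grading \<Phi> B D x)
      = triple_class Polarization C (D.corner_triple (triple_base_change \<Phi> B D T))" .
  note cT = B.corner_is_triple[OF T(1)]
  obtain U :: "('a, nat \<Rightarrow> 'a) triple" where U: "is_triple Polarization A U" "triple_iso A (B.corner_triple T) U"
    using B.A.normalize_triple[OF cT] .
  obtain w where w: "\<phi>.is_base_change U (D.corner_triple (triple_base_change \<Phi> B D T)) w"
    using \<phi>.is_base_change_iso[OF U(1) cT B.A.triple_iso_sym[OF cT U(2)] corner_base_change[OF T(1) v]] .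
  have "B.corner.class_map x = triple_class Polarization A U"
    unfolding T(2) B.corner.class_map_class[OF T(1)]
    by (rule B.A.triple_class_eq[OF cT U(1) B.A.triple_iso_stably_equiv[OF cT U]])
  then show ?thesis
    unfolding 1 using \<phi>.induced_map_class[OF U(1) w] by simp
qed

end

lemma (in comm_group) comm_group_subgroup:
  assumes "subgroup H G"
  shows "comm_group (G\<lparr>carrier := H\<rparr>)"
  by (rule group.group_comm_groupI[OF subgroup.subgroup_is_group[OF assms group_axioms]])
    (use subgroup.subset[OF assms] in \<open>auto intro: m_comm\<close>)

text \<open>Injectivity of \<open>l\<close> makes \<open>h x\<close> lie in the kernel exactly when
  \<open>x\<close> does, so \<open>h\<close> restricts to a bijection of kernels.\<close>

lemma kernel_iso:
  assumes G: "comm_group G" "comm_group G'" "comm_group H" "comm_group H'"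
    and h: "h \<in> iso G G'" and l: "l \<in> iso H H'" and i: "i \<in> hom G H" and j: "j \<in> hom G' H'"
    and comm: "\<And>x. x \<in> carrier G \<Longrightarrow> j (h x) = l (i x)"
  shows "comm_group (G\<lparr>carrier := kernel G H i\<rparr>)" "comm_group (G'\<lparr>carrier := kernel G' H' j\<rparr>)"
    and "h \<in> iso (G\<lparr>carrier := kernel G H i\<rparr>) (G'\<lparr>carrier := kernel G' H' j\<rparr>)"
proof -
  interpret G: comm_group G by fact
  interpret G': comm_group G' by fact
  interpret H: comm_group H by fact
  interpret H': comm_group H' by fact
  interpret i: group_hom G H i by unfold_locales (rule i)
  interpret j: group_hom G' H' j by unfold_locales (rule j)
  interpret l: group_hom H H' l by unfold_locales (use l in \<open>simp add: iso_def\<close>)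
  interpret h: group_hom G G' h by unfold_locales (use h in \<open>simp add: iso_def\<close>)
  show "comm_group (G\<lparr>carrier := kernel G H i\<rparr>)"
    by (rule G.comm_group_subgroup[OF i.subgroup_kernel])
  show "comm_group (G'\<lparr>carrier := kernel G' H' j\<rparr>)"
    by (rule G'.comm_group_subgroup[OF j.subgroup_kernel])
  have bij: "bij_betw h (carrier G) (carrier G')" and linj: "inj_on l (carrier H)"
    using h l by (auto simp: iso_def bij_betw_def)
  have mem: "h x \<in> kernel G' H' j \<longleftrightarrow> x \<in> kernel G H i" if x: "x \<in> carrier G" for x
  proof -
    have "j (h x) = \<one>\<^bsub>H'\<^esub> \<longleftrightarrow> l (i x) = l \<one>\<^bsub>H\<^esub>"
      using comm[OF x] by simp
    also have "\<dots> \<longleftrightarrow> i x = \<one>\<^bsub>H\<^esub>"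
      by (rule inj_on_eq_iff[OF linj]) (use x in simp_all)
    finally show ?thesis using x by (simp add: kernel_def)
  qed
  show "h \<in> iso (G\<lparr>carrier := kernel G H i\<rparr>) (G'\<lparr>carrier := kernel G' H' j\<rparr>)"
  proof (rule isoI)
    show "h \<in> hom (G\<lparr>carrier := kernel G H i\<rparr>) (G'\<lparr>carrier := kernel G' H' j\<rparr>)"
      by (rule homI) (use mem in \<open>auto simp: kernel_def\<close>)
    have "h ` kernel G H i = kernel G' H' j"
    proof
      show "h ` kernel G H i \<subseteq> kernel G' H' j" using mem by (auto simp: kernel_def)
      show "kernel G' H' j \<subseteq> h ` kernel G H i"
      proof
        fix y assume y: "y \<in> kernel G' H' j"
        then have "y \<in> h ` carrier G" using bij by (simp add: bij_betw_def kernel_def)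
        then show "y \<in> h ` kernel G H i" using mem y by blast
      qed
    qed
    moreover have "inj_on h (kernel G H i)"
      using bij by (auto simp: bij_betw_def kernel_def inj_on_def)
    ultimately show "bij_betw h (carrier (G\<lparr>carrier := kernel G H i\<rparr>)) (carrier (G'\<lparr>carrier := kernel G' H' j\<rparr>))"
      by (simp add: bij_betw_def)
  qed
qed

section \<open>\<open>Cl\<^bsub>+2\<^esub> \<otimes> A\<^sup>o\<^sup>p\<close> as an algebra of matrices\<close>

lemma (in graded_space) parity_projections:
  assumes "a \<in> carrier R"
  shows "a \<oplus> parity R a \<in> part R 0" "a \<ominus> parity R a \<in> part R 1"
proof -
  have "rscale R 2 (hcomp R 0 a) = a \<oplus> parity R a" "rscale R 2 (hcomp R 1 a) = a \<ominus> parity R a"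
    unfolding hcomp_even_eq[OF assms] using assms by (simp_all add: scale_scale)
  then show "a \<oplus> parity R a \<in> part R 0" "a \<ominus> parity R a \<in> part R 1"
    using part_scale[of 0 "hcomp R 0 a" 2] part_scale[of 1 "hcomp R 1 a" 2] hcomp_part[OF assms] by simp_all
qed

section \<open>The Clifford tensor product as a graded normed space\<close>

lemma clifford_tensor_simps [simp]:
  "carrier (clifford_tensor n D) = Pow {..<n} \<rightarrow>\<^sub>E carrier D"
  "\<one>\<^bsub>clifford_tensor n D\<^esub> = (\<lambda>I\<in>Pow {..<n}. if I = {} then \<one>\<^bsub>D\<^esub> else \<zero>\<^bsub>D\<^esub>)"
  "\<zero>\<^bsub>clifford_tensor n D\<^esub> = (\<lambda>I\<in>Pow {..<n}. \<zero>\<^bsub>D\<^esub>)"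
  "x \<oplus>\<^bsub>clifford_tensor n D\<^esub> y = (\<lambda>I\<in>Pow {..<n}. x I \<oplus>\<^bsub>D\<^esub> y I)"
  "rscale (clifford_tensor n D) r x = (\<lambda>I\<in>Pow {..<n}. rscale D r (x I))"
  "nrm (clifford_tensor n D) x = (\<Sum>I\<in>Pow {..<n}. nrm D (x I))"
  "part (clifford_tensor n D) d = (\<Pi>\<^sub>E I\<in>Pow {..<n}. part D ((d + card I) mod 2))"
  by (simp_all add: clifford_tensor_def)

context normed_graded_space
begin

lemma clifford_tensor_abelian_group: "abelian_group (clifford_tensor n R)"
proof (rule abelian_groupI)
  fix x assume x: "x \<in> carrier (clifford_tensor n R)"
  show "\<exists>y\<in>carrier (clifford_tensor n R). y \<oplus>\<^bsub>clifford_tensor n R\<^esub> x = \<zero>\<^bsub>clifford_tensor n R\<^esub>"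
  proof
    show "(\<lambda>I\<in>Pow {..<n}. \<ominus> x I) \<in> carrier (clifford_tensor n R)"
      using x by (auto simp: PiE_iff)
    show "(\<lambda>I\<in>Pow {..<n}. \<ominus> x I) \<oplus>\<^bsub>clifford_tensor n R\<^esub> x = \<zero>\<^bsub>clifford_tensor n R\<^esub>"
      using x by (auto simp: PiE_iff l_neg restrict_def fun_eq_iff)
  qed
qed (auto simp: PiE_iff a_ac restrict_def fun_eq_iff extensional_def)

lemma mod2_cases: "(k :: nat) mod 2 \<in> {0, 1}"
  by auto

lemma clifford_tensor_normed_graded_space: "normed_graded_space (clifford_tensor n R)"
proof -
  let ?B = "clifford_tensor n R"
  interpret B: abelian_group ?B by (rule clifford_tensor_abelian_group)
  show ?thesis
  proof unfold_locales
    fix i :: nat assume "i \<in> {0, 1}"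
    show "part ?B i \<subseteq> carrier ?B"
      using part_subset[OF mod2_cases] by (fastforce simp: PiE_iff)
    show "\<zero>\<^bsub>?B\<^esub> \<in> part ?B i"
      using part_zero[OF mod2_cases] by (simp add: PiE_iff)
    fix x assume x: "x \<in> part ?B i"
    show "rscale ?B r x \<in> part ?B i" for r
      using x part_scale[OF mod2_cases] by (simp add: PiE_iff)
    fix y assume y: "y \<in> part ?B i"
    show "x \<oplus>\<^bsub>?B\<^esub> y \<in> part ?B i"
      using x y part_add[OF mod2_cases] by (simp add: PiE_iff)
  next
    fix x assume x: "x \<in> carrier ?B"
    \<comment> \<open>The basis element indexed by \<open>I\<close> has the parity of
      \<open>card I\<close>, so a homogeneous element of degree \<open>d\<close> has coefficients of
      degree \<open>d + card I\<close>.\<close>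
    define h where "h d = (\<lambda>I\<in>Pow {..<n}. hcomp R ((d + card I) mod 2) (x I))" for d
    have xI: "x I \<in> carrier R" if "I \<in> Pow {..<n}" for I
      using x that by (auto simp: PiE_iff)
    have "hcomp R ((d + card I) mod 2) (x I) \<in> part R ((d + card I) mod 2)" if "I \<in> Pow {..<n}" for d I
      using hcomp_part[OF xI[OF that]] by (cases "even (d + card I)") (simp_all add: even_iff_mod_2_eq_zero odd_iff_mod_2_eq_one)
    moreover from this have hc: "hcomp R ((d + card I) mod 2) (x I) \<in> carrier R" if "I \<in> Pow {..<n}" for d I
      using part_subset[OF mod2_cases] that by blast
    ultimately have "h d \<in> part ?B d" for d
      by (simp add: h_def)
    moreover have "x = h 0 \<oplus>\<^bsub>?B\<^esub> h 1"
    proof (rule PiE_ext[of _ "Pow {..<n}" "\<lambda>_. carrier R"])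
      show "x \<in> Pow {..<n} \<rightarrow>\<^sub>E carrier R" using x by simp
      show "h 0 \<oplus>\<^bsub>?B\<^esub> h 1 \<in> Pow {..<n} \<rightarrow>\<^sub>E carrier R"
        using hc[of _ 0] hc[of _ 1] by (auto simp: h_def)
      fix I assume I: "I \<in> Pow {..<n}"
      show "x I = (h 0 \<oplus>\<^bsub>?B\<^esub> h 1) I"
        using hcomp_part(3)[OF xI[OF I]] I hcomp_closed[OF xI[OF I]]
        by (cases "even (card I)") (simp_all add: h_def even_iff_mod_2_eq_zero odd_iff_mod_2_eq_one mod_Suc a_comm)
    qed
    ultimately show "\<exists>u\<in>part ?B 0. \<exists>v\<in>part ?B 1. x = u \<oplus>\<^bsub>?B\<^esub> v" by blast
  next
    have "x I = \<zero>" if "x \<in> part ?B 0" "x \<in> part ?B 1" "I \<in> Pow {..<n}" for x I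
    proof -
      have "x I \<in> part R (card I mod 2)" "x I \<in> part R ((1 + card I) mod 2)"
        using that by (auto simp: PiE_iff)
      then have "x I \<in> part R 0 \<inter> part R 1"
        by (cases "even (card I)") (auto simp: even_iff_mod_2_eq_zero odd_iff_mod_2_eq_one mod_Suc)
      then show ?thesis unfolding part_int by simp
    qed
    then have "part ?B 0 \<inter> part ?B 1 \<subseteq> {\<zero>\<^bsub>?B\<^esub>}"
      by (auto simp: PiE_iff extensional_def fun_eq_iff restrict_def)
    moreover have "\<zero>\<^bsub>?B\<^esub> \<in> part ?B 0 \<inter> part ?B 1"
      using part_zero[OF mod2_cases] by (simp add: PiE_iff)
    ultimately show "part ?B 0 \<inter> part ?B 1 = {\<zero>\<^bsub>?B\<^esub>}" by blast
  next
    fix x assume x: "x \<in> carrier ?B"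
    then have xI: "x I \<in> carrier R" if "I \<in> Pow {..<n}" for I
      using that by (auto simp: PiE_iff)
    show "0 \<le> nrm ?B x"
      unfolding clifford_tensor_simps using xI by (intro sum_nonneg) simp
    show "nrm ?B x = 0 \<longleftrightarrow> x = \<zero>\<^bsub>?B\<^esub>"
    proof -
      have "nrm ?B x = 0 \<longleftrightarrow> (\<forall>I\<in>Pow {..<n}. nrm R (x I) = 0)"
        unfolding clifford_tensor_simps using xI by (intro sum_nonneg_eq_0_iff) simp_all
      also have "\<dots> \<longleftrightarrow> (\<forall>I\<in>Pow {..<n}. x I = \<zero>)"
        using xI by (simp add: nrm_eq_0)
      also have "\<dots> \<longleftrightarrow> x = \<zero>\<^bsub>?B\<^esub>"
        using x by (auto simp: PiE_iff extensional_def fun_eq_iff restrict_def)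
      finally show ?thesis .
    qed
    show "nrm ?B (rscale ?B r x) = \<bar>r\<bar> * nrm ?B x" for r
      using xI by (simp add: nrm_scale sum_distrib_left)
    fix y assume y: "y \<in> carrier ?B"
    then have "y I \<in> carrier R" if "I \<in> Pow {..<n}" for I
      using that by (auto simp: PiE_iff)
    then show "nrm ?B (x \<oplus>\<^bsub>?B\<^esub> y) \<le> nrm ?B x + nrm ?B y"
      using xI by (simp add: sum.distrib[symmetric] del: sum.distrib) (intro sum_mono, simp add: nrm_triangle)
  qed (auto simp: PiE_iff scale_add_right scale_add_left scale_scale restrict_def fun_eq_iff extensional_def)
qed

text \<open>The sign is the parity of the product of the generators in \<open>I\<close>. Rather than
  computing components, the candidate is checked with \<open>parityI\<close>.\<close>

lemma parity_clifford_tensor: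
  assumes x: "x \<in> carrier (clifford_tensor n R)"
  shows "parity (clifford_tensor n R) x = (\<lambda>I\<in>Pow {..<n}. rscale R ((-1) ^ card I) (parity R (x I)))"
proof -
  let ?B = "clifford_tensor n R"
  interpret B: normed_graded_space ?B by (rule clifford_tensor_normed_graded_space)
  define z where "z = (\<lambda>I\<in>Pow {..<n}. rscale R ((-1) ^ card I) (parity R (x I)))"
  have xI: "x I \<in> carrier R" if "I \<in> Pow {..<n}" for I
    using x that by (auto simp: PiE_iff)
  have z: "z \<in> carrier ?B"
    using xI by (auto simp: z_def)
  have neg: "\<ominus>\<^bsub>?B\<^esub> z = (\<lambda>I\<in>Pow {..<n}. \<ominus> z I)"
  proof -
    have "\<ominus>\<^bsub>?B\<^esub> z = (\<lambda>I\<in>Pow {..<n}. rscale R (-1) (z I))"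
      unfolding B.scale_minus_one[OF z, symmetric] by simp
    also have "\<dots> = (\<lambda>I\<in>Pow {..<n}. \<ominus> z I)"
      by (rule restrict_ext) (use z in \<open>auto simp: scale_minus_one PiE_iff\<close>)
    finally show ?thesis .
  qed
  have s: "x I \<oplus> z I \<in> part R (card I mod 2)" "x I \<ominus> z I \<in> part R ((1 + card I) mod 2)"
    if I: "I \<in> Pow {..<n}" for I
  proof -
    have zI: "z I = rscale R ((-1) ^ card I) (parity R (x I))"
      using I by (simp add: z_def)
    show "x I \<oplus> z I \<in> part R (card I mod 2)" "x I \<ominus> z I \<in> part R ((1 + card I) mod 2)"
      using parity_projections[OF xI[OF I]] xI[OF I] unfolding zI
      by (cases "even (card I)"; simp add: even_iff_mod_2_eq_zero odd_iff_mod_2_eq_one mod_Suc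
          scale_minus_one minus_eq)+
  qed
  have "parity ?B x = z"
  proof (rule B.parityI[OF x z])
    show "x \<oplus>\<^bsub>?B\<^esub> z \<in> part ?B 0" using s(1) by (simp add: PiE_iff)
    have "x \<ominus>\<^bsub>?B\<^esub> z = (\<lambda>I\<in>Pow {..<n}. x I \<ominus> z I)"
      by (auto simp: B.minus_eq neg minus_eq restrict_def fun_eq_iff)
    then show "x \<ominus>\<^bsub>?B\<^esub> z \<in> part ?B 1" using s(2) by (simp add: PiE_iff)
  qed
  then show ?thesis by (simp add: z_def)
qed

end

section \<open>Homogeneous components under products and adjoints\<close>

context normed_graded_ring
begin

lemma hcomp_mult_even:
  assumes a: "a \<in> part R 0" and b: "b \<in> carrier R"
  shows "hcomp R 0 (a \<otimes> b) = a \<otimes> hcomp R 0 b" "hcomp R 1 (a \<otimes> b) = a \<otimes> hcomp R 1 b"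
proof -
  have ac: "a \<in> carrier R" using a part_closed_carrier by blast
  show "hcomp R 0 (a \<otimes> b) = a \<otimes> hcomp R 0 b" "hcomp R 1 (a \<otimes> b) = a \<otimes> hcomp R 1 b"
    using ac b by (simp_all add: hcomp_even_eq[unfolded One_nat_def] parity_mult parity_even[OF a] scale_mult_right
        r_distr minus_eq r_minus)
qed

lemma hcomp_mult_odd:
  assumes a: "a \<in> part R 1" and b: "b \<in> carrier R"
  shows "hcomp R 0 (a \<otimes> b) = a \<otimes> hcomp R 1 b" "hcomp R 1 (a \<otimes> b) = a \<otimes> hcomp R 0 b"
proof -
  have ac: "a \<in> carrier R" using a part_closed_carrier by blast
  show "hcomp R 0 (a \<otimes> b) = a \<otimes> hcomp R 1 b" "hcomp R 1 (a \<otimes> b) = a \<otimes> hcomp R 0 b"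
    using ac b by (simp_all add: hcomp_even_eq[unfolded One_nat_def] parity_mult parity_odd[OF a] scale_mult_right
        r_distr minus_eq r_minus l_minus)
qed

lemma hcomp_one: "hcomp R 0 \<one> = \<one>" "hcomp R (Suc 0) \<one> = \<zero>"
  using hcomp_even_eq[of \<one>] scale_add_left[of \<one> "1/2" "1/2"] by (simp_all add: scale_add_right)

lemma hcomp_bounded:
  obtains K where "K \<ge> 0" "\<And>a. a \<in> carrier R \<Longrightarrow> nrm R (hcomp R 0 a) \<le> K * nrm R a"
    "\<And>a. a \<in> carrier R \<Longrightarrow> nrm R (hcomp R 1 a) \<le> K * nrm R a"
proof -
  obtain C where C: "\<And>a. a \<in> carrier R \<Longrightarrow> nrm R (parity R a) \<le> C * nrm R a"
    using nrm_parity_bounded by blast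
  define K where "K = (1 + \<bar>C\<bar>) / 2"
  have C': "nrm R (parity R a) \<le> \<bar>C\<bar> * nrm R a" if "a \<in> carrier R" for a
    using C[OF that] mult_right_mono[OF abs_ge_self[of C] nrm_nonneg[OF that]] by simp
  have 0: "nrm R (hcomp R 0 a) \<le> K * nrm R a" if a: "a \<in> carrier R" for a
  proof -
    have "nrm R (hcomp R 0 a) = 1/2 * nrm R (a \<oplus> parity R a)"
      unfolding hcomp_even_eq[OF a] using a by (simp add: nrm_scale)
    also have "\<dots> \<le> 1/2 * (nrm R a + \<bar>C\<bar> * nrm R a)"
      using nrm_triangle[of a "parity R a"] C'[OF a] a by simp
    finally show ?thesis by (simp add: K_def field_simps)
  qed
  have 1: "nrm R (hcomp R 1 a) \<le> K * nrm R a" if a: "a \<in> carrier R" for a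
  proof -
    have "nrm R (hcomp R 1 a) = 1/2 * nrm R (a \<ominus> parity R a)"
      unfolding hcomp_even_eq[OF a] using a by (simp add: nrm_scale)
    also have "\<dots> \<le> 1/2 * (nrm R a + \<bar>C\<bar> * nrm R a)"
      using nrm_diff_le[of a "parity R a"] C'[OF a] a by simp
    finally show ?thesis by (simp add: K_def field_simps)
  qed
  have "K \<ge> 0" by (simp add: K_def)
  then show ?thesis using that 0 1 by blast
qed

end

context normed_graded_star_ring
begin

lemma star_zero [simp]: "star R \<zero> = \<zero>"
  using star_scale[of \<zero> 0] by simp

lemma star_neg: "a \<in> carrier R \<Longrightarrow> star R (\<ominus> a) = \<ominus> star R a"
  using star_scale[of a "-1"] by (simp add: scale_minus_one)

lemma star_one [simp]: "star R \<one> = \<one>"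
proof -
  have "star R (\<one> \<otimes> star R \<one>) = star R (star R \<one>) \<otimes> star R \<one>"
    by (rule star_mult) simp_all
  then show ?thesis by simp
qed

lemma hcomp_star:
  assumes "a \<in> carrier R"
  shows "hcomp R 0 (star R a) = star R (hcomp R 0 a)" "hcomp R 1 (star R a) = star R (hcomp R 1 a)"
proof -
  have e: "star R a = star R (hcomp R 0 a) \<oplus> star R (hcomp R 1 a)"
    using hcomp_part(3)[OF assms] star_add[of "hcomp R 0 a" "hcomp R 1 a"] assms by simp
  show "hcomp R 0 (star R a) = star R (hcomp R 0 a)" "hcomp R 1 (star R a) = star R (hcomp R 1 a)"
    unfolding e using hcomp_add star_part hcomp_part[OF assms] by simp_all
qed

lemma parity_star: "a \<in> carrier R \<Longrightarrow> parity R (star R a) = star R (parity R a)"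
  using hcomp_star by (simp add: parity_eq minus_eq star_add star_neg)

end

text \<open>An opaque copy of \<open>sym_diff\<close>, so that the finite table below can act as
  rewrite rules.\<close>

definition symdiff :: "nat set \<Rightarrow> nat set \<Rightarrow> nat set" where
  "symdiff I K = sym_diff I K"

lemma symdiff_values [unfolded One_nat_def, simp]:
  "symdiff {} K = K" "symdiff K {} = K" "symdiff K K = {}"
  "symdiff {0} {1} = {0, 1}" "symdiff {0} {0, 1} = {1}"
  "symdiff {1} {0} = {0, 1}" "symdiff {1} {0, 1} = {0}"
  "symdiff {0, 1} {0} = {1}" "symdiff {0, 1} {1} = {0}"
  by (auto simp: symdiff_def)

lemma symdiff_closed: "I \<in> Pow {..<n} \<Longrightarrow> K \<in> Pow {..<n} \<Longrightarrow> symdiff I K \<in> Pow {..<n}"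
  by (auto simp: symdiff_def)

text \<open>With two generators the only possible inversion is the pair \<open>(1, 0)\<close>, so
  the sign is negative exactly when \<open>I\<close> contains 1 and \<open>J\<close> contains
  0.\<close>

lemma clifford_sign_values [unfolded One_nat_def, simp]:
  "clifford_sign {} J = 1" "clifford_sign I {} = 1" "clifford_sign {0} J = 1"
  "clifford_sign {1} {1} = 1" "clifford_sign {0, 1} {1} = 1"
  "clifford_sign {1} {0} = -1" "clifford_sign {0, 1} {0} = -1"
  "clifford_sign {1} {0, 1} = -1" "clifford_sign {0, 1} {0, 1} = -1"
proof -
  have "{(i, j). i \<in> {1::nat} \<and> j \<in> {0} \<and> j < i} = {(1, 0)}"
    "{(i, j). i \<in> {0, 1::nat} \<and> j \<in> {0} \<and> j < i} = {(1, 0)}"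
    "{(i, j). i \<in> {1::nat} \<and> j \<in> {0, 1} \<and> j < i} = {(1, 0)}"
    "{(i, j). i \<in> {0, 1::nat} \<and> j \<in> {0, 1} \<and> j < i} = {(1, 0)}"
    by auto
  then show "clifford_sign {1} {0} = -1" "clifford_sign {0, 1} {0} = -1"
    "clifford_sign {1} {0, 1} = -1" "clifford_sign {0, 1} {0, 1} = -1"
    by (simp_all only: clifford_sign_def card.insert card.empty finite.emptyI empty_iff if_False simp_thms) simp_all
  have "{(i, j). i \<in> {0, 1::nat} \<and> j \<in> {1} \<and> j < i} = {}" "{(i, j). i \<in> {1::nat} \<and> j \<in> {1} \<and> j < i} = {}"
    by auto
  then show "clifford_sign {1} {1} = 1" "clifford_sign {0, 1} {1} = 1"
    by (simp_all only: clifford_sign_def card.empty power_0)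
  have "{(i, j). i \<in> {0::nat} \<and> j \<in> J \<and> j < i} = {}" by auto
  then show "clifford_sign {0} J = 1"
    by (simp only: clifford_sign_def card.empty power_0)
qed (simp_all add: clifford_sign_def)

lemma Pow_2: "Pow {..<2::nat} = {{}, {0}, {1}, {0, 1}}"
proof -
  have "{..<2::nat} = {0, 1}" by auto
  then show ?thesis by (simp add: Pow_insert) blast
qed

lemma (in abelian_group) finsum_Pow_2:
  assumes "\<And>I. I \<in> Pow {..<2::nat} \<Longrightarrow> g I \<in> carrier G"
  shows "finsum G g (Pow {..<2::nat}) = g {} \<oplus> (g {0} \<oplus> (g {1} \<oplus> g {0, 1}))"
proof -
  have g: "g {} \<in> carrier G" "g {0} \<in> carrier G" "g {1} \<in> carrier G" "g {0, 1} \<in> carrier G"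
    using assms unfolding Pow_2 by simp_all
  have ne: "({0} :: nat set) \<noteq> {0, 1}" "({1} :: nat set) \<noteq> {0, 1}" "({0} :: nat set) \<noteq> {1}" by auto
  show ?thesis
    unfolding Pow_2 using g ne by (simp add: finsum_insert Pi_def)
qed

lemma sum_Pow_2:
  fixes g :: "nat set \<Rightarrow> real"
  shows "sum g (Pow {..<2::nat}) = g {} + g {0} + g {1} + g {0, 1}"
proof -
  have ne: "({0} :: nat set) \<noteq> {0, 1}" "({1} :: nat set) \<noteq> {0, 1}" "({0} :: nat set) \<noteq> {1}" by auto
  then show ?thesis
    unfolding Pow_2 by simp
qed

text \<open>Opposites are described by axioms rather than by the record \<open>opposite A\<close>,
  so that \<open>unitization (opposite A)\<close> and the real numbers are instances as well. In the
  product, splitting \<open>d\<close> by degree absorbs the Koszul sign: only its odd part sees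
  \<open>f\<close>, through the parity of \<open>f\<close>.\<close>

locale graded_opposite = normed_graded_star_ring A for A :: "'a gr_alg" (structure) +
  fixes D :: "'a gr_alg"
  assumes opposite_simps: "carrier D = carrier A" "ring.zero D = ring.zero A" "ring.add D = ring.add A"
      "monoid.one D = monoid.one A" "rscale D = rscale A" "nrm D = nrm A" "part D = part A"
    and opposite_mult: "d \<in> carrier A \<Longrightarrow> f \<in> carrier A \<Longrightarrow>
      d \<otimes>\<^bsub>D\<^esub> f = f \<otimes> hcomp A 0 d \<oplus> parity A f \<otimes> hcomp A 1 d"
begin

lemma add_monoid_D: "add_monoid D = add_monoid A"
  by (simp add: opposite_simps)

lemma finsum_D: "finsum D = finsum A"
  by (rule ext)+ (simp add: finsum_def add_monoid_D)

lemma hcomp_D: "hcomp D = hcomp A"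
  by (intro ext) (simp add: hcomp_def opposite_simps)

lemma parity_D: "parity D = parity A"
  by (rule ext) (simp add: parity_def hcomp_D finsum_D opposite_simps)

lemma normed_graded_space_D: "normed_graded_space D"
proof -
  have "abelian_group D"
    by (rule abelian_groupI) (auto simp: opposite_simps a_ac intro!: bexI[of _ "\<ominus> _"] l_neg)
  then interpret D: abelian_group D .
  show ?thesis
  proof unfold_locales
    show "part D 0 \<inter> part D 1 = {\<zero>\<^bsub>D\<^esub>}" using part_int by (simp add: opposite_simps)
    show "\<exists>x\<in>part D 0. \<exists>y\<in>part D 1. a = x \<oplus>\<^bsub>D\<^esub> y" if "a \<in> carrier D" for a
      using part_sum that unfolding opposite_simps by blast
    show "i \<in> {0, 1} \<Longrightarrow> part D i \<subseteq> carrier D" for i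
      using part_subset unfolding opposite_simps by blast
  qed (simp_all add: opposite_simps scale_add_right scale_add_left scale_scale part_zero part_add
      part_scale nrm_eq_0 nrm_scale nrm_triangle)
qed

abbreviation B :: "(nat set \<Rightarrow> 'a) gr_alg" where
  "B \<equiv> clifford_tensor 2 D"

sublocale B: normed_graded_space B
  by (rule normed_graded_space.clifford_tensor_normed_graded_space[OF normed_graded_space_D])

text \<open>Coefficients are passed through the adjoint of \<open>A\<close>, which restores the
  order of factors that the product of \<open>D\<close> reverses, and are then split by
  degree.\<close>

definition p :: "(nat set \<Rightarrow> 'a) \<Rightarrow> nat set \<Rightarrow> 'a" where
  "p x I = hcomp A 0 (star A (x I))"

definition q :: "(nat set \<Rightarrow> 'a) \<Rightarrow> nat set \<Rightarrow> 'a" where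
  "q x I = hcomp A 1 (star A (x I))"

lemma component_closed: "x \<in> carrier B \<Longrightarrow> I \<in> Pow {..<2} \<Longrightarrow> x I \<in> carrier A"
  by (auto simp: opposite_simps PiE_iff)

lemma pq_closed:
  assumes "x \<in> carrier B" "I \<in> Pow {..<2}"
  shows "p x I \<in> carrier A" "q x I \<in> carrier A"
  using component_closed[OF assms] by (simp_all add: p_def q_def)

lemma pq_closed_2 [simp]:
  assumes "x \<in> carrier B"
  shows "p x {} \<in> carrier A" "p x {0} \<in> carrier A" "p x {Suc 0} \<in> carrier A" "p x {0, Suc 0} \<in> carrier A"
    "q x {} \<in> carrier A" "q x {0} \<in> carrier A" "q x {Suc 0} \<in> carrier A" "q x {0, Suc 0} \<in> carrier A"
  using pq_closed[OF assms] unfolding Pow_2 by simp_all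

text \<open>The adjoint puts \<open>d\<close> back to the left of \<open>f\<close>. What remains of
  the graded opposite is the parity on \<open>f\<close> when \<open>d\<close> is odd, hence a sign
  for odd times odd only.\<close>

lemma star_opposite_mult:
  assumes d: "d \<in> carrier A" and f: "f \<in> carrier A"
  shows "hcomp A 0 (star A (hcomp A 0 d \<otimes>\<^bsub>D\<^esub> f)) = hcomp A 0 (star A d) \<otimes> hcomp A 0 (star A f)"
    "hcomp A 1 (star A (hcomp A 0 d \<otimes>\<^bsub>D\<^esub> f)) = hcomp A 0 (star A d) \<otimes> hcomp A 1 (star A f)"
    "hcomp A 0 (star A (hcomp A 1 d \<otimes>\<^bsub>D\<^esub> f)) = \<ominus> (hcomp A 1 (star A d) \<otimes> hcomp A 1 (star A f))"
    "hcomp A 1 (star A (hcomp A 1 d \<otimes>\<^bsub>D\<^esub> f)) = hcomp A 1 (star A d) \<otimes> hcomp A 0 (star A f)"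
proof -
  have h: "hcomp A 0 (hcomp A 0 d) = hcomp A 0 d" "hcomp A 1 (hcomp A 0 d) = \<zero>"
    "hcomp A 0 (hcomp A 1 d) = \<zero>" "hcomp A 1 (hcomp A 1 d) = hcomp A 1 d"
    using hcomp_of_part[of 0 "hcomp A 0 d"] hcomp_of_part[of 1 "hcomp A 1 d"] hcomp_part[OF d] by auto
  have s: "star A (hcomp A 0 d) \<in> part A 0" "star A (hcomp A 1 d) \<in> part A 1"
    using star_part hcomp_part[OF d] by simp_all
  have "hcomp A 0 d \<otimes>\<^bsub>D\<^esub> f = f \<otimes> hcomp A 0 d" "hcomp A 1 d \<otimes>\<^bsub>D\<^esub> f = parity A f \<otimes> hcomp A 1 d"
    using d f h by (simp_all add: opposite_mult)
  then have e: "star A (hcomp A 0 d \<otimes>\<^bsub>D\<^esub> f) = star A (hcomp A 0 d) \<otimes> star A f"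
    "star A (hcomp A 1 d \<otimes>\<^bsub>D\<^esub> f) = star A (hcomp A 1 d) \<otimes> parity A (star A f)"
    using d f by (simp_all add: star_mult parity_star)
  show "hcomp A 0 (star A (hcomp A 0 d \<otimes>\<^bsub>D\<^esub> f)) = hcomp A 0 (star A d) \<otimes> hcomp A 0 (star A f)"
    "hcomp A 1 (star A (hcomp A 0 d \<otimes>\<^bsub>D\<^esub> f)) = hcomp A 0 (star A d) \<otimes> hcomp A 1 (star A f)"
    unfolding e using hcomp_mult_even[OF s(1)] hcomp_star[OF d] f by simp_all
  show "hcomp A 0 (star A (hcomp A 1 d \<otimes>\<^bsub>D\<^esub> f)) = \<ominus> (hcomp A 1 (star A d) \<otimes> hcomp A 1 (star A f))"
    "hcomp A 1 (star A (hcomp A 1 d \<otimes>\<^bsub>D\<^esub> f)) = hcomp A 1 (star A d) \<otimes> hcomp A 0 (star A f)"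
    unfolding e using hcomp_mult_odd[OF s(2)] hcomp_star[OF d] hcomp_parity[of "star A f"] f d
    by (simp_all add: r_minus)
qed

lemma opposite_mult_closed: "d \<in> carrier A \<Longrightarrow> f \<in> carrier A \<Longrightarrow> d \<otimes>\<^bsub>D\<^esub> f \<in> carrier A"
  by (simp add: opposite_mult)

text \<open>The coefficient at \<open>K\<close> collects the products of the basis elements at
  \<open>I\<close> and \<open>symdiff I K\<close>. The additional sign moves the odd part of
  \<open>x I\<close> past the second basis element.\<close>

lemma clifford_mult_component:
  assumes x: "x \<in> carrier B" and y: "y \<in> carrier B" and K: "K \<in> Pow {..<2}"
  shows "(x \<otimes>\<^bsub>B\<^esub> y) K = (\<Oplus>I\<in>Pow {..<2}.
      rscale A (clifford_sign I (symdiff I K)) (hcomp A 0 (x I) \<otimes>\<^bsub>D\<^esub> y (symdiff I K)) \<oplus>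
      rscale A (clifford_sign I (symdiff I K) * (-1) ^ card (symdiff I K)) (hcomp A 1 (x I) \<otimes>\<^bsub>D\<^esub> y (symdiff I K)))"
proof -
  have c: "x I \<in> carrier A" "y (symdiff I K) \<in> carrier A" if "I \<in> Pow {..<2}" for I
    using component_closed[OF x that] component_closed[OF y symdiff_closed[OF that K]] .
  have "(x \<otimes>\<^bsub>B\<^esub> y) K = (\<Oplus>I\<in>Pow {..<2}. \<Oplus>i\<in>{0, 1}.
        rscale A (clifford_sign I (symdiff I K) * (-1) ^ (i * card (symdiff I K)))
          (hcomp A i (x I) \<otimes>\<^bsub>D\<^esub> y (symdiff I K)))"
    using K unfolding symdiff_def by (simp add: clifford_tensor_def finsum_D hcomp_D opposite_simps)
  also have "\<dots> = (\<Oplus>I\<in>Pow {..<2}.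
      rscale A (clifford_sign I (symdiff I K)) (hcomp A 0 (x I) \<otimes>\<^bsub>D\<^esub> y (symdiff I K)) \<oplus>
      rscale A (clifford_sign I (symdiff I K) * (-1) ^ card (symdiff I K)) (hcomp A 1 (x I) \<otimes>\<^bsub>D\<^esub> y (symdiff I K)))"
    using c by (intro finsum_cong') (auto simp: finsum_insert Pi_def opposite_mult_closed)
  finally show ?thesis .
qed

lemma clifford_mult_closed:
  assumes x: "x \<in> carrier B" and y: "y \<in> carrier B"
  shows "x \<otimes>\<^bsub>B\<^esub> y \<in> carrier B"
proof -
  have "(x \<otimes>\<^bsub>B\<^esub> y) K \<in> carrier A" if K: "K \<in> Pow {..<2}" for K
    unfolding clifford_mult_component[OF x y K]
    using component_closed[OF x] component_closed[OF y symdiff_closed[OF _ K]]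
    by (intro finsum_closed) (auto simp: opposite_mult_closed)
  moreover have "x \<otimes>\<^bsub>B\<^esub> y \<in> extensional (Pow {..<2})"
    by (simp add: clifford_tensor_def)
  ultimately show ?thesis
    by (auto simp: PiE_iff opposite_simps)
qed

lemma pq_mult:
  assumes x: "x \<in> carrier B" and y: "y \<in> carrier B" and K: "K \<in> Pow {..<2}"
  shows "p (x \<otimes>\<^bsub>B\<^esub> y) K = (\<Oplus>I\<in>Pow {..<2}.
      rscale A (clifford_sign I (symdiff I K)) (p x I \<otimes> p y (symdiff I K)) \<ominus>
      rscale A (clifford_sign I (symdiff I K) * (-1) ^ card (symdiff I K)) (q x I \<otimes> q y (symdiff I K)))"
    and "q (x \<otimes>\<^bsub>B\<^esub> y) K = (\<Oplus>I\<in>Pow {..<2}.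
      rscale A (clifford_sign I (symdiff I K)) (p x I \<otimes> q y (symdiff I K)) \<oplus>
      rscale A (clifford_sign I (symdiff I K) * (-1) ^ card (symdiff I K)) (q x I \<otimes> p y (symdiff I K)))"
proof -
  have c: "x I \<in> carrier A" "y (symdiff I K) \<in> carrier A" if "I \<in> Pow {..<2}" for I
    using component_closed[OF x that] component_closed[OF y symdiff_closed[OF that K]] .
  have am: "additive_map A A (\<lambda>a. hcomp A 0 (star A a))" "additive_map A A (\<lambda>a. hcomp A 1 (star A a))"
    by (auto simp: additive_map_def star_add hcomp_sum)
  have hs: "hcomp A 0 (star A (rscale A r a)) = rscale A r (hcomp A 0 (star A a))"
    "hcomp A 1 (star A (rscale A r a)) = rscale A r (hcomp A 1 (star A a))" if "a \<in> carrier A" for r a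
    using that by (simp_all add: star_scale hcomp_scale)
  have oc: "hcomp A 0 (x I) \<otimes>\<^bsub>D\<^esub> y (symdiff I K) \<in> carrier A" "hcomp A 1 (x I) \<otimes>\<^bsub>D\<^esub> y (symdiff I K) \<in> carrier A"
    if "I \<in> Pow {..<2}" for I
    using c[OF that] by (simp_all add: opposite_mult_closed)
  show "p (x \<otimes>\<^bsub>B\<^esub> y) K = (\<Oplus>I\<in>Pow {..<2}.
      rscale A (clifford_sign I (symdiff I K)) (p x I \<otimes> p y (symdiff I K)) \<ominus>
      rscale A (clifford_sign I (symdiff I K) * (-1) ^ card (symdiff I K)) (q x I \<otimes> q y (symdiff I K)))"
    unfolding p_def[of "x \<otimes>\<^bsub>B\<^esub> y"] clifford_mult_component[OF assms]
  proof (subst additive_map_finsum[OF abelian_group_axioms abelian_group_axioms am(1)])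
    show "(\<Oplus>I\<in>Pow {..<2}. hcomp A 0 (star A
        (rscale A (clifford_sign I (symdiff I K)) (hcomp A 0 (x I) \<otimes>\<^bsub>D\<^esub> y (symdiff I K)) \<oplus>
         rscale A (clifford_sign I (symdiff I K) * (-1) ^ card (symdiff I K)) (hcomp A 1 (x I) \<otimes>\<^bsub>D\<^esub> y (symdiff I K)))))
      = (\<Oplus>I\<in>Pow {..<2}. rscale A (clifford_sign I (symdiff I K)) (p x I \<otimes> p y (symdiff I K)) \<ominus>
      rscale A (clifford_sign I (symdiff I K) * (-1) ^ card (symdiff I K)) (q x I \<otimes> q y (symdiff I K)))"
    proof (rule finsum_cong')
      fix I assume I: "I \<in> Pow {..<2::nat}"
      show "hcomp A 0 (star A
        (rscale A (clifford_sign I (symdiff I K)) (hcomp A 0 (x I) \<otimes>\<^bsub>D\<^esub> y (symdiff I K)) \<oplus>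
         rscale A (clifford_sign I (symdiff I K) * (-1) ^ card (symdiff I K)) (hcomp A 1 (x I) \<otimes>\<^bsub>D\<^esub> y (symdiff I K))))
       = rscale A (clifford_sign I (symdiff I K)) (p x I \<otimes> p y (symdiff I K)) \<ominus>
      rscale A (clifford_sign I (symdiff I K) * (-1) ^ card (symdiff I K)) (q x I \<otimes> q y (symdiff I K))"
        unfolding additive_mapD(2)[OF am(1) scale_closed[OF oc(1)[OF I]] scale_closed[OF oc(2)[OF I]]]
          hs(1)[OF oc(1)[OF I]] hs(1)[OF oc(2)[OF I]] star_opposite_mult[OF c[OF I]]
        using c[OF I] by (simp add: p_def q_def minus_eq scale_neg_right)
    qed (use c in \<open>auto simp: p_def q_def\<close>)
  qed (use oc in auto)
  show "q (x \<otimes>\<^bsub>B\<^esub> y) K = (\<Oplus>I\<in>Pow {..<2}.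
      rscale A (clifford_sign I (symdiff I K)) (p x I \<otimes> q y (symdiff I K)) \<oplus>
      rscale A (clifford_sign I (symdiff I K) * (-1) ^ card (symdiff I K)) (q x I \<otimes> p y (symdiff I K)))"
    unfolding q_def[of "x \<otimes>\<^bsub>B\<^esub> y"] clifford_mult_component[OF assms]
  proof (subst additive_map_finsum[OF abelian_group_axioms abelian_group_axioms am(2)])
    show "(\<Oplus>I\<in>Pow {..<2}. hcomp A 1 (star A
        (rscale A (clifford_sign I (symdiff I K)) (hcomp A 0 (x I) \<otimes>\<^bsub>D\<^esub> y (symdiff I K)) \<oplus>
         rscale A (clifford_sign I (symdiff I K) * (-1) ^ card (symdiff I K)) (hcomp A 1 (x I) \<otimes>\<^bsub>D\<^esub> y (symdiff I K)))))
      = (\<Oplus>I\<in>Pow {..<2}. rscale A (clifford_sign I (symdiff I K)) (p x I \<otimes> q y (symdiff I K)) \<oplus>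
      rscale A (clifford_sign I (symdiff I K) * (-1) ^ card (symdiff I K)) (q x I \<otimes> p y (symdiff I K)))"
    proof (rule finsum_cong')
      fix I assume I: "I \<in> Pow {..<2::nat}"
      show "hcomp A 1 (star A
        (rscale A (clifford_sign I (symdiff I K)) (hcomp A 0 (x I) \<otimes>\<^bsub>D\<^esub> y (symdiff I K)) \<oplus>
         rscale A (clifford_sign I (symdiff I K) * (-1) ^ card (symdiff I K)) (hcomp A 1 (x I) \<otimes>\<^bsub>D\<^esub> y (symdiff I K))))
       = rscale A (clifford_sign I (symdiff I K)) (p x I \<otimes> q y (symdiff I K)) \<oplus>
      rscale A (clifford_sign I (symdiff I K) * (-1) ^ card (symdiff I K)) (q x I \<otimes> p y (symdiff I K))"
        unfolding additive_mapD(2)[OF am(2) scale_closed[OF oc(1)[OF I]] scale_closed[OF oc(2)[OF I]]]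
          hs(2)[OF oc(1)[OF I]] hs(2)[OF oc(2)[OF I]] star_opposite_mult[OF c[OF I]]
        using c[OF I] by (simp add: p_def q_def star_opposite_mult[OF c[OF I], unfolded One_nat_def])
    qed (use c in \<open>auto simp: p_def q_def\<close>)
  qed (use oc in auto)
qed

lemma pq_mult_expand:
  assumes x: "x \<in> carrier B" and y: "y \<in> carrier B" and K: "K \<in> Pow {..<2}"
  defines "gp \<equiv> \<lambda>I. rscale A (clifford_sign I (symdiff I K)) (p x I \<otimes> p y (symdiff I K)) \<ominus>
      rscale A (clifford_sign I (symdiff I K) * (-1) ^ card (symdiff I K)) (q x I \<otimes> q y (symdiff I K))"
    and "gq \<equiv> \<lambda>I. rscale A (clifford_sign I (symdiff I K)) (p x I \<otimes> q y (symdiff I K)) \<oplus>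
      rscale A (clifford_sign I (symdiff I K) * (-1) ^ card (symdiff I K)) (q x I \<otimes> p y (symdiff I K))"
  shows "p (x \<otimes>\<^bsub>B\<^esub> y) K = gp {} \<oplus> (gp {0} \<oplus> (gp {1} \<oplus> gp {0, 1}))"
    and "q (x \<otimes>\<^bsub>B\<^esub> y) K = gq {} \<oplus> (gq {0} \<oplus> (gq {1} \<oplus> gq {0, 1}))"
  unfolding pq_mult[OF x y K] gp_def gq_def
  by (rule finsum_Pow_2; use pq_closed[OF x] pq_closed[OF y symdiff_closed[OF _ K]] in simp)+

text \<open>The sum over the four subsets with all signs evaluated, so that products of the
  coefficients \<open>k0\<close> to \<open>k3\<close> become a matter of expanding in
  \<open>A\<close>.\<close>

lemma pq_mult_values:
  assumes x: "x \<in> carrier B" and y: "y \<in> carrier B"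
  shows "p (x \<otimes>\<^bsub>B\<^esub> y) {} = (p x {} \<otimes> p y {} \<ominus> q x {} \<otimes> q y {}) \<oplus> ((p x {0} \<otimes> p y {0} \<oplus> q x {0} \<otimes> q y {0})
      \<oplus> ((p x {1} \<otimes> p y {1} \<oplus> q x {1} \<otimes> q y {1}) \<oplus> (q x {0, 1} \<otimes> q y {0, 1} \<ominus> p x {0, 1} \<otimes> p y {0, 1})))"
    "q (x \<otimes>\<^bsub>B\<^esub> y) {} = (p x {} \<otimes> q y {} \<oplus> q x {} \<otimes> p y {}) \<oplus> ((p x {0} \<otimes> q y {0} \<ominus> q x {0} \<otimes> p y {0})
      \<oplus> ((p x {1} \<otimes> q y {1} \<ominus> q x {1} \<otimes> p y {1}) \<oplus> \<ominus> (p x {0, 1} \<otimes> q y {0, 1} \<oplus> q x {0, 1} \<otimes> p y {0, 1})))"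
    "p (x \<otimes>\<^bsub>B\<^esub> y) {0} = (p x {} \<otimes> p y {0} \<oplus> q x {} \<otimes> q y {0}) \<oplus> ((p x {0} \<otimes> p y {} \<ominus> q x {0} \<otimes> q y {})
      \<oplus> ((q x {1} \<otimes> q y {0, 1} \<ominus> p x {1} \<otimes> p y {0, 1}) \<oplus> (p x {0, 1} \<otimes> p y {1} \<oplus> q x {0, 1} \<otimes> q y {1})))"
    "q (x \<otimes>\<^bsub>B\<^esub> y) {0} = (p x {} \<otimes> q y {0} \<ominus> q x {} \<otimes> p y {0}) \<oplus> ((p x {0} \<otimes> q y {} \<oplus> q x {0} \<otimes> p y {})
      \<oplus> (\<ominus> (p x {1} \<otimes> q y {0, 1} \<oplus> q x {1} \<otimes> p y {0, 1}) \<oplus> (p x {0, 1} \<otimes> q y {1} \<ominus> q x {0, 1} \<otimes> p y {1})))"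
    "p (x \<otimes>\<^bsub>B\<^esub> y) {1} = (p x {} \<otimes> p y {1} \<oplus> q x {} \<otimes> q y {1}) \<oplus> ((p x {0} \<otimes> p y {0, 1} \<ominus> q x {0} \<otimes> q y {0, 1})
      \<oplus> ((p x {1} \<otimes> p y {} \<ominus> q x {1} \<otimes> q y {}) \<oplus> \<ominus> (p x {0, 1} \<otimes> p y {0} \<oplus> q x {0, 1} \<otimes> q y {0})))"
    "q (x \<otimes>\<^bsub>B\<^esub> y) {1} = (p x {} \<otimes> q y {1} \<ominus> q x {} \<otimes> p y {1}) \<oplus> ((p x {0} \<otimes> q y {0, 1} \<oplus> q x {0} \<otimes> p y {0, 1})
      \<oplus> ((p x {1} \<otimes> q y {} \<oplus> q x {1} \<otimes> p y {}) \<oplus> (q x {0, 1} \<otimes> p y {0} \<ominus> p x {0, 1} \<otimes> q y {0})))"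
    "p (x \<otimes>\<^bsub>B\<^esub> y) {0, 1} = (p x {} \<otimes> p y {0, 1} \<ominus> q x {} \<otimes> q y {0, 1}) \<oplus> ((p x {0} \<otimes> p y {1} \<oplus> q x {0} \<otimes> q y {1})
      \<oplus> (\<ominus> (p x {1} \<otimes> p y {0} \<oplus> q x {1} \<otimes> q y {0}) \<oplus> (p x {0, 1} \<otimes> p y {} \<ominus> q x {0, 1} \<otimes> q y {})))"
    "q (x \<otimes>\<^bsub>B\<^esub> y) {0, 1} = (p x {} \<otimes> q y {0, 1} \<oplus> q x {} \<otimes> p y {0, 1}) \<oplus> ((p x {0} \<otimes> q y {1} \<ominus> q x {0} \<otimes> p y {1})
      \<oplus> ((q x {1} \<otimes> p y {0} \<ominus> p x {1} \<otimes> q y {0}) \<oplus> (p x {0, 1} \<otimes> q y {} \<oplus> q x {0, 1} \<otimes> p y {})))"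
proof -
  have K: "{} \<in> Pow {..<2::nat}" "{0} \<in> Pow {..<2::nat}" "{1} \<in> Pow {..<2::nat}" "{0, 1} \<in> Pow {..<2::nat}"
    by auto
  note c = pq_closed_2[OF x] pq_closed_2[OF y]
  note s = scale_minus_one minus_eq minus_add a_ac c
  show "p (x \<otimes>\<^bsub>B\<^esub> y) {} = (p x {} \<otimes> p y {} \<ominus> q x {} \<otimes> q y {}) \<oplus> ((p x {0} \<otimes> p y {0} \<oplus> q x {0} \<otimes> q y {0})
      \<oplus> ((p x {1} \<otimes> p y {1} \<oplus> q x {1} \<otimes> q y {1}) \<oplus> (q x {0, 1} \<otimes> q y {0, 1} \<ominus> p x {0, 1} \<otimes> p y {0, 1})))"
    unfolding pq_mult_expand(1)[OF x y K(1)] by (simp add: s)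
  show "q (x \<otimes>\<^bsub>B\<^esub> y) {} = (p x {} \<otimes> q y {} \<oplus> q x {} \<otimes> p y {}) \<oplus> ((p x {0} \<otimes> q y {0} \<ominus> q x {0} \<otimes> p y {0})
      \<oplus> ((p x {1} \<otimes> q y {1} \<ominus> q x {1} \<otimes> p y {1}) \<oplus> \<ominus> (p x {0, 1} \<otimes> q y {0, 1} \<oplus> q x {0, 1} \<otimes> p y {0, 1})))"
    unfolding pq_mult_expand(2)[OF x y K(1)] by (simp add: s)
  show "p (x \<otimes>\<^bsub>B\<^esub> y) {0} = (p x {} \<otimes> p y {0} \<oplus> q x {} \<otimes> q y {0}) \<oplus> ((p x {0} \<otimes> p y {} \<ominus> q x {0} \<otimes> q y {})
      \<oplus> ((q x {1} \<otimes> q y {0, 1} \<ominus> p x {1} \<otimes> p y {0, 1}) \<oplus> (p x {0, 1} \<otimes> p y {1} \<oplus> q x {0, 1} \<otimes> q y {1})))"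
    unfolding pq_mult_expand(1)[OF x y K(2)] by (simp add: s)
  show "q (x \<otimes>\<^bsub>B\<^esub> y) {0} = (p x {} \<otimes> q y {0} \<ominus> q x {} \<otimes> p y {0}) \<oplus> ((p x {0} \<otimes> q y {} \<oplus> q x {0} \<otimes> p y {})
      \<oplus> (\<ominus> (p x {1} \<otimes> q y {0, 1} \<oplus> q x {1} \<otimes> p y {0, 1}) \<oplus> (p x {0, 1} \<otimes> q y {1} \<ominus> q x {0, 1} \<otimes> p y {1})))"
    unfolding pq_mult_expand(2)[OF x y K(2)] by (simp add: s)
  show "p (x \<otimes>\<^bsub>B\<^esub> y) {1} = (p x {} \<otimes> p y {1} \<oplus> q x {} \<otimes> q y {1}) \<oplus> ((p x {0} \<otimes> p y {0, 1} \<ominus> q x {0} \<otimes> q y {0, 1})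
      \<oplus> ((p x {1} \<otimes> p y {} \<ominus> q x {1} \<otimes> q y {}) \<oplus> \<ominus> (p x {0, 1} \<otimes> p y {0} \<oplus> q x {0, 1} \<otimes> q y {0})))"
    unfolding pq_mult_expand(1)[OF x y K(3)] by (simp add: s)
  show "q (x \<otimes>\<^bsub>B\<^esub> y) {1} = (p x {} \<otimes> q y {1} \<ominus> q x {} \<otimes> p y {1}) \<oplus> ((p x {0} \<otimes> q y {0, 1} \<oplus> q x {0} \<otimes> p y {0, 1})
      \<oplus> ((p x {1} \<otimes> q y {} \<oplus> q x {1} \<otimes> p y {}) \<oplus> (q x {0, 1} \<otimes> p y {0} \<ominus> p x {0, 1} \<otimes> q y {0})))"
    unfolding pq_mult_expand(2)[OF x y K(3)] by (simp add: s)
  show "p (x \<otimes>\<^bsub>B\<^esub> y) {0, 1} = (p x {} \<otimes> p y {0, 1} \<ominus> q x {} \<otimes> q y {0, 1}) \<oplus> ((p x {0} \<otimes> p y {1} \<oplus> q x {0} \<otimes> q y {1})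
      \<oplus> (\<ominus> (p x {1} \<otimes> p y {0} \<oplus> q x {1} \<otimes> q y {0}) \<oplus> (p x {0, 1} \<otimes> p y {} \<ominus> q x {0, 1} \<otimes> q y {})))"
    unfolding pq_mult_expand(1)[OF x y K(4)] by (simp add: s)
  show "q (x \<otimes>\<^bsub>B\<^esub> y) {0, 1} = (p x {} \<otimes> q y {0, 1} \<oplus> q x {} \<otimes> p y {0, 1}) \<oplus> ((p x {0} \<otimes> q y {1} \<ominus> q x {0} \<otimes> p y {1})
      \<oplus> ((q x {1} \<otimes> p y {0} \<ominus> p x {1} \<otimes> q y {0}) \<oplus> (p x {0, 1} \<otimes> q y {} \<oplus> q x {0, 1} \<otimes> p y {})))"
    unfolding pq_mult_expand(2)[OF x y K(4)] by (simp add: s)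
qed

text \<open>The even part \<open>p\<close> and the odd part \<open>q\<close> of the adjoint of a coefficient stand for \<open>p - q w\<close> with
  \<open>w = e\<^sub>0 e\<^sub>1\<close>, where now \<open>A\<close> commutes with \<open>e\<^sub>0\<close> and \<open>e\<^sub>1\<close>. So the coefficients of \<open>1, e\<^sub>0, e\<^sub>1, w\<close>
  with respect to \<open>A\<close> are as follows.\<close>

definition k0 :: "(nat set \<Rightarrow> 'a) \<Rightarrow> 'a" where "k0 x = p x {} \<oplus> q x {0, 1}"
definition k1 :: "(nat set \<Rightarrow> 'a) \<Rightarrow> 'a" where "k1 x = p x {0} \<oplus> q x {1}"
definition k2 :: "(nat set \<Rightarrow> 'a) \<Rightarrow> 'a" where "k2 x = p x {1} \<ominus> q x {0}"
definition k3 :: "(nat set \<Rightarrow> 'a) \<Rightarrow> 'a" where "k3 x = p x {0, 1} \<ominus> q x {}"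

lemma k_closed [simp]:
  assumes "x \<in> carrier B"
  shows "k0 x \<in> carrier A" "k1 x \<in> carrier A" "k2 x \<in> carrier A" "k3 x \<in> carrier A"
  using pq_closed_2[OF assms] by (simp_all add: k0_def k1_def k2_def k3_def)

lemmas ring_expand = l_distr r_distr l_minus r_minus minus_eq minus_add a_ac minus_minus

text \<open>This is the multiplication table of \<open>1\<close>, \<open>e0\<close>,
  \<open>e1\<close> and \<open>w = e0 e1\<close> over coefficients that commute with them:
  \<open>e0\<close> and \<open>e1\<close> square to 1, \<open>w\<close> to -1. All signs caused by
  the grading of \<open>A\<close> have been absorbed into the coefficients.\<close>

lemma k_mult:
  assumes x: "x \<in> carrier B" and y: "y \<in> carrier B"
  shows "k0 (x \<otimes>\<^bsub>B\<^esub> y) = k0 x \<otimes> k0 y \<oplus> k1 x \<otimes> k1 y \<oplus> k2 x \<otimes> k2 y \<ominus> k3 x \<otimes> k3 y"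
    and "k1 (x \<otimes>\<^bsub>B\<^esub> y) = k0 x \<otimes> k1 y \<oplus> k1 x \<otimes> k0 y \<ominus> k2 x \<otimes> k3 y \<oplus> k3 x \<otimes> k2 y"
    and "k2 (x \<otimes>\<^bsub>B\<^esub> y) = k0 x \<otimes> k2 y \<oplus> k2 x \<otimes> k0 y \<oplus> k1 x \<otimes> k3 y \<ominus> k3 x \<otimes> k1 y"
    and "k3 (x \<otimes>\<^bsub>B\<^esub> y) = k0 x \<otimes> k3 y \<oplus> k3 x \<otimes> k0 y \<oplus> k1 x \<otimes> k2 y \<ominus> k2 x \<otimes> k1 y"
proof -
  note c = pq_closed_2[OF x] pq_closed_2[OF y]
  show "k0 (x \<otimes>\<^bsub>B\<^esub> y) = k0 x \<otimes> k0 y \<oplus> k1 x \<otimes> k1 y \<oplus> k2 x \<otimes> k2 y \<ominus> k3 x \<otimes> k3 y"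
    unfolding k0_def k1_def k2_def k3_def pq_mult_values[OF x y] by (simp add: c ring_expand)
  show "k1 (x \<otimes>\<^bsub>B\<^esub> y) = k0 x \<otimes> k1 y \<oplus> k1 x \<otimes> k0 y \<ominus> k2 x \<otimes> k3 y \<oplus> k3 x \<otimes> k2 y"
    unfolding k0_def k1_def k2_def k3_def pq_mult_values[OF x y] by (simp add: c ring_expand)
  show "k2 (x \<otimes>\<^bsub>B\<^esub> y) = k0 x \<otimes> k2 y \<oplus> k2 x \<otimes> k0 y \<oplus> k1 x \<otimes> k3 y \<ominus> k3 x \<otimes> k1 y"
    unfolding k0_def k1_def k2_def k3_def pq_mult_values[OF x y] by (simp add: c ring_expand)
  show "k3 (x \<otimes>\<^bsub>B\<^esub> y) = k0 x \<otimes> k3 y \<oplus> k3 x \<otimes> k0 y \<oplus> k1 x \<otimes> k2 y \<ominus> k2 x \<otimes> k1 y"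
    unfolding k0_def k1_def k2_def k3_def pq_mult_values[OF x y] by (simp add: c ring_expand)
qed

text \<open>The entries for the representation by real matrices with
  \<open>e0 = (1, 0; 0, -1)\<close> and \<open>e1 = (0, 1; 1, 0)\<close>, hence
  \<open>w = (0, 1; -1, 0)\<close>.\<close>

definition e11 :: "(nat set \<Rightarrow> 'a) \<Rightarrow> 'a" where "e11 x = k0 x \<oplus> k1 x"
definition e12 :: "(nat set \<Rightarrow> 'a) \<Rightarrow> 'a" where "e12 x = k2 x \<oplus> k3 x"
definition e21 :: "(nat set \<Rightarrow> 'a) \<Rightarrow> 'a" where "e21 x = k2 x \<ominus> k3 x"
definition e22 :: "(nat set \<Rightarrow> 'a) \<Rightarrow> 'a" where "e22 x = k0 x \<ominus> k1 x"

text \<open>Half sums and half differences of the entries recover the coefficients \<open>k0\<close>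
  to \<open>k3\<close>. Each Clifford coefficient takes its even part from one of them and its odd
  part from a partner, \<open>k0\<close> with \<open>k3\<close> and \<open>k1\<close> with
  \<open>k2\<close>, as the definitions of \<open>k0\<close> to \<open>k3\<close> dictate; the last
  branch is the subset \<open>{0, 1}\<close>.\<close>

definition mat :: "'a \<Rightarrow> 'a \<Rightarrow> 'a \<Rightarrow> 'a \<Rightarrow> nat set \<Rightarrow> 'a" where
  "mat a b c d = (\<lambda>I\<in>Pow {..<2}.
     let h = rscale A (1/2); c0 = h (a \<oplus> d); c1 = h (a \<ominus> d); c2 = h (b \<oplus> c); c3 = h (b \<ominus> c) in
     if I = {} then star A (hcomp A 0 c0 \<ominus> hcomp A 1 c3)
     else if I = {0} then star A (hcomp A 0 c1 \<ominus> hcomp A 1 c2)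
     else if I = {1} then star A (hcomp A 0 c2 \<oplus> hcomp A 1 c1)
     else star A (hcomp A 0 c3 \<oplus> hcomp A 1 c0))"

lemma entries_closed [simp]:
  assumes "x \<in> carrier B"
  shows "e11 x \<in> carrier A" "e12 x \<in> carrier A" "e21 x \<in> carrier A" "e22 x \<in> carrier A"
  using assms by (simp_all add: e11_def e12_def e21_def e22_def)

lemma entries_mult:
  assumes "x \<in> carrier B" "y \<in> carrier B"
  shows "e11 (x \<otimes>\<^bsub>B\<^esub> y) = e11 x \<otimes> e11 y \<oplus> e12 x \<otimes> e21 y"
    "e12 (x \<otimes>\<^bsub>B\<^esub> y) = e11 x \<otimes> e12 y \<oplus> e12 x \<otimes> e22 y"
    "e21 (x \<otimes>\<^bsub>B\<^esub> y) = e21 x \<otimes> e11 y \<oplus> e22 x \<otimes> e21 y"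
    "e22 (x \<otimes>\<^bsub>B\<^esub> y) = e21 x \<otimes> e12 y \<oplus> e22 x \<otimes> e22 y"
  using k_closed[OF assms(1)] k_closed[OF assms(2)] unfolding e11_def e12_def e21_def e22_def k_mult[OF assms]
  by (simp_all add: ring_expand)

lemma mat_closed [simp]:
  assumes "a \<in> carrier A" "b \<in> carrier A" "c \<in> carrier A" "d \<in> carrier A"
  shows "mat a b c d \<in> carrier B"
  using assms by (auto simp: mat_def opposite_simps Let_def)

lemma mat_components:
  assumes "a \<in> carrier A" "b \<in> carrier A" "c \<in> carrier A" "d \<in> carrier A"
  defines "h \<equiv> rscale A (1/2)"
  shows "mat a b c d {} = star A (hcomp A 0 (h (a \<oplus> d)) \<ominus> hcomp A 1 (h (b \<ominus> c)))"
    "mat a b c d {0} = star A (hcomp A 0 (h (a \<ominus> d)) \<ominus> hcomp A 1 (h (b \<oplus> c)))"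
    "mat a b c d {1} = star A (hcomp A 0 (h (b \<oplus> c)) \<oplus> hcomp A 1 (h (a \<ominus> d)))"
    "mat a b c d {0, 1} = star A (hcomp A 0 (h (b \<ominus> c)) \<oplus> hcomp A 1 (h (a \<oplus> d)))"
proof -
  have ne: "({0} :: nat set) \<noteq> {0, 1}" "({1} :: nat set) \<noteq> {0, 1}" "({0} :: nat set) \<noteq> {1}"
    "({0, 1} :: nat set) \<noteq> {0}" "({0, 1} :: nat set) \<noteq> {1}" "({1} :: nat set) \<noteq> {0}"
    "{} \<in> Pow {..<2::nat}" "{0} \<in> Pow {..<2::nat}" "{1} \<in> Pow {..<2::nat}" "{0, 1} \<in> Pow {..<2::nat}"
    by auto
  show "mat a b c d {} = star A (hcomp A 0 (h (a \<oplus> d)) \<ominus> hcomp A 1 (h (b \<ominus> c)))"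
    "mat a b c d {0} = star A (hcomp A 0 (h (a \<ominus> d)) \<ominus> hcomp A 1 (h (b \<oplus> c)))"
    "mat a b c d {1} = star A (hcomp A 0 (h (b \<oplus> c)) \<oplus> hcomp A 1 (h (a \<ominus> d)))"
    "mat a b c d {0, 1} = star A (hcomp A 0 (h (b \<ominus> c)) \<oplus> hcomp A 1 (h (a \<oplus> d)))"
    using ne by (simp_all only: mat_def Let_def h_def restrict_apply if_True if_False insert_not_empty refl)
qed

lemma hcomp_homogeneous_add:
  assumes "a \<in> carrier A" "b \<in> carrier A"
  shows "hcomp A 0 (hcomp A 0 a \<oplus> hcomp A 1 b) = hcomp A 0 a" "hcomp A 1 (hcomp A 0 a \<oplus> hcomp A 1 b) = hcomp A 1 b"
    "hcomp A 0 (hcomp A 0 a \<ominus> hcomp A 1 b) = hcomp A 0 a" "hcomp A 1 (hcomp A 0 a \<ominus> hcomp A 1 b) = \<ominus> hcomp A 1 b"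
  using hcomp_add[OF hcomp_part(1)[OF assms(1)] hcomp_part(2)[OF assms(2)]]
    hcomp_add[OF hcomp_part(1)[OF assms(1)] part_neg[OF _ hcomp_part(2)[OF assms(2)]]] by (simp_all add: minus_eq)

lemma pq_mat:
  assumes "a \<in> carrier A" "b \<in> carrier A" "c \<in> carrier A" "d \<in> carrier A"
  defines "h \<equiv> rscale A (1/2)"
  shows "p (mat a b c d) {} = hcomp A 0 (h (a \<oplus> d))" "q (mat a b c d) {} = \<ominus> hcomp A 1 (h (b \<ominus> c))"
    "p (mat a b c d) {0} = hcomp A 0 (h (a \<ominus> d))" "q (mat a b c d) {0} = \<ominus> hcomp A 1 (h (b \<oplus> c))"
    "p (mat a b c d) {1} = hcomp A 0 (h (b \<oplus> c))" "q (mat a b c d) {1} = hcomp A 1 (h (a \<ominus> d))"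
    "p (mat a b c d) {0, 1} = hcomp A 0 (h (b \<ominus> c))" "q (mat a b c d) {0, 1} = hcomp A 1 (h (a \<oplus> d))"
proof -
  have hc: "h z \<in> carrier A" if "z \<in> carrier A" for z using that by (simp add: h_def)
  have cl: "a \<oplus> d \<in> carrier A" "a \<ominus> d \<in> carrier A" "b \<oplus> c \<in> carrier A" "b \<ominus> c \<in> carrier A"
    using assms by simp_all
  note hcl = cl[THEN hc]
  have ss: "star A (star A (hcomp A 0 u \<oplus> hcomp A 1 v)) = hcomp A 0 u \<oplus> hcomp A 1 v"
    "star A (star A (hcomp A 0 u \<ominus> hcomp A 1 v)) = hcomp A 0 u \<ominus> hcomp A 1 v"
    if "u \<in> carrier A" "v \<in> carrier A" for u v
    using that by simp_all
  note m = mat_components[OF assms(1-4), folded h_def]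
  show "p (mat a b c d) {} = hcomp A 0 (h (a \<oplus> d))" "q (mat a b c d) {} = \<ominus> hcomp A 1 (h (b \<ominus> c))"
    "p (mat a b c d) {0} = hcomp A 0 (h (a \<ominus> d))" "q (mat a b c d) {0} = \<ominus> hcomp A 1 (h (b \<oplus> c))"
    "p (mat a b c d) {1} = hcomp A 0 (h (b \<oplus> c))" "q (mat a b c d) {1} = hcomp A 1 (h (a \<ominus> d))"
    "p (mat a b c d) {0, 1} = hcomp A 0 (h (b \<ominus> c))" "q (mat a b c d) {0, 1} = hcomp A 1 (h (a \<oplus> d))"
    unfolding p_def q_def m
    by (simp_all only: ss[OF hcl(1) hcl(4)] ss[OF hcl(2) hcl(3)] ss[OF hcl(3) hcl(2)] ss[OF hcl(4) hcl(1)]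
        hcomp_homogeneous_add[OF hcl(1) hcl(4)] hcomp_homogeneous_add[OF hcl(2) hcl(3)]
        hcomp_homogeneous_add[OF hcl(3) hcl(2)] hcomp_homogeneous_add[OF hcl(4) hcl(1)])
qed

lemma half_double:
  assumes "x \<in> carrier A" shows "rscale A (1/2) (x \<oplus> x) = x"
  using scale_add_left[of x "1/2" "1/2"] scale_add_right[of x x "1/2"] assms by simp

lemma entries_mat [simp]:
  assumes abcd: "a \<in> carrier A" "b \<in> carrier A" "c \<in> carrier A" "d \<in> carrier A"
  shows "e11 (mat a b c d) = a" "e12 (mat a b c d) = b" "e21 (mat a b c d) = c" "e22 (mat a b c d) = d"
proof -
  let ?h = "rscale A (1/2)"
  have k: "k0 (mat a b c d) = ?h (a \<oplus> d)" "k1 (mat a b c d) = ?h (a \<ominus> d)"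
    "k2 (mat a b c d) = ?h (b \<oplus> c)" "k3 (mat a b c d) = ?h (b \<ominus> c)"
    unfolding k0_def k1_def k2_def k3_def pq_mat[OF abcd] using abcd
    by (simp_all add: minus_eq hcomp_part[unfolded One_nat_def])
  have "?h (a \<oplus> d) \<oplus> ?h (a \<ominus> d) = ?h (a \<oplus> a)" "?h (b \<oplus> c) \<oplus> ?h (b \<ominus> c) = ?h (b \<oplus> b)"
    "?h (b \<oplus> c) \<ominus> ?h (b \<ominus> c) = ?h (c \<oplus> c)" "?h (a \<oplus> d) \<ominus> ?h (a \<ominus> d) = ?h (d \<oplus> d)"
    using abcd by (simp_all add: scale_add_right scale_neg_right abelian_simps)
  then show "e11 (mat a b c d) = a" "e12 (mat a b c d) = b" "e21 (mat a b c d) = c" "e22 (mat a b c d) = d"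
    unfolding e11_def e12_def e21_def e22_def k using abcd half_double by simp_all
qed

lemma mat_entries:
  assumes x: "x \<in> carrier B"
  shows "mat (e11 x) (e12 x) (e21 x) (e22 x) = x"
proof (rule PiE_ext[of _ "Pow {..<2}" "\<lambda>_. carrier A"])
  show "mat (e11 x) (e12 x) (e21 x) (e22 x) \<in> Pow {..<2} \<rightarrow>\<^sub>E carrier A"
    using mat_closed[OF entries_closed[OF x]] by (simp add: opposite_simps)
  show "x \<in> Pow {..<2} \<rightarrow>\<^sub>E carrier A"
    using x by (simp add: opposite_simps)
  fix I assume I: "I \<in> Pow {..<2::nat}"
  let ?h = "rscale A (1/2)"
  note kc = k_closed[OF x]
  have "e11 x \<oplus> e22 x = k0 x \<oplus> k0 x" "e11 x \<ominus> e22 x = k1 x \<oplus> k1 x"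
    "e12 x \<oplus> e21 x = k2 x \<oplus> k2 x" "e12 x \<ominus> e21 x = k3 x \<oplus> k3 x"
    using kc by (simp_all add: e11_def e12_def e21_def e22_def abelian_simps)
  then have h: "?h (e11 x \<oplus> e22 x) = k0 x" "?h (e11 x \<ominus> e22 x) = k1 x"
    "?h (e12 x \<oplus> e21 x) = k2 x" "?h (e12 x \<ominus> e21 x) = k3 x"
    using kc half_double by simp_all
  have st: "star A (x J) \<in> carrier A" if "J \<in> Pow {..<2}" for J
    using component_closed[OF x that] by simp
  have K: "{} \<in> Pow {..<2::nat}" "{0} \<in> Pow {..<2::nat}" "{1} \<in> Pow {..<2::nat}" "{0, 1} \<in> Pow {..<2::nat}"
    by auto
  have hk: "hcomp A 0 (k0 x) = p x {}" "hcomp A 1 (k0 x) = q x {0, 1}"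
    "hcomp A 0 (k1 x) = p x {0}" "hcomp A 1 (k1 x) = q x {1}"
    "hcomp A 0 (k2 x) = p x {1}" "hcomp A 1 (k2 x) = \<ominus> q x {0}"
    "hcomp A 0 (k3 x) = p x {0, 1}" "hcomp A 1 (k3 x) = \<ominus> q x {}"
    unfolding k0_def k1_def k2_def k3_def p_def q_def
    by (rule hcomp_homogeneous_add[OF st[OF K(1)] st[OF K(4)]] hcomp_homogeneous_add[OF st[OF K(2)] st[OF K(3)]]
        hcomp_homogeneous_add[OF st[OF K(3)] st[OF K(2)]] hcomp_homogeneous_add[OF st[OF K(4)] st[OF K(1)]])+
  have s: "star A (p x J \<oplus> q x J) = x J" if "J \<in> Pow {..<2}" for J
    using hcomp_part(3)[OF st[OF that]] component_closed[OF x that] by (simp add: p_def q_def)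
  have "mat (e11 x) (e12 x) (e21 x) (e22 x) {} = x {}" "mat (e11 x) (e12 x) (e21 x) (e22 x) {0} = x {0}"
    "mat (e11 x) (e12 x) (e21 x) (e22 x) {1} = x {1}" "mat (e11 x) (e12 x) (e21 x) (e22 x) {0, 1} = x {0, 1}"
    unfolding mat_components[OF entries_closed[OF x]] h hk using s K pq_closed[OF x]
    by (simp_all add: minus_eq)
  then show "mat (e11 x) (e12 x) (e21 x) (e22 x) I = x I"
    using I unfolding Pow_2 by blast
qed

lemma matrix_eqI:
  assumes x: "x \<in> carrier B" and y: "y \<in> carrier B"
    and e: "e11 x = e11 y" "e12 x = e12 y" "e21 x = e21 y" "e22 x = e22 y"
  shows "x = y"
proof -
  have "x = mat (e11 x) (e12 x) (e21 x) (e22 x)" by (rule mat_entries[OF x, symmetric])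
  also have "\<dots> = y" unfolding e by (rule mat_entries[OF y])
  finally show ?thesis .
qed

lemma pq_add:
  assumes "x \<in> carrier B" "y \<in> carrier B" "I \<in> Pow {..<2}"
  shows "p (x \<oplus>\<^bsub>B\<^esub> y) I = p x I \<oplus> p y I" "q (x \<oplus>\<^bsub>B\<^esub> y) I = q x I \<oplus> q y I"
  using component_closed[OF assms(1,3)] component_closed[OF assms(2,3)] assms(3)
  by (simp_all add: p_def q_def opposite_simps star_add hcomp_sum)

lemma pq_scale:
  assumes "x \<in> carrier B" "I \<in> Pow {..<2}"
  shows "p (rscale B r x) I = rscale A r (p x I)" "q (rscale B r x) I = rscale A r (q x I)"
  using component_closed[OF assms] assms(2)
  by (simp_all add: p_def q_def opposite_simps star_scale hcomp_scale)

lemma pq_one: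
  assumes "I \<in> Pow {..<2}"
  shows "p \<one>\<^bsub>B\<^esub> I = (if I = {} then \<one> else \<zero>)" "q \<one>\<^bsub>B\<^esub> I = \<zero>"
  using assms hcomp_of_part[of 0 \<zero>] part_zero by (simp_all add: p_def q_def opposite_simps hcomp_one)

lemma pq_parity:
  assumes x: "x \<in> carrier B" and I: "I \<in> Pow {..<2}"
  shows "p (parity B x) I = rscale A ((-1) ^ card I) (p x I)"
    "q (parity B x) I = rscale A ((-1) ^ card I) (\<ominus> q x I)"
proof -
  interpret D: normed_graded_space D by (rule normed_graded_space_D)
  have "parity B x I = rscale A ((-1) ^ card I) (parity A (x I))"
    using D.parity_clifford_tensor[OF x] I by (simp add: parity_D opposite_simps)
  then have "star A (parity B x I) = rscale A ((-1) ^ card I) (parity A (star A (x I)))"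
    using component_closed[OF x I] by (simp add: star_scale parity_star)
  then show "p (parity B x) I = rscale A ((-1) ^ card I) (p x I)"
    "q (parity B x) I = rscale A ((-1) ^ card I) (\<ominus> q x I)"
    using component_closed[OF x I] hcomp_parity[of "star A (x I)"]
    by (simp_all add: p_def q_def hcomp_scale)
qed

lemma subsets_2: "{} \<in> Pow {..<2::nat}" "{0} \<in> Pow {..<2::nat}" "{1} \<in> Pow {..<2::nat}" "{0, 1} \<in> Pow {..<2::nat}"
  by auto

lemma entries_add:
  assumes x: "x \<in> carrier B" and y: "y \<in> carrier B"
  shows "e11 (x \<oplus>\<^bsub>B\<^esub> y) = e11 x \<oplus> e11 y" "e12 (x \<oplus>\<^bsub>B\<^esub> y) = e12 x \<oplus> e12 y"
    "e21 (x \<oplus>\<^bsub>B\<^esub> y) = e21 x \<oplus> e21 y" "e22 (x \<oplus>\<^bsub>B\<^esub> y) = e22 x \<oplus> e22 y"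
  unfolding e11_def e12_def e21_def e22_def k0_def k1_def k2_def k3_def subsets_2[THEN pq_add(1)[OF x y]]
    subsets_2[THEN pq_add(2)[OF x y]]
  using pq_closed_2[OF x] pq_closed_2[OF y] by (simp_all add: ring_expand)

lemma entries_scale:
  assumes x: "x \<in> carrier B"
  shows "e11 (rscale B r x) = rscale A r (e11 x)" "e12 (rscale B r x) = rscale A r (e12 x)"
    "e21 (rscale B r x) = rscale A r (e21 x)" "e22 (rscale B r x) = rscale A r (e22 x)"
  unfolding e11_def e12_def e21_def e22_def k0_def k1_def k2_def k3_def subsets_2[THEN pq_scale(1)[OF x]]
    subsets_2[THEN pq_scale(2)[OF x]]
  using pq_closed_2[OF x] by (simp_all add: scale_add_right scale_neg_right minus_eq)

lemma entries_one: "e11 \<one>\<^bsub>B\<^esub> = \<one>" "e12 \<one>\<^bsub>B\<^esub> = \<zero>" "e21 \<one>\<^bsub>B\<^esub> = \<zero>" "e22 \<one>\<^bsub>B\<^esub> = \<one>"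
  unfolding e11_def e12_def e21_def e22_def k0_def k1_def k2_def k3_def subsets_2[THEN pq_one(1)]
    subsets_2[THEN pq_one(2)]
  by (simp_all add: minus_eq)

lemma hcomp_hcomp:
  assumes "a \<in> carrier A"
  shows "parity A (hcomp A 0 a) = hcomp A 0 a" "parity A (hcomp A 1 a) = \<ominus> hcomp A 1 a"
  using parity_even parity_odd hcomp_part[OF assms] by simp_all

lemma parity_pq:
  assumes "x \<in> carrier B" "I \<in> Pow {..<2}"
  shows "parity A (p x I) = p x I" "parity A (q x I) = \<ominus> q x I"
  using hcomp_hcomp[of "star A (x I)"] component_closed[OF assms] by (simp_all add: p_def q_def)

text \<open>On \<open>k0\<close> and \<open>k3\<close> the grading is the parity of
  \<open>A\<close>, on \<open>k1\<close> and \<open>k2\<close> its negative. Fixing \<open>1\<close>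
  and \<open>w\<close> while negating \<open>e0\<close> and \<open>e1\<close> is conjugation with
  \<open>w\<close>, which exchanges the diagonal entries and swaps the others up to sign.\<close>

lemma entries_parity:
  assumes x: "x \<in> carrier B"
  shows "e11 (parity B x) = parity A (e22 x)" "e12 (parity B x) = \<ominus> parity A (e21 x)"
    "e21 (parity B x) = \<ominus> parity A (e12 x)" "e22 (parity B x) = parity A (e11 x)"
proof -
  note c = pq_closed_2[OF x]
  note pp = subsets_2[THEN parity_pq(1)[OF x]] subsets_2[THEN parity_pq(2)[OF x]]
  have r: "rscale A (-1) a = \<ominus> a" "\<ominus> (\<ominus> a) = a" if "a \<in> carrier A" for a
    using that by (simp_all add: scale_minus_one)
  show "e11 (parity B x) = parity A (e22 x)" "e12 (parity B x) = \<ominus> parity A (e21 x)"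
    "e21 (parity B x) = \<ominus> parity A (e12 x)" "e22 (parity B x) = parity A (e11 x)"
    unfolding e11_def e12_def e21_def e22_def k0_def k1_def k2_def k3_def subsets_2[THEN pq_parity(1)[OF x]]
      subsets_2[THEN pq_parity(2)[OF x]]
    using c pp[unfolded One_nat_def]
    by (simp_all add: minus_eq parity_add parity_neg r minus_add a_ac)
qed

text \<open>The entries separate elements and turn sums and products into those of matrices over
  \<open>A\<close>. So associativity and distributivity are pulled back from matrices, and no
  identity between Clifford signs has to be proved.\<close>

lemma clifford_ring: "ring B"
proof (rule ringI)
  show "abelian_group B" by (rule B.abelian_group_axioms)
  have one: "\<one>\<^bsub>B\<^esub> \<in> carrier B"
    by (auto simp: opposite_simps)
  show "monoid B"
  proof (rule monoidI)
    fix x y z assume xyz: "x \<in> carrier B" "y \<in> carrier B" "z \<in> carrier B"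
    note c = clifford_mult_closed
    show "x \<otimes>\<^bsub>B\<^esub> y \<in> carrier B" using c xyz by blast
    show "x \<otimes>\<^bsub>B\<^esub> y \<otimes>\<^bsub>B\<^esub> z = x \<otimes>\<^bsub>B\<^esub> (y \<otimes>\<^bsub>B\<^esub> z)"
      by (rule matrix_eqI)
        (use xyz in \<open>simp_all add: c entries_mult l_distr r_distr m_assoc a_ac del: clifford_tensor_simps(1)\<close>)
  next
    fix x assume x: "x \<in> carrier B"
    show "\<one>\<^bsub>B\<^esub> \<otimes>\<^bsub>B\<^esub> x = x" "x \<otimes>\<^bsub>B\<^esub> \<one>\<^bsub>B\<^esub> = x"
      by (rule matrix_eqI; use x one in \<open>simp add: clifford_mult_closed entries_mult entries_one
            del: clifford_tensor_simps(1,2)\<close>)+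
  qed (rule one)
  fix x y z assume xyz: "x \<in> carrier B" "y \<in> carrier B" "z \<in> carrier B"
  note c = clifford_mult_closed B.add.m_closed
  show "(x \<oplus>\<^bsub>B\<^esub> y) \<otimes>\<^bsub>B\<^esub> z = x \<otimes>\<^bsub>B\<^esub> z \<oplus>\<^bsub>B\<^esub> y \<otimes>\<^bsub>B\<^esub> z"
    "z \<otimes>\<^bsub>B\<^esub> (x \<oplus>\<^bsub>B\<^esub> y) = z \<otimes>\<^bsub>B\<^esub> x \<oplus>\<^bsub>B\<^esub> z \<otimes>\<^bsub>B\<^esub> y"
    by (rule matrix_eqI; use xyz in \<open>simp add: clifford_mult_closed entries_mult entries_add l_distr r_distr a_ac
          del: clifford_tensor_simps(1,4)\<close>)+
qed

lemma entries_bounded: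
  obtains K where "K \<ge> 0" "\<And>x. x \<in> carrier B \<Longrightarrow> nrm A (e11 x) \<le> K * nrm B x"
    "\<And>x. x \<in> carrier B \<Longrightarrow> nrm A (e12 x) \<le> K * nrm B x"
    "\<And>x. x \<in> carrier B \<Longrightarrow> nrm A (e21 x) \<le> K * nrm B x"
    "\<And>x. x \<in> carrier B \<Longrightarrow> nrm A (e22 x) \<le> K * nrm B x"
proof -
  obtain K where K: "K \<ge> 0" "\<And>a. a \<in> carrier A \<Longrightarrow> nrm A (hcomp A 0 a) \<le> K * nrm A a"
    "\<And>a. a \<in> carrier A \<Longrightarrow> nrm A (hcomp A 1 a) \<le> K * nrm A a"
    by (rule hcomp_bounded, blast)
  have pq: "nrm A (p x I) \<le> K * nrm B x" "nrm A (q x I) \<le> K * nrm B x"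
    if x: "x \<in> carrier B" and I: "I \<in> Pow {..<2}" for x I
  proof -
    have "nrm A (x I) \<le> nrm B x"
      using component_closed[OF x] I unfolding clifford_tensor_simps opposite_simps
      by (intro member_le_sum) auto
    then have le: "K * nrm A (x I) \<le> K * nrm B x"
      using K(1) by (rule mult_left_mono)
    show "nrm A (p x I) \<le> K * nrm B x" "nrm A (q x I) \<le> K * nrm B x"
      using K(2,3)[of "star A (x I)"] component_closed[OF x I] le by (simp_all add: p_def q_def)
  qed
  have k: "nrm A (k0 x) \<le> 2 * K * nrm B x" "nrm A (k1 x) \<le> 2 * K * nrm B x"
    "nrm A (k2 x) \<le> 2 * K * nrm B x" "nrm A (k3 x) \<le> 2 * K * nrm B x" if x: "x \<in> carrier B" for x
  proof -
    note c = pq_closed_2[OF x, folded One_nat_def] and b = subsets_2[THEN pq(1)[OF x]] subsets_2[THEN pq(2)[OF x]]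
    show "nrm A (k0 x) \<le> 2 * K * nrm B x"
      using nrm_triangle[OF c(1) c(8)] b(1,8) by (simp add: k0_def)
    show "nrm A (k1 x) \<le> 2 * K * nrm B x"
      using nrm_triangle[OF c(2) c(7)] b(2,7) by (simp add: k1_def)
    show "nrm A (k2 x) \<le> 2 * K * nrm B x"
      using nrm_diff_le[OF c(3) c(6)] b(3,6) by (simp add: k2_def)
    show "nrm A (k3 x) \<le> 2 * K * nrm B x"
      using nrm_diff_le[OF c(4) c(5)] b(4,5) by (simp add: k3_def)
  qed
  show ?thesis
  \<comment> \<open>Each of \<open>k0\<close> to \<open>k3\<close> is made of two homogeneous
    components, and each entry of two of these coefficients, which gives the factor 4.\<close>
  proof (rule that[of "4 * K"])
    fix x assume x: "x \<in> carrier B"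
    note kc = k_closed[OF x] and kb = k[OF x]
    show "nrm A (e11 x) \<le> 4 * K * nrm B x"
      using nrm_triangle[OF kc(1,2)] kb by (simp add: e11_def)
    show "nrm A (e12 x) \<le> 4 * K * nrm B x"
      using nrm_triangle[OF kc(3,4)] kb by (simp add: e12_def)
    show "nrm A (e21 x) \<le> 4 * K * nrm B x"
      using nrm_diff_le[OF kc(3,4)] kb by (simp add: e21_def)
    show "nrm A (e22 x) \<le> 4 * K * nrm B x"
      using nrm_diff_le[OF kc(1,2)] kb by (simp add: e22_def)
  qed (use K in simp)
qed

lemma mat_bounded:
  obtains K where "K \<ge> 0" "\<And>a b c d. a \<in> carrier A \<Longrightarrow> b \<in> carrier A \<Longrightarrow> c \<in> carrier A \<Longrightarrow> d \<in> carrier A \<Longrightarrow>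
    nrm B (mat a b c d) \<le> K * (nrm A a + nrm A b + nrm A c + nrm A d)"
proof -
  obtain K where K: "K \<ge> 0" "\<And>a. a \<in> carrier A \<Longrightarrow> nrm A (hcomp A 0 a) \<le> K * nrm A a"
    "\<And>a. a \<in> carrier A \<Longrightarrow> nrm A (hcomp A 1 a) \<le> K * nrm A a"
    by (rule hcomp_bounded, blast)
  let ?h = "rscale A (1/2)"
  show ?thesis
  \<comment> \<open>There are four Clifford coefficients, each built from an even and an odd
    component of norm at most \<open>K * N\<close>.\<close>
  proof (rule that[of "8 * K"])
    fix a b c d assume abcd: "a \<in> carrier A" "b \<in> carrier A" "c \<in> carrier A" "d \<in> carrier A"
    define N where "N = nrm A a + nrm A b + nrm A c + nrm A d"
    have n0: "nrm A a \<ge> 0" "nrm A b \<ge> 0" "nrm A c \<ge> 0" "nrm A d \<ge> 0" using abcd by simp_all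
    have hs: "nrm A (?h z) = nrm A z / 2" if "z \<in> carrier A" for z
      using that by (simp add: nrm_scale)
    have hb: "nrm A (?h (a \<oplus> d)) \<le> N" "nrm A (?h (a \<ominus> d)) \<le> N" "nrm A (?h (b \<oplus> c)) \<le> N" "nrm A (?h (b \<ominus> c)) \<le> N"
      using nrm_triangle[OF abcd(1,4)] nrm_diff_le[OF abcd(1,4)] nrm_triangle[OF abcd(2,3)] nrm_diff_le[OF abcd(2,3)] n0
      unfolding N_def hs[OF a_closed[OF abcd(1,4)]] hs[OF minus_closed[OF abcd(1,4)]]
        hs[OF a_closed[OF abcd(2,3)]] hs[OF minus_closed[OF abcd(2,3)]]
      by linarith+
    have cl: "?h (a \<oplus> d) \<in> carrier A" "?h (a \<ominus> d) \<in> carrier A" "?h (b \<oplus> c) \<in> carrier A" "?h (b \<ominus> c) \<in> carrier A"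
      using abcd by simp_all
    have uv: "nrm A (star A (hcomp A 0 u \<oplus> hcomp A 1 v)) \<le> 2 * K * N"
      "nrm A (star A (hcomp A 0 u \<ominus> hcomp A 1 v)) \<le> 2 * K * N"
      if "u \<in> carrier A" "nrm A u \<le> N" "v \<in> carrier A" "nrm A v \<le> N" for u v
    proof -
      have "nrm A (hcomp A 0 u) \<le> K * N" "nrm A (hcomp A 1 v) \<le> K * N"
        using K(2)[OF that(1)] K(3)[OF that(3)] mult_left_mono[OF that(2) K(1)] mult_left_mono[OF that(4) K(1)] by simp_all
      then show "nrm A (star A (hcomp A 0 u \<oplus> hcomp A 1 v)) \<le> 2 * K * N"
        "nrm A (star A (hcomp A 0 u \<ominus> hcomp A 1 v)) \<le> 2 * K * N"
        using nrm_triangle[of "hcomp A 0 u" "hcomp A 1 v"] nrm_diff_le[of "hcomp A 0 u" "hcomp A 1 v"] that by simp_all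
    qed
    have "nrm B (mat a b c d) = nrm A (mat a b c d {}) + nrm A (mat a b c d {0}) + nrm A (mat a b c d {1}) + nrm A (mat a b c d {0, 1})"
      unfolding clifford_tensor_simps opposite_simps by (rule sum_Pow_2)
    also have "\<dots> \<le> 2 * K * N + 2 * K * N + 2 * K * N + 2 * K * N"
      unfolding mat_components[OF abcd]
      by (intro add_mono uv cl hb)
    finally show "nrm B (mat a b c d) \<le> 8 * K * (nrm A a + nrm A b + nrm A c + nrm A d)"
      by (simp add: N_def)
  qed (use K in simp)
qed

lemma clifford_normed_graded_ring: "normed_graded_ring B"
proof -
  interpret BR: ring B by (rule clifford_ring)
  note [simp del] = clifford_tensor_simps
  show ?thesis
  proof unfold_locales
    fix x y assume x: "x \<in> carrier B" and y: "y \<in> carrier B"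
    show "rscale B r x \<otimes>\<^bsub>B\<^esub> y = rscale B r (x \<otimes>\<^bsub>B\<^esub> y)" "x \<otimes>\<^bsub>B\<^esub> rscale B r y = rscale B r (x \<otimes>\<^bsub>B\<^esub> y)" for r
      by (rule matrix_eqI; use x y in \<open>simp add: entries_mult entries_scale scale_add_right scale_mult_left scale_mult_right\<close>)+
    show "parity B (x \<otimes>\<^bsub>B\<^esub> y) = parity B x \<otimes>\<^bsub>B\<^esub> parity B y"
      by (rule matrix_eqI; use x y in \<open>simp add: entries_mult entries_parity parity_add parity_mult l_minus r_minus a_ac minus_add\<close>)
  next
    obtain K where K: "K \<ge> 0" "\<And>x. x \<in> carrier B \<Longrightarrow> nrm A (e11 x) \<le> K * nrm B x"
      "\<And>x. x \<in> carrier B \<Longrightarrow> nrm A (e12 x) \<le> K * nrm B x"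
      "\<And>x. x \<in> carrier B \<Longrightarrow> nrm A (e21 x) \<le> K * nrm B x"
      "\<And>x. x \<in> carrier B \<Longrightarrow> nrm A (e22 x) \<le> K * nrm B x"
      by (rule entries_bounded, blast)
    obtain L where L: "L \<ge> 0" "\<And>a b c d. a \<in> carrier A \<Longrightarrow> b \<in> carrier A \<Longrightarrow> c \<in> carrier A \<Longrightarrow> d \<in> carrier A \<Longrightarrow>
      nrm B (mat a b c d) \<le> L * (nrm A a + nrm A b + nrm A c + nrm A d)"
      by (rule mat_bounded, blast)
    \<comment> \<open>Together with \<open>entries_bounded\<close> this makes the norm of
      \<open>B\<close> equivalent to the sum of the norms of the matrix entries, where products are
      easy to estimate.\<close>
    have nB: "nrm B x \<le> L * (nrm A (e11 x) + nrm A (e12 x) + nrm A (e21 x) + nrm A (e22 x))" if "x \<in> carrier B" for x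
      using L(2)[OF entries_closed[OF that]] mat_entries[OF that] by simp
    obtain C0 where C0: "\<And>a b. a \<in> carrier A \<Longrightarrow> b \<in> carrier A \<Longrightarrow> nrm A (a \<otimes> b) \<le> C0 * nrm A a * nrm A b"
      using nrm_mult_bounded by blast
    define C where "C = \<bar>C0\<bar> * K * K"
    have C: "nrm A (a \<otimes> b \<oplus> c \<otimes> d) \<le> 2 * (C * nrm B x * nrm B y)"
      if "a \<in> carrier A" "nrm A a \<le> K * nrm B x" "b \<in> carrier A" "nrm A b \<le> K * nrm B y"
        "c \<in> carrier A" "nrm A c \<le> K * nrm B x" "d \<in> carrier A" "nrm A d \<le> K * nrm B y" for a b c d x y
    proof -
      have 1: "nrm A (a \<otimes> b) \<le> C * nrm B x * nrm B y"
        if "a \<in> carrier A" "nrm A a \<le> K * nrm B x" "b \<in> carrier A" "nrm A b \<le> K * nrm B y" for a b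
      proof -
        have "nrm A (a \<otimes> b) \<le> C0 * (nrm A a * nrm A b)" using C0[OF that(1,3)] by (simp add: mult.assoc)
        also have "\<dots> \<le> \<bar>C0\<bar> * (nrm A a * nrm A b)"
          using that by (intro mult_right_mono) auto
        also have "\<dots> \<le> \<bar>C0\<bar> * ((K * nrm B x) * (K * nrm B y))"
        proof (intro mult_left_mono mult_mono that)
          show "0 \<le> K * nrm B x" using that(2) nrm_nonneg[OF that(1)] by linarith
        qed (use that in auto)
        also have "\<dots> = C * nrm B x * nrm B y" by (simp add: C_def)
        finally show ?thesis .
      qed
      show ?thesis
        using nrm_triangle[of "a \<otimes> b" "c \<otimes> d"] 1[OF that(1-4)] 1[OF that(5-8)] that by simp
    qed
    have "nrm B (x \<otimes>\<^bsub>B\<^esub> y) \<le> (8 * L * C) * nrm B x * nrm B y" if x: "x \<in> carrier B" and y: "y \<in> carrier B" for x y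
    proof -
      have "nrm B (x \<otimes>\<^bsub>B\<^esub> y) \<le> L * (2 * (C * nrm B x * nrm B y) + 2 * (C * nrm B x * nrm B y) + 2 * (C * nrm B x * nrm B y) + 2 * (C * nrm B x * nrm B y))"
        by (rule order_trans[OF nB[OF BR.m_closed[OF x y]]], unfold entries_mult[OF x y])
          (intro mult_left_mono add_mono C K entries_closed x y L(1))
      then show ?thesis by (simp add: mult_ac)
    qed
    then show "\<exists>C. \<forall>x\<in>carrier B. \<forall>y\<in>carrier B. nrm B (x \<otimes>\<^bsub>B\<^esub> y) \<le> C * nrm B x * nrm B y"
      by blast
    obtain P0 where P0: "\<And>a. a \<in> carrier A \<Longrightarrow> nrm A (parity A a) \<le> P0 * nrm A a"
      using nrm_parity_bounded by blast
    interpret D: normed_graded_space D by (rule normed_graded_space_D)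
    have "nrm B (parity B x) \<le> P0 * nrm B x" if x: "x \<in> carrier B" for x
    proof -
      have "nrm B (parity B x) = (\<Sum>I\<in>Pow {..<2}. nrm A (parity A (x I)))"
        unfolding D.parity_clifford_tensor[OF x] clifford_tensor_simps opposite_simps parity_D
        using component_closed[OF x] by (intro sum.cong refl) (simp add: nrm_scale power_abs)
      also have "\<dots> \<le> (\<Sum>I\<in>Pow {..<2}. P0 * nrm A (x I))"
        by (intro sum_mono P0 component_closed[OF x])
      also have "\<dots> = P0 * nrm B x"
        unfolding clifford_tensor_simps opposite_simps by (simp add: sum_distrib_left)
      finally show ?thesis .
    qed
    then show "\<exists>C. \<forall>x\<in>carrier B. nrm B (parity B x) \<le> C * nrm B x" by blast
  qed
qed

lemma clifford_matrix_ring_iso: "matrix_ring_iso A B mat e11 e12 e21 e22"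
proof -
  interpret BR: normed_graded_ring B by (rule clifford_normed_graded_ring)
  note [simp del] = clifford_tensor_simps
  show ?thesis
  proof unfold_locales
    show "\<exists>K. \<forall>x\<in>carrier B. nrm A (e11 x) \<le> K * nrm B x \<and> nrm A (e12 x) \<le> K * nrm B x \<and>
        nrm A (e21 x) \<le> K * nrm B x \<and> nrm A (e22 x) \<le> K * nrm B x"
      by (rule entries_bounded, blast)
    show "\<exists>K. \<forall>a\<in>carrier A. \<forall>b\<in>carrier A. \<forall>c\<in>carrier A. \<forall>d\<in>carrier A.
        nrm B (mat a b c d) \<le> K * (nrm A a + nrm A b + nrm A c + nrm A d)"
      by (rule mat_bounded, blast)
  qed (simp_all add: mat_entries entries_add entries_mult entries_parity)
qed

end

section \<open>Functoriality of the matrix description\<close>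

locale graded_opposite_surjection =
  S: graded_opposite A D + T: graded_opposite A' D' + \<phi>: graded_surjection A A' \<phi>
  for A :: "'a gr_alg" and D and A' :: "'b gr_alg" and D' and \<phi> +
  assumes \<phi>_star: "a \<in> carrier A \<Longrightarrow> \<phi> (star A a) = star A' (\<phi> a)"
    and \<phi>_scale: "a \<in> carrier A \<Longrightarrow> \<phi> (rscale A r a) = rscale A' r (\<phi> a)"
begin

abbreviation \<Phi> :: "(nat set \<Rightarrow> 'a) \<Rightarrow> nat set \<Rightarrow> 'b" where
  "\<Phi> \<equiv> \<lambda>x. \<lambda>I\<in>Pow {..<2}. \<phi> (x I)"

lemma \<phi>_neg: "a \<in> carrier A \<Longrightarrow> \<phi> (\<ominus>\<^bsub>A\<^esub> a) = \<ominus>\<^bsub>A'\<^esub> \<phi> a"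
  using \<phi>_scale[of a "-1"] by (simp add: S.scale_minus_one T.scale_minus_one)

lemma \<phi>_diff: "a \<in> carrier A \<Longrightarrow> b \<in> carrier A \<Longrightarrow> \<phi> (a \<ominus>\<^bsub>A\<^esub> b) = \<phi> a \<ominus>\<^bsub>A'\<^esub> \<phi> b"
  by (simp add: S.minus_eq T.minus_eq \<phi>.\<phi>_add \<phi>_neg)

lemma \<phi>_hcomp:
  assumes "a \<in> carrier A"
  shows "\<phi> (hcomp A 0 a) = hcomp A' 0 (\<phi> a)" "\<phi> (hcomp A 1 a) = hcomp A' 1 (\<phi> a)"
  unfolding S.hcomp_even_eq[OF assms] T.hcomp_even_eq[OF \<phi>.\<phi>_closed[OF assms]]
  using assms by (simp_all add: \<phi>_scale \<phi>.\<phi>_add \<phi>_diff \<phi>.\<phi>_parity)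

lemma \<Phi>_closed: "x \<in> carrier S.B \<Longrightarrow> \<Phi> x \<in> carrier T.B"
  using S.component_closed by (auto simp: T.opposite_simps simp del: clifford_tensor_simps(1))
    (simp add: T.opposite_simps)

lemma pq_\<Phi>:
  assumes "x \<in> carrier S.B" "I \<in> Pow {..<2}"
  shows "T.p (\<Phi> x) I = \<phi> (S.p x I)" "T.q (\<Phi> x) I = \<phi> (S.q x I)"
  unfolding S.p_def S.q_def T.p_def T.q_def
  using S.component_closed[OF assms] assms(2) \<phi>_hcomp by (simp_all add: \<phi>_star)

lemma entries_\<Phi>:
  assumes x: "x \<in> carrier S.B"
  shows "T.e11 (\<Phi> x) = \<phi> (S.e11 x)" "T.e12 (\<Phi> x) = \<phi> (S.e12 x)"
    "T.e21 (\<Phi> x) = \<phi> (S.e21 x)" "T.e22 (\<Phi> x) = \<phi> (S.e22 x)"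
  unfolding S.e11_def S.e12_def S.e21_def S.e22_def S.k0_def S.k1_def S.k2_def S.k3_def
    T.e11_def T.e12_def T.e21_def T.e22_def T.k0_def T.k1_def T.k2_def T.k3_def
    S.subsets_2[THEN pq_\<Phi>(1)[OF x]] S.subsets_2[THEN pq_\<Phi>(2)[OF x]]
  using S.pq_closed_2[OF x] by (simp_all add: \<phi>.\<phi>_add \<phi>_diff)

lemma clifford_graded_surjection: "graded_surjection S.B T.B \<Phi>"
proof -
  interpret SB: normed_graded_ring S.B by (rule S.clifford_normed_graded_ring)
  interpret TB: normed_graded_ring T.B by (rule T.clifford_normed_graded_ring)
  note [simp del] = clifford_tensor_simps
  note c = \<Phi>_closed
  show ?thesis
  proof unfold_locales
    show "\<Phi> ` carrier S.B = carrier T.B"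
    proof
      show "\<Phi> ` carrier S.B \<subseteq> carrier T.B" using c by blast
      show "carrier T.B \<subseteq> \<Phi> ` carrier S.B"
      proof
        fix y assume y: "y \<in> carrier T.B"
        \<comment> \<open>Preimages are chosen for the four matrix entries, and
          \<open>T.matrix_eqI\<close> then recognizes the image of the resulting matrix as
          \<open>y\<close>.\<close>
        obtain a where a: "a \<in> carrier A" "T.e11 y = \<phi> a" using \<phi>.\<phi>_lift[OF T.entries_closed(1)[OF y]] .
        obtain b where b: "b \<in> carrier A" "T.e12 y = \<phi> b" using \<phi>.\<phi>_lift[OF T.entries_closed(2)[OF y]] .
        obtain c where c: "c \<in> carrier A" "T.e21 y = \<phi> c" using \<phi>.\<phi>_lift[OF T.entries_closed(3)[OF y]] .
        obtain d where d: "d \<in> carrier A" "T.e22 y = \<phi> d" using \<phi>.\<phi>_lift[OF T.entries_closed(4)[OF y]] .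
        have m: "S.mat a b c d \<in> carrier S.B" using a b c d by simp
        have "\<Phi> (S.mat a b c d) = y"
          by (rule T.matrix_eqI[OF \<Phi>_closed[OF m] y]) (use a b c d in \<open>simp_all add: entries_\<Phi>[OF m]\<close>)
        then show "y \<in> \<Phi> ` carrier S.B" using m by blast
      qed
    qed
    fix x y assume x: "x \<in> carrier S.B" and y: "y \<in> carrier S.B"
    show "\<Phi> (x \<oplus>\<^bsub>S.B\<^esub> y) = \<Phi> x \<oplus>\<^bsub>T.B\<^esub> \<Phi> y"
      by (rule T.matrix_eqI) (use x y c[OF x] c[OF y] c[OF S.B.a_closed[OF x y]] in
        \<open>simp_all only: entries_\<Phi> S.B.a_closed T.B.a_closed S.entries_add T.entries_add S.entries_closed \<phi>.\<phi>_add\<close>)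
    show "\<Phi> (x \<otimes>\<^bsub>S.B\<^esub> y) = \<Phi> x \<otimes>\<^bsub>T.B\<^esub> \<Phi> y"
      by (rule T.matrix_eqI) (use x y c[OF x] c[OF y] c[OF SB.m_closed[OF x y]] in
        \<open>simp_all only: entries_\<Phi> SB.m_closed TB.m_closed S.entries_mult T.entries_mult S.entries_closed
          S.m_closed \<phi>.\<phi>_add \<phi>.\<phi>_mult\<close>)
    show "\<Phi> (parity S.B x) = parity T.B (\<Phi> x)"
      by (rule T.matrix_eqI) (use x c[OF x] c[OF S.B.parity_closed[OF x]] in
        \<open>simp_all only: entries_\<Phi> S.B.parity_closed T.B.parity_closed S.entries_parity T.entries_parity
          S.entries_closed S.parity_closed \<phi>_neg \<phi>.\<phi>_parity\<close>)
  next
    obtain K where K: "\<And>a. a \<in> carrier A \<Longrightarrow> nrm A' (\<phi> a) \<le> K * nrm A a"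
      using \<phi>.\<phi>_bounded by blast
    have "nrm T.B (\<Phi> x) \<le> K * nrm S.B x" if x: "x \<in> carrier S.B" for x
      unfolding clifford_tensor_simps S.opposite_simps T.opposite_simps sum_distrib_left
      using K[OF S.component_closed[OF x]] by (intro sum_mono) simp
    then show "\<exists>K. \<forall>x\<in>carrier S.B. nrm T.B (\<Phi> x) \<le> K * nrm S.B x" by blast
  qed
qed

lemma clifford_matrix_ring_surjection:
  "matrix_ring_surjection A S.B S.mat S.e11 S.e12 S.e21 S.e22 A' T.B T.mat T.e11 T.e12 T.e21 T.e22 \<phi> \<Phi>"
  by (intro matrix_ring_surjection.intro matrix_ring_surjection_axioms.intro S.clifford_matrix_ring_iso
      T.clifford_matrix_ring_iso \<phi>.graded_surjection_axioms clifford_graded_surjection entries_\<Phi>)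

end

section \<open>Opposites and unitizations of C*-algebras\<close>

context graded_real_cstar_algebra
begin

lemma opposite_record_simps:
  "carrier (opposite A) = carrier A" "\<zero>\<^bsub>opposite A\<^esub> = \<zero>" "ring.add (opposite A) = ring.add A"
  "\<one>\<^bsub>opposite A\<^esub> = \<one>" "rscale (opposite A) = rscale A" "nrm (opposite A) = nrm A" "part (opposite A) = part A"
  by (simp_all add: opposite_def)

text \<open>In the double sum over degrees, the signed sum over the degree of \<open>f\<close> is
  \<open>f\<close> itself when the component of \<open>d\<close> is even and the parity of
  \<open>f\<close> when it is odd.\<close>

lemma opposite_mult_eq:
  assumes d: "d \<in> carrier A" and f: "f \<in> carrier A"
  shows "d \<otimes>\<^bsub>opposite A\<^esub> f = f \<otimes> hcomp A 0 d \<oplus> parity A f \<otimes> hcomp A 1 d"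
proof -
  note c = V.hcomp_closed[OF d] V.hcomp_closed[OF f]
  have f': "f \<otimes> z = hcomp A 0 f \<otimes> z \<oplus> hcomp A 1 f \<otimes> z" "parity A f \<otimes> z = hcomp A 0 f \<otimes> z \<ominus> hcomp A 1 f \<otimes> z"
    if "z \<in> carrier A" for z
    using V.hcomp_part(3)[OF f] V.parity_eq[OF f] distrib_right[of "hcomp A 0 f" "hcomp A 1 f" z]
      distrib_right[of "hcomp A 0 f" "\<ominus> hcomp A 1 f" z] neg_mult(1)[of "hcomp A 1 f" z] c that
    by (simp_all add: minus_eq)
  have "d \<otimes>\<^bsub>opposite A\<^esub> f = (hcomp A 0 f \<otimes> hcomp A 0 d \<oplus> hcomp A 1 f \<otimes> hcomp A 0 d)
      \<oplus> (hcomp A 0 f \<otimes> hcomp A 1 d \<ominus> hcomp A 1 f \<otimes> hcomp A 1 d)"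
    using c by (simp add: opposite_def finsum_insert Pi_def mult_closed V.scale_minus_one minus_eq)
  then show ?thesis
    using f'[OF c(1)] f'[OF c(2)] by simp
qed

lemma unital_opposite:
  assumes "unital A"
  shows "graded_opposite A (opposite A)"
proof -
  interpret normed_graded_star_ring A by (rule unital_star_ring[OF assms])
  show ?thesis
    by unfold_locales (simp_all add: opposite_record_simps opposite_mult_eq)
qed

text \<open>Unitization commutes with the opposite because the adjoined unit is even and central:
  the scalar of \<open>x\<close> belongs to its even component, and mixed terms carry no
  sign.\<close>

lemma unitization_opposite: "graded_opposite (unitization A) (unitization (opposite A))"
proof -
  interpret U: normed_graded_star_ring "unitization A" by (rule unitization_star_ring)
  show ?thesis
  proof (intro graded_opposite.intro U.normed_graded_star_ring_axioms graded_opposite_axioms.intro)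
    fix x y assume "x \<in> carrier (unitization A)" "y \<in> carrier (unitization A)"
    then obtain a r b s where xy: "x = (a, r)" "y = (b, s)" "a \<in> carrier A" "b \<in> carrier A" by auto
    have "hcomp (unitization A) 0 x = (hcomp A 0 a, r)" "hcomp (unitization A) 1 x = (hcomp A 1 a, 0)"
      using U.hcomp_add[of "(hcomp A 0 a, r)" "(hcomp A 1 a, 0)"] V.hcomp_part[OF xy(3)] xy(1) by auto
    then have "y \<otimes>\<^bsub>unitization A\<^esub> hcomp (unitization A) 0 x \<oplus>\<^bsub>unitization A\<^esub>
        parity (unitization A) y \<otimes>\<^bsub>unitization A\<^esub> hcomp (unitization A) 1 x
      = ((b \<otimes> hcomp A 0 a \<oplus> rscale A s (hcomp A 0 a) \<oplus> rscale A r b) \<oplus>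
         (parity A b \<otimes> hcomp A 1 a \<oplus> rscale A s (hcomp A 1 a) \<oplus> rscale A 0 (parity A b)), s * r)"
      using xy by (simp add: parity_unitization)
    also have "\<dots> = ((b \<otimes> hcomp A 0 a \<oplus> parity A b \<otimes> hcomp A 1 a) \<oplus> rscale A r b \<oplus>
        (rscale A s (hcomp A 0 a) \<oplus> rscale A s (hcomp A 1 a)), r * s)"
      using xy by (simp add: mult_closed a_ac)
    also have "rscale A s (hcomp A 0 a) \<oplus> rscale A s (hcomp A 1 a) = rscale A s a"
      using V.hcomp_part(3)[OF xy(3)] V.scale_add_right[of "hcomp A 0 a" "hcomp A 1 a" s] xy by simp
    finally show "x \<otimes>\<^bsub>unitization (opposite A)\<^esub> y = y \<otimes>\<^bsub>unitization A\<^esub> hcomp (unitization A) 0 x \<oplus>\<^bsub>unitization A\<^esub>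
        parity (unitization A) y \<otimes>\<^bsub>unitization A\<^esub> hcomp (unitization A) 1 x"
      using xy by (simp add: unitization_def opposite_record_simps opposite_mult_eq)
  qed (simp_all add: unitization_def opposite_record_simps)
qed

end

lemma real_opposite: "graded_opposite real_alg real_alg"
proof -
  interpret normed_graded_star_ring real_alg by (rule real_alg_star_ring)
  show ?thesis
  proof unfold_locales
    fix d f :: real assume "d \<in> carrier real_alg" "f \<in> carrier real_alg"
    have "hcomp real_alg 0 d = d" "hcomp real_alg 1 d = 0"
      using hcomp_of_part[of 0 d] by simp_all
    then show "d \<otimes>\<^bsub>real_alg\<^esub> f = f \<otimes>\<^bsub>real_alg\<^esub> hcomp real_alg 0 d \<oplus>\<^bsub>real_alg\<^esub>
        parity real_alg f \<otimes>\<^bsub>real_alg\<^esub> hcomp real_alg 1 d"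
      by simp
  qed simp_all
qed

lemma (in graded_real_cstar_algebra) unitization_opposite_surjection:
  "graded_opposite_surjection (unitization A) (unitization (opposite A)) real_alg real_alg snd"
proof -
  interpret U: normed_graded_star_ring "unitization A" by (rule unitization_star_ring)
  interpret r: normed_graded_star_ring real_alg by (rule real_alg_star_ring)
  have "graded_surjection (unitization A) real_alg snd"
  proof unfold_locales
    show "snd ` carrier (unitization A) = carrier real_alg"
      using zero_closed by (auto simp: image_iff)
    show "snd (parity (unitization A) x) = parity real_alg (snd x)" if "x \<in> carrier (unitization A)" for x
      using that by (auto simp: parity_unitization)
    show "\<exists>K. \<forall>x\<in>carrier (unitization A). nrm real_alg (snd x) \<le> K * nrm (unitization A) x"
      by (intro exI[of _ 1]) (auto simp: nrm_nonneg)
  qed auto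
  then show ?thesis
    by (intro graded_opposite_surjection.intro graded_opposite_surjection_axioms.intro unitization_opposite
        real_opposite) auto
qed

theorem theorem1p1:
  fixes A :: "'a gr_alg"
  assumes "graded_real_cstar_algebra A"
  shows "if unital A
         then abelian_group_iso (SPT_unital A) (K_unital 2 (opposite A))
         else abelian_group_iso (SPT_nonunital A) (K_nonunital 2 (opposite A))"
proof -
  interpret graded_real_cstar_algebra A by fact
  show ?thesis
  proof (cases "unital A")
    case True
    interpret graded_opposite A "opposite A" by (rule unital_opposite[OF True])
    interpret M: matrix_ring_iso A B mat e11 e12 e21 e22 by (rule clifford_matrix_ring_iso)
    have G: "comm_group (K_unital 2 (opposite A))" "comm_group (SPT_unital A)"
      unfolding K_unital_def K0_unital_def SPT_unital_def
      by (rule M.B.difference_group_comm_group difference_group_comm_group)+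
    have "K_unital 2 (opposite A) \<cong> SPT_unital A"
      unfolding K_unital_def K0_unital_def SPT_unital_def is_iso_def
      using M.corner_class_map_iso by blast
    \<comment> \<open>The Morita map goes from modules over the matrix algebra to modules over
      \<open>A\<close>, that is, from K-theory to \<open>SPT_unital\<close>; it is inverted
      here.\<close>
    then have "SPT_unital A \<cong> K_unital 2 (opposite A)"
      by (rule group.iso_sym[OF comm_group.axioms(2)[OF G(1)]])
    then show ?thesis
      using True G by (simp add: abelian_group_iso_def)
  next
    case False
    interpret graded_opposite_surjection "unitization A" "unitization (opposite A)" real_alg real_alg snd
      by (rule unitization_opposite_surjection)
    interpret M: matrix_ring_surjection "unitization A" S.B S.mat S.e11 S.e12 S.e21 S.e22
        real_alg T.B T.mat T.e11 T.e12 T.e21 T.e22 snd \<Phi>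
      by (rule clifford_matrix_ring_surjection)
    \<comment> \<open>The corner maps for \<open>unitization A\<close> and for
      \<open>real_alg\<close> are isomorphisms that commute with base change along
      \<open>snd\<close>, so they match the kernels of the two augmentations.\<close>
    note kernel = kernel_iso[OF normed_graded_ring.difference_group_comm_group[OF S.clifford_normed_graded_ring]
        S.difference_group_comm_group
        normed_graded_ring.difference_group_comm_group[OF T.clifford_normed_graded_ring]
        T.difference_group_comm_group
        M.B.corner_class_map_iso M.D.corner_class_map_iso M.\<Phi>.induced_map_hom \<phi>.induced_map_hom
        M.class_map_naturality]
    have K: "K_nonunital 2 (opposite A) = (difference_group Grading S.B)
        \<lparr>carrier := kernel (difference_group Grading S.B) (difference_group Grading T.B)
          (induced_map Grading \<Phi> S.B T.B)\<rparr>"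
      by (simp add: K_nonunital_def K_unital_def K0_unital_def)
    have S: "SPT_nonunital A = (difference_group Polarization (unitization A))
        \<lparr>carrier := kernel (difference_group Polarization (unitization A)) (difference_group Polarization real_alg)
          (induced_map Polarization snd (unitization A) real_alg)\<rparr>"
      by (simp add: SPT_nonunital_def SPT_unital_def)
    have G: "comm_group (K_nonunital 2 (opposite A))" "comm_group (SPT_nonunital A)"
      unfolding K S by (rule kernel, assumption)+
    have "K_nonunital 2 (opposite A) \<cong> SPT_nonunital A"
      unfolding K S is_iso_def using kernel(3) by blast
    then have "SPT_nonunital A \<cong> K_nonunital 2 (opposite A)"
      by (rule group.iso_sym[OF comm_group.axioms(2)[OF G(1)]])
    then show ?thesis
      using False G by (simp add: abelian_group_iso_def)
  qed
qed

end
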